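(* For any $X\in\mathcal{M}_{g,n}$ there exists a constant $K_X$ (depending only on $X$) such that the following holds. For all $0<\varepsilon\le 1$, all $0<\xi\le 1$, and any finite collection $\{c_i\}_{i=1}^N$ of geodesic arcs in $X^\xi$ of average length $\bar c=\frac1N\sum_{i=1}^N\ell(c_i)$, there exists a closed geodesic $\gamma$ on $X$ of length at most $$N\left(K_X+\bar c+10\log\frac{1}{\varepsilon}+8\log\frac{1}{\xi}\right)$$ which contains $\{c_i\}_{i=1}^N$ in its $2\varepsilon$-neighborhood.
   Context: $\mathcal{M}_{g,n}$ denotes the moduli space of complete connected orientable finite-area hyperbolic surfaces of genus $g$ with $n$ cusps, where $2g+n\ge 3$. A cusp region of area $\xi$ is a portion of the surface isometric to $\{z\in\mathbb{H}:\operatorname{Im} z\ge 1\}/(z\mapsto z+\xi)$. For $X\in\mathcal{M}_{g,n}$ and $0<\xi\le 2$, $X^\xi$ is the closure of the complement in $X$ of all cusp regions of area $\xi$; thus $X^\xi$ is a surface of genus $g$ with $n$ boundary components, each a horocycle of length $\xi$. $\ell$ denotes hyperbolic length. That $\gamma$ contains $\{c_i\}$ in its $2\varepsilon$-neighborhood means that every arc $c_i$ is contained in the $2\varepsilon$-neighborhood of $\gamma$ in $X$. *)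

theory Defs
  imports "HOL-Analysis.Analysis"
begin

subsection \<open>The hyperbolic plane (upper half-plane model)\<close>

definition upper_half_plane :: "complex set" where
  "upper_half_plane = {z. Im z > 0}"

definition hyp_dist :: "complex \<Rightarrow> complex \<Rightarrow> real" where
  "hyp_dist z w = arcosh (1 + (cmod (z - w))\<^sup>2 / (2 * Im z * Im w))"

text \<open>The area form $dx\,dy/y^2$; only its values on subsets of the upper half-plane matter.\<close>

definition hyp_area :: "complex measure" where
  "hyp_area = density lborel (\<lambda>z. ennreal (1 / (Im z)\<^sup>2))"


subsection \<open>Curves in metric spaces\<close>

text \<open>Curves are parametrised by the unit interval. The length of a curve is the supremum of the
  lengths of its inscribed polygons.\<close>

definition curve_length :: "(real \<Rightarrow> 'a::metric_space) \<Rightarrow> ennreal" where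
  "curve_length c =
     (SUP ts \<in> {ts. sorted ts \<and> set ts \<subseteq> {0..1}}.
        \<Sum>i<length ts - 1. ennreal (dist (c (ts ! i)) (c (ts ! Suc i))))"

text \<open>The real-valued length. It is used for geodesics only, which are Lipschitz on the unit
  interval, so that \<open>curve_length\<close> is finite.\<close>

definition len :: "(real \<Rightarrow> 'a::metric_space) \<Rightarrow> real" where
  "len c = enn2real (curve_length c)"

text \<open>Nonconstant geodesics with constant speed \<open>v\<close>. They are distance minimising locally, not
  necessarily globally, and need not be injective.\<close>

definition geodesic_on :: "real set \<Rightarrow> (real \<Rightarrow> 'a::metric_space) \<Rightarrow> bool" where
  "geodesic_on T c \<longleftrightarrow>
     (\<exists>v>0. \<forall>t\<in>T. \<exists>\<delta>>0. \<forall>s\<in>T. \<forall>s'\<in>T.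
        \<bar>s - t\<bar> < \<delta> \<and> \<bar>s' - t\<bar> < \<delta> \<longrightarrow> dist (c s) (c s') = v * \<bar>s - s'\<bar>)"

definition geodesic_arc :: "(real \<Rightarrow> 'a::metric_space) \<Rightarrow> bool" where
  "geodesic_arc c \<longleftrightarrow> geodesic_on {0..1} c"

text \<open>A closed geodesic is a 1-periodic geodesic defined on the whole line, so that it is also
  geodesic at its base point. Its length is the length of its restriction to one period, which is
  what \<open>len\<close> measures.\<close>

definition closed_geodesic :: "(real \<Rightarrow> 'a::metric_space) \<Rightarrow> bool" where
  "closed_geodesic \<gamma> \<longleftrightarrow> geodesic_on UNIV \<gamma> \<and> (\<forall>t. \<gamma> (t + 1) = \<gamma> t)"


subsection \<open>Hyperbolic surfaces\<close>

text \<open>A surface is a subset \<open>X\<close> of an arbitrary metric space and carries the restricted metric. The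
  ambient space plays no role: every metric space can occur as \<open>X\<close>.\<close>

definition hyp_chart :: "'a::metric_space set \<Rightarrow> 'a set \<Rightarrow> ('a \<Rightarrow> complex) \<Rightarrow> bool" where
  "hyp_chart X U \<phi> \<longleftrightarrow>
     openin (top_of_set X) U \<and> open (\<phi> ` U) \<and> \<phi> ` U \<subseteq> upper_half_plane \<and>
     (\<forall>x\<in>U. \<forall>y\<in>U. hyp_dist (\<phi> x) (\<phi> y) = dist x y)"

text \<open>The metric of \<open>X\<close> is the one measured along curves in \<open>X\<close>, as for a Riemannian manifold.\<close>

definition length_metric :: "'a::metric_space set \<Rightarrow> bool" where
  "length_metric X \<longleftrightarrow>
     (\<forall>x\<in>X. \<forall>y\<in>X. ennreal (dist x y) =
        (INF c \<in> {c. path c \<and> path_image c \<subseteq> X \<and> pathstart c = x \<and> pathfinish c = y}.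
           curve_length c))"

definition hyperbolic_surface :: "'a::metric_space set \<Rightarrow> bool" where
  "hyperbolic_surface X \<longleftrightarrow> length_metric X \<and> (\<forall>x\<in>X. \<exists>U \<phi>. x \<in> U \<and> hyp_chart X U \<phi>)"

text \<open>The transition maps are locally restrictions of isometries of the hyperbolic plane; among
  these, the orientation preserving ones are the holomorphic ones.\<close>

definition orientable_surface :: "'a::metric_space set \<Rightarrow> bool" where
  "orientable_surface X \<longleftrightarrow>
     (\<exists>A. (\<forall>(U, \<phi>)\<in>A. hyp_chart X U \<phi>) \<and> X \<subseteq> (\<Union>(U, \<phi>)\<in>A. U) \<and>
        (\<forall>(U, \<phi>)\<in>A. \<forall>(V, \<psi>)\<in>A. (\<lambda>z. \<psi> (inv_into U \<phi> z)) holomorphic_on \<phi> ` (U \<inter> V)))"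

definition is_area_measure :: "'a::metric_space set \<Rightarrow> 'a measure \<Rightarrow> bool" where
  "is_area_measure X \<mu> \<longleftrightarrow>
     sets \<mu> = sets (restrict_space borel X) \<and>
     (\<forall>U \<phi> B. hyp_chart X U \<phi> \<and> B \<in> sets \<mu> \<and> B \<subseteq> U
        \<longrightarrow> emeasure \<mu> B = emeasure hyp_area (\<phi> ` B))"

definition finite_area :: "'a::metric_space set \<Rightarrow> bool" where
  "finite_area X \<longleftrightarrow> (\<exists>\<mu>. is_area_measure X \<mu> \<and> emeasure \<mu> X < \<infinity>)"


subsection \<open>Genus\<close>

definition nonseparating_curves :: "'a::metric_space set \<Rightarrow> nat \<Rightarrow> bool" where
  "nonseparating_curves X k \<longleftrightarrow>
     (\<exists>p :: nat \<Rightarrow> real \<Rightarrow> 'a.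
        (\<forall>i<k. simple_path (p i) \<and> pathfinish (p i) = pathstart (p i) \<and> path_image (p i) \<subseteq> X) \<and>
        disjoint_family_on (\<lambda>i. path_image (p i)) {..<k} \<and>
        connected (X - (\<Union>i<k. path_image (p i))))"

text \<open>The genus is the maximal number of disjoint simple closed curves that together do not
  separate the surface.\<close>

definition has_genus :: "'a::metric_space set \<Rightarrow> nat \<Rightarrow> bool" where
  "has_genus X g \<longleftrightarrow>
     nonseparating_curves X g \<and> (\<forall>k. nonseparating_curves X k \<longrightarrow> k \<le> g)"


subsection \<open>Cusps\<close>

definition horoball :: "complex set" where
  "horoball = {z. Im z \<ge> 1}"

text \<open>An isometry from the quotient of the horoball by \<open>z \<mapsto> z + \<xi>\<close> onto \<open>C\<close> is given as a map \<open>f\<close>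
  on the horoball whose fibres are exactly the orbits. It is an isometry in the Riemannian sense,
  that is, \<open>f\<close> preserves small distances; distances in \<open>X\<close> between far apart points of \<open>C\<close> may be
  realised outside of \<open>C\<close>.\<close>

definition cusp_region :: "'a::metric_space set \<Rightarrow> real \<Rightarrow> 'a set \<Rightarrow> bool" where
  "cusp_region X \<xi> C \<longleftrightarrow> C \<subseteq> X \<and>
     (\<exists>f. f ` horoball = C \<and>
        (\<forall>z\<in>horoball. \<forall>w\<in>horoball. f z = f w \<longleftrightarrow> (\<exists>k::int. w = z + of_real (of_int k * \<xi>))) \<and>
        (\<forall>z\<in>horoball. \<exists>r>0. \<forall>w\<in>horoball. \<forall>w'\<in>horoball.
           hyp_dist z w < r \<and> hyp_dist z w' < r \<longrightarrow> dist (f w) (f w') = hyp_dist w w'))"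

text \<open>Each cusp has exactly one cusp region of area \<open>\<xi>\<close> once \<open>\<xi>\<close> is small enough, so the cusps are
  counted by these regions.\<close>

definition has_cusps :: "'a::metric_space set \<Rightarrow> nat \<Rightarrow> bool" where
  "has_cusps X n \<longleftrightarrow>
     (\<forall>\<^sub>F \<xi> in at_right 0. finite {C. cusp_region X \<xi> C} \<and> card {C. cusp_region X \<xi> C} = n)"

definition truncated :: "'a::metric_space set \<Rightarrow> real \<Rightarrow> 'a set" where
  "truncated X \<xi> = X \<inter> closure (X - \<Union>{C. cusp_region X \<xi> C})"


subsection \<open>Moduli space\<close>

text \<open>\<open>in_moduli_space g n X\<close>: the surface \<open>X\<close> represents a point (an isometry class) of the moduli
  space of surfaces of genus \<open>g\<close> with \<open>n\<close> cusps.\<close>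

definition in_moduli_space :: "nat \<Rightarrow> nat \<Rightarrow> 'a::metric_space set \<Rightarrow> bool" where
  "in_moduli_space g n X \<longleftrightarrow>
     2 * g + n \<ge> 3 \<and> hyperbolic_surface X \<and> complete X \<and> connected X \<and> orientable_surface X \<and>
     finite_area X \<and> has_genus X g \<and> has_cusps X n"

end

theory Submission
  imports Defs "HOL-Complex_Analysis.Complex_Analysis"
begin

text \<open>The surface is covered by the upper half-plane. Below a Margulis constant, commutators of deck
  transformations contract, so a point with small injectivity radius has an essentially cyclic group of short
  deck transformations; since the area is finite, the points of large injectivity radius lie within bounded
  distance of the orbit of \<open>\<i>\<close>, and a point of \<open>X\<^sup>\<xi>\<close> lies within distance \<open>log (1 / \<xi>) + O(1)\<close> of it.

  Extend every arc at both ends by \<open>log (1 / \<epsilon>) + O(1)\<close>, go from there to an orbit point, almost without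
  backtracking, and connect consecutive orbit points by deck transformations of bounded length chosen from a finite
  set, again almost without backtracking. The resulting broken geodesic has long sides and corners with bounded
  Gromov products. It is therefore a quasi-geodesic, and its holonomy is hyperbolic with an axis at bounded
  distance from the corners. Geodesics diverge exponentially, so the axis is \<open>O(\<epsilon>)\<close>-close to the original arcs,
  and it projects to the required closed geodesic.\<close>

section \<open>The hyperbolic plane\<close>

text \<open>Each arc is lengthened by \<open>E\<close>, which is ln (1 / \<epsilon>) up to a
  constant, at both ends, and the way from either new end to an orbit point costs at most
  \<open>E\<close> + ln (1 / \<xi>) up to a constant, because the distance to the orbit grows by no
  more than the extension. Hence an arc contributes its own length and 4 ln (1 / \<epsilon>) + 2 ln
  (1 / \<xi>), which fits into the allowed 10 and 8. The difficulty is backtracking: a lengthened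
  arc may end deep in a cusp or in a thin collar, and the shortest way back to the orbit may be the
  reversed arc. There a power of the short deck transformation offers a second way back in nearly
  the opposite direction. Corners are measured by Gromov products, so that the four-point inequality
  replaces angles and trigonometry. This controls the axis only up to a bounded distance, however
  long the arcs are; the precision \<epsilon> is gained at the very end, as a factor exp
  (-\<open>E\<close>) between the ends of a lengthened arc and the arc itself.\<close>

lemma cosh_hyp_dist:
  assumes "Im z > 0" "Im w > 0"
  shows "cosh (hyp_dist z w) = 1 + (cmod (z - w))\<^sup>2 / (2 * Im z * Im w)"
proof -
  have "0 \<le> (cmod (z - w))\<^sup>2 / (2 * Im z * Im w)" using assms by simp
  then show ?thesis unfolding hyp_dist_def by (intro cosh_arcosh_real) simp
qed

lemma hyp_dist_nonneg [simp]:
  assumes "Im z > 0" "Im w > 0"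
  shows "0 \<le> hyp_dist z w"
proof -
  have "0 \<le> (cmod (z - w))\<^sup>2 / (2 * Im z * Im w)" using assms by simp
  then show ?thesis unfolding hyp_dist_def by (intro arcosh_nonneg_real) simp
qed

lemma hyp_dist_commute: "hyp_dist z w = hyp_dist w z"
  unfolding hyp_dist_def by (simp add: norm_minus_commute mult.commute mult.left_commute)

text \<open>Half distances are used because their \<open>sinh\<close> is linear in the Euclidean
  distance, so that metric inequalities become Euclidean ones.\<close>

lemma sinh_half_hyp_dist:
  assumes "Im z > 0" "Im w > 0"
  shows "sinh (hyp_dist z w / 2) = cmod (z - w) / (2 * sqrt (Im z * Im w))"
proof -
  have "cosh (hyp_dist z w) = 1 + 2 * (sinh (hyp_dist z w / 2))\<^sup>2"
    using cosh_double[of "hyp_dist z w / 2"] cosh_square_eq[of "hyp_dist z w / 2"] by simp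
  then have "(sinh (hyp_dist z w / 2))\<^sup>2 = (cmod (z - w) / (2 * sqrt (Im z * Im w)))\<^sup>2"
    using cosh_hyp_dist[OF assms] assms by (simp add: power_divide power_mult_distrib field_simps)
  then show ?thesis using assms
    by (subst (asm) power2_eq_iff_nonneg) auto
qed

lemma cosh_half_hyp_dist:
  assumes "Im z > 0" "Im w > 0"
  shows "cosh (hyp_dist z w / 2) = cmod (z - cnj w) / (2 * sqrt (Im z * Im w))"
proof -
  have "(cosh (hyp_dist z w / 2))\<^sup>2 = 1 + (cmod (z - w))\<^sup>2 / (4 * Im z * Im w)"
    using cosh_square_eq[of "hyp_dist z w / 2"] sinh_half_hyp_dist[OF assms] assms
    by (simp add: power_divide power_mult_distrib field_simps)
  also have "\<dots> = (cmod (z - cnj w) / (2 * sqrt (Im z * Im w)))\<^sup>2"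
    using assms by (simp add: power_divide power_mult_distrib cmod_power2 field_simps)
       (simp add: power2_eq_square algebra_simps)
  finally show ?thesis using assms
    by (subst (asm) power2_eq_iff_nonneg) auto
qed

lemma hyp_dist_eq_0_iff [simp]:
  assumes "Im z > 0" "Im w > 0"
  shows "hyp_dist z w = 0 \<longleftrightarrow> z = w"
  using sinh_half_hyp_dist[OF assms] assms by (auto simp: hyp_dist_def)

lemma hyp_dist_self [simp]: "hyp_dist z z = 0"
  by (simp add: hyp_dist_def)

lemma cmod_Ptolemy: "cmod (x - z) * cmod (y - w) \<le> cmod (x - y) * cmod (z - w) + cmod (x - w) * cmod (y - z)"
proof -
  have "(x - z) * (y - w) = (x - y) * (z - w) + (x - w) * (y - z)" by (simp add: algebra_simps)
  then show ?thesis by (metis norm_mult norm_triangle_ineq)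
qed

lemma sinh_half_le_iff:
  fixes a b :: real shows "sinh (a / 2) \<le> sinh (b / 2) \<longleftrightarrow> a \<le> b"
  by simp

text \<open>The triangle inequality is Ptolemy's inequality for the four points \<open>x, y, z, cnj y\<close>.\<close>

lemma hyp_dist_triangle:
  assumes "Im x > 0" "Im y > 0" "Im z > 0"
  shows "hyp_dist x z \<le> hyp_dist x y + hyp_dist y z"
proof -
  have P: "cmod (x - z) * (2 * Im y) \<le> cmod (x - y) * cmod (y - cnj z) + cmod (x - cnj y) * cmod (y - z)"
  proof -
    have "cmod (y - cnj y) = 2 * Im y" using assms by (simp add: complex_diff_cnj norm_mult)
    moreover have "cmod (z - cnj y) = cmod (y - cnj z)"
      by (metis complex_cnj_cnj complex_cnj_diff complex_mod_cnj norm_minus_commute)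
    ultimately show ?thesis using cmod_Ptolemy[of x z y "cnj y"] by simp
  qed
  have "sinh (hyp_dist x z / 2) \<le> sinh (hyp_dist x y / 2 + hyp_dist y z / 2)"
    unfolding sinh_add
    unfolding sinh_half_hyp_dist[OF assms(1,3)] sinh_half_hyp_dist[OF assms(1,2)] sinh_half_hyp_dist[OF assms(2,3)]
      cosh_half_hyp_dist[OF assms(1,2)] cosh_half_hyp_dist[OF assms(2,3)]
    using P assms by (simp add: real_sqrt_mult divide_simps) (simp add: algebra_simps power2_eq_square flip: real_sqrt_mult)
  then have "sinh (hyp_dist x z / 2) \<le> sinh ((hyp_dist x y + hyp_dist y z) / 2)"
    by (simp add: add_divide_distrib)
  then show ?thesis unfolding sinh_half_le_iff .
qed

section \<open>The action of SL(2,R)\<close>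

text \<open>Explicit matrices instead of maps keep entries and traces at hand. A Moebius map is
  represented by two matrices, \<open>M\<close> and \<open>mneg M\<close>; where the sign matters,
  it is fixed by the trace.\<close>

datatype mat2 = Mat (ma: real) (mb: real) (mc: real) (md: real)

definition mmul :: "mat2 \<Rightarrow> mat2 \<Rightarrow> mat2" (infixl "\<odot>" 70) where
  "M \<odot> N = Mat (ma M * ma N + mb M * mc N) (ma M * mb N + mb M * md N)
               (mc M * ma N + md M * mc N) (mc M * mb N + md M * md N)"

definition mid :: mat2 where "mid = Mat 1 0 0 1"

definition madj :: "mat2 \<Rightarrow> mat2" where "madj M = Mat (md M) (- mb M) (- mc M) (ma M)"

definition mneg :: "mat2 \<Rightarrow> mat2" where "mneg M = Mat (- ma M) (- mb M) (- mc M) (- md M)"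

definition SL2 :: "mat2 set" where "SL2 = {M. ma M * md M - mb M * mc M = 1}"

definition mtr :: "mat2 \<Rightarrow> real" where "mtr M = ma M + md M"

definition act :: "mat2 \<Rightarrow> complex \<Rightarrow> complex" where
  "act M z = (of_real (ma M) * z + of_real (mb M)) / (of_real (mc M) * z + of_real (md M))"

lemma mid_in [simp]: "mid \<in> SL2" by (simp add: SL2_def mid_def)

lemma mmul_in [simp]: "M \<in> SL2 \<Longrightarrow> N \<in> SL2 \<Longrightarrow> M \<odot> N \<in> SL2"
proof -
  assume "M \<in> SL2" "N \<in> SL2"
  moreover have "ma (M \<odot> N) * md (M \<odot> N) - mb (M \<odot> N) * mc (M \<odot> N)
      = (ma M * md M - mb M * mc M) * (ma N * md N - mb N * mc N)"
    by (simp add: mmul_def algebra_simps)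
  ultimately show ?thesis by (simp add: SL2_def)
qed

lemma madj_in [simp]: "M \<in> SL2 \<Longrightarrow> madj M \<in> SL2"
  by (simp add: SL2_def madj_def algebra_simps)

lemma mneg_in [simp]: "M \<in> SL2 \<Longrightarrow> mneg M \<in> SL2"
  by (simp add: SL2_def mneg_def algebra_simps)

lemma mmul_assoc: "M \<odot> N \<odot> P = M \<odot> (N \<odot> P)"
  by (simp add: mmul_def algebra_simps)

lemma mmul_mid [simp]: "M \<odot> mid = M" "mid \<odot> M = M"
  by (simp_all add: mmul_def mid_def)

lemma mmul_madj [simp]: "M \<in> SL2 \<Longrightarrow> M \<odot> madj M = mid" "M \<in> SL2 \<Longrightarrow> madj M \<odot> M = mid"
  by (simp_all add: mmul_def mid_def madj_def SL2_def algebra_simps)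

lemma mmul_madj_cancel [simp]:
  "M \<in> SL2 \<Longrightarrow> M \<odot> (madj M \<odot> N) = N" "M \<in> SL2 \<Longrightarrow> madj M \<odot> (M \<odot> N) = N"
  "M \<in> SL2 \<Longrightarrow> N \<odot> M \<odot> madj M = N" "M \<in> SL2 \<Longrightarrow> N \<odot> madj M \<odot> M = N"
  by (simp_all flip: mmul_assoc) (simp_all add: mmul_assoc)

lemma madj_madj [simp]: "madj (madj M) = M" by (simp add: madj_def)

lemma madj_mmul: "madj (M \<odot> N) = madj N \<odot> madj M"
  by (simp add: madj_def mmul_def algebra_simps)

lemma mneg_mmul [simp]: "mneg M \<odot> N = mneg (M \<odot> N)" "M \<odot> mneg N = mneg (M \<odot> N)"
  by (simp_all add: mneg_def mmul_def)

lemma mneg_mneg [simp]: "mneg (mneg M) = M" by (simp add: mneg_def)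

lemma denom_nz: assumes "M \<in> SL2" "Im z > 0" shows "of_real (mc M) * z + of_real (md M) \<noteq> 0"
proof
  assume h: "of_real (mc M) * z + of_real (md M) = (0::complex)"
  then have "Im (of_real (mc M) * z + of_real (md M)) = 0" by simp
  then have "mc M * Im z = 0" by simp
  then have "mc M = 0" using assms by simp
  moreover from this h have "md M = 0" by simp
  ultimately show False using assms(1) by (simp add: SL2_def)
qed

lemma Im_act:
  assumes "M \<in> SL2" "Im z > 0"
  shows "Im (act M z) = Im z / (cmod (of_real (mc M) * z + of_real (md M)))\<^sup>2"
proof -
  have "Im (act M z) = (ma M * md M - mb M * mc M) * Im z / (cmod (of_real (mc M) * z + of_real (md M)))\<^sup>2"
    unfolding act_def Im_divide cmod_power2 by (simp add: algebra_simps power2_eq_square)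
  then show ?thesis using assms by (simp add: SL2_def)
qed

lemma Im_act_pos [simp]: "M \<in> SL2 \<Longrightarrow> Im z > 0 \<Longrightarrow> Im (act M z) > 0"
  using denom_nz[of M z] by (simp add: Im_act)

lemma act_diff:
  assumes "M \<in> SL2" "Im z > 0" "Im w > 0"
  shows "act M z - act M w
    = (z - w) / ((of_real (mc M) * z + of_real (md M)) * (of_real (mc M) * w + of_real (md M)))"
proof -
  let ?u = "of_real (mc M) * z + of_real (md M)" and ?v = "of_real (mc M) * w + of_real (md M)"
  have nz: "?u \<noteq> 0" "?v \<noteq> 0" using assms denom_nz by auto
  have "act M z - act M w = ((of_real (ma M) * z + of_real (mb M)) * ?v - (of_real (ma M) * w + of_real (mb M)) * ?u) / (?u * ?v)"
    unfolding act_def by (rule diff_frac_eq[OF nz])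
  also have "(of_real (ma M) * z + of_real (mb M)) * ?v - (of_real (ma M) * w + of_real (mb M)) * ?u
    = of_real (ma M * md M - mb M * mc M) * (z - w)"
    by (simp add: algebra_simps)
  also have "of_real (ma M * md M - mb M * mc M) * (z - w) = z - w"
    using assms by (simp add: SL2_def del: of_real_diff of_real_mult)
  finally show ?thesis .
qed

lemma hyp_dist_act [simp]:
  assumes "M \<in> SL2" "Im z > 0" "Im w > 0"
  shows "hyp_dist (act M z) (act M w) = hyp_dist z w"
proof -
  let ?u = "cmod (of_real (mc M) * z + of_real (md M))" and ?v = "cmod (of_real (mc M) * w + of_real (md M))"
  have nz: "?u > 0" "?v > 0" using assms denom_nz by auto
  have "(cmod (act M z - act M w))\<^sup>2 / (2 * Im (act M z) * Im (act M w)) = (cmod (z - w))\<^sup>2 / (2 * Im z * Im w)"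
    unfolding act_diff[OF assms] Im_act[OF assms(1,2)] Im_act[OF assms(1,3)] norm_divide norm_mult
    using nz by (simp add: power_divide power_mult_distrib)
  then show ?thesis unfolding hyp_dist_def by simp
qed

lemma act_mmul: 
  assumes "M \<in> SL2" "N \<in> SL2" "Im z > 0"
  shows "act (M \<odot> N) z = act M (act N z)"
proof -
  let ?p = "of_real (ma N) * z + of_real (mb N)" and ?q = "of_real (mc N) * z + of_real (md N)"
  have q: "?q \<noteq> 0" using assms denom_nz by auto
  have "act M (act N z) = ((of_real (ma M) * ?p + of_real (mb M) * ?q) / ?q) / ((of_real (mc M) * ?p + of_real (md M) * ?q) / ?q)"
  proof -
    have e: "x * (?p / ?q) + y = (x * ?p + y * ?q) / ?q" for x y using q by (simp add: field_simps)
    show ?thesis unfolding act_def[of M] act_def[of N] e ..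
  qed
  also have "\<dots> = (of_real (ma M) * ?p + of_real (mb M) * ?q) / (of_real (mc M) * ?p + of_real (md M) * ?q)"
    using q by simp
  also have "\<dots> = act (M \<odot> N) z"
    unfolding act_def mmul_def by (simp add: algebra_simps)
  finally show ?thesis by simp
qed

lemma act_mid [simp]: "act mid z = z" by (simp add: act_def mid_def)

lemma act_mneg [simp]: "act (mneg M) z = act M z"
proof -
  have "act (mneg M) z = (- (of_real (ma M) * z + of_real (mb M))) / (- (of_real (mc M) * z + of_real (md M)))"
    by (simp add: act_def mneg_def)
  then show ?thesis unfolding minus_divide_divide by (simp add: act_def)
qed

lemma act_madj [simp]:
  assumes "M \<in> SL2" "Im z > 0"
  shows "act M (act (madj M) z) = z" "act (madj M) (act M z) = z"
  using assms by (simp_all flip: act_mmul)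

text \<open>Fixed points are the roots of c z^2 + (d - a) z - b, whose discriminant is the square of
  the trace minus 4, hence negative; \<open>z\<close> is the root in the upper half-plane. Freeness
  of the deck group turns this into the trace bound \<open>\<Gamma>_trace\<close>.\<close>

lemma act_fix_elliptic:
  assumes "M \<in> SL2" "\<bar>mtr M\<bar> < 2"
  shows "\<exists>z. Im z > 0 \<and> act M z = z"
proof -
  let ?a = "ma M" and ?b = "mb M" and ?c = "mc M" and ?d = "md M"
  have det: "?a * ?d - ?b * ?c = 1" using assms by (simp add: SL2_def)
  have tr: "(?a + ?d)\<^sup>2 < 4" using assms unfolding mtr_def
    using power_strict_mono[of "\<bar>ma M + md M\<bar>" 2 2] by simp
  have c: "?c \<noteq> 0"
  proof
    assume "?c = 0"
    then have "?a * ?d = 1" using det by simp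
    then have "(?a - ?d)\<^sup>2 = (?a + ?d)\<^sup>2 - 4" by (simp add: power2_eq_square algebra_simps)
    then show False using tr zero_le_power2[of "?a - ?d"] by linarith
  qed
  define z where "z = Complex ((?a - ?d) / (2 * ?c)) (sqrt (4 - (?a + ?d)\<^sup>2) / (2 * \<bar>?c\<bar>))"
  have Im: "Im z > 0" using tr c by (simp add: z_def)
  have "(Im z)\<^sup>2 = (4 - (?a + ?d)\<^sup>2) / (4 * ?c\<^sup>2)" using tr by (simp add: z_def power_divide power_mult_distrib)
  then have Im2: "?c * (Im z)\<^sup>2 * (4 * ?c) = 4 - (?a + ?d)\<^sup>2" using c by (simp add: field_simps power2_eq_square)
  have Re: "2 * ?c * Re z = ?a - ?d" using c by (simp add: z_def)
  have "of_real ?c * z\<^sup>2 + of_real (?d - ?a) * z - of_real ?b = 0"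
  proof (rule complex_eqI)
    have "4 * ?c * (?c * ((Re z)\<^sup>2 - (Im z)\<^sup>2) + (?d - ?a) * Re z - ?b)
       = (2 * ?c * Re z)\<^sup>2 - ?c * (Im z)\<^sup>2 * (4 * ?c) + 2 * (?d - ?a) * (2 * ?c * Re z) - 4 * ?b * ?c"
      by (simp add: algebra_simps power2_eq_square)
    also have "\<dots> = 4 * (?a * ?d - ?b * ?c) - 4" unfolding Re Im2
      by (simp add: algebra_simps power2_eq_square)
    also have "\<dots> = 0" using det by simp
    finally have "?c * ((Re z)\<^sup>2 - (Im z)\<^sup>2) + (?d - ?a) * Re z - ?b = 0" using c by simp
    then show "Re (of_real ?c * z\<^sup>2 + of_real (?d - ?a) * z - of_real ?b) = Re 0"
      by (simp add: power2_eq_square algebra_simps)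
    have "?c * (2 * Re z * Im z) + (?d - ?a) * Im z = Im z * (2 * ?c * Re z - (?a - ?d))" by (simp add: algebra_simps)
    then show "Im (of_real ?c * z\<^sup>2 + of_real (?d - ?a) * z - of_real ?b) = Im 0"
      unfolding Re by (simp add: power2_eq_square algebra_simps)
  qed
  then have "of_real ?a * z + of_real ?b = z * (of_real ?c * z + of_real ?d)"
    by (simp add: algebra_simps power2_eq_square)
  then have "act M z = z" unfolding act_def using denom_nz[OF assms(1) Im] by (simp add: field_simps)
  then show ?thesis using Im by blast
qed

lemma exists_act_i:
  assumes "Im z > 0"
  shows "\<exists>M\<in>SL2. act M \<i> = z"
proof
  let ?M = "Mat (sqrt (Im z)) (Re z / sqrt (Im z)) 0 (1 / sqrt (Im z))"
  show "?M \<in> SL2" using assms by (simp add: SL2_def)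
  have "of_real (sqrt (Im z)) * complex_of_real (sqrt (Im z)) = of_real (Im z)"
    using assms by (simp flip: of_real_mult)
  then show "act ?M \<i> = z" using assms
    by (simp add: act_def field_simps complex_eq_iff)
qed

text \<open>In the disk coordinate \<open>u\<close> = (w - i) / (w + i), the rotation matrix of
  angle \<phi> acts as multiplication by cis (2 \<phi>). The choice \<phi> = - Arg u / 2 turns
  \<open>u\<close> onto the nonnegative reals, and these are the points of the imaginary axis from
  \<open>\<i>\<close> upwards.\<close>

lemma exists_rotation:
  assumes "Im w > 0"
  shows "\<exists>M\<in>SL2. act M \<i> = \<i> \<and> (\<exists>t\<ge>1. act M w = of_real t * \<i>)"
proof -
  define u where "u = (w - \<i>) / (w + \<i>)"
  have wi: "w + \<i> \<noteq> 0" using assms by (auto simp: complex_eq_iff)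
  have "cmod (w - \<i>) < cmod (w + \<i>)"
  proof -
    have "(cmod (w - \<i>))\<^sup>2 < (cmod (w + \<i>))\<^sup>2"
      unfolding cmod_power2 using assms by (simp add: power2_eq_square algebra_simps)
    then show ?thesis by (simp add: power2_less_imp_less)
  qed
  then have u1: "cmod u < 1" using wi by (simp add: u_def norm_divide)
  define \<phi> where "\<phi> = - Arg u / 2"
  let ?M = "Mat (cos \<phi>) (sin \<phi>) (- sin \<phi>) (cos \<phi>)"
  have M: "?M \<in> SL2" using sin_cos_squared_add2[of \<phi>] by (simp add: SL2_def power2_eq_square)
  have Mi: "act ?M \<i> = \<i>"
  proof -
    have "of_real (- sin \<phi>) * \<i> + complex_of_real (cos \<phi>) \<noteq> 0" using denom_nz[OF M, of \<i>] by simp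
    moreover have "of_real (cos \<phi>) * \<i> + complex_of_real (sin \<phi>) = \<i> * (of_real (- sin \<phi>) * \<i> + of_real (cos \<phi>))"
      by (simp add: algebra_simps)
    ultimately show ?thesis by (simp add: act_def)
  qed
  define v where "v = act ?M w"
  have v: "Im v > 0" unfolding v_def using M assms by simp
  let ?D = "of_real (- sin \<phi>) * w + complex_of_real (cos \<phi>)"
  have D: "?D \<noteq> 0" using denom_nz[OF M assms] by simp
  have v1: "v - \<i> = cis \<phi> * (w - \<i>) / ?D" "v + \<i> = cis (- \<phi>) * (w + \<i>) / ?D"
  proof -
    have c: "cis \<phi> = of_real (cos \<phi>) + \<i> * of_real (sin \<phi>)" "cis (- \<phi>) = of_real (cos \<phi>) - \<i> * of_real (sin \<phi>)"
      by (simp_all add: complex_eq_iff)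
    have e: "act ?M w = (of_real (cos \<phi>) * w + of_real (sin \<phi>)) / ?D" by (simp add: act_def)
    have "v - \<i> = ((of_real (cos \<phi>) * w + of_real (sin \<phi>)) - \<i> * ?D) / ?D"
      unfolding v_def e using D by (simp add: diff_divide_distrib)
    also have "(of_real (cos \<phi>) * w + of_real (sin \<phi>)) - \<i> * ?D = cis \<phi> * (w - \<i>)"
      unfolding c by (simp add: algebra_simps)
    finally show "v - \<i> = cis \<phi> * (w - \<i>) / ?D" .
    have "v + \<i> = ((of_real (cos \<phi>) * w + of_real (sin \<phi>)) + \<i> * ?D) / ?D"
      unfolding v_def e using D by (simp add: add_divide_distrib)
    also have "(of_real (cos \<phi>) * w + of_real (sin \<phi>)) + \<i> * ?D = cis (- \<phi>) * (w + \<i>)"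
      unfolding c by (simp add: algebra_simps)
    finally show "v + \<i> = cis (- \<phi>) * (w + \<i>) / ?D" .
  qed
  have vi: "v + \<i> \<noteq> 0" unfolding v1(2) using D wi by simp
  have "(v - \<i>) / (v + \<i>) = (cis \<phi> / cis (- \<phi>)) * u"
    unfolding v1 u_def using D by simp
  also have "cis \<phi> / cis (- \<phi>) = cis (- Arg u)" unfolding cis_divide by (simp add: \<phi>_def)
  also have "cis (- Arg u) * u = of_real (cmod u)"
  proof -
    have "cis (- Arg u) * u = cis (- Arg u) * rcis (cmod u) (Arg u)" by (simp only: rcis_cmod_Arg)
    also have "\<dots> = of_real (cmod u) * (cis (- Arg u) * cis (Arg u))" by (simp only: rcis_def mult_ac)
    also have "\<dots> = of_real (cmod u)" by (simp add: cis_mult)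
    finally show ?thesis .
  qed
  finally have "v - \<i> = of_real (cmod u) * (v + \<i>)" using nonzero_divide_eq_eq[OF vi] by blast
  then have "v * of_real (1 - cmod u) = of_real (1 + cmod u) * \<i>" by (simp add: algebra_simps)
  moreover have nz: "complex_of_real (1 - cmod u) \<noteq> 0" using u1 by (simp del: of_real_diff)
  ultimately have "v = of_real (1 + cmod u) * \<i> / of_real (1 - cmod u)"
    using nonzero_eq_divide_eq[OF nz] by blast
  then have "v = of_real ((1 + cmod u) / (1 - cmod u)) * \<i>"
    by (simp only: of_real_divide times_divide_eq_left)
  moreover have "(1 + cmod u) / (1 - cmod u) \<ge> 1" using u1 by (simp add: field_simps)
  ultimately have "\<exists>t\<ge>1. act ?M w = of_real t * \<i>" unfolding v_def[symmetric] by blast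
  then show ?thesis using M Mi by (intro bexI[of _ ?M] conjI)
qed

lemma hyp_dist_vertical:
  assumes "t > 0" "s > 0"
  shows "hyp_dist (of_real t * \<i>) (of_real s * \<i>) = \<bar>ln t - ln s\<bar>"
proof -
  have "cosh (hyp_dist (of_real t * \<i>) (of_real s * \<i>)) = 1 + (t - s)\<^sup>2 / (2 * t * s)"
    using assms by (subst cosh_hyp_dist) (simp_all add: cmod_power2)
  also have "\<dots> = (t / s + s / t) / 2" using assms by (simp add: field_simps power2_eq_square)
  also have "\<dots> = cosh (\<bar>ln t - ln s\<bar>)"
    using assms unfolding cosh_real_abs by (simp add: cosh_def exp_diff exp_minus field_simps)
  finally have "arcosh (cosh (hyp_dist (of_real t * \<i>) (of_real s * \<i>))) = arcosh (cosh (\<bar>ln t - ln s\<bar>))"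
    by (rule arg_cong)
  then show ?thesis using assms by (subst (asm) (1 2) arcosh_cosh_real) simp_all
qed

lemma hyp_normal_form:
  assumes "Im z > 0" "Im w > 0"
  shows "\<exists>M\<in>SL2. act M \<i> = z \<and> act M (of_real (exp (hyp_dist z w)) * \<i>) = w"
proof -
  obtain P where P: "P \<in> SL2" "act P \<i> = z" using exists_act_i assms by blast
  define w' where "w' = act (madj P) w"
  have w': "Im w' > 0" using P assms by (simp add: w'_def)
  obtain R t where R: "R \<in> SL2" "act R \<i> = \<i>" "t \<ge> 1" "act R w' = of_real t * \<i>"
    using exists_rotation[OF w'] by blast
  let ?M = "P \<odot> madj R"
  have i: "act (madj R) \<i> = \<i>" using R by (metis act_madj(2) imaginary_unit.sel(2) zero_less_one)
  have M1: "act ?M \<i> = z" using P R i by (simp add: act_mmul)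
  have "act (madj R) (of_real t * \<i>) = w'" using R w' by (metis act_madj(2))
  then have M2: "act ?M (of_real t * \<i>) = w" using P R assms by (simp add: act_mmul w'_def)
  have "hyp_dist z w = hyp_dist (of_real 1 * \<i>) (of_real t * \<i>)"
    using M1 M2 P R hyp_dist_act[of ?M \<i> "of_real t * \<i>"] by simp
  also have "\<dots> = ln t" using R by (subst hyp_dist_vertical) auto
  finally have "exp (hyp_dist z w) = t" using R by simp
  then show ?thesis using M1 M2 P R by (metis madj_in mmul_in)
qed

lemma hyp_dist_pair_transitive:
  assumes "Im z > 0" "Im w > 0" "Im z' > 0" "Im w' > 0" "hyp_dist z w = hyp_dist z' w'"
  shows "\<exists>M\<in>SL2. act M z = z' \<and> act M w = w'"
proof -
  obtain P where P: "P \<in> SL2" "act P \<i> = z" "act P (of_real (exp (hyp_dist z w)) * \<i>) = w"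
    using hyp_normal_form[OF assms(1,2)] by blast
  obtain Q where Q: "Q \<in> SL2" "act Q \<i> = z'" "act Q (of_real (exp (hyp_dist z w)) * \<i>) = w'"
    using hyp_normal_form[OF assms(3,4)] assms(5) by auto
  have "act (madj P) z = \<i>" "act (madj P) w = of_real (exp (hyp_dist z w)) * \<i>"
    using act_madj(2)[OF P(1), of \<i>] act_madj(2)[OF P(1), of "of_real (exp (hyp_dist z w)) * \<i>"] P
    by (simp_all del: of_real_exp)
  then show ?thesis using P Q assms by (intro bexI[of _ "Q \<odot> madj P"]) (simp_all add: act_mmul)
qed

lemma abs_ln_Im_le_hyp_dist:
  assumes "Im z > 0" "Im w > 0"
  shows "\<bar>ln (Im z) - ln (Im w)\<bar> \<le> hyp_dist z w"
    and "hyp_dist z w = \<bar>ln (Im z) - ln (Im w)\<bar> \<Longrightarrow> Re z = Re w"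
proof -
  let ?d = "\<bar>ln (Im z) - ln (Im w)\<bar>"
  have c: "cosh ?d = 1 + (Im z - Im w)\<^sup>2 / (2 * Im z * Im w)"
    using assms unfolding cosh_real_abs by (simp add: cosh_def exp_diff exp_minus field_simps power2_eq_square)
  have e: "cosh (hyp_dist z w) = cosh ?d + (Re z - Re w)\<^sup>2 / (2 * Im z * Im w)"
    unfolding c cosh_hyp_dist[OF assms] cmod_power2 by (simp add: add_divide_distrib)
  have "cosh ?d \<le> cosh (hyp_dist z w)" unfolding e using assms by simp
  then show "?d \<le> hyp_dist z w" using assms by (subst (asm) cosh_real_nonneg_le_iff) simp_all
  show "Re z = Re w" if "hyp_dist z w = ?d"
    using e assms unfolding that by simp
qed

lemma hyp_geodesic_unique:
  assumes "Im z > 0" "t \<ge> 0" "s \<ge> 0"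
    and "hyp_dist \<i> z = t" "hyp_dist z (of_real (exp (t + s)) * \<i>) = s"
  shows "z = of_real (exp t) * \<i>"
proof -
  have 1: "\<bar>ln (Im z)\<bar> \<le> t" using abs_ln_Im_le_hyp_dist(1)[of \<i> z] assms by simp
  have 2: "\<bar>ln (Im z) - (t + s)\<bar> \<le> s" using abs_ln_Im_le_hyp_dist(1)[of z "of_real (exp (t + s)) * \<i>"] assms by simp
  have 3: "ln (Im z) = t" using 1 2 by linarith
  then have "Im z = exp t" using assms by (metis exp_ln)
  moreover have "Re z = 0" using abs_ln_Im_le_hyp_dist(2)[of \<i> z] assms 3 by simp
  ultimately show ?thesis by (simp add: complex_eq_iff)
qed

section \<open>Geodesic lines with unit speed, encoded by the matrix that moves the imaginary axis
  onto them\<close>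

definition hline :: "mat2 \<Rightarrow> real \<Rightarrow> complex" where
  "hline M s = act M (of_real (exp s) * \<i>)"

lemma Im_hline_pos [simp]: "M \<in> SL2 \<Longrightarrow> Im (hline M s) > 0"
  by (simp add: hline_def)

lemma hyp_dist_hline [simp]: "M \<in> SL2 \<Longrightarrow> hyp_dist (hline M s) (hline M t) = \<bar>s - t\<bar>"
  unfolding hline_def by (simp del: of_real_exp add: hyp_dist_vertical)

lemma exists_hline:
  assumes "Im z > 0" "Im w > 0"
  shows "\<exists>M\<in>SL2. hline M 0 = z \<and> hline M (hyp_dist z w) = w"
  using hyp_normal_form[OF assms] by (auto simp: hline_def)

lemma act_hline: "M \<in> SL2 \<Longrightarrow> N \<in> SL2 \<Longrightarrow> act M (hline N s) = hline (M \<odot> N) s"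
  by (simp add: hline_def act_mmul)

lemma hline_unique:
  assumes "M \<in> SL2" "Im z > 0" "s \<le> t" "t \<le> r" "hyp_dist (hline M s) z = t - s" "hyp_dist z (hline M r) = r - t"
  shows "z = hline M t"
proof -
  \<comment> \<open>\<open>T\<close> slides the imaginary axis along itself by \<open>s\<close>, so
    that the segment starts at parameter 0 as in \<open>hyp_geodesic_unique\<close>.\<close>
  define T where "T = Mat (exp (s/2)) 0 0 (exp (-s/2))"
  have T: "T \<in> SL2" by (simp add: SL2_def T_def flip: exp_add)
  have actT: "act T (of_real (exp u) * \<i>) = of_real (exp (u + s)) * \<i>" for u
  proof -
    have "exp (u + s) = exp (s/2) * exp u / exp (-s/2)" by (simp flip: exp_add exp_diff)
    then show ?thesis by (simp add: act_def T_def del: of_real_exp)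
  qed
  let ?N = "M \<odot> T"
  have N: "?N \<in> SL2" using assms T by simp
  have h: "hline M (u + s) = act ?N (of_real (exp u) * \<i>)" for u
    unfolding hline_def using assms T by (simp add: act_mmul actT del: of_real_exp)
  define z' where "z' = act (madj ?N) z"
  have z': "Im z' > 0" "z = act ?N z'" using N assms by (auto simp: z'_def)
  have "hyp_dist \<i> z' = t - s" 
    using assms(5) h[of 0] N z' by simp
  moreover have "hyp_dist z' (of_real (exp ((t - s) + (r - t))) * \<i>) = r - t"
    using assms(6) h[of "r - s"] N z' by (simp del: of_real_exp)
  ultimately have "z' = of_real (exp (t - s)) * \<i>" using assms z' by (intro hyp_geodesic_unique[where s = "r - t"]) auto
  then show ?thesis using h[of "t - s"] z' by simp
qed

text \<open>Ptolemy's inequality holds for the products of \<open>sinh\<close> of half distances,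
  and 2 sinh (d / 2) differs from exp (d / 2) by at most 1. Five terms of size at most exp (M / 2)
  remain, and 5 \<le> exp 2 yields the additive constant 4. The corner estimates below use
  hyperbolicity only in this form.\<close>

lemma hyp_dist_four_point:
  assumes "Im x > 0" "Im y > 0" "Im z > 0" "Im w > 0"
  shows "hyp_dist x y + hyp_dist z w \<le> max (hyp_dist x z + hyp_dist y w) (hyp_dist x w + hyp_dist y z) + 4"
proof -
  define M where "M = max (hyp_dist x z + hyp_dist y w) (hyp_dist x w + hyp_dist y z)"
  define e where "e = (\<lambda>u v. exp (hyp_dist u v / 2))"
  have tri: "hyp_dist x y \<le> hyp_dist x z + hyp_dist z y" "hyp_dist x y \<le> hyp_dist x w + hyp_dist w y"
     "hyp_dist z w \<le> hyp_dist z x + hyp_dist x w" "hyp_dist z w \<le> hyp_dist z y + hyp_dist y w"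
    using assms by (auto intro: hyp_dist_triangle)
  \<comment> \<open>Each is the average of the two triangle inequalities through the other two
    points.\<close>
  have m1: "hyp_dist x y \<le> M" "hyp_dist z w \<le> M" 
    using tri hyp_dist_commute[of z y] hyp_dist_commute[of w y] hyp_dist_commute[of z x] unfolding M_def by linarith+
  have m2: "0 \<le> M" using assms m1(1) hyp_dist_nonneg[of x y] by linarith
  let ?s = "\<lambda>u v. sinh (hyp_dist u v / 2)"
  have P: "?s x y * ?s z w \<le> ?s x z * ?s y w + ?s x w * ?s y z"
  proof -
    have "cmod (x - y) * cmod (z - w) \<le> cmod (x - z) * cmod (y - w) + cmod (x - w) * cmod (y - z)"
      using cmod_Ptolemy[of x y z w] norm_minus_commute[of z y] by (simp add: mult.commute)
    then show ?thesis using assms by (simp add: sinh_half_hyp_dist real_sqrt_mult divide_simps)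
  qed
  have s_le: "2 * ?s u v \<le> e u v" for u v by (simp add: sinh_def e_def)
  have s_nonneg: "0 \<le> ?s u v" if "Im u > 0" "Im v > 0" for u v using that by simp
  have e_le: "e u v \<le> 2 * ?s u v + 1" if "Im u > 0" "Im v > 0" for u v
  proof -
    have "exp (- (hyp_dist u v / 2)) \<le> 1" unfolding exp_le_one_iff using that by simp
    moreover have "2 * ?s u v = exp (hyp_dist u v / 2) - exp (- (hyp_dist u v / 2))" by (simp add: sinh_def)
    ultimately show ?thesis unfolding e_def by linarith
  qed
  have prod_le: "4 * (?s u v * ?s u' v') \<le> exp (M / 2)"
    if "hyp_dist u v + hyp_dist u' v' \<le> M" "Im u > 0" "Im v > 0" "Im u' > 0" "Im v' > 0" for u v u' v'
  proof -
    have "(2 * ?s u v) * (2 * ?s u' v') \<le> e u v * e u' v'"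
      by (intro mult_mono s_le) (use s_nonneg that in \<open>auto simp: e_def\<close>)
    also have "\<dots> = exp ((hyp_dist u v + hyp_dist u' v') / 2)" by (simp add: e_def add_divide_distrib flip: exp_add)
    also have "\<dots> \<le> exp (M / 2)" using that by simp
    finally show ?thesis by (simp add: algebra_simps)
  qed
  have "e x y * e z w \<le> (2 * ?s x y + 1) * (2 * ?s z w + 1)"
    by (intro mult_mono e_le) (use assms s_nonneg in \<open>auto simp: e_def\<close>)
  also have "\<dots> = 4 * (?s x y * ?s z w) + 2 * ?s x y + 2 * ?s z w + 1" by (simp add: algebra_simps)
  also have "\<dots> \<le> 4 * (?s x z * ?s y w) + 4 * (?s x w * ?s y z) + e x y + e z w + 1"
    using P s_le[of x y] s_le[of z w] by linarith
  also have "\<dots> \<le> exp (M/2) + exp (M/2) + exp (M/2) + exp (M/2) + exp (M/2)"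
    using prod_le[of x z y w] prod_le[of x w y z] assms m1 m2 by (intro add_mono) (auto simp: M_def e_def)
  also have "\<dots> = 5 * exp (M / 2)" by simp
  also have "\<dots> \<le> exp 2 * exp (M / 2)"
  proof -
    have "(5::real) \<le> exp 2" using exp_lower_Taylor_quadratic[of "2::real"] by simp
    then show ?thesis by simp
  qed
  finally have "exp ((hyp_dist x y + hyp_dist z w) / 2) \<le> exp ((M + 4) / 2)"
    by (simp add: e_def add_divide_distrib flip: exp_add) 
  then show ?thesis unfolding M_def by simp
qed

section \<open>Hyperbolic balls\<close>

definition hball :: "complex \<Rightarrow> real \<Rightarrow> complex set" where
  "hball z r = {w. Im w > 0 \<and> hyp_dist z w < r}"

text \<open>The purpose is to see hyperbolic balls as Euclidean ones: openness, convexity,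
  connectedness and compactness of closed balls are then available for the usual topology.\<close>

lemma hyp_dist_less_iff:
  assumes "Im z > 0" "Im w > 0" "r \<ge> 0"
  shows "hyp_dist z w < r \<longleftrightarrow> dist (Complex (Re z) (Im z * cosh r)) w < Im z * sinh r"
    and "hyp_dist z w \<le> r \<longleftrightarrow> dist (Complex (Re z) (Im z * cosh r)) w \<le> Im z * sinh r"
proof -
  let ?c = "Complex (Re z) (Im z * cosh r)"
  have "cosh (hyp_dist z w) * (2 * Im z * Im w) = 2 * Im z * Im w + (cmod (z - w))\<^sup>2"
    unfolding cosh_hyp_dist[OF assms(1,2)] using assms(1,2) by (simp add: distrib_right)
  then have eq: "(cosh (hyp_dist z w) - cosh r) * (2 * Im z * Im w) = (dist ?c w)\<^sup>2 - (Im z * sinh r)\<^sup>2"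
    unfolding dist_complex_def cmod_power2 power_mult_distrib sinh_square_eq
    by (simp add: algebra_simps power2_eq_square)
  have pos: "2 * Im z * Im w > 0" using assms by simp
  have rpos: "0 \<le> Im z * sinh r" using assms by simp
  have "hyp_dist z w < r \<longleftrightarrow> cosh (hyp_dist z w) - cosh r < 0"
    using assms by (simp add: cosh_real_nonneg_less_iff)
  also have "\<dots> \<longleftrightarrow> (cosh (hyp_dist z w) - cosh r) * (2 * Im z * Im w) < 0"
    by (metis mult_less_cancel_right_pos[OF pos] mult_zero_left)
  also have "\<dots> \<longleftrightarrow> dist ?c w < Im z * sinh r"
    unfolding eq diff_less_0_iff_less using rpos power_mono_iff[of "Im z * sinh r" "dist ?c w" 2]
    by (simp add: not_le[symmetric])
  finally show "hyp_dist z w < r \<longleftrightarrow> dist ?c w < Im z * sinh r" .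
  have "hyp_dist z w \<le> r \<longleftrightarrow> cosh (hyp_dist z w) - cosh r \<le> 0"
    using assms by (simp add: cosh_real_nonneg_le_iff)
  also have "\<dots> \<longleftrightarrow> (cosh (hyp_dist z w) - cosh r) * (2 * Im z * Im w) \<le> 0"
    by (metis mult_le_cancel_right_pos[OF pos] mult_zero_left)
  also have "\<dots> \<longleftrightarrow> dist ?c w \<le> Im z * sinh r"
    unfolding eq diff_le_0_iff_le using rpos by (intro power_mono_iff) simp_all
  finally show "hyp_dist z w \<le> r \<longleftrightarrow> dist ?c w \<le> Im z * sinh r" .
qed

lemma euclidean_ball_in_upper:
  assumes "Im z > 0" "dist (Complex (Re z) (Im z * cosh r)) w \<le> Im z * sinh r"
  shows "Im w > 0"
proof -
  have "\<bar>Im z * cosh r - Im w\<bar> \<le> Im z * sinh r"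
    using assms(2) abs_Im_le_cmod[of "Complex (Re z) (Im z * cosh r) - w"] by (simp add: dist_complex_def)
  moreover have "Im z * sinh r < Im z * cosh r" using assms sinh_less_cosh_real by simp
  ultimately show ?thesis by linarith
qed

lemma hball_eq_ball:
  assumes "Im z > 0" "r \<ge> 0"
  shows "hball z r = ball (Complex (Re z) (Im z * cosh r)) (Im z * sinh r)"
  unfolding hball_def using assms hyp_dist_less_iff(1)[OF assms(1) _ assms(2)] euclidean_ball_in_upper[OF assms(1) less_imp_le]
  by auto

lemma hcball_eq_cball:
  assumes "Im z > 0" "r \<ge> 0"
  shows "{w. Im w > 0 \<and> hyp_dist z w \<le> r} = cball (Complex (Re z) (Im z * cosh r)) (Im z * sinh r)"
  using assms hyp_dist_less_iff(2)[OF assms(1) _ assms(2)] euclidean_ball_in_upper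
  by auto

lemma hball_subset_ball:
  assumes "Im z > 0" "r \<ge> 0"
  shows "hball z r \<subseteq> ball z (Im z * (exp r - 1))"
proof
  fix w assume "w \<in> hball z r"
  then have "dist (Complex (Re z) (Im z * cosh r)) w < Im z * sinh r"
    using assms by (simp add: hball_eq_ball)
  moreover have "dist z (Complex (Re z) (Im z * cosh r)) = Im z * (cosh r - 1)"
  proof -
    have "z - Complex (Re z) (Im z * cosh r) = of_real (- (Im z * (cosh r - 1))) * \<i>"
      by (simp add: complex_eq_iff algebra_simps)
    then have "dist z (Complex (Re z) (Im z * cosh r)) = \<bar>Im z * (cosh r - 1)\<bar>"
      unfolding dist_complex_def by (simp only: norm_mult norm_of_real norm_ii abs_minus_cancel mult_1_right)
    then show ?thesis using assms cosh_real_ge_1[of r] by simp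
  qed
  ultimately have "dist z w < Im z * (cosh r - 1) + Im z * sinh r"
    using dist_triangle[of z w "Complex (Re z) (Im z * cosh r)"] by linarith
  also have "\<dots> = Im z * (exp r - 1)" unfolding cosh_plus_sinh[symmetric] by (simp add: algebra_simps)
  finally show "w \<in> ball z (Im z * (exp r - 1))" by simp
qed

lemma open_hball [simp]: "Im z > 0 \<Longrightarrow> open (hball z r)"
proof (cases "r \<ge> 0")
  case False
  assume "Im z > 0"
  then have "hball z r = {}" using False hyp_dist_nonneg[of z] by (fastforce simp: hball_def)
  then show ?thesis by simp
qed (simp add: hball_eq_ball)

lemma centre_in_hball [simp]: "Im z > 0 \<Longrightarrow> z \<in> hball z r \<longleftrightarrow> r > 0"
  by (simp add: hball_def)

lemma convex_hball: "Im z > 0 \<Longrightarrow> r \<ge> 0 \<Longrightarrow> convex (hball z r)"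
  by (simp add: hball_eq_ball)

lemma connected_hball: "Im z > 0 \<Longrightarrow> r \<ge> 0 \<Longrightarrow> connected (hball z r)"
  by (simp add: hball_eq_ball)

lemma hball_mono: "r \<le> s \<Longrightarrow> hball z r \<subseteq> hball z s"
  by (auto simp: hball_def)

lemma hball_Im: "w \<in> hball z r \<Longrightarrow> Im w > 0" by (simp add: hball_def)

lemma hball_dist: "w \<in> hball z r \<Longrightarrow> hyp_dist z w < r" by (simp add: hball_def)

lemma exists_hball_subset:
  assumes "open S" "z \<in> S" "Im z > 0"
  shows "\<exists>r>0. hball z r \<subseteq> S"
proof -
  obtain e where e: "e > 0" "ball z e \<subseteq> S" using assms by (auto simp: open_contains_ball)
  let ?r = "ln (1 + e / Im z)"
  have "e / Im z > 0" using e assms by simp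
  then have "?r > 0" by simp
  moreover have "exp ?r = 1 + e / Im z" using e assms by (intro exp_ln) (simp add: add_pos_pos)
  then have "Im z * (exp ?r - 1) = e" using assms by simp
  then have "hball z ?r \<subseteq> ball z e" using hball_subset_ball[of z ?r] assms \<open>?r > 0\<close> by simp
  ultimately show ?thesis using e by blast
qed

lemma hball_subset_hball:
  assumes "Im z > 0" "w \<in> hball z r" "hyp_dist z w + s \<le> r"
  shows "hball w s \<subseteq> hball z r"
proof
  fix u assume u: "u \<in> hball w s"
  have "hyp_dist z u \<le> hyp_dist z w + hyp_dist w u"
    using assms u by (intro hyp_dist_triangle) (auto dest: hball_Im)
  then show "u \<in> hball z r" using u assms by (auto simp: hball_def)
qed

lemma act_hball: "M \<in> SL2 \<Longrightarrow> Im z > 0 \<Longrightarrow> w \<in> hball z r \<Longrightarrow> act M w \<in> hball (act M z) r"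
  by (auto simp: hball_def)

lemma open_iff_hball:
  assumes "S \<subseteq> {z. Im z > 0}"
  shows "open S \<longleftrightarrow> (\<forall>z\<in>S. \<exists>r>0. hball z r \<subseteq> S)"
proof
  assume "open S" then show "\<forall>z\<in>S. \<exists>r>0. hball z r \<subseteq> S" using assms exists_hball_subset by blast
next
  assume r: "\<forall>z\<in>S. \<exists>r>0. hball z r \<subseteq> S"
  show "open S"
  proof (subst open_subopen, intro ballI)
    fix z assume "z \<in> S"
    then obtain r where "r > 0" "hball z r \<subseteq> S" using r by blast
    then show "\<exists>T. open T \<and> z \<in> T \<and> T \<subseteq> S" using \<open>z \<in> S\<close> assms by (intro exI[of _ "hball z r"]) auto
  qed
qed

lemma holomorphic_act: "M \<in> SL2 \<Longrightarrow> S \<subseteq> {z. Im z > 0} \<Longrightarrow> act M holomorphic_on S"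
  unfolding act_def using denom_nz by (intro holomorphic_intros) blast

lemma le_sinh: "0 \<le> x \<Longrightarrow> x \<le> sinh x" for x :: real
  using real_le_x_sinh[of x] by (simp add: sinh_def exp_minus)

lemma hyp_dist_le_euclidean:
  assumes "Im z > 0" "Im w > 0"
  shows "hyp_dist z w \<le> cmod (z - w) / sqrt (Im z * Im w)"
proof -
  have "hyp_dist z w / 2 \<le> sinh (hyp_dist z w / 2)" using assms by (intro le_sinh) simp
  then show ?thesis unfolding sinh_half_hyp_dist[OF assms] by simp
qed

text \<open>If the lower left entry is nonzero, a fixed point \<open>u\<close> has its real part and
  its modulus determined by the matrix, so that only one point of the upper half-plane can be fixed.
  Two fixed points therefore force this entry to vanish, and then the matrix is scalar.\<close>

lemma act_fix_two:
  assumes "M \<in> SL2" "Im z > 0" "Im w > 0" "z \<noteq> w" "act M z = z" "act M w = w"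
  shows "M = mid \<or> M = mneg mid"
proof -
  let ?a = "ma M" and ?b = "mb M" and ?c = "mc M" and ?d = "md M"
  have *: "?d - ?a = - 2 * ?c * Re u \<and> ?b = - ?c * (cmod u)\<^sup>2" if "Im u > 0" "act M u = u" for u
  proof -
    have "of_real ?a * u + of_real ?b = u * (of_real ?c * u + of_real ?d)"
      using that denom_nz[OF assms(1) that(1)] unfolding act_def by (simp add: field_simps)
    then have re: "?a * Re u + ?b = ?c * ((Re u)\<^sup>2 - (Im u)\<^sup>2) + ?d * Re u"
      and im: "?a * Im u = ?c * (2 * Re u * Im u) + ?d * Im u"
      by (simp_all add: complex_eq_iff algebra_simps power2_eq_square)
    have "?a * Im u = (?c * (2 * Re u) + ?d) * Im u" using im by (simp add: algebra_simps)
    then have a: "?a = ?c * (2 * Re u) + ?d" using that by simp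
    then show ?thesis using re unfolding cmod_power2 by (simp add: algebra_simps power2_eq_square)
  qed
  have c: "?c = 0"
  proof (rule ccontr)
    assume c: "?c \<noteq> 0"
    then have "Re z = Re w" "(cmod z)\<^sup>2 = (cmod w)\<^sup>2" using *[of z] *[of w] assms by auto
    then have "(Im z)\<^sup>2 = (Im w)\<^sup>2" unfolding cmod_power2 by simp
    then have "Im z = Im w" using assms by (simp add: power2_eq_iff)
    with \<open>Re z = Re w\<close> show False using assms by (simp add: complex_eq_iff)
  qed
  then have "?d = ?a" "?b = 0" using *[of z] assms by auto
  moreover from this have "?a * ?a = 1" using assms(1) c by (simp add: SL2_def)
  then have "?a = 1 \<or> ?a = -1" by (simp add: square_eq_1_iff)
  ultimately show ?thesis using c by (cases M) (auto simp: mid_def mneg_def)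
qed

lemma act_eqI:
  assumes "M \<in> SL2" "N \<in> SL2" "Im z > 0" "Im w > 0" "z \<noteq> w" "act M z = act N z" "act M w = act N w"
  shows "M = N \<or> M = mneg N"
proof -
  have "madj N \<odot> M = mid \<or> madj N \<odot> M = mneg mid"
    by (rule act_fix_two[of _ z w]) (use assms in \<open>simp_all add: act_mmul\<close>)
  then have "N \<odot> (madj N \<odot> M) = N \<or> N \<odot> (madj N \<odot> M) = mneg N" by auto
  then show ?thesis using assms by simp
qed

lemma exists_other_point:
  assumes "Im z > 0" "r > 0"
  shows "\<exists>w\<in>hball z r. w \<noteq> z"
proof -
  obtain P where P: "P \<in> SL2" "hline P 0 = z"
    using exists_hline[OF assms(1) assms(1)] by blast
  have "hyp_dist z (hline P (r/2)) = r / 2" using P(1) hyp_dist_hline[OF P(1), of 0 "r/2"] assms by (simp add: P(2))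
  then have "hline P (r/2) \<in> hball z r" "hline P (r/2) \<noteq> z" using P assms by (auto simp: hball_def)
  then show ?thesis by blast
qed

lemma act_eq_on_hball:
  assumes "M \<in> SL2" "N \<in> SL2" "Im z > 0" "r > 0" "\<And>w. w \<in> hball z r \<Longrightarrow> act M w = act N w"
  shows "M = N \<or> M = mneg N"
proof -
  obtain w where "w \<in> hball z r" "w \<noteq> z" using exists_other_point assms by blast
  then show ?thesis using assms by (intro act_eqI[of M N z w]) (auto dest: hball_Im)
qed

text \<open>After composing with a Moebius map, a holomorphic isometry fixes two points, hence the geodesic
  segment between them, hence everything by analytic continuation.\<close>

lemma holomorphic_isometry_is_act:
  assumes z: "Im z > 0" "r > 0" and hol: "T holomorphic_on hball z r"
    and im: "\<And>w. w \<in> hball z r \<Longrightarrow> Im (T w) > 0"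
    and iso: "\<And>w w'. w \<in> hball z r \<Longrightarrow> w' \<in> hball z r \<Longrightarrow> hyp_dist (T w) (T w') = hyp_dist w w'"
  shows "\<exists>M\<in>SL2. \<forall>w\<in>hball z r. T w = act M w"
proof -
  obtain P where P: "P \<in> SL2" "hline P 0 = z"
    using exists_hline[OF z(1) z(1)] by blast
  have d0: "hyp_dist z (hline P s) = s" if "s \<ge> 0" for s
    using hyp_dist_hline[OF P(1), of 0 s] that by (simp add: P)
  have inb: "hline P s \<in> hball z r" if "0 \<le> s" "s < r" for s
    using d0 that P by (simp add: hball_def)
  have zr: "z \<in> hball z r" using z by simp
  define w1 where "w1 = hline P (r/2)"
  have w1: "w1 \<in> hball z r" "Im w1 > 0" unfolding w1_def using inb z P by auto
  obtain Q where Q: "Q \<in> SL2" "act Q z = T z" "act Q w1 = T w1"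
    using hyp_dist_pair_transitive[of z w1 "T z" "T w1"] z w1 im iso zr by metis
  define S where "S = (\<lambda>w. act (madj Q) (T w))"
  have fix': "S (hline P s) = hline P s" if "0 \<le> s" "s \<le> r/2" for s
  proof (rule hline_unique[OF P(1), of _ 0 s "r/2"])
    have b: "hline P s \<in> hball z r" using inb that z by auto
    have "S z = z" "S w1 = w1" unfolding S_def using Q z w1 by (metis act_madj(2))+
    show "0 < Im (S (hline P s))" unfolding S_def using Q im b by simp
    have "hyp_dist z (S (hline P s)) = hyp_dist (S z) (S (hline P s))" using \<open>S z = z\<close> by simp
    also have "\<dots> = hyp_dist z (hline P s)" unfolding S_def using Q im b zr iso by simp
    also have "\<dots> = s - 0" using d0 that by simp
    finally show "hyp_dist (hline P 0) (S (hline P s)) = s - 0" using P by simp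
    have "hyp_dist (S (hline P s)) w1 = hyp_dist (S (hline P s)) (S w1)" using \<open>S w1 = w1\<close> by simp
    also have "\<dots> = hyp_dist (hline P s) w1" unfolding S_def using Q im b w1 iso by simp
    also have "\<dots> = r/2 - s" using that unfolding w1_def by (simp add: P)
    finally show "hyp_dist (S (hline P s)) (hline P (r/2)) = r/2 - s" unfolding w1_def .
  qed (use that in auto)
  have "S w - w = 0" if "w \<in> hball z r" for w
  proof (rule analytic_continuation[of "\<lambda>w. S w - w" "hball z r" "hline P ` {0<..r/2}" z])
    have "act (madj Q) holomorphic_on T ` hball z r"
      using Q im by (intro holomorphic_act) auto
    then have "S holomorphic_on hball z r"
      unfolding S_def by (rule holomorphic_on_compose_gen[OF hol, unfolded o_def]) simp
    then show "(\<lambda>w. S w - w) holomorphic_on hball z r" by (intro holomorphic_intros)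
    show "hline P ` {0<..r/2} \<subseteq> hball z r" using inb z by auto
    show "z islimpt hline P ` {0<..r/2}"
    proof (rule islimptI)
      fix V assume V: "z \<in> V" "open V"
      then obtain e where e: "e > 0" "hball z e \<subseteq> V" using exists_hball_subset z by blast
      let ?s = "min (e/2) (r/2)"
      have "hline P ?s \<in> hball z e" "hyp_dist z (hline P ?s) \<noteq> 0" using d0[of ?s] e z P by (auto simp: hball_def)
      then show "\<exists>y\<in>hline P ` {0<..r/2}. y \<in> V \<and> y \<noteq> z"
        using e z by (intro bexI[of _ "hline P ?s"]) auto
    qed
    show "S w - w = 0" if "w \<in> hline P ` {0<..r/2}" for w using fix' that by auto
  qed (use z connected_hball that in auto)
  then have "T w = act Q w" if "w \<in> hball z r" for w
    using that Q im[OF that] unfolding S_def by (metis act_madj(1) eq_iff_diff_eq_0)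
  then show ?thesis using Q by blast
qed

text \<open>The bound is additive over adjacent intervals, so bisection (\<open>Bolzano\<close>)
  passes from small intervals to large ones.\<close>

lemma dist_le_of_locally_Lipschitz:
  fixes f :: "real \<Rightarrow> 'b::metric_space"
  assumes "a \<le> b" and loc: "\<And>t. t \<in> {a..b} \<Longrightarrow> \<exists>\<delta>>0. \<forall>s\<in>{a..b}. \<forall>s'\<in>{a..b}.
      \<bar>s - t\<bar> < \<delta> \<and> \<bar>s' - t\<bar> < \<delta> \<longrightarrow> dist (f s) (f s') \<le> L * \<bar>s - s'\<bar>"
  shows "dist (f a) (f b) \<le> L * (b - a)"
proof -
  let ?P = "\<lambda>u v. a \<le> u \<and> v \<le> b \<longrightarrow> dist (f u) (f v) \<le> L * (v - u)"
  have "?P a b"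
  proof (induction rule: Bolzano[where P = ?P, OF assms(1)])
    case (1 u v w)
    show ?case
    proof
      assume "a \<le> u \<and> w \<le> b"
      then have "dist (f u) (f v) \<le> L * (v - u)" "dist (f v) (f w) \<le> L * (w - v)" using 1 by auto
      then show "dist (f u) (f w) \<le> L * (w - u)" using dist_triangle[of "f u" "f w" "f v"] by (simp add: algebra_simps)
    qed
  next
    case (2 x)
    then obtain \<delta> where \<delta>: "\<delta> > 0" "\<forall>s\<in>{a..b}. \<forall>s'\<in>{a..b}. \<bar>s - x\<bar> < \<delta> \<and> \<bar>s' - x\<bar> < \<delta> \<longrightarrow> dist (f s) (f s') \<le> L * \<bar>s - s'\<bar>"
      using loc[of x] by auto
    have "dist (f u) (f v) \<le> L * (v - u)" if "u \<le> x" "x \<le> v" "v - u < \<delta>" "a \<le> u" "v \<le> b" for u v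
    proof -
      have "\<bar>u - x\<bar> < \<delta>" "\<bar>v - x\<bar> < \<delta>" "\<bar>u - v\<bar> = v - u" "u \<in> {a..b}" "v \<in> {a..b}" using that by auto
      then show ?thesis using \<delta>(2) by metis
    qed
    then show ?case using \<delta>(1) by blast
  qed
  then show ?thesis by simp
qed

section \<open>The universal covering\<close>

text \<open>One oriented atlas is fixed, so that chart changes, and later deck transformations,
  preserve the orientation and are given by real matrices of determinant 1.\<close>

locale oriented_surface =
  fixes X :: "'a::metric_space set" and A :: "('a set \<times> ('a \<Rightarrow> complex)) set"
  assumes chart: "\<And>U \<phi>. (U, \<phi>) \<in> A \<Longrightarrow> hyp_chart X U \<phi>"
    and covered: "X \<subseteq> (\<Union>(U, \<phi>)\<in>A. U)"
    and holo: "\<And>U \<phi> V \<psi>. (U, \<phi>) \<in> A \<Longrightarrow> (V, \<psi>) \<in> A \<Longrightarrow>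
       (\<lambda>z. \<psi> (inv_into U \<phi> z)) holomorphic_on \<phi> ` (U \<inter> V)"
    and complete: "complete X" and connected: "connected X" and length_metric: "length_metric X"
begin

lemma chart_openin: "(U, \<phi>) \<in> A \<Longrightarrow> openin (top_of_set X) U"
  and chart_open: "(U, \<phi>) \<in> A \<Longrightarrow> open (\<phi> ` U)"
  and chart_Im: "(U, \<phi>) \<in> A \<Longrightarrow> x \<in> U \<Longrightarrow> Im (\<phi> x) > 0"
  and chart_dist: "(U, \<phi>) \<in> A \<Longrightarrow> x \<in> U \<Longrightarrow> y \<in> U \<Longrightarrow> hyp_dist (\<phi> x) (\<phi> y) = dist x y"
  using chart unfolding hyp_chart_def upper_half_plane_def by blast+

lemma chart_subset: "(U, \<phi>) \<in> A \<Longrightarrow> U \<subseteq> X"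
  using chart_openin openin_imp_subset by blast

lemma chart_inj: "(U, \<phi>) \<in> A \<Longrightarrow> inj_on \<phi> U"
  using chart_dist by (auto simp: inj_on_def) (metis dist_eq_0_iff hyp_dist_self)

lemma chart_inv [simp]: "(U, \<phi>) \<in> A \<Longrightarrow> x \<in> U \<Longrightarrow> inv_into U \<phi> (\<phi> x) = x"
  using chart_inj by simp

lemma openin_dist:
  assumes "openin (top_of_set X) U" "x \<in> U"
  shows "\<exists>e>0. \<forall>y\<in>X. dist x y < e \<longrightarrow> y \<in> U"
  using assms by (metis dist_commute openin_euclidean_subtopology_iff)

text \<open>A chart change is a holomorphic isometry, hence a Moebius map near each point. The claim
  is local because the overlap of two charts may be disconnected, with different matrices on its
  components.\<close>

lemma transition:
  assumes U: "(U, \<phi>) \<in> A" and V: "(V, \<psi>) \<in> A" and x: "x \<in> U" "x \<in> V"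
  shows "\<exists>r>0. \<exists>M\<in>SL2. \<forall>y\<in>X. dist x y < r \<longrightarrow> y \<in> U \<and> y \<in> V \<and> \<psi> y = act M (\<phi> y)"
proof -
  obtain e where e: "e > 0" "\<And>y. y \<in> X \<Longrightarrow> dist x y < e \<Longrightarrow> y \<in> U \<inter> V"
    using openin_dist[of "U \<inter> V" x] U V x chart_openin by blast
  obtain r0 where r0: "r0 > 0" "hball (\<phi> x) r0 \<subseteq> \<phi> ` U"
    using exists_hball_subset chart_open[OF U] chart_Im[OF U x(1)] x by blast
  define r where "r = min e r0"
  have r: "r > 0" "hball (\<phi> x) r \<subseteq> \<phi> ` (U \<inter> V)"
  proof -
    show "r > 0" using e r0 by (simp add: r_def)
    show "hball (\<phi> x) r \<subseteq> \<phi> ` (U \<inter> V)"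
    proof
      fix w assume w: "w \<in> hball (\<phi> x) r"
      then have "w \<in> hball (\<phi> x) r0" using hball_mono[of r r0] by (auto simp: r_def)
      then obtain y where y: "y \<in> U" "w = \<phi> y" using r0 by blast
      have "dist x y < e" using w y chart_dist[OF U x(1) y(1)] by (auto simp: hball_def r_def)
      then show "w \<in> \<phi> ` (U \<inter> V)" using y e(2)[of y] chart_subset[OF U] by auto
    qed
  qed
  let ?T = "\<lambda>z. \<psi> (inv_into U \<phi> z)"
  have "\<exists>M\<in>SL2. \<forall>w\<in>hball (\<phi> x) r. ?T w = act M w"
  proof (rule holomorphic_isometry_is_act)
    show "?T holomorphic_on hball (\<phi> x) r" by (rule holomorphic_on_subset[OF holo[OF U V] r(2)])
    show "Im (?T w) > 0" if "w \<in> hball (\<phi> x) r" for w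
      using that r U chart_Im[OF V] by auto
    fix w w' assume "w \<in> hball (\<phi> x) r" "w' \<in> hball (\<phi> x) r"
    then obtain y y' where "y \<in> U \<inter> V" "y' \<in> U \<inter> V" "w = \<phi> y" "w' = \<phi> y'" using r by blast
    then show "hyp_dist (?T w) (?T w') = hyp_dist w w'" using U V by (simp add: chart_dist)
  qed (use chart_Im[OF U x(1)] r in auto)
  then obtain M where M: "M \<in> SL2" "\<And>w. w \<in> hball (\<phi> x) r \<Longrightarrow> ?T w = act M w" by blast
  have "y \<in> U \<and> y \<in> V \<and> \<psi> y = act M (\<phi> y)" if y: "y \<in> X" "dist x y < r" for y
  proof -
    have yUV: "y \<in> U" "y \<in> V" using e y by (auto simp: r_def)
    then have "\<phi> y \<in> hball (\<phi> x) r" using chart_dist[OF U x(1) yUV(1)] y chart_Im[OF U] by (simp add: hball_def)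
    then show ?thesis using M yUV U by fastforce
  qed
  then show ?thesis using M r by blast
qed

text \<open>Orientation preserving local isometries from a set of the upper half-plane to the surface.\<close>

definition liso :: "complex set \<Rightarrow> (complex \<Rightarrow> 'a) \<Rightarrow> bool" where
  "liso S p \<longleftrightarrow> (\<forall>z\<in>S. Im z > 0 \<and> (\<exists>U \<phi> M r. (U, \<phi>) \<in> A \<and> M \<in> SL2 \<and> r > 0 \<and> hball z r \<subseteq> S \<and>
      (\<forall>w\<in>hball z r. p w \<in> U \<and> \<phi> (p w) = act M w)))"

lemma liso_Im: "liso S p \<Longrightarrow> z \<in> S \<Longrightarrow> Im z > 0" by (auto simp: liso_def)

lemma liso_open: "liso S p \<Longrightarrow> open S"
  unfolding liso_def by (subst open_iff_hball) blast+

lemma liso_in: "liso S p \<Longrightarrow> z \<in> S \<Longrightarrow> p z \<in> X"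
  unfolding liso_def using chart_subset by (metis centre_in_hball subsetD)

lemma lisoE:
  assumes "liso S p" "z \<in> S"
  obtains U \<phi> M r where "Im z > 0" "(U, \<phi>) \<in> A" "M \<in> SL2" "hball z r \<subseteq> S" "r > 0"
      "\<forall>w\<in>hball z r. p w \<in> U" "\<forall>w\<in>hball z r. \<phi> (p w) = act M w"
proof -
  have "Im z > 0 \<and> (\<exists>U \<phi> M r. (U, \<phi>) \<in> A \<and> M \<in> SL2 \<and> r > 0 \<and> hball z r \<subseteq> S \<and>
      (\<forall>w\<in>hball z r. p w \<in> U \<and> \<phi> (p w) = act M w))"
    using assms unfolding liso_def by (rule bspec)
  then show ?thesis
    by (elim conjE exE) (rule that, assumption+, simp_all)
qed

lemma liso_local:
  assumes "liso S p" "z \<in> S"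
  shows "\<exists>r>0. hball z r \<subseteq> S \<and> (\<forall>w\<in>hball z r. \<forall>w'\<in>hball z r. dist (p w) (p w') = hyp_dist w w')"
proof -
  obtain U \<phi> M r where *: "(U, \<phi>) \<in> A" "M \<in> SL2" "hball z r \<subseteq> S" "r > 0"
      "\<forall>w\<in>hball z r. p w \<in> U" "\<forall>w\<in>hball z r. \<phi> (p w) = act M w"
    by (rule lisoE[OF assms], rule that, assumption+)
  have "dist (p w) (p w') = hyp_dist w w'" if "w \<in> hball z r" "w' \<in> hball z r" for w w'
  proof -
    have "dist (p w) (p w') = hyp_dist (\<phi> (p w)) (\<phi> (p w'))" using *(1,5) that by (intro chart_dist[symmetric]) auto
    also have "\<dots> = hyp_dist (act M w) (act M w')" using *(6) that by simp
    also have "\<dots> = hyp_dist w w'" using *(2) that hball_Im by (intro hyp_dist_act) auto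
    finally show ?thesis .
  qed
  then show ?thesis using *(3,4) by (intro exI[of _ r]) simp
qed

lemma liso_subset:
  assumes "liso S p" "open T" "T \<subseteq> S"
  shows "liso T p"
  unfolding liso_def
proof (intro ballI conjI)
  fix z assume z: "z \<in> T"
  then have zS: "z \<in> S" using assms by blast
  obtain U \<phi> M r where *: "0 < Im z" and r: "(U, \<phi>) \<in> A" "M \<in> SL2" "hball z r \<subseteq> S" "0 < r"
     "\<forall>w\<in>hball z r. p w \<in> U" "\<forall>w\<in>hball z r. \<phi> (p w) = act M w"
    by (rule lisoE[OF assms(1) zS], rule that, assumption+)
  show "0 < Im z" by fact
  obtain e where e: "e > 0" "hball z e \<subseteq> T" using exists_hball_subset[of T z] * z assms by blast
  show "\<exists>U \<phi> M r. (U, \<phi>) \<in> A \<and> M \<in> SL2 \<and> 0 < r \<and> hball z r \<subseteq> T \<and> (\<forall>w\<in>hball z r. p w \<in> U \<and> \<phi> (p w) = act M w)"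
    using r e hball_mono[of "min r e" r z] hball_mono[of "min r e" e z]
    by (intro exI[of _ U] exI[of _ \<phi>] exI[of _ M] exI[of _ "min r e"]) auto
qed

lemma liso_cong:
  assumes "open S" "\<And>z. z \<in> S \<Longrightarrow> \<exists>T q. z \<in> T \<and> liso T q \<and> (\<forall>w\<in>T. p w = q w)"
  shows "liso S p"
  unfolding liso_def
proof
  fix z assume "z \<in> S"
  then obtain T q where T: "z \<in> T" "liso T q" "\<forall>w\<in>T. p w = q w" using assms by blast
  have l: "liso (S \<inter> T) q" using T assms liso_open[OF T(2)] by (intro liso_subset[OF T(2)]) auto
  obtain U \<phi> M r where "0 < Im z" "(U, \<phi>) \<in> A" "M \<in> SL2" "hball z r \<subseteq> S \<inter> T" "r > 0"
     "\<forall>w\<in>hball z r. q w \<in> U" "\<forall>w\<in>hball z r. \<phi> (q w) = act M w"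
  proof -
    have zi: "z \<in> S \<inter> T" using T \<open>z \<in> S\<close> by simp
    show ?thesis by (rule lisoE[OF l zi], rule that, assumption+)
  qed
  then show "Im z > 0 \<and> (\<exists>U \<phi> M r. (U, \<phi>) \<in> A \<and> M \<in> SL2 \<and> r > 0 \<and> hball z r \<subseteq> S \<and>
      (\<forall>w\<in>hball z r. p w \<in> U \<and> \<phi> (p w) = act M w))"
    using T by (intro conjI exI[of _ U] exI[of _ \<phi>] exI[of _ M] exI[of _ r]) auto
qed

lemma liso_chart:
  assumes "liso S p" "z \<in> S" "(V, \<psi>) \<in> A" "p z \<in> V"
  shows "\<exists>M\<in>SL2. \<exists>r>0. hball z r \<subseteq> S \<and> (\<forall>w\<in>hball z r. p w \<in> V \<and> \<psi> (p w) = act M w)"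
proof -
  obtain U \<phi> M r where *: "0 < Im z" "(U, \<phi>) \<in> A" "M \<in> SL2" "hball z r \<subseteq> S" "r > 0"
     "\<forall>w\<in>hball z r. p w \<in> U" "\<forall>w\<in>hball z r. \<phi> (p w) = act M w"
    by (rule lisoE[OF assms(1,2)], rule that, assumption+)
  then have pz: "p z \<in> U" by simp
  obtain r' M' where r': "r' > 0" "M' \<in> SL2" 
      "\<And>y. y \<in> X \<Longrightarrow> dist (p z) y < r' \<Longrightarrow> y \<in> V \<and> \<psi> y = act M' (\<phi> y)"
    using transition[OF *(2) assms(3) pz assms(4)] by blast
  have "p w \<in> V \<and> \<psi> (p w) = act (M' \<odot> M) w" if "w \<in> hball z (min r r')" for w
  proof -
    have w: "w \<in> hball z r" "hyp_dist z w < r'" "Im w > 0" using that by (auto simp: hball_def)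
    have "dist (p z) (p w) = hyp_dist (act M z) (act M w)"
      using chart_dist[OF *(2) pz, of "p w"] *(1,5,6,7) w by simp
    then have "dist (p z) (p w) = hyp_dist z w" using * w by simp
    then have "p w \<in> V \<and> \<psi> (p w) = act M' (\<phi> (p w))"
      using r'(3)[of "p w"] w *(6) chart_subset[OF *(2)] by auto
    then show ?thesis using w * r' by (simp add: act_mmul)
  qed
  then show ?thesis using * r' hball_mono[of "min r r'" r z]
    by (intro bexI[of _ "M' \<odot> M"] exI[of _ "min r r'"]) auto
qed

text \<open>The set \<open>E\<close> of points near which both maps agree is open, and so is its
  complement. Where the values differ, they differ nearby. Where they coincide, both maps are
  Moebius maps in one chart; agreement on any ball inside the common neighbourhood makes the
  matrices equal up to sign, and this spreads to the whole neighbourhood.\<close>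

lemma liso_unique:
  assumes p: "liso S p" and q: "liso S q" and con: "Topological_Spaces.connected S"
    and z0: "z0 \<in> S" "e > 0" "\<And>w. w \<in> hball z0 e \<Longrightarrow> p w = q w" and w: "w \<in> S"
  shows "p w = q w"
proof -
  define E where "E = {z \<in> S. \<exists>r>0. hball z r \<subseteq> S \<and> (\<forall>w\<in>hball z r. p w = q w)}"
  have ImS: "Im z > 0" if "z \<in> S" for z using liso_Im[OF p that] .
  have openE: "open E"
  proof (subst open_iff_hball)
    show "E \<subseteq> {z. 0 < Im z}" using ImS by (auto simp: E_def)
    show "\<forall>z\<in>E. \<exists>r>0. hball z r \<subseteq> E"
    proof
      fix z assume "z \<in> E"
      then obtain r where r: "z \<in> S" "r > 0" "hball z r \<subseteq> S" "\<forall>w\<in>hball z r. p w = q w" by (auto simp: E_def)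
      have "v \<in> E" if v: "v \<in> hball z r" for v
      proof -
        have "hball v (r - hyp_dist z v) \<subseteq> hball z r" using v r ImS by (intro hball_subset_hball) auto
        moreover have "0 < r - hyp_dist z v" using v by (auto simp: hball_def)
        ultimately show ?thesis using r v unfolding E_def by blast
      qed
      then show "\<exists>r>0. hball z r \<subseteq> E" using r by blast
    qed
  qed
  have openC: "open (S - E)"
  proof (subst open_iff_hball)
    show "S - E \<subseteq> {z. 0 < Im z}" using ImS by auto
    show "\<forall>z\<in>S - E. \<exists>r>0. hball z r \<subseteq> S - E"
    proof
      fix z assume z: "z \<in> S - E"
      have Imz: "Im z > 0" using z ImS by auto
      show "\<exists>r>0. hball z r \<subseteq> S - E"
      proof (cases "p z = q z")
        case False
        define d where "d = dist (p z) (q z)"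
        have d: "d > 0" using False by (simp add: d_def)
        obtain r1 where r1: "r1 > 0" "hball z r1 \<subseteq> S" "\<forall>w\<in>hball z r1. \<forall>w'\<in>hball z r1. dist (p w) (p w') = hyp_dist w w'"
          using liso_local[OF p] z by blast
        obtain r2 where r2: "r2 > 0" "hball z r2 \<subseteq> S" "\<forall>w\<in>hball z r2. \<forall>w'\<in>hball z r2. dist (q w) (q w') = hyp_dist w w'"
          using liso_local[OF q] z by blast
        let ?r = "min (d/2) (min r1 r2)"
        have "v \<in> S - E" if v: "v \<in> hball z ?r" for v
        proof -
          have v1: "v \<in> hball z r1" "v \<in> hball z r2" "hyp_dist z v < d/2" "Im v > 0" using v by (auto simp: hball_def)
          have "dist (p z) (p v) < d/2" "dist (q z) (q v) < d/2" using v1 r1 r2 Imz by auto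
          then have "p v \<noteq> q v" using dist_triangle_half_r[of "p v" "p z" d "q z"] unfolding d_def
            by (metis dist_commute dist_triangle_half_l less_irrefl)
          then have "v \<notin> E" using v1(4) by (auto simp: E_def)
          then show ?thesis using v1 r1 by blast
        qed
        then show ?thesis using d r1 r2 by (intro exI[of _ ?r]) auto
      next
        case True
        obtain V \<psi> where V: "(V, \<psi>) \<in> A" "p z \<in> V" using liso_in[OF p, of z] z covered by fastforce
        obtain M r1 where M: "M \<in> SL2" "r1 > 0" "hball z r1 \<subseteq> S" "\<forall>w\<in>hball z r1. p w \<in> V \<and> \<psi> (p w) = act M w"
          using liso_chart[OF p _ V] z by blast
        obtain N r2 where N: "N \<in> SL2" "r2 > 0" "hball z r2 \<subseteq> S" "\<forall>w\<in>hball z r2. q w \<in> V \<and> \<psi> (q w) = act N w"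
        proof -
          have "z \<in> S" "q z \<in> V" using z V(2) True by auto
          from liso_chart[OF q this(1) V(1) this(2)] show ?thesis using that by blast
        qed
        let ?r = "min r1 r2"
        have "v \<notin> E" if v: "v \<in> hball z ?r" for v
        proof
          assume "v \<in> E"
          then obtain s where s: "s > 0" "\<forall>w\<in>hball v s. p w = q w" by (auto simp: E_def)
          have Imv: "Im v > 0" using v hball_Im by blast
          define t where "t = min s (?r - hyp_dist z v)"
          have t: "t > 0" "hball v t \<subseteq> hball z ?r" "hball v t \<subseteq> hball v s"
          proof -
            show "t > 0" using v s by (simp add: t_def hball_def)
            have "hyp_dist z v + t \<le> ?r" unfolding t_def by linarith
            then show "hball v t \<subseteq> hball z ?r" by (rule hball_subset_hball[OF Imz v])
            show "hball v t \<subseteq> hball v s" by (rule hball_mono) (simp add: t_def)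
          qed
          have "act M u = act N u" if "u \<in> hball v t" for u
          proof -
            have "u \<in> hball z ?r" "p u = q u" using that t s by auto
            then show ?thesis using M N by (auto simp: hball_def)
          qed
          then have "M = N \<or> M = mneg N" using act_eq_on_hball[OF M(1) N(1) Imv t(1)] by blast
          then have MN: "act M u = act N u" for u by auto
          have "p u = q u" if "u \<in> hball z ?r" for u
          proof -
            have "u \<in> hball z r1" "u \<in> hball z r2" using that by (auto simp: hball_def)
            then have "p u \<in> V" "q u \<in> V" "\<psi> (p u) = \<psi> (q u)" using M N MN by auto
            then show ?thesis using chart_inj[OF V(1)] by (simp add: inj_on_def)
          qed
          moreover have "hball z ?r \<subseteq> S" using M hball_mono[of ?r r1 z] by auto
          ultimately have "z \<in> E" using z M N unfolding E_def by (intro CollectI conjI exI[of _ ?r]) auto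
          then show False using z by blast
        qed
        then show ?thesis using M N hball_mono[of ?r r1 z] by (intro exI[of _ ?r]) auto
      qed
    qed
  qed
  have "z0 \<in> E"
  proof -
    obtain r where r: "r > 0" "hball z0 r \<subseteq> S" using exists_hball_subset[OF liso_open[OF p] z0(1) ImS[OF z0(1)]] by blast
    then show ?thesis using z0 hball_mono[of "min r e" r z0] hball_mono[of "min r e" e z0] unfolding E_def
      by (intro CollectI conjI exI[of _ "min r e"]) auto
  qed
  then have "S - E = {}" using connectedD[OF con openE openC] z0(1) by (auto simp: E_def)
  then have "w \<in> E" using w by blast
  then show ?thesis unfolding E_def using ImS by auto
qed

text \<open>An even covering radius: over any preimage of \<open>x\<close>, a local isometry
  continues to the full ball of radius \<open>r\<close> (\<open>good_extend\<close>). Nearby points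
  keep half of the radius (\<open>good_shift\<close>), which gives the uniformity needed for
  continuation.\<close>

definition good :: "'a \<Rightarrow> real \<Rightarrow> bool" where
  "good x r \<longleftrightarrow> r > 0 \<and> (\<exists>U \<phi>. (U, \<phi>) \<in> A \<and> x \<in> U \<and> (\<forall>y\<in>X. dist x y < r \<longrightarrow> y \<in> U) \<and> hball (\<phi> x) r \<subseteq> \<phi> ` U)"

lemma exists_good:
  assumes "x \<in> X"
  shows "\<exists>r. good x r"
proof -
  obtain U \<phi> where U: "(U, \<phi>) \<in> A" "x \<in> U" using assms covered by fastforce
  obtain e where e: "e > 0" "\<forall>y\<in>X. dist x y < e \<longrightarrow> y \<in> U" using openin_dist[OF chart_openin[OF U(1)] U(2)] by blast
  obtain r where r: "r > 0" "hball (\<phi> x) r \<subseteq> \<phi> ` U"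
    using exists_hball_subset chart_open[OF U(1)] chart_Im[OF U] U by blast
  have "good x (min e r)" unfolding good_def using U e r hball_mono[of "min e r" r "\<phi> x"]
    by (intro conjI exI[of _ U] exI[of _ \<phi>]) auto
  then show ?thesis ..
qed

lemma good_shift:
  assumes "good x r" "y \<in> X" "dist x y < r / 2"
  shows "good y (r / 2)"
proof -
  obtain U \<phi> where U: "r > 0" "(U, \<phi>) \<in> A" "x \<in> U" "\<forall>y\<in>X. dist x y < r \<longrightarrow> y \<in> U" "hball (\<phi> x) r \<subseteq> \<phi> ` U"
    using assms by (auto simp: good_def)
  have y: "y \<in> U" using U assms by auto
  have "hball (\<phi> y) (r/2) \<subseteq> hball (\<phi> x) r"
    using chart_dist[OF U(2,3) y] chart_Im[OF U(2)] U(1,3) y assms by (intro hball_subset_hball) (auto simp: hball_def)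
  moreover have "z \<in> U" if "z \<in> X" "dist y z < r/2" for z
    using that U(4) assms dist_triangle_half_r[of y x r z] dist_triangle[of x z y] by (metis dist_commute dist_triangle_half_l)
  ultimately show ?thesis unfolding good_def using U y by (intro conjI exI[of _ U] exI[of _ \<phi>]) auto
qed

lemma good_lift:
  assumes "good x r"
  obtains U \<phi> where "(U, \<phi>) \<in> A" "x \<in> U"
    "\<And>M z. M \<in> SL2 \<Longrightarrow> Im z > 0 \<Longrightarrow> act M z = \<phi> x \<Longrightarrow>
      \<exists>q. liso (hball z r) q \<and> q z = x \<and> (\<forall>w\<in>hball z r. q w \<in> U \<and> \<phi> (q w) = act M w) \<and>
        (\<forall>w\<in>hball z r. \<forall>w'\<in>hball z r. dist (q w) (q w') = hyp_dist w w') \<and>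
        (\<forall>y\<in>X. dist x y < r \<longrightarrow> (\<exists>w\<in>hball z r. q w = y))"
proof -
  obtain U \<phi> where U: "r > 0" "(U, \<phi>) \<in> A" "x \<in> U" "\<forall>y\<in>X. dist x y < r \<longrightarrow> y \<in> U" "hball (\<phi> x) r \<subseteq> \<phi> ` U"
    using assms by (auto simp: good_def)
  show ?thesis
  proof (rule that[OF U(2,3)])
    fix M z assume M: "M \<in> SL2" "Im z > 0" "act M z = \<phi> x"
    define q where "q = (\<lambda>w. inv_into U \<phi> (act M w))"
    have q: "q w \<in> U" "\<phi> (q w) = act M w" if "w \<in> hball z r" for w
    proof -
      have "act M w \<in> \<phi> ` U" using act_hball[OF M(1,2) that] M U by auto
      then show "q w \<in> U" "\<phi> (q w) = act M w" unfolding q_def by (auto simp: f_inv_into_f inv_into_into)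
    qed
    have "liso (hball z r) q" unfolding liso_def
    proof (intro ballI conjI)
      fix w assume w: "w \<in> hball z r"
      then show "0 < Im w" by (rule hball_Im)
      have "hball w (r - hyp_dist z w) \<subseteq> hball z r" "r - hyp_dist z w > 0"
        using hball_subset_hball[OF M(2) w, of "r - hyp_dist z w"] hball_dist[OF w] by simp_all
      then show "\<exists>U \<phi> M ra. (U, \<phi>) \<in> A \<and> M \<in> SL2 \<and> 0 < ra \<and> hball w ra \<subseteq> hball z r \<and> (\<forall>w\<in>hball w ra. q w \<in> U \<and> \<phi> (q w) = act M w)"
        using U q M by blast
    qed
    moreover have "q z = x" unfolding q_def using M U by simp
    moreover have "dist (q w) (q w') = hyp_dist w w'" if "w \<in> hball z r" "w' \<in> hball z r" for w w'
    proof -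
      have "dist (q w) (q w') = hyp_dist (act M w) (act M w')"
        using chart_dist[OF U(2) q(1)[OF that(1)] q(1)[OF that(2)]] q(2)[OF that(1)] q(2)[OF that(2)] by simp
      then show ?thesis using M that hball_Im by simp
    qed
    moreover have "\<exists>w\<in>hball z r. q w = y" if y: "y \<in> X" "dist x y < r" for y
    proof (rule bexI)
      have yU: "y \<in> U" using y U by auto
      have "hyp_dist (\<phi> x) (\<phi> y) < r" using chart_dist[OF U(2,3) yU] y by simp
      then have "\<phi> y \<in> hball (\<phi> x) r" using chart_Im[OF U(2) yU] by (simp add: hball_def)
      then have "act (madj M) (\<phi> y) \<in> hball (act (madj M) (\<phi> x)) r" using act_hball[of "madj M"] M chart_Im[OF U(2,3)] by simp
      then show "act (madj M) (\<phi> y) \<in> hball z r" using M by (metis act_madj(2))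
      show "q (act (madj M) (\<phi> y)) = y" unfolding q_def using M U chart_Im[OF U(2) yU] yU by simp
    qed
    ultimately show "\<exists>q. liso (hball z r) q \<and> q z = x \<and> (\<forall>w\<in>hball z r. q w \<in> U \<and> \<phi> (q w) = act M w) \<and>
        (\<forall>w\<in>hball z r. \<forall>w'\<in>hball z r. dist (q w) (q w') = hyp_dist w w') \<and>
        (\<forall>y\<in>X. dist x y < r \<longrightarrow> (\<exists>w\<in>hball z r. q w = y))" using q by blast
  qed
qed

lemma good_extend:
  assumes p: "liso S p" "z \<in> S" "good (p z) r"
  shows "\<exists>q. liso (hball z r) q \<and> (\<exists>e>0. \<forall>w\<in>hball z e. q w = p w) \<and>
        (\<forall>w\<in>hball z r. \<forall>w'\<in>hball z r. dist (q w) (q w') = hyp_dist w w') \<and>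
        (\<forall>y\<in>X. dist (p z) y < r \<longrightarrow> (\<exists>w\<in>hball z r. q w = y))"
proof -
  obtain U \<phi> where U: "(U, \<phi>) \<in> A" "p z \<in> U"
    and lift: "\<And>M z'. M \<in> SL2 \<Longrightarrow> Im z' > 0 \<Longrightarrow> act M z' = \<phi> (p z) \<Longrightarrow>
      \<exists>q. liso (hball z' r) q \<and> q z' = p z \<and> (\<forall>w\<in>hball z' r. q w \<in> U \<and> \<phi> (q w) = act M w) \<and>
        (\<forall>w\<in>hball z' r. \<forall>w'\<in>hball z' r. dist (q w) (q w') = hyp_dist w w') \<and>
        (\<forall>y\<in>X. dist (p z) y < r \<longrightarrow> (\<exists>w\<in>hball z' r. q w = y))"
    using good_lift[OF p(3)] by blast
  have Imz: "Im z > 0" using liso_Im p by blast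
  obtain M e where M: "M \<in> SL2" "e > 0" "\<forall>w\<in>hball z e. p w \<in> U \<and> \<phi> (p w) = act M w"
    using liso_chart[OF p(1,2) U] by blast
  have "act M z = \<phi> (p z)" using M Imz by simp
  from lift[OF M(1) Imz this] obtain q where q: "liso (hball z r) q"
     "\<forall>w\<in>hball z r. q w \<in> U \<and> \<phi> (q w) = act M w"
      "(\<forall>w\<in>hball z r. \<forall>w'\<in>hball z r. dist (q w) (q w') = hyp_dist w w') \<and>
        (\<forall>y\<in>X. dist (p z) y < r \<longrightarrow> (\<exists>w\<in>hball z r. q w = y))" by blast
  have "q w = p w" if "w \<in> hball z (min e r)" for w
  proof -
    have "w \<in> hball z e" "w \<in> hball z r" using that by (auto simp: hball_def)
    then have "p w \<in> U" "q w \<in> U" "\<phi> (p w) = \<phi> (q w)" using M q by auto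
    then show ?thesis using chart_inj[OF U(1)] by (simp add: inj_on_def)
  qed
  moreover have "min e r > 0" using M p(3) by (simp add: good_def)
  ultimately show ?thesis using q by blast
qed

lemma liso_good_ball:
  assumes p: "liso S p" "z \<in> S" "good (p z) r" "hball z r \<subseteq> S"
  shows "\<forall>w\<in>hball z r. \<forall>w'\<in>hball z r. dist (p w) (p w') = hyp_dist w w'"
    and "\<forall>y\<in>X. dist (p z) y < r \<longrightarrow> (\<exists>w\<in>hball z r. p w = y)"
proof -
  have Imz: "Im z > 0" using liso_Im p by blast
  obtain q e where q: "liso (hball z r) q" "e > 0" "\<forall>w\<in>hball z e. q w = p w"
        "(\<forall>w\<in>hball z r. \<forall>w'\<in>hball z r. dist (q w) (q w') = hyp_dist w w')"
        "(\<forall>y\<in>X. dist (p z) y < r \<longrightarrow> (\<exists>w\<in>hball z r. q w = y))" using good_extend[OF p(1-3)] by blast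
  have r: "r > 0" using p by (simp add: good_def)
  have "q w = p w" if "w \<in> hball z r" for w
    by (rule liso_unique[OF q(1) liso_subset[OF p(1) open_hball p(4)] _ _ q(2), of z])
       (use q that Imz r connected_hball in auto)
  then show "\<forall>w\<in>hball z r. \<forall>w'\<in>hball z r. dist (p w) (p w') = hyp_dist w w'"
    and "\<forall>y\<in>X. dist (p z) y < r \<longrightarrow> (\<exists>w\<in>hball z r. p w = y)" using q by (metis, metis)
qed

end

section \<open>Continuation of local isometries to the whole half-plane\<close>

context oriented_surface
begin

text \<open>Uniform continuity in the Euclidean metric is what lets completeness of \<open>X\<close>
  produce boundary values of a local isometry on a ball.\<close>

lemma liso_lipschitz:
  assumes p: "liso S p" and S: "convex S" "\<And>z. z \<in> S \<Longrightarrow> Im z \<ge> m" "m > 0" and w: "w \<in> S" "w' \<in> S"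
  shows "dist (p w) (p w') \<le> cmod (w - w') / m"
proof -
  let ?l = "\<lambda>t::real. w + of_real t * (w' - w)"
  have lS: "?l t \<in> S" if "t \<in> {0..1}" for t
  proof -
    have "(1 - t) *\<^sub>R w + t *\<^sub>R w' \<in> S" using S(1) w that by (simp add: convex_alt)
    moreover have "(1 - t) *\<^sub>R w + t *\<^sub>R w' = ?l t" by (simp add: scaleR_conv_of_real algebra_simps)
    ultimately show ?thesis by simp
  qed
  have "dist (p (?l 0)) (p (?l 1)) \<le> (cmod (w - w') / m) * (1 - 0)"
  proof (rule dist_le_of_locally_Lipschitz[of 0 1 "\<lambda>t. p (?l t)"])
    fix t :: real assume t: "t \<in> {0..1}"
    obtain r where r: "r > 0" "hball (?l t) r \<subseteq> S" "\<forall>u\<in>hball (?l t) r. \<forall>u'\<in>hball (?l t) r. dist (p u) (p u') = hyp_dist u u'"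
      using liso_local[OF p lS[OF t]] by blast
    have "Im (?l t) > 0" by (rule order_less_le_trans[OF S(3) S(2)[OF lS[OF t]]])
    then have "open (?l -` hball (?l t) r)" "t \<in> ?l -` hball (?l t) r"
      using r by (auto intro!: open_vimage continuous_intros simp del: vimage_eq)
    then obtain \<delta> where \<delta>: "\<delta> > 0" "\<And>s. dist s t < \<delta> \<Longrightarrow> ?l s \<in> hball (?l t) r"
      unfolding open_dist by blast
    have "dist (p (?l s)) (p (?l s')) \<le> cmod (w - w') / m * \<bar>s - s'\<bar>"
      if s: "s \<in> {0..1}" "s' \<in> {0..1}" "\<bar>s - t\<bar> < \<delta>" "\<bar>s' - t\<bar> < \<delta>" for s s'
    proof -
      have b: "?l s \<in> hball (?l t) r" "?l s' \<in> hball (?l t) r" using \<delta> s by (auto simp: dist_real_def)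
      have im: "m \<le> Im (?l s)" "m \<le> Im (?l s')" using lS s S by blast+
      have "m\<^sup>2 \<le> Im (?l s) * Im (?l s')" unfolding power2_eq_square using im S(3) by (intro mult_mono) auto
      then have "m \<le> sqrt (Im (?l s) * Im (?l s'))" using S(3) by (intro real_le_rsqrt)
      then have "cmod (?l s - ?l s') / sqrt (Im (?l s) * Im (?l s')) \<le> cmod (?l s - ?l s') / m"
        using S(3) by (intro divide_left_mono mult_pos_pos norm_ge_zero) linarith+
      moreover have "hyp_dist (?l s) (?l s') \<le> cmod (?l s - ?l s') / sqrt (Im (?l s) * Im (?l s'))"
        using im S(3) by (intro hyp_dist_le_euclidean) linarith+
      moreover have "?l s - ?l s' = of_real (s - s') * (w' - w)" by (simp add: algebra_simps)
      then have "cmod (?l s - ?l s') = \<bar>s - s'\<bar> * cmod (w - w')" by (simp only: norm_mult norm_of_real norm_minus_commute)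
      ultimately show ?thesis using r b by (simp add: mult.commute)
    qed
    then show "\<exists>\<delta>>0. \<forall>s\<in>{0..1}. \<forall>s'\<in>{0..1}. \<bar>s - t\<bar> < \<delta> \<and> \<bar>s' - t\<bar> < \<delta> \<longrightarrow>
         dist (p (?l s)) (p (?l s')) \<le> cmod (w - w') / m * \<bar>s - s'\<bar>" using \<delta>(1) by blast
  qed simp
  then show ?thesis by simp
qed

lemma hball_i_Im:
  assumes "t > 0" "z \<in> hball \<i> t"
  shows "Im z \<ge> exp (- t)"
proof -
  have "\<bar>ln (Im \<i>) - ln (Im z)\<bar> < t" using abs_ln_Im_le_hyp_dist(1)[of \<i> z] assms by (auto simp: hball_def)
  then have "- t \<le> ln (Im z)" by simp
  then show ?thesis using hball_Im[OF assms(2)] by (simp add: ln_ge_iff)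
qed

text \<open>A sequence tending to \<open>z\<close> has a Cauchy image, which converges to some
  \<open>x\<close> by completeness. Half of an even covering radius at \<open>x\<close> serves a
  late member \<open>f n\<close> of the sequence, and the ball to which the map continues around
  \<open>f n\<close> contains \<open>z\<close>.\<close>

lemma liso_extend_closure:
  assumes t: "t > 0" and p: "liso (hball \<i> t) p" and z: "z \<in> closure (hball \<i> t)"
  shows "\<exists>G \<psi>. open G \<and> convex G \<and> z \<in> G \<and> liso G \<psi> \<and> (\<forall>v\<in>G \<inter> hball \<i> t. \<psi> v = p v)"
proof -
  obtain f where f: "\<And>n. f n \<in> hball \<i> t" "f \<longlonglongrightarrow> z" using z by (auto simp: closure_sequential)
  have lip: "dist (p w) (p w') \<le> dist w w' / exp (- t)" if "w \<in> hball \<i> t" "w' \<in> hball \<i> t" for w w'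
    unfolding dist_complex_def using liso_lipschitz[OF p _ _ _ that, of "exp (- t)"] hball_i_Im[OF t] convex_hball[of \<i> t] t by simp
  have "Cauchy f" using f(2) by (rule LIMSEQ_imp_Cauchy)
  have "Cauchy (\<lambda>n. p (f n))"
  proof (rule metric_CauchyI)
    fix e :: real assume "e > 0"
    then obtain M where M: "\<And>m n. m \<ge> M \<Longrightarrow> n \<ge> M \<Longrightarrow> dist (f m) (f n) < e * exp (- t)"
      using metric_CauchyD[OF \<open>Cauchy f\<close>, of "e * exp (- t)"] by auto
    have "dist (p (f m)) (p (f n)) < e" if "m \<ge> M" "n \<ge> M" for m n
    proof -
      have "dist (p (f m)) (p (f n)) \<le> dist (f m) (f n) / exp (- t)" using lip f by blast
      also have "\<dots> < e" using M[OF that] by (simp add: pos_divide_less_eq)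
      finally show ?thesis .
    qed
    then show "\<exists>M. \<forall>m\<ge>M. \<forall>n\<ge>M. dist (p (f m)) (p (f n)) < e" by blast
  qed
  then obtain x where x: "x \<in> X" "(\<lambda>n. p (f n)) \<longlonglongrightarrow> x"
    using complete f liso_in[OF p] unfolding complete_def by metis
  obtain r where r: "good x r" using exists_good[OF x(1)] by blast
  then have r0: "r > 0" by (simp add: good_def)
  have Imz: "Im z > 0"
  proof -
    have "Im z \<ge> exp (- t)"
      by (rule LIMSEQ_le_const[OF tendsto_Im[OF f(2)]]) (use hball_i_Im[OF t f(1)] in auto)
    then show ?thesis using exp_gt_zero[of "- t"] by linarith
  qed
  have "\<forall>\<^sub>F n in sequentially. dist (p (f n)) x < r / 2" using x(2) r0 by (intro tendstoD) auto
  moreover have "\<forall>\<^sub>F n in sequentially. f n \<in> hball z (r / 2)"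
    using f(2) Imz r0 by (intro topological_tendstoD) auto
  ultimately have "\<forall>\<^sub>F n in sequentially. dist (p (f n)) x < r / 2 \<and> f n \<in> hball z (r / 2)" by eventually_elim simp
  then obtain n where n: "dist (p (f n)) x < r / 2" "f n \<in> hball z (r / 2)"
    by (metis (no_types, lifting) eventually_sequentially order_refl)
  have Imf: "Im (f n) > 0" using n hball_Im by blast
  have "good (p (f n)) (r / 2)" using good_shift[OF r liso_in[OF p f(1)]] n by (simp add: dist_commute)
  then obtain q e where q: "liso (hball (f n) (r/2)) q" "e > 0" "\<forall>w\<in>hball (f n) e. q w = p w"
    using good_extend[OF p f(1)] by blast
  let ?G = "hball (f n) (r/2)"
  \<comment> \<open>Both sets are Euclidean balls, so their intersection is convex, hence connected
    as \<open>liso_unique\<close> requires.\<close>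
  have ci: "Topological_Spaces.connected (?G \<inter> hball \<i> t)"
    using Imf r0 t by (intro convex_connected convex_Int convex_hball) auto
  have l: "liso (?G \<inter> hball \<i> t) q" "liso (?G \<inter> hball \<i> t) p"
    using Imf by (auto intro!: liso_subset[OF q(1)] liso_subset[OF p])
  have "q v = p v" if "v \<in> ?G \<inter> hball \<i> t" for v
    by (rule liso_unique[OF l ci _ q(2) _ that, of "f n"]) (use f(1) Imf r0 q in auto)
  moreover have "z \<in> ?G" using n Imz by (auto simp: hball_def hyp_dist_commute)
  ultimately show ?thesis using q Imf r0 convex_hball[of "f n" "r/2"] by (intro exI[of _ ?G] exI[of _ q]) auto
qed

text \<open>The extensions at the boundary are glued by means of a Lebesgue number \<open>e\<close>.
  If two balls of radius e / 3 around points of \<open>K\<close> meet, each centre lies in the set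
  \<open>G\<close> of the other. Both convex sets then contain a common point of the closed ball, so
  they meet inside the open ball, where both extensions equal \<open>p\<close>.\<close>

lemma liso_extend_ball:
  assumes t: "t > 0" and p: "liso (hball \<i> t) p"
  shows "\<exists>t'>t. \<exists>p'. liso (hball \<i> t') p' \<and> (\<forall>w\<in>hball \<i> t. p' w = p w)"
proof -
  let ?B = "hball \<i> t"
  define c where "c = Complex 0 (cosh t)"
  have B: "?B = ball c (sinh t)" using t by (simp add: hball_eq_ball c_def)
  define K where "K = closure ?B"
  have K: "K = cball c (sinh t)" "compact K" unfolding K_def B using t by simp_all
  define F where "F = {G. open G \<and> convex G \<and> (\<exists>\<psi>. liso G \<psi> \<and> (\<forall>v\<in>G \<inter> ?B. \<psi> v = p v))}"
  have "K \<subseteq> \<Union>F" using liso_extend_closure[OF t p] unfolding F_def K_def by blast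
  moreover have "\<And>G. G \<in> F \<Longrightarrow> open G" by (simp add: F_def)
  ultimately obtain e where e: "e > 0" "\<And>x. x \<in> K \<Longrightarrow> \<exists>G\<in>F. ball x e \<subseteq> G"
    by (rule Heine_Borel_lemma[OF K(2)]) auto
  then have "\<forall>x\<in>K. \<exists>G. G \<in> F \<and> ball x e \<subseteq> G" by blast
  then obtain G where G: "\<forall>x\<in>K. G x \<in> F \<and> ball x e \<subseteq> G x" by (rule bchoice[THEN exE])
  then have "\<forall>x\<in>K. \<exists>\<psi>. liso (G x) \<psi> \<and> (\<forall>v\<in>G x \<inter> ?B. \<psi> v = p v)" by (auto simp: F_def)
  then obtain \<Psi> where "\<forall>x\<in>K. liso (G x) (\<Psi> x) \<and> (\<forall>v\<in>G x \<inter> ?B. \<Psi> x v = p v)" by (rule bchoice[THEN exE])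
  then have \<Psi>: "\<And>x. x \<in> K \<Longrightarrow> liso (G x) (\<Psi> x)" "\<And>x v. x \<in> K \<Longrightarrow> v \<in> G x \<inter> ?B \<Longrightarrow> \<Psi> x v = p v" by auto
  have G: "\<And>x. x \<in> K \<Longrightarrow> G x \<in> F" "\<And>x. x \<in> K \<Longrightarrow> ball x e \<subseteq> G x" using G by auto
  have consistent: "\<Psi> z v = \<Psi> z' v" if z: "z \<in> K" "z' \<in> K" "v \<in> ball z (e/3)" "v \<in> ball z' (e/3)" for z z' v
  proof -
    have "dist z z' < e" using z e(1) dist_triangle[of z z' v] by (simp add: dist_commute)
    then have z'G: "z' \<in> G z" "z' \<in> G z'" using G(2)[OF z(1)] G(2)[OF z(2)] e by auto
    have vG: "v \<in> G z" "v \<in> G z'" using G(2)[OF z(1)] G(2)[OF z(2)] e z by auto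
    have op: "open (G z \<inter> G z')" "convex (G z \<inter> G z')" using G(1) z by (auto simp: F_def intro: convex_Int)
    have "z' \<in> closure ?B" using z by (simp add: K_def)
    then have "?B \<inter> (G z \<inter> G z') \<noteq> {}"
      using op(1) z'G unfolding closure_iff_nhds_not_empty by blast
    then obtain u where u: "u \<in> G z \<inter> G z'" "u \<in> ?B" by blast
    have Imu: "Im u > 0" using u hball_Im by blast
    obtain s where s: "s > 0" "hball u s \<subseteq> G z \<inter> G z' \<inter> ?B"
    proof -
      have "open (G z \<inter> G z' \<inter> ?B)" by (intro open_Int[OF op(1)]) simp
      from exists_hball_subset[OF this _ Imu] show ?thesis using that u by blast
    qed
    show ?thesis
    proof (rule liso_unique[of "G z \<inter> G z'" "\<Psi> z" "\<Psi> z'" u s])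
      show "liso (G z \<inter> G z') (\<Psi> z)" "liso (G z \<inter> G z') (\<Psi> z')"
        using liso_subset[OF \<Psi>(1)[OF z(1)] op(1)] liso_subset[OF \<Psi>(1)[OF z(2)] op(1)] by auto
      show "Topological_Spaces.connected (G z \<inter> G z')" using op(2) convex_connected by blast
      show "\<Psi> z w = \<Psi> z' w" if "w \<in> hball u s" for w
      proof -
        have "w \<in> G z \<inter> ?B" "w \<in> G z' \<inter> ?B" using s that by blast+
        then show ?thesis using \<Psi>(2)[OF z(1)] \<Psi>(2)[OF z(2)] by metis
      qed
    qed (use u s vG in auto)
  qed
  define N where "N = (\<Union>z\<in>K. ball z (e/3))"
  define p' where "p' = (\<lambda>v. \<Psi> (SOME z. z \<in> K \<and> v \<in> ball z (e/3)) v)"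
  have p': "p' v = \<Psi> z v" if "z \<in> K" "v \<in> ball z (e/3)" for z v
  proof -
    let ?z = "SOME z. z \<in> K \<and> v \<in> ball z (e/3)"
    have "?z \<in> K \<and> v \<in> ball ?z (e/3)" by (rule someI[of _ z]) (use that in auto)
    then show ?thesis unfolding p'_def using consistent that by blast
  qed
  have lN: "liso N p'"
  proof (rule liso_cong)
    show "open N" unfolding N_def by auto
    fix v assume "v \<in> N"
    then obtain z where z: "z \<in> K" "v \<in> ball z (e/3)" unfolding N_def by blast
    have "ball z (e/3) \<subseteq> ball z e" using e by auto
    then have "liso (ball z (e/3)) (\<Psi> z)" using G(2)[OF z(1)] by (intro liso_subset[OF \<Psi>(1)[OF z(1)]]) auto
    then show "\<exists>T q. v \<in> T \<and> liso T q \<and> (\<forall>w\<in>T. p' w = q w)" using z p' by blast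
  qed
  \<comment> \<open>With this choice cosh t' + sinh t' exceeds cosh t + sinh t by e / 4, so the
    larger ball stays within e / 4 < e / 3 of \<open>K\<close>, although its Euclidean centre is
    higher.\<close>
  define t' where "t' = ln (exp t + e / 4)"
  have et': "exp t' = exp t + e / 4" unfolding t'_def using e by (intro exp_ln) (simp add: add_pos_pos)
  have tt': "t < t'"
  proof -
    have "exp t < exp t'" using et' e by simp
    then show ?thesis by simp
  qed
  have "hball \<i> t' \<subseteq> N"
  proof
    fix v assume "v \<in> hball \<i> t'"
    then have v: "dist (Complex 0 (cosh t')) v < sinh t'" using tt' t by (simp add: hball_eq_ball)
    have "dist c (Complex 0 (cosh t')) = cosh t' - cosh t"
    proof -
      have "c - Complex 0 (cosh t') = of_real (cosh t - cosh t') * \<i>" by (simp add: c_def complex_eq_iff)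
      then have "dist c (Complex 0 (cosh t')) = \<bar>cosh t - cosh t'\<bar>" unfolding dist_complex_def by (simp only: norm_mult norm_of_real norm_ii mult_1_right)
      moreover have "cosh t \<le> cosh t'" using t tt' by (simp add: cosh_real_nonneg_le_iff)
      ultimately show ?thesis by simp
    qed
    then have "dist c v < cosh t' - cosh t + sinh t'" using v dist_triangle[of c v "Complex 0 (cosh t')"] by linarith
    also have "\<dots> = sinh t + e / 4" using et' unfolding cosh_plus_sinh[symmetric] by simp
    finally have d: "dist c v < sinh t + e / 4" .
    show "v \<in> N"
    proof (cases "v \<in> K")
      case True
      then show ?thesis unfolding N_def using e by (intro UN_I[of v]) auto
    next
      case False
      then have dp: "dist c v > sinh t" "sinh t > 0" using K t by auto
      define D where "D = dist c v"
      have D: "D > 0" "sinh t < D" "cmod (v - c) = D" using dp by (auto simp: D_def dist_complex_def norm_minus_commute)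
      define z where "z = c + of_real (sinh t / D) * (v - c)"
      have "z - c = of_real (sinh t / D) * (v - c)" by (simp add: z_def)
      then have "cmod (z - c) = \<bar>sinh t / D\<bar> * D" by (simp only: norm_mult norm_of_real D(3))
      also have "\<dots> = sinh t" using D(1) dp(2) by simp
      finally have "z \<in> K" unfolding K by (simp add: dist_complex_def norm_minus_commute)
      have "v - z = of_real (1 - sinh t / D) * (v - c)" unfolding z_def by (simp add: algebra_simps)
      then have "cmod (v - z) = \<bar>1 - sinh t / D\<bar> * D" by (simp only: norm_mult norm_of_real D(3))
      also have "\<dots> = (1 - sinh t / D) * D" using D by simp
      also have "\<dots> = D - sinh t" using D by (simp add: field_simps)
      finally have "dist z v < e / 3" using d e unfolding D_def[symmetric] by (simp add: dist_complex_def norm_minus_commute)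
      then show ?thesis unfolding N_def using \<open>z \<in> K\<close> by auto
    qed
  qed
  then have "liso (hball \<i> t') p'" using liso_subset[OF lN] by auto
  moreover have "p' w = p w" if "w \<in> ?B" for w
  proof -
    have "w \<in> K" using that closure_subset unfolding K_def by blast
    then have "p' w = \<Psi> w w" "w \<in> G w" using p'[of w w] G(2)[of w] e by auto
    then show ?thesis using \<Psi>(2)[OF \<open>w \<in> K\<close>, of w] that by simp
  qed
  ultimately show ?thesis using tt' by blast
qed

text \<open>The germ \<open>q0\<close> at \<open>\<i>\<close> pins down the maps on all concentric
  balls, so they are nested and can be glued.\<close>

lemma liso_union:
  assumes T: "T \<noteq> {}" "\<And>t. t \<in> T \<Longrightarrow> t > 0" and e: "e > 0"
    and ex: "\<And>t. t \<in> T \<Longrightarrow> \<exists>p. liso (hball \<i> t) p \<and> (\<forall>w\<in>hball \<i> (min e t). p w = q0 w)"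
  shows "\<exists>p. liso (\<Union>t\<in>T. hball \<i> t) p \<and> (\<forall>t\<in>T. \<forall>w\<in>hball \<i> (min e t). p w = q0 w)"
proof -
  have "\<forall>t\<in>T. \<exists>p. liso (hball \<i> t) p \<and> (\<forall>w\<in>hball \<i> (min e t). p w = q0 w)" using ex by blast
  then obtain P where "\<forall>t\<in>T. liso (hball \<i> t) (P t) \<and> (\<forall>w\<in>hball \<i> (min e t). P t w = q0 w)"
    by (rule bchoice[THEN exE])
  then have P: "\<And>t. t \<in> T \<Longrightarrow> liso (hball \<i> t) (P t)" "\<And>t w. t \<in> T \<Longrightarrow> w \<in> hball \<i> (min e t) \<Longrightarrow> P t w = q0 w"
    by auto
  have cons1: "P t w = P t' w" if "t \<in> T" "t' \<in> T" "w \<in> hball \<i> t" "t \<le> t'" for t t' w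
  proof (rule liso_unique[of "hball \<i> t" _ _ \<i> "min e t"])
    show "liso (hball \<i> t) (P t')" using liso_subset[OF P(1)[OF that(2)]] hball_mono[OF that(4)] by simp
    show "P t w = P t' w" if "w \<in> hball \<i> (min e t)" for w
    proof -
      have "w \<in> hball \<i> (min e t')" using that \<open>t \<le> t'\<close> by (auto simp: hball_def)
      then show ?thesis using P(2)[OF \<open>t \<in> T\<close> that] P(2)[OF \<open>t' \<in> T\<close>, of w] by simp
    qed
  next
    show "Topological_Spaces.connected (hball \<i> t)" using T that by (intro connected_hball) (auto simp: less_imp_le)
    show "liso (hball \<i> t) (P t)" "w \<in> hball \<i> t" using P that by auto
    show "\<i> \<in> hball \<i> t" "min e t > 0" using T that e by auto
  qed
  have cons: "P t w = P t' w" if "t \<in> T" "t' \<in> T" "w \<in> hball \<i> t" "w \<in> hball \<i> t'" for t t' w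
  proof (cases "t \<le> t'")
    case True
    show ?thesis by (rule cons1[OF that(1,2,3) True])
  next
    case False
    then have "t' \<le> t" by simp
    then show ?thesis by (rule cons1[OF that(2,1,4), symmetric])
  qed
  define p where "p = (\<lambda>w. P (SOME t. t \<in> T \<and> w \<in> hball \<i> t) w)"
  have p: "p w = P t w" if "t \<in> T" "w \<in> hball \<i> t" for t w
  proof -
    let ?t = "SOME t. t \<in> T \<and> w \<in> hball \<i> t"
    have "?t \<in> T \<and> w \<in> hball \<i> ?t" by (rule someI[of _ t]) (use that in auto)
    then show ?thesis unfolding p_def using cons[OF _ that(1) _ that(2), of ?t] by simp
  qed
  have "liso (\<Union>t\<in>T. hball \<i> t) p"
  proof (rule liso_cong)
    show "open (\<Union>t\<in>T. hball \<i> t)" by auto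
    fix z assume "z \<in> (\<Union>t\<in>T. hball \<i> t)"
    then obtain t where t: "t \<in> T" "z \<in> hball \<i> t" by blast
    show "\<exists>T q. z \<in> T \<and> liso T q \<and> (\<forall>w\<in>T. p w = q w)"
      using t p P(1) by (intro exI[of _ "hball \<i> t"] exI[of _ "P t"]) auto
  qed
  moreover have "p w = q0 w" if "t \<in> T" "w \<in> hball \<i> (min e t)" for t w
    using p[OF that(1), of w] P(2)[OF that] that(2) hball_mono[of "min e t" t \<i>] by auto
  ultimately show ?thesis by blast
qed

text \<open>The universal covering is built from balls instead of homotopy classes of paths: the
  radii to which a germ at \<open>\<i>\<close> continues have no finite supremum, because the maps
  for smaller radii unite to one on the limiting ball and \<open>liso_extend_ball\<close> goes
  beyond it.\<close>

lemma exists_covering: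
  assumes "X \<noteq> {}"
  shows "\<exists>\<pi>. liso {z. Im z > 0} \<pi>"
proof -
  obtain x0 where x0: "x0 \<in> X" using assms by blast
  obtain r where r: "good x0 r" using exists_good[OF x0] by blast
  then have r0: "r > 0" by (simp add: good_def)
  obtain U \<phi> where U: "(U, \<phi>) \<in> A" "x0 \<in> U"
    and lift: "\<And>M z'. M \<in> SL2 \<Longrightarrow> Im z' > 0 \<Longrightarrow> act M z' = \<phi> x0 \<Longrightarrow> \<exists>q. liso (hball z' r) q"
    using good_lift[OF r] by metis
  obtain M where "M \<in> SL2" "act M \<i> = \<phi> x0" using exists_act_i[OF chart_Im[OF U]] by blast
  then obtain q0 where q0: "liso (hball \<i> r) q0" using lift[of M \<i>] by auto
  define T where "T = {t. t > 0 \<and> (\<exists>p. liso (hball \<i> t) p \<and> (\<forall>w\<in>hball \<i> (min r t). p w = q0 w))}"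
  have rT: "r \<in> T" using q0 r0 unfolding T_def by auto
  obtain p where p: "liso (\<Union>t\<in>T. hball \<i> t) p" "\<forall>t\<in>T. \<forall>w\<in>hball \<i> (min r t). p w = q0 w"
    using liso_union[of T r q0] rT r0 unfolding T_def by blast
  have unb: "\<not> bdd_above T"
  proof
    assume bdd: "bdd_above T"
    define s where "s = Sup T"
    have s: "\<And>t. t \<in> T \<Longrightarrow> t \<le> s" using bdd by (simp add: s_def cSup_upper)
    have s0: "s > 0" using s[OF rT] r0 by simp
    have "(\<Union>t\<in>T. hball \<i> t) = hball \<i> s"
    proof (intro equalityI subsetI)
      fix w assume "w \<in> (\<Union>t\<in>T. hball \<i> t)" then show "w \<in> hball \<i> s" using s hball_mono by blast
    next
      fix w assume w: "w \<in> hball \<i> s"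
      then have "hyp_dist \<i> w < Sup T" by (simp add: hball_def s_def)
      then obtain t where "t \<in> T" "hyp_dist \<i> w < t" using rT bdd by (metis less_cSup_iff empty_iff)
      then show "w \<in> (\<Union>t\<in>T. hball \<i> t)" using w by (auto simp: hball_def)
    qed
    then have ps: "liso (hball \<i> s) p" using p by simp
    obtain t' p' where t': "t' > s" "liso (hball \<i> t') p'" "\<forall>w\<in>hball \<i> s. p' w = p w"
      using liso_extend_ball[OF s0 ps] by blast
    have "p' w = q0 w" if "w \<in> hball \<i> (min r t')" for w
    proof -
      have "w \<in> hball \<i> r" "w \<in> hball \<i> (min r r)" "w \<in> hball \<i> s" using that s[OF rT] by (auto simp: hball_def)
      then show ?thesis using t' p rT by auto
    qed
    then have "t' \<in> T" using t' s0 unfolding T_def by auto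
    then show False using s t' by force
  qed
  have "(\<Union>t\<in>T. hball \<i> t) = {z. Im z > 0}"
  proof (intro equalityI subsetI)
    fix z assume z: "z \<in> {z. Im z > 0}"
    obtain t where "t \<in> T" "t > hyp_dist \<i> z" using unb by (meson bdd_above.I not_le)
    then show "z \<in> (\<Union>t\<in>T. hball \<i> t)" using z by (auto simp: hball_def)
  qed (auto simp: hball_def)
  then show ?thesis using p by auto
qed

end

lemma sum_dist_le_curve_length:
  assumes "n \<ge> 1"
  shows "(\<Sum>i<n. ennreal (dist (c (real i / real n)) (c (real (Suc i) / real n)))) \<le> curve_length c"
proof -
  let ?ts = "map (\<lambda>i. real i / real n) [0..<Suc n]"
  have "sorted ?ts" using assms by (auto simp: sorted_iff_nth_mono divide_right_mono simp del: upt_Suc)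
  moreover have "set ?ts \<subseteq> {0..1}" using assms by (auto simp: field_simps simp del: upt_Suc)
  moreover have "(\<Sum>i<n. ennreal (dist (c (real i / real n)) (c (real (Suc i) / real n))))
      = (\<Sum>i<length ?ts - 1. ennreal (dist (c (?ts ! i)) (c (?ts ! Suc i))))"
    by (rule sum.cong) (auto simp del: upt_Suc)
  ultimately show ?thesis unfolding curve_length_def
    by (intro SUP_upper2[of ?ts]) auto
qed

section \<open>The deck group, and distances on the quotient\<close>

locale covering = oriented_surface +
  fixes \<pi> :: "complex \<Rightarrow> 'a"
  assumes liso_pi: "liso {z. Im z > 0} \<pi>"
begin

lemma pi_in: "Im z > 0 \<Longrightarrow> \<pi> z \<in> X"
  using liso_in[OF liso_pi] by simp

lemma pi_local:
  assumes "Im z > 0"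
  shows "\<exists>r>0. \<forall>w\<in>hball z r. \<forall>w'\<in>hball z r. dist (\<pi> w) (\<pi> w') = hyp_dist w w'"
  using liso_local[OF liso_pi, of z] assms by auto

lemma hball_upper: "hball z r \<subseteq> {z. Im z > 0}" by (auto simp: hball_def)

lemma pi_good_ball:
  assumes "Im z > 0" "good (\<pi> z) r"
  shows "\<forall>w\<in>hball z r. \<forall>w'\<in>hball z r. dist (\<pi> w) (\<pi> w') = hyp_dist w w'"
    and "\<forall>y\<in>X. dist (\<pi> z) y < r \<longrightarrow> (\<exists>w\<in>hball z r. \<pi> w = y)"
  using liso_good_ball[OF liso_pi _ assms(2) hball_upper] assms(1) by blast+

lemma dist_pi_le:
  assumes "Im z > 0" "Im w > 0"
  shows "dist (\<pi> z) (\<pi> w) \<le> hyp_dist z w"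
proof -
  obtain P where P: "P \<in> SL2" "hline P 0 = z" "hline P (hyp_dist z w) = w" using exists_hline[OF assms] by blast
  have "dist (\<pi> (hline P 0)) (\<pi> (hline P (hyp_dist z w))) \<le> 1 * (hyp_dist z w - 0)"
  proof (rule dist_le_of_locally_Lipschitz[of 0 _ "\<lambda>t. \<pi> (hline P t)"])
    show "0 \<le> hyp_dist z w" using assms by simp
    fix t assume "t \<in> {0..hyp_dist z w}"
    obtain r where r: "r > 0" "\<forall>u\<in>hball (hline P t) r. \<forall>u'\<in>hball (hline P t) r. dist (\<pi> u) (\<pi> u') = hyp_dist u u'"
      using pi_local[of "hline P t"] P by auto
    have "dist (\<pi> (hline P s)) (\<pi> (hline P s')) \<le> 1 * \<bar>s - s'\<bar>" if "\<bar>s - t\<bar> < r" "\<bar>s' - t\<bar> < r" for s s'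
    proof -
      have "hline P s \<in> hball (hline P t) r" "hline P s' \<in> hball (hline P t) r"
        using that P by (auto simp: hball_def abs_minus_commute)
      then show ?thesis using r P by simp
    qed
    then show "\<exists>\<delta>>0. \<forall>s\<in>{0..hyp_dist z w}. \<forall>s'\<in>{0..hyp_dist z w}. \<bar>s - t\<bar> < \<delta> \<and> \<bar>s' - t\<bar> < \<delta> \<longrightarrow>
        dist (\<pi> (hline P s)) (\<pi> (hline P s')) \<le> 1 * \<bar>s - s'\<bar>" using r by blast
  qed
  then show ?thesis using P by simp
qed

lemma openin_pi_image:
  assumes "open S" "S \<subseteq> {z. Im z > 0}"
  shows "openin (top_of_set X) (\<pi> ` S)"
  unfolding openin_euclidean_subtopology_iff
proof (intro conjI ballI)
  show "\<pi> ` S \<subseteq> X" using pi_in assms by auto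
  fix x assume "x \<in> \<pi> ` S"
  then obtain z where z: "z \<in> S" "x = \<pi> z" by blast
  then have Imz: "Im z > 0" using assms by auto
  obtain r where r: "good x r" using exists_good[of x] pi_in[OF Imz] z by auto
  obtain e where e: "e > 0" "hball z e \<subseteq> S" using exists_hball_subset[OF assms(1) z(1) Imz] by blast
  have "y \<in> \<pi> ` S" if y: "y \<in> X" "dist y x < min r e" for y
  proof -
    obtain w where w: "w \<in> hball z r" "\<pi> w = y" using pi_good_ball(2)[OF Imz, of r] r z y by (auto simp: dist_commute)
    have "hyp_dist z w = dist x y" using pi_good_ball(1)[OF Imz, of r] r z w Imz by (auto simp: good_def)
    then have "w \<in> hball z e" using w y by (simp add: hball_def dist_commute)
    then show ?thesis using e w by blast
  qed
  then show "\<exists>e>0. \<forall>x'\<in>X. dist x' x < e \<longrightarrow> x' \<in> \<pi> ` S" using r e by (intro exI[of _ "min r e"]) (auto simp: good_def)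
qed

text \<open>The image is open; it is closed since a preimage of a point near a limit point has an
  even covering ball that reaches the limit point.\<close>

lemma pi_surj:
  assumes "x \<in> X"
  shows "\<exists>z. Im z > 0 \<and> \<pi> z = x"
proof -
  let ?H = "{z. Im z > 0}"
  have o: "openin (top_of_set X) (\<pi> ` ?H)" by (rule openin_pi_image) (auto simp: open_halfspace_Im_gt)
  have c: "closedin (top_of_set X) (\<pi> ` ?H)"
    unfolding closedin_limpt
  proof (intro conjI allI impI)
    show "\<pi> ` ?H \<subseteq> X" using pi_in by auto
    fix x assume x: "x islimpt \<pi> ` ?H \<and> x \<in> X"
    obtain r where r: "good x r" using exists_good x by blast
    then have "r / 2 > 0" by (simp add: good_def)
    then obtain z where z: "Im z > 0" "dist (\<pi> z) x < r / 2" using x unfolding islimpt_approachable by blast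
    have "good (\<pi> z) (r/2)" using good_shift[OF r pi_in[OF z(1)]] z by (simp add: dist_commute)
    then obtain w where "w \<in> hball z (r/2)" "\<pi> w = x" using pi_good_ball(2)[OF z(1), of "r/2"] x z by auto
    then show "x \<in> \<pi> ` ?H" using hball_Im by blast
  qed
  have "\<pi> ` ?H = {} \<or> \<pi> ` ?H = X" using connected o c unfolding connected_clopen by blast
  moreover have "\<pi> \<i> \<in> \<pi> ` ?H" by auto
  ultimately show ?thesis using assms by (metis (mono_tags, lifting) empty_iff image_iff mem_Collect_eq)
qed

text \<open>The deck group lifted to matrices; it contains \<open>mneg mid\<close>, so every deck
  transformation occurs with both signs.\<close>

definition \<Gamma> :: "mat2 set" where
  "\<Gamma> = {M \<in> SL2. \<forall>z. Im z > 0 \<longrightarrow> \<pi> (act M z) = \<pi> z}"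

lemma \<Gamma>_SL2: "M \<in> \<Gamma> \<Longrightarrow> M \<in> SL2" by (simp add: \<Gamma>_def)

lemma pi_\<Gamma>: "M \<in> \<Gamma> \<Longrightarrow> Im z > 0 \<Longrightarrow> \<pi> (act M z) = \<pi> z" by (simp add: \<Gamma>_def)

lemma \<Gamma>_mid [simp]: "mid \<in> \<Gamma>" by (simp add: \<Gamma>_def)

lemma \<Gamma>_mmul [simp]: "M \<in> \<Gamma> \<Longrightarrow> N \<in> \<Gamma> \<Longrightarrow> M \<odot> N \<in> \<Gamma>"
  by (simp add: \<Gamma>_def act_mmul)

lemma \<Gamma>_madj [simp]: "M \<in> \<Gamma> \<Longrightarrow> madj M \<in> \<Gamma>"
proof -
  assume M: "M \<in> \<Gamma>"
  have "\<pi> (act (madj M) z) = \<pi> z" if "Im z > 0" for z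
    using pi_\<Gamma>[OF M, of "act (madj M) z"] \<Gamma>_SL2[OF M] that by simp
  then show ?thesis using M by (simp add: \<Gamma>_def)
qed

lemma \<Gamma>_mneg [simp]: "M \<in> \<Gamma> \<Longrightarrow> mneg M \<in> \<Gamma>" by (simp add: \<Gamma>_def)

lemmas [simp] = \<Gamma>_SL2 pi_\<Gamma>

lemma liso_pi_act:
  assumes M: "M \<in> SL2"
  shows "liso {z. Im z > 0} (\<lambda>z. \<pi> (act M z))"
  unfolding liso_def
proof
  fix z assume "z \<in> {z. Im z > 0}"
  then have z: "Im z > 0" "act M z \<in> {z. Im z > 0}" using M by auto
  obtain U \<phi> N r where N: "(U, \<phi>) \<in> A" "N \<in> SL2" "r > 0" "\<forall>w\<in>hball (act M z) r. \<pi> w \<in> U" "\<forall>w\<in>hball (act M z) r. \<phi> (\<pi> w) = act N w"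
    by (rule lisoE[OF liso_pi z(2)])
  have "\<pi> (act M w) \<in> U \<and> \<phi> (\<pi> (act M w)) = act (N \<odot> M) w" if "w \<in> hball z r" for w
    using act_hball[OF M z(1) that] N M hball_Im[OF that] by (simp add: act_mmul)
  then show "Im z > 0 \<and> (\<exists>U \<phi> Ma r. (U, \<phi>) \<in> A \<and> Ma \<in> SL2 \<and> r > 0 \<and> hball z r \<subseteq> {z. Im z > 0} \<and>
      (\<forall>w\<in>hball z r. \<pi> (act M w) \<in> U \<and> \<phi> (\<pi> (act M w)) = act Ma w))"
    using N M z hball_upper[of z r] by (intro conjI exI[of _ U] exI[of _ \<phi>] exI[of _ "N \<odot> M"] exI[of _ r]) auto
qed

text \<open>Two preimages of one point, read in one chart, are related by a Moebius map under which
  \<open>\<pi>\<close> is invariant near \<open>z\<close>. Uniqueness of local isometries makes it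
  invariant on the whole half-plane, so the deck group is transitive on fibres.\<close>

lemma pi_eqE:
  assumes "Im z > 0" "Im w > 0" "\<pi> z = \<pi> w"
  shows "\<exists>M\<in>\<Gamma>. act M z = w"
proof -
  obtain U \<phi> where U: "(U, \<phi>) \<in> A" "\<pi> z \<in> U" using pi_in[OF assms(1)] covered by fastforce
  obtain P r1 where P: "P \<in> SL2" "r1 > 0" "\<forall>v\<in>hball z r1. \<pi> v \<in> U \<and> \<phi> (\<pi> v) = act P v"
    using liso_chart[OF liso_pi _ U] assms by auto
  obtain Q r2 where Q: "Q \<in> SL2" "r2 > 0" "\<forall>v\<in>hball w r2. \<pi> v \<in> U \<and> \<phi> (\<pi> v) = act Q v"
    using liso_chart[OF liso_pi _ U(1), of w] U(2) assms by auto
  let ?M = "madj Q \<odot> P"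
  have M: "?M \<in> SL2" using P Q by simp
  have "act P z = \<phi> (\<pi> z)" "act Q w = \<phi> (\<pi> w)" using P(2,3) Q(2,3) assms(1,2) by auto
  then have "act P z = act Q w" by (simp only: assms(3))
  then have Mz: "act ?M z = w" using P Q assms by (simp add: act_mmul)
  have near: "\<pi> (act ?M v) = \<pi> v" if "v \<in> hball z (min r1 r2)" for v
  proof -
    have v: "v \<in> hball z r1" "v \<in> hball z r2" "Im v > 0" using that by (auto simp: hball_def)
    have "act ?M v \<in> hball w r2" using act_hball[OF M assms(1) v(2)] Mz by simp
    then have "\<pi> (act ?M v) \<in> U" "\<phi> (\<pi> (act ?M v)) = act Q (act ?M v)" using Q by auto
    moreover have "act Q (act ?M v) = act P v" using P Q v by (simp add: act_mmul)
    moreover have "\<pi> v \<in> U" "\<phi> (\<pi> v) = act P v" using P v by auto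
    ultimately show ?thesis using chart_inj[OF U(1)] by (simp add: inj_on_def)
  qed
  have "\<pi> (act ?M v) = \<pi> v" if "Im v > 0" for v
    by (rule liso_unique[OF liso_pi_act[OF M] liso_pi, of z "min r1 r2"])
       (use near P Q assms that in \<open>auto intro!: convex_connected convex_halfspace_Im_gt\<close>)
  then show ?thesis using M Mz unfolding \<Gamma>_def by blast
qed

text \<open>Near a fixed point the element maps a ball to itself on which \<open>\<pi>\<close> is
  injective, so it is the identity there.\<close>

lemma \<Gamma>_free:
  assumes "M \<in> \<Gamma>" "Im z > 0" "act M z = z"
  shows "M = mid \<or> M = mneg mid"
proof -
  obtain r where r: "r > 0" "\<forall>w\<in>hball z r. \<forall>w'\<in>hball z r. dist (\<pi> w) (\<pi> w') = hyp_dist w w'"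
    using pi_local[OF assms(2)] by blast
  have "act M w = w" if w: "w \<in> hball z r" for w
  proof -
    have Imw: "Im w > 0" using w hball_Im by blast
    have "act M w \<in> hball z r" using act_hball[of M z w r] assms w by simp
    then have "hyp_dist w (act M w) = 0" using r w pi_\<Gamma>[OF assms(1) Imw] by (metis dist_self)
    then show ?thesis using Imw assms by simp
  qed
  then show ?thesis using act_eq_on_hball[of M mid z r] assms r by simp
qed

lemma \<Gamma>_trace:
  assumes "M \<in> \<Gamma>" "M \<noteq> mid" "M \<noteq> mneg mid"
  shows "\<bar>mtr M\<bar> \<ge> 2"
  using act_fix_elliptic[of M] \<Gamma>_free[of M] assms by force

lemma \<Gamma>_eq:
  assumes "M \<in> \<Gamma>" "N \<in> \<Gamma>" "Im z > 0" "act M z = act N z"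
  shows "M = N \<or> M = mneg N"
proof -
  have "madj N \<odot> M = mid \<or> madj N \<odot> M = mneg mid"
    by (rule \<Gamma>_free[of _ z]) (use assms in \<open>simp_all add: act_mmul\<close>)
  then have "N \<odot> (madj N \<odot> M) = N \<or> N \<odot> (madj N \<odot> M) = mneg N" by auto
  then show ?thesis using assms by simp
qed

text \<open>An accumulation point of the orbit would have a ball on which \<open>\<pi>\<close> is
  injective, although \<open>\<pi>\<close> takes a single value on the orbit. Each orbit point comes
  from at most two matrices.\<close>

lemma \<Gamma>_discrete:
  assumes z: "Im z > 0"
  shows "finite {M \<in> \<Gamma>. hyp_dist z (act M z) \<le> R}"
proof (cases "R \<ge> 0")
  case False
  have "{M \<in> \<Gamma>. hyp_dist z (act M z) \<le> R} = {}"
  proof -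
    have "\<not> hyp_dist z (act M z) \<le> R" if "M \<in> \<Gamma>" for M
      using False order_trans[OF hyp_dist_nonneg[OF z Im_act_pos[OF \<Gamma>_SL2[OF that] z]]] by blast
    then show ?thesis by blast
  qed
  then show ?thesis by (simp only: finite.emptyI)
next
  case True
  let ?S = "{M \<in> \<Gamma>. hyp_dist z (act M z) \<le> R}"
  let ?O = "(\<lambda>M. act M z) ` ?S"
  define K where "K = {w. Im w > 0 \<and> hyp_dist z w \<le> R}"
  have K: "compact K" unfolding K_def hcball_eq_cball[OF z True] by simp
  have "finite ?O"
  proof (rule ccontr)
    assume inf: "infinite ?O"
    have "?O \<subseteq> K" using z by (auto simp: K_def)
    then obtain x where x: "x \<in> K" "x islimpt ?O"
      using K[unfolded compact_eq_Bolzano_Weierstrass, rule_format, OF conjI, OF inf] by blast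
    then have Imx: "Im x > 0" by (simp add: K_def)
    obtain r where r: "r > 0" "\<forall>w\<in>hball x r. \<forall>w'\<in>hball x r. dist (\<pi> w) (\<pi> w') = hyp_dist w w'"
      using pi_local[OF Imx] by blast
    have infO: "infinite (?O \<inter> hball x r)"
      using x(2)[unfolded islimpt_eq_acc_point, rule_format, of "hball x r"] Imx r by (simp add: Int_commute)
    have sub: "?O \<inter> hball x r \<subseteq> {p}" if p: "p \<in> ?O \<inter> hball x r" for p
    proof
      fix p' assume p': "p' \<in> ?O \<inter> hball x r"
      have "\<pi> p = \<pi> z" "\<pi> p' = \<pi> z" using p p' z by auto
      moreover have pp': "p \<in> hball x r" "p' \<in> hball x r" using p p' by auto
      then have "hyp_dist p p' = dist (\<pi> p) (\<pi> p')" using r(2) by simp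
      ultimately have "hyp_dist p p' = 0" by simp
      then show "p' \<in> {p}" using pp' hball_Im by simp
    qed
    obtain p where "p \<in> ?O \<inter> hball x r" using infO infinite_imp_nonempty by blast
    then have "finite (?O \<inter> hball x r)" by (intro finite_subset[OF sub]) auto
    with infO show False by contradiction
  qed
  moreover have "finite ((\<lambda>M. act M z) -` {p} \<inter> ?S)" for p
  proof (cases "(\<lambda>M. act M z) -` {p} \<inter> ?S = {}")
    case False
    then obtain N where N: "N \<in> \<Gamma>" "act N z = p" by auto
    have "(\<lambda>M. act M z) -` {p} \<inter> ?S \<subseteq> {N, mneg N}" using \<Gamma>_eq[OF _ N(1) z] N by auto
    then show ?thesis by (rule finite_subset) simp
  qed (simp only: finite.emptyI)
  ultimately have "finite ((\<lambda>M. act M z) -` ?O \<inter> ?S)"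
    by (rule finite_finite_vimage_IntI)
  moreover have "(\<lambda>M. act M z) -` ?O \<inter> ?S = ?S" by blast
  ultimately show ?thesis by simp
qed

text \<open>Only the points of a fine subdivision are lifted, one after the other. Consecutive
  points lie in one even covering ball, so each step of the lifted polygon has the length of the
  corresponding chord, and the chords sum up to at most the length of the curve.\<close>

lemma curve_lift:
  assumes c: "path c" "path_image c \<subseteq> X" "pathstart c = \<pi> u" "pathfinish c = \<pi> v"
    and Im: "Im u > 0" "Im v > 0"
  shows "\<exists>M\<in>\<Gamma>. ennreal (hyp_dist u (act M v)) \<le> curve_length c"
proof -
  have cX: "c t \<in> X" if "t \<in> {0..1}" for t using c(2) that by (auto simp: path_image_def)
  have "\<forall>t\<in>{0..1}. \<exists>r. good (c t) r" using cX exists_good by blast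
  then obtain r where r: "\<forall>t\<in>{0..1}. good (c t) (r t)" by (rule bchoice[THEN exE])
  have cc: "continuous_on {0..1} c" using c by (simp add: path_def)
  have "\<forall>t\<in>{0..1}. \<exists>V. open V \<and> t \<in> V \<and> (\<forall>s\<in>V \<inter> {0..1}. dist (c s) (c t) < r t / 4)"
  proof
    fix t :: real assume t: "t \<in> {0..1}"
    then have "r t / 4 > 0" using r by (auto simp: good_def)
    then obtain d where "d > 0" "\<forall>s\<in>{0..1}. dist s t < d \<longrightarrow> dist (c s) (c t) < r t / 4"
      using cc t unfolding continuous_on_iff by blast
    then show "\<exists>V. open V \<and> t \<in> V \<and> (\<forall>s\<in>V \<inter> {0..1}. dist (c s) (c t) < r t / 4)"
      by (intro exI[of _ "ball t d"]) (auto simp: dist_commute)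
  qed
  then obtain V where V: "\<forall>t\<in>{0..1}. open (V t) \<and> t \<in> V t \<and> (\<forall>s\<in>V t \<inter> {0..1}. dist (c s) (c t) < r t / 4)"
    by (rule bchoice[THEN exE])
  obtain e where e: "e > 0" "\<And>s. s \<in> {0..1} \<Longrightarrow> \<exists>G\<in>V ` {0..1}. ball s e \<subseteq> G"
    by (rule Heine_Borel_lemma[of "{0..1::real}" "V ` {0..1}"]) (use V in auto)
  obtain n :: nat where n: "n \<ge> 1" "1 / real n < e"
  proof -
    obtain m :: nat where "m > 1 / e" using reals_Archimedean2 by blast
    then have "1 / real (Suc m) < e" using e by (simp add: field_simps)
    then show ?thesis using that[of "Suc m"] by simp
  qed
  define t where "t = (\<lambda>i::nat. real i / real n)"
  have t01: "t i \<in> {0..1}" if "i \<le> n" for i using that n by (auto simp: t_def)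
  have lift: "\<exists>w'. Im w' > 0 \<and> \<pi> w' = c (t (Suc i)) \<and> hyp_dist w w' = dist (c (t i)) (c (t (Suc i)))"
    if i: "i < n" and w: "Im w > 0" "\<pi> w = c (t i)" for i w
  proof -
    obtain s where s: "s \<in> {0..1}" "ball (t i) e \<subseteq> V s" using e(2)[OF t01[of i]] i by auto
    have "dist (t i) (t (Suc i)) < e" using n by (simp add: t_def dist_real_def field_simps)
    then have "t i \<in> V s \<inter> {0..1}" "t (Suc i) \<in> V s \<inter> {0..1}" using s e t01[of i] t01[of "Suc i"] i by auto
    then have d: "dist (c (t i)) (c s) < r s / 4" "dist (c (t (Suc i))) (c s) < r s / 4" using V s by auto
    have g: "good (c s) (r s)" using r s by blast
    have "r s > 0" using g by (simp add: good_def)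
    then have gi: "good (\<pi> w) (r s / 2)" using good_shift[OF g, of "c (t i)"] cX t01[of i] i d w by (simp add: dist_commute)
    have "dist (\<pi> w) (c (t (Suc i))) < r s / 2" using d dist_triangle[of "c (t i)" "c (t (Suc i))" "c s"] w by (simp add: dist_commute)
    then obtain w' where w': "w' \<in> hball w (r s / 2)" "\<pi> w' = c (t (Suc i))"
      using pi_good_ball(2)[OF w(1) gi] cX[OF t01[of "Suc i"]] i by auto
    have "w \<in> hball w (r s / 2)" using w \<open>r s > 0\<close> by simp
    then have "dist (\<pi> w) (\<pi> w') = hyp_dist w w'" using pi_good_ball(1)[OF w(1) gi] w'(1) by blast
    then have "hyp_dist w w' = dist (c (t i)) (c (t (Suc i)))" unfolding w(2) w'(2) by simp
    then show ?thesis using w' hball_Im by blast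
  qed
  have "\<exists>w. Im w > 0 \<and> \<pi> w = c (t k) \<and> hyp_dist u w \<le> (\<Sum>i<k. dist (c (t i)) (c (t (Suc i))))" if "k \<le> n" for k
    using that
  proof (induction k)
    case 0
    then show ?case using Im c by (intro exI[of _ u]) (simp add: t_def pathstart_def)
  next
    case (Suc k)
    then obtain w where w: "Im w > 0" "\<pi> w = c (t k)" "hyp_dist u w \<le> (\<Sum>i<k. dist (c (t i)) (c (t (Suc i))))" by auto
    obtain w' where w': "Im w' > 0" "\<pi> w' = c (t (Suc k))" "hyp_dist w w' = dist (c (t k)) (c (t (Suc k)))"
      using lift[of k w] Suc w by auto
    have "hyp_dist u w' \<le> hyp_dist u w + hyp_dist w w'" using Im w w' by (intro hyp_dist_triangle)
    then show ?case using w w' by (intro exI[of _ w']) auto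
  qed
  then obtain w where w: "Im w > 0" "\<pi> w = c (t n)" "hyp_dist u w \<le> (\<Sum>i<n. dist (c (t i)) (c (t (Suc i))))" by blast
  have "\<pi> v = \<pi> w" using w c n by (simp add: t_def pathfinish_def)
  then obtain M where M: "M \<in> \<Gamma>" "act M v = w" using pi_eqE Im w by blast
  have "ennreal (hyp_dist u w) \<le> ennreal (\<Sum>i<n. dist (c (t i)) (c (t (Suc i))))" using w by (intro ennreal_leI)
  also have "\<dots> = (\<Sum>i<n. ennreal (dist (c (t i)) (c (t (Suc i)))))" by (subst sum_ennreal) auto
  also have "\<dots> \<le> curve_length c" using sum_dist_le_curve_length[OF n(1), of c] by (simp add: t_def)
  finally show ?thesis using M by blast
qed

text \<open>The length metric enters here: a distance on \<open>X\<close> is an infimum over curves,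
  and every curve bounds the distance between suitable lifts of its ends.\<close>

lemma dist_pi_ge:
  assumes "Im u > 0" "Im v > 0" "\<And>M. M \<in> \<Gamma> \<Longrightarrow> d \<le> hyp_dist u (act M v)"
  shows "d \<le> dist (\<pi> u) (\<pi> v)"
proof -
  have "ennreal d \<le> ennreal (dist (\<pi> u) (\<pi> v))"
    unfolding length_metric[unfolded length_metric_def, rule_format, OF pi_in[OF assms(1)] pi_in[OF assms(2)]]
  proof (rule INF_greatest)
    fix c assume "c \<in> {c. path c \<and> path_image c \<subseteq> X \<and> pathstart c = \<pi> u \<and> pathfinish c = \<pi> v}"
    then obtain M where M: "M \<in> \<Gamma>" "ennreal (hyp_dist u (act M v)) \<le> curve_length c" using curve_lift[of c u v] assms by blast
    have "ennreal d \<le> ennreal (hyp_dist u (act M v))" using assms(3)[OF M(1)] by (rule ennreal_leI)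
    then show "ennreal d \<le> curve_length c" using M by simp
  qed
  then show ?thesis by (simp add: ennreal_le_iff)
qed

end

text \<open>A crude bound that does not depend on the centre: the Euclidean area times the least
  density, taken at the greatest height Im z * exp r.\<close>

lemma hyp_area_hball:
  assumes "Im z > 0" "r > 0"
  shows "ennreal (unit_ball_vol 2 * (sinh r)\<^sup>2 * exp (- 2 * r)) \<le> emeasure hyp_area (hball z r)"
proof -
  let ?c = "ennreal (1 / (Im z * exp r)\<^sup>2)"
  have B: "hball z r = ball (Complex (Re z) (Im z * cosh r)) (Im z * sinh r)" using assms by (simp add: hball_eq_ball)
  have le: "1 / (Im z * exp r)\<^sup>2 \<le> 1 / (Im w)\<^sup>2" if "w \<in> hball z r" for w
  proof -
    have w: "Im w > 0" "\<bar>ln (Im z) - ln (Im w)\<bar> < r" using that abs_ln_Im_le_hyp_dist(1)[of z w] assms by (auto simp: hball_def)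
    then have "ln (Im w) \<le> ln (Im z) + r" by linarith
    then have "Im w \<le> Im z * exp r" using w assms by (metis exp_add exp_le_cancel_iff exp_ln)
    then show ?thesis using w assms by (intro divide_left_mono power_mono mult_pos_pos zero_less_power) auto
  qed
  have "emeasure lborel (hball z r) = ennreal (unit_ball_vol 2 * (Im z * sinh r) ^ 2)"
    unfolding B using assms emeasure_ball[of "Im z * sinh r" "Complex (Re z) (Im z * cosh r)"] by simp
  then have "?c * emeasure lborel (hball z r) = ennreal (1 / (Im z * exp r)\<^sup>2 * (unit_ball_vol 2 * (Im z * sinh r) ^ 2))"
    using unit_ball_vol_nonneg[of 2] by (simp only: ennreal_mult[symmetric] zero_le_divide_1_iff zero_le_power2 mult_nonneg_nonneg)
  also have "1 / (Im z * exp r)\<^sup>2 * (unit_ball_vol 2 * (Im z * sinh r) ^ 2) = unit_ball_vol 2 * (sinh r)\<^sup>2 * exp (- 2 * r)"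
    using assms by (simp add: power_mult_distrib exp_minus field_simps flip: exp_double)
  finally have "ennreal (unit_ball_vol 2 * (sinh r)\<^sup>2 * exp (- 2 * r)) = (\<integral>\<^sup>+w. ?c * indicator (hball z r) w \<partial>lborel)"
    unfolding B by (subst nn_integral_cmult_indicator) auto
  also have "\<dots> \<le> (\<integral>\<^sup>+w. ennreal (1 / (Im w)\<^sup>2) * indicator (hball z r) w \<partial>lborel)"
    using le by (intro nn_integral_mono) (auto simp: indicator_def intro!: ennreal_leI)
  also have "\<dots> = emeasure hyp_area (hball z r)"
    unfolding hyp_area_def B by (subst emeasure_density) auto
  finally show ?thesis .
qed

section \<open>Displacement functions\<close>

text \<open>This is \<open>sinh\<close> of half the displacement of \<open>z\<close>
  (\<open>sinh_half_displacement\<close>), as the modulus of the fixed point polynomial over 2 Im z.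
  The polynomial is linear in the entries, so that commuting elements and powers have proportional
  functions.\<close>

definition mdisp :: "mat2 \<Rightarrow> complex \<Rightarrow> real" where
  "mdisp M z = cmod (of_real (mc M) * z\<^sup>2 + of_real (md M - ma M) * z - of_real (mb M)) / (2 * Im z)"

lemma sinh_half_displacement:
  assumes "M \<in> SL2" "Im z > 0"
  shows "sinh (hyp_dist z (act M z) / 2) = mdisp M z"
proof -
  let ?D = "of_real (mc M) * z + complex_of_real (md M)"
  have D: "?D \<noteq> 0" using denom_nz assms by blast
  have "z - act M z = (z * ?D - (of_real (ma M) * z + of_real (mb M))) / ?D"
    unfolding act_def using D by (simp add: diff_divide_distrib)
  also have "z * ?D - (of_real (ma M) * z + of_real (mb M)) = of_real (mc M) * z\<^sup>2 + of_real (md M - ma M) * z - of_real (mb M)"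
    by (simp add: algebra_simps power2_eq_square)
  finally have 1: "cmod (z - act M z) = cmod (of_real (mc M) * z\<^sup>2 + of_real (md M - ma M) * z - of_real (mb M)) / cmod ?D"
    by (simp only: norm_divide)
  have "Im z * Im (act M z) = (Im z / cmod ?D)\<^sup>2" unfolding Im_act[OF assms] by (simp add: power2_eq_square)
  then have 2: "sqrt (Im z * Im (act M z)) = Im z / cmod ?D" using assms by (simp only: real_sqrt_abs) simp
  show ?thesis unfolding sinh_half_hyp_dist[OF assms(2) Im_act_pos[OF assms]] 1 2 mdisp_def using D by simp
qed

lemma mdisp_nonneg: "Im z > 0 \<Longrightarrow> 0 \<le> mdisp M z" by (simp add: mdisp_def)

definition mconj :: "mat2 \<Rightarrow> mat2 \<Rightarrow> mat2" where "mconj P M = madj P \<odot> M \<odot> P"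

lemma mconj_in [simp]: "P \<in> SL2 \<Longrightarrow> M \<in> SL2 \<Longrightarrow> mconj P M \<in> SL2" by (simp add: mconj_def)

lemma mconj_mmul: "P \<in> SL2 \<Longrightarrow> mconj P (M \<odot> N) = mconj P M \<odot> mconj P N"
  by (simp add: mconj_def mmul_assoc)

lemma mconj_madj: "P \<in> SL2 \<Longrightarrow> mconj P (madj M) = madj (mconj P M)"
  by (simp add: mconj_def madj_mmul mmul_assoc)

lemma mtr_mmul_commute: "mtr (M \<odot> N) = mtr (N \<odot> M)" by (simp add: mtr_def mmul_def algebra_simps)

lemma mtr_mconj [simp]: "P \<in> SL2 \<Longrightarrow> mtr (mconj P M) = mtr M"
  unfolding mconj_def by (subst mtr_mmul_commute) simp

lemma mdisp_mconj:
  assumes "P \<in> SL2" "M \<in> SL2" "Im z > 0"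
  shows "mdisp (mconj P M) z = mdisp M (act P z)"
proof -
  have "act (mconj P M) z = act (madj P) (act M (act P z))" using assms by (simp add: mconj_def act_mmul mmul_assoc)
  then have "hyp_dist z (act (mconj P M) z) = hyp_dist (act (madj P) (act P z)) (act (madj P) (act M (act P z)))"
    using assms by simp
  also have "\<dots> = hyp_dist (act P z) (act M (act P z))" using assms by (intro hyp_dist_act) auto
  finally show ?thesis
    using sinh_half_displacement[of "mconj P M" z] sinh_half_displacement[of M "act P z"] assms by simp
qed

lemma mdisp_mneg [simp]: "mdisp (mneg M) z = mdisp M z"
proof -
  have "of_real (mc (mneg M)) * z\<^sup>2 + of_real (md (mneg M) - ma (mneg M)) * z - of_real (mb (mneg M))
    = - (of_real (mc M) * z\<^sup>2 + complex_of_real (md M - ma M) * z - of_real (mb M))"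
    by (simp add: mneg_def algebra_simps)
  then show ?thesis unfolding mdisp_def by (simp only: norm_minus_cancel)
qed

lemma mdisp_axis:
  assumes "u > 0"
  shows "(mdisp M (of_real u * \<i>))\<^sup>2 = ((mc M * u + mb M / u)\<^sup>2 + (ma M - md M)\<^sup>2) / 4"
proof -
  have e: "of_real (mc M) * (of_real u * \<i>)\<^sup>2 + of_real (md M - ma M) * (of_real u * \<i>) - complex_of_real (mb M)
     = Complex (- (mc M * u\<^sup>2 + mb M)) ((md M - ma M) * u)" by (simp add: complex_eq_iff power2_eq_square algebra_simps)
  have "mdisp M (of_real u * \<i>) = cmod (Complex (- (mc M * u\<^sup>2 + mb M)) ((md M - ma M) * u)) / (2 * u)"
    unfolding mdisp_def e by simp
  then have "(mdisp M (of_real u * \<i>))\<^sup>2 = ((- (mc M * u\<^sup>2 + mb M))\<^sup>2 + ((md M - ma M) * u)\<^sup>2) / (4 * u\<^sup>2)"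
    by (simp only: power_divide cmod_power2 complex.sel power_mult_distrib) simp
  also have "\<dots> = (((mc M * u\<^sup>2 + mb M) / u)\<^sup>2 + (md M - ma M)\<^sup>2) / 4" using assms
  proof -
    have "((- X)\<^sup>2 + (Y * u)\<^sup>2) / (4 * u\<^sup>2) = ((X / u)\<^sup>2 + Y\<^sup>2) / 4" for X Y
      using assms by (simp add: power_divide power_mult_distrib field_simps)
    then show ?thesis .
  qed
  also have "(mc M * u\<^sup>2 + mb M) / u = mc M * u + mb M / u" using assms by (simp add: field_simps power2_eq_square)
  finally show ?thesis by (simp add: power2_commute)
qed

lemma mdisp_i: "(mdisp M \<i>)\<^sup>2 = ((mb M + mc M)\<^sup>2 + (ma M - md M)\<^sup>2) / 4"
  using mdisp_axis[of 1 M] by (simp add: add.commute)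

lemma mdisp_trace:
  assumes "M \<in> SL2"
  shows "4 * (mdisp M \<i>)\<^sup>2 = (mtr M)\<^sup>2 - 4 + (mb M - mc M)\<^sup>2"
proof -
  have "ma M * md M = 1 + mb M * mc M" using assms by (simp add: SL2_def)
  moreover have "4 * (mdisp M \<i>)\<^sup>2 = (mb M + mc M)\<^sup>2 + (ma M - md M)\<^sup>2" by (simp add: mdisp_i)
  ultimately show ?thesis unfolding mtr_def by (simp add: power2_eq_square algebra_simps)
qed

lemma trace_le_mdisp:
  assumes "M \<in> SL2" "Im z > 0"
  shows "(mtr M)\<^sup>2 - 4 \<le> 4 * (mdisp M z)\<^sup>2"
proof -
  obtain P where P: "P \<in> SL2" "act P \<i> = z" using exists_act_i assms by blast
  have "mdisp (mconj P M) \<i> = mdisp M z" using mdisp_mconj[OF P(1) assms(1), of \<i>] P by simp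
  then show ?thesis using mdisp_trace[of "mconj P M"] P assms zero_le_power2[of "mb (mconj P M) - mc (mconj P M)"] by simp
qed

text \<open>A small displacement of \<open>\<i>\<close> alone allows rotations about
  \<open>\<i>\<close>; trace at least 2 excludes them and puts the matrix near the identity. The
  quantities (b + c)^2 + (a - d)^2 = 4 F^2 and (b - c)^2 + tr^2 = 4 + 4 F^2 control all
  entries.\<close>

lemma entries_bound:
  assumes "A \<in> SL2" "mtr A \<ge> 2" "mdisp A \<i> \<le> 1"
  defines "F \<equiv> mdisp A \<i>"
  shows "\<bar>ma A - 1\<bar> \<le> 2 * F" "\<bar>md A - 1\<bar> \<le> 2 * F" "\<bar>mb A\<bar> \<le> 2 * F" "\<bar>mc A\<bar> \<le> 2 * F"
    "\<bar>ma A - md A\<bar> \<le> 2 * F"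
proof -
  have F: "0 \<le> F" "F \<le> 1" using assms mdisp_nonneg[of \<i>] by auto
  have 1: "(mb A + mc A)\<^sup>2 + (ma A - md A)\<^sup>2 = (2 * F)\<^sup>2" using mdisp_i[of A] by (simp add: F_def power_mult_distrib)
  have 2: "(mb A - mc A)\<^sup>2 + (mtr A)\<^sup>2 = 4 + (2 * F)\<^sup>2"
    using mdisp_trace[OF assms(1)] by (simp add: F_def power_mult_distrib)
  have tr4: "(mtr A)\<^sup>2 \<ge> 4" using power_mono[OF assms(2), of 2] by simp
  have le: "\<bar>x\<bar> \<le> 2 * F" if "x\<^sup>2 \<le> (2 * F)\<^sup>2" for x using that F by (metis abs_le_square_iff abs_of_nonneg mult_nonneg_nonneg zero_le_numeral)
  have a: "\<bar>mb A + mc A\<bar> \<le> 2 * F" using 1 zero_le_power2[of "ma A - md A"] by (intro le) linarith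
  show b: "\<bar>ma A - md A\<bar> \<le> 2 * F" using 1 zero_le_power2[of "mb A + mc A"] by (intro le) linarith
  have c: "\<bar>mb A - mc A\<bar> \<le> 2 * F" using 2 tr4 by (intro le) linarith
  show "\<bar>mb A\<bar> \<le> 2 * F" "\<bar>mc A\<bar> \<le> 2 * F" using a c by linarith+
  have "(mtr A)\<^sup>2 \<le> (2 + F\<^sup>2)\<^sup>2"
  proof -
    have "(2 + F\<^sup>2)\<^sup>2 = 4 + (2 * F)\<^sup>2 + (F\<^sup>2)\<^sup>2" by (simp add: power2_eq_square algebra_simps)
    then show ?thesis using 2 zero_le_power2[of "mb A - mc A"] zero_le_power2[of "F\<^sup>2"] by linarith
  qed
  then have "mtr A \<le> 2 + F\<^sup>2" by (rule power2_le_imp_le) simp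
  moreover have "F\<^sup>2 \<le> F" using F by (simp add: power2_eq_square mult_left_le)
  ultimately have "ma A + md A \<le> 2 + F" "2 \<le> ma A + md A" using assms(2) by (simp_all add: mtr_def)
  then show "\<bar>ma A - 1\<bar> \<le> 2 * F" "\<bar>md A - 1\<bar> \<le> 2 * F" using b F by linarith+
qed

section \<open>Commutators of short elements\<close>

definition comm :: "mat2 \<Rightarrow> mat2 \<Rightarrow> mat2" where "comm A B = (A \<odot> B) \<odot> (madj A \<odot> madj B)"

lemma abs_mult_add_le:
  fixes p q :: real
  assumes "\<bar>p\<bar> \<le> x" "\<bar>q\<bar> \<le> y" "\<bar>p'\<bar> \<le> x'" "\<bar>q'\<bar> \<le> y'"
  shows "\<bar>p * q + p' * q'\<bar> \<le> x * y + x' * y'"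
proof -
  have "\<bar>p * q\<bar> \<le> x * y" "\<bar>p' * q'\<bar> \<le> x' * y'" unfolding abs_mult using assms by (auto intro!: mult_mono)
  then show ?thesis by linarith
qed

text \<open>The difference of the commutator and the identity is (AB - BA) times the inverse of BA,
  and every entry of AB - BA is a sum of two products of one factor of order F and one of order
  G.\<close>

lemma comm_mdisp_i:
  assumes A: "A \<in> SL2" "mtr A \<ge> 2" "mdisp A \<i> \<le> 1/2" and B: "B \<in> SL2" "mtr B \<ge> 2" "mdisp B \<i> \<le> 1/2"
  shows "mdisp (comm A B) \<i> \<le> 256 * mdisp A \<i> * mdisp B \<i>"
proof -
  define F G where "F = mdisp A \<i>" and "G = mdisp B \<i>"
  have FG: "0 \<le> F" "0 \<le> G" by (simp_all add: F_def G_def mdisp_nonneg)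
  have "mdisp A \<i> \<le> 1" "mdisp B \<i> \<le> 1" using A(3) B(3) by simp_all
  note eA = entries_bound[OF A(1,2) this(1), folded F_def]
    and eB = entries_bound[OF B(1,2) this(2), folded G_def]
  \<comment> \<open>These are entries of AB - BA; the fourth one is the negative of
    \<open>P11\<close>, since the difference has trace 0.\<close>
  define P11 P12 P21 where "P11 = mb A * mc B + (- mc A) * mb B"
    and "P12 = (ma A - md A) * mb B + (- mb A) * (ma B - md B)"
    and "P21 = (- mc B) * (ma A - md A) + (mc A) * (ma B - md B)"
  have P: "\<bar>P11\<bar> \<le> 8 * (F * G)" "\<bar>P12\<bar> \<le> 8 * (F * G)" "\<bar>P21\<bar> \<le> 8 * (F * G)"
  proof -
    have "\<bar>P11\<bar> \<le> (2 * F) * (2 * G) + (2 * F) * (2 * G)" unfolding P11_def by (rule abs_mult_add_le; simp only: abs_minus_cancel eA eB)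
    then show "\<bar>P11\<bar> \<le> 8 * (F * G)" by simp
    have "\<bar>P12\<bar> \<le> (2 * F) * (2 * G) + (2 * F) * (2 * G)" unfolding P12_def by (rule abs_mult_add_le; simp only: abs_minus_cancel eA eB)
    then show "\<bar>P12\<bar> \<le> 8 * (F * G)" by simp
    have "\<bar>P21\<bar> \<le> (2 * G) * (2 * F) + (2 * F) * (2 * G)" unfolding P21_def by (rule abs_mult_add_le; simp only: abs_minus_cancel eA eB)
    then show "\<bar>P21\<bar> \<le> 8 * (F * G)" by simp
  qed
  define W where "W = madj A \<odot> madj B"
  have eA2: "\<bar>ma A\<bar> \<le> 2" "\<bar>mb A\<bar> \<le> 2" "\<bar>mc A\<bar> \<le> 2" "\<bar>md A\<bar> \<le> 2" using eA A(3) unfolding F_def by linarith+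
  have eB2: "\<bar>ma B\<bar> \<le> 2" "\<bar>mb B\<bar> \<le> 2" "\<bar>mc B\<bar> \<le> 2" "\<bar>md B\<bar> \<le> 2" using eB B(3) unfolding G_def by linarith+
  have g: "\<bar>p * q + p' * q'\<bar> \<le> 8" if "\<bar>p\<bar> \<le> 2" "\<bar>q\<bar> \<le> 2" "\<bar>p'\<bar> \<le> 2" "\<bar>q'\<bar> \<le> 2" for p q p' q' :: real
    using abs_mult_add_le[OF that] by simp
  have W: "\<bar>ma W\<bar> \<le> 8" "\<bar>mb W\<bar> \<le> 8" "\<bar>mc W\<bar> \<le> 8" "\<bar>md W\<bar> \<le> 8"
    unfolding W_def mmul_def madj_def mat2.sel
    by (rule g; simp only: abs_minus_cancel eA2 eB2)+
  let ?N = "comm A B"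
  have N: "?N = (A \<odot> B) \<odot> W" by (simp add: comm_def W_def)
  have I: "(B \<odot> A) \<odot> W = mid" unfolding W_def using A B by (simp add: mmul_assoc)
  have diff: "ma (A \<odot> B) = ma (B \<odot> A) + P11" "mb (A \<odot> B) = mb (B \<odot> A) + P12"
     "mc (A \<odot> B) = mc (B \<odot> A) + P21" "md (A \<odot> B) = md (B \<odot> A) - P11"
    by (simp_all add: mmul_def P11_def P12_def P21_def algebra_simps)
  have n: "ma ?N = 1 + (P11 * ma W + P12 * mc W)" "mb ?N = P11 * mb W + P12 * md W"
    "mc ?N = P21 * ma W + (- P11) * mc W" "md ?N = 1 + (P21 * mb W + (- P11) * md W)"
  proof -
    have i: "ma (B \<odot> A) * ma W + mb (B \<odot> A) * mc W = 1" "ma (B \<odot> A) * mb W + mb (B \<odot> A) * md W = 0"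
      "mc (B \<odot> A) * ma W + md (B \<odot> A) * mc W = 0" "mc (B \<odot> A) * mb W + md (B \<odot> A) * md W = 1"
      using arg_cong[OF I, of ma] arg_cong[OF I, of mb] arg_cong[OF I, of mc] arg_cong[OF I, of md]
      unfolding mmul_def[of "B \<odot> A" W] mid_def by simp_all
    show "ma ?N = 1 + (P11 * ma W + P12 * mc W)" "mb ?N = P11 * mb W + P12 * md W"
      "mc ?N = P21 * ma W + (- P11) * mc W" "md ?N = 1 + (P21 * mb W + (- P11) * md W)"
      unfolding N mmul_def[of "A \<odot> B" W] mat2.sel diff using i by (simp_all add: algebra_simps)
  qed
  let ?K = "8 * (F * G) * 8 + 8 * (F * G) * 8"
  have b: "\<bar>P11 * ma W + P12 * mc W\<bar> \<le> ?K" "\<bar>P11 * mb W + P12 * md W\<bar> \<le> ?K"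
     "\<bar>P21 * ma W + (- P11) * mc W\<bar> \<le> ?K" "\<bar>P21 * mb W + (- P11) * md W\<bar> \<le> ?K"
    by ((rule abs_mult_add_le; simp only: abs_minus_cancel P W))+
  have "\<bar>ma ?N - md ?N\<bar> \<le> 256 * (F * G)" "\<bar>mb ?N + mc ?N\<bar> \<le> 256 * (F * G)"
    using b unfolding n by linarith+
  then have "(ma ?N - md ?N)\<^sup>2 \<le> (256 * (F * G))\<^sup>2" "(mb ?N + mc ?N)\<^sup>2 \<le> (256 * (F * G))\<^sup>2"
    by (metis abs_ge_zero power2_abs power_mono)+
  then have "(mdisp ?N \<i>)\<^sup>2 \<le> (256 * (F * G))\<^sup>2" 
  proof -
    have "(y + x) / 4 \<le> k" if "x \<le> k" "y \<le> k" "0 \<le> k" for x y k :: real using that by simp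
    then show ?thesis unfolding mdisp_i using \<open>(ma ?N - md ?N)\<^sup>2 \<le> _\<close> \<open>(mb ?N + mc ?N)\<^sup>2 \<le> _\<close> zero_le_power2 by blast
  qed
  then have "mdisp ?N \<i> \<le> 256 * (F * G)" by (rule power2_le_imp_le) (use FG in simp)
  then show ?thesis by (simp add: F_def G_def mult.assoc)
qed

lemma comm_in [simp]: "A \<in> SL2 \<Longrightarrow> B \<in> SL2 \<Longrightarrow> comm A B \<in> SL2" by (simp add: comm_def)

text \<open>Conjugation moves \<open>z\<close> to \<open>\<i>\<close>, and 1/1024 is chosen so that
  the factor 256 * \<open>mdisp B z\<close> is at most 1/4.\<close>

lemma comm_mdisp:
  assumes A: "A \<in> SL2" "mtr A \<ge> 2" "mdisp A z \<le> 1/1024" and B: "B \<in> SL2" "mtr B \<ge> 2" "mdisp B z \<le> 1/1024"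
    and z: "Im z > 0"
  shows "mdisp (comm A B) z \<le> mdisp A z / 4"
proof -
  obtain P where P: "P \<in> SL2" "act P \<i> = z" using exists_act_i z by blast
  have c: "mdisp (mconj P M) \<i> = mdisp M z" if "M \<in> SL2" for M using mdisp_mconj[OF P(1) that, of \<i>] P by simp
  have "mconj P (comm A B) = comm (mconj P A) (mconj P B)" unfolding comm_def using P by (simp add: mconj_mmul mconj_madj)
  then have "mdisp (comm A B) z = mdisp (comm (mconj P A) (mconj P B)) \<i>" using c[of "comm A B"] A B by simp
  also have "\<dots> \<le> 256 * mdisp (mconj P A) \<i> * mdisp (mconj P B) \<i>"
    using A B P by (intro comm_mdisp_i) (simp_all add: c)
  also have "\<dots> = (256 * mdisp B z) * mdisp A z" using c A B by simp
  also have "\<dots> \<le> (1/4) * mdisp A z" using B(3) by (intro mult_right_mono) (simp_all add: mdisp_nonneg z)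
  finally show ?thesis by simp
qed

lemma mdisp_eq_0_iff:
  assumes "M \<in> SL2" "Im z > 0"
  shows "mdisp M z = 0 \<longleftrightarrow> act M z = z"
  using assms by (simp flip: sinh_half_displacement) metis

text \<open>Commuting matrices have proportional fixed point polynomials. A comparison of
  displacements at one point therefore holds at all points.\<close>

lemma commute_mdisp:
  assumes A: "A \<in> SL2" "A \<noteq> mid" "A \<noteq> mneg mid" and B: "A \<odot> B = B \<odot> A"
  shows "\<exists>t. \<forall>z. Im z > 0 \<longrightarrow> mdisp B z = \<bar>t\<bar> * mdisp A z"
proof -
  have e: "mb A * mc B = mb B * mc A" "(ma A - md A) * mb B = (ma B - md B) * mb A" "(ma A - md A) * mc B = (ma B - md B) * mc A"
    using arg_cong[OF B, of ma] arg_cong[OF B, of mb] arg_cong[OF B, of mc] by (simp_all add: mmul_def algebra_simps)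
  have "\<exists>t. mc B = t * mc A \<and> mb B = t * mb A \<and> md B - ma B = t * (md A - ma A)"
  proof (cases "mc A = 0")
    case c: False
    then show ?thesis using e by (intro exI[of _ "mc B / mc A"]) (simp add: field_simps)
  next
    case c: True
    show ?thesis
    proof (cases "mb A = 0")
      case b: False
      then show ?thesis using e c by (intro exI[of _ "mb B / mb A"]) (simp add: field_simps)
    next
      case b: True
      have "ma A - md A \<noteq> 0"
      proof
        assume "ma A - md A = 0"
        then have "ma A * ma A = 1" "md A = ma A" using A(1) b c by (auto simp: SL2_def)
        then have "ma A = 1 \<or> ma A = -1" by (simp add: square_eq_1_iff)
        then show False using A b c \<open>md A = ma A\<close> by (cases A) (auto simp: mid_def mneg_def)
      qed
      then show ?thesis using e b c by (intro exI[of _ "(ma B - md B) / (ma A - md A)"]) (simp add: field_simps)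
    qed
  qed
  then obtain t where t: "mc B = t * mc A" "mb B = t * mb A" "md B - ma B = t * (md A - ma A)" by blast
  have "mdisp B z = \<bar>t\<bar> * mdisp A z" for z
  proof -
    have "of_real (mc B) * z\<^sup>2 + of_real (md B - ma B) * z - of_real (mb B)
      = of_real t * (of_real (mc A) * z\<^sup>2 + of_real (md A - ma A) * z - complex_of_real (mb A))"
      unfolding t by (simp add: algebra_simps)
    then show ?thesis unfolding mdisp_def by (simp only: norm_mult norm_of_real times_divide_eq_right)
  qed
  then show ?thesis by blast
qed

section \<open>Powers, and the variation of displacement functions\<close>

fun mpow :: "mat2 \<Rightarrow> nat \<Rightarrow> mat2" where
  "mpow A 0 = mid" | "mpow A (Suc n) = A \<odot> mpow A n"

lemma mpow_in [simp]: "A \<in> SL2 \<Longrightarrow> mpow A n \<in> SL2" by (induction n) auto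

text \<open>For n \<ge> 1 this is the Chebyshev polynomial of the second kind of degree n - 1 at t /
  2. By Cayley-Hamilton, the n-th power of a matrix of determinant 1 and trace t is chebU t n times
  the matrix minus chebU t (n - 1) times the identity.\<close>

fun chebU :: "real \<Rightarrow> nat \<Rightarrow> real" where
  "chebU t 0 = 0" | "chebU t (Suc 0) = 1" | "chebU t (Suc (Suc n)) = t * chebU t (Suc n) - chebU t n"

lemma mpow_chebU:
  assumes "A \<in> SL2"
  defines "u \<equiv> chebU (mtr A)"
  shows "mpow A (Suc n) = Mat (u (Suc n) * ma A - u n) (u (Suc n) * mb A) (u (Suc n) * mc A) (u (Suc n) * md A - u n)"
proof (induction n)
  case 0
  then show ?case by (cases A) (simp add: u_def)
next
  case (Suc n)
  have det: "ma A * md A = 1 + mb A * mc A" using assms by (simp add: SL2_def)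
  have "mpow A (Suc (Suc n)) = A \<odot> Mat (u (Suc n) * ma A - u n) (u (Suc n) * mb A) (u (Suc n) * mc A) (u (Suc n) * md A - u n)"
    using Suc by simp
  moreover have "u (Suc (Suc n)) = (ma A + md A) * u (Suc n) - u n" by (simp add: u_def mtr_def)
  moreover have "A \<odot> Mat (x * ma A - y) (x * mb A) (x * mc A) (x * md A - y)
    = Mat (((ma A + md A) * x - y) * ma A - x) (((ma A + md A) * x - y) * mb A) (((ma A + md A) * x - y) * mc A) (((ma A + md A) * x - y) * md A - x)" for x y
  proof -
    have "x * (ma A * md A) = x + x * (mb A * mc A)" unfolding det by (simp add: algebra_simps)
    then show ?thesis by (simp add: mmul_def algebra_simps)
  qed
  ultimately show ?case by simp
qed

lemma mdisp_mpow:
  assumes "A \<in> SL2" "Im z > 0"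
  shows "mdisp (mpow A n) z = \<bar>chebU (mtr A) n\<bar> * mdisp A z"
proof (cases n)
  case 0
  then show ?thesis using assms by (simp add: mdisp_def mid_def)
next
  case (Suc m)
  let ?u = "chebU (mtr A) (Suc m)"
  have "of_real (mc (mpow A n)) * z\<^sup>2 + of_real (md (mpow A n) - ma (mpow A n)) * z - of_real (mb (mpow A n))
      = of_real ?u * (of_real (mc A) * z\<^sup>2 + of_real (md A - ma A) * z - complex_of_real (mb A))"
    unfolding Suc mpow_chebU[OF assms(1)] by (simp add: algebra_simps)
  then show ?thesis unfolding mdisp_def Suc by (simp only: norm_mult norm_of_real times_divide_eq_right)
qed

lemma chebU_ge:
  assumes "t \<ge> 2"
  shows "chebU t n \<ge> 0 \<and> chebU t (Suc n) - chebU t n \<ge> 1"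
proof (induction n)
  case (Suc n)
  have "2 * chebU t (Suc n) \<le> t * chebU t (Suc n)" using assms Suc by (intro mult_right_mono) auto
  moreover have "chebU t (Suc (Suc n)) = t * chebU t (Suc n) - chebU t n" by simp
  ultimately show ?case using Suc by linarith
qed simp

lemma chebU_ge_of_nat: "t \<ge> 2 \<Longrightarrow> chebU t n \<ge> real n"
proof (induction n)
  case (Suc n)
  then show ?case using chebU_ge[of t n] by auto
qed simp

lemma chebU_2: "chebU 2 n = real n \<and> chebU 2 (Suc n) = real (Suc n)"
  by (induction n) auto

text \<open>After conjugation \<open>z\<close> is \<open>\<i>\<close> and \<open>w\<close> is
  \<open>u\<close> times \<open>\<i>\<close> with u = exp of the distance. Trace at least 2 in
  absolute value means (a - d)^2 + 4 b c \<ge> 0, which bounds |b| + |c| by twice the displacement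
  at \<open>\<i>\<close>; along the axis the terms then grow at most by the factor
  \<open>u\<close>.\<close>

lemma mdisp_growth:
  assumes A: "A \<in> SL2" "\<bar>mtr A\<bar> \<ge> 2" and z: "Im z > 0" "Im w > 0"
  shows "mdisp A w \<le> 2 * exp (hyp_dist z w) * mdisp A z"
proof -
  obtain P where P: "P \<in> SL2" "act P \<i> = z" "act P (of_real (exp (hyp_dist z w)) * \<i>) = w"
    using hyp_normal_form[OF z] by blast
  define u where "u = exp (hyp_dist z w)"
  have u: "u \<ge> 1" using z by (simp add: u_def)
  let ?C = "mconj P A"
  have C: "?C \<in> SL2" using P A by simp
  have Fz: "mdisp ?C \<i> = mdisp A z" using mdisp_mconj[OF P(1) A(1), of \<i>] P by simp
  have Fw: "mdisp ?C (of_real u * \<i>) = mdisp A w"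
    using mdisp_mconj[OF P(1) A(1), of "of_real u * \<i>"] P u by (simp add: u_def)
  define F where "F = mdisp A z"
  have F0: "0 \<le> F" using z by (simp add: F_def mdisp_nonneg)
  have F2: "(mb ?C + mc ?C)\<^sup>2 + (ma ?C - md ?C)\<^sup>2 = (2 * F)\<^sup>2" using mdisp_i[of ?C] Fz by (simp add: F_def power_mult_distrib)
  have le: "\<bar>x\<bar> \<le> 2 * F" if "x\<^sup>2 \<le> (2 * F)\<^sup>2" for x using that F0 by (metis abs_le_square_iff abs_of_nonneg mult_nonneg_nonneg zero_le_numeral)
  have ad: "\<bar>ma ?C - md ?C\<bar> \<le> 2 * F" using F2 zero_le_power2[of "mb ?C + mc ?C"] by (intro le) linarith
  have "4 \<le> (mtr ?C)\<^sup>2" using power_mono[OF A(2), of 2] P by simp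
  then have disc: "0 \<le> (ma ?C - md ?C)\<^sup>2 + 4 * (mb ?C * mc ?C)"
    using C unfolding SL2_def mtr_def by (simp add: power2_eq_square algebra_simps)
  have "(\<bar>mb ?C\<bar> + \<bar>mc ?C\<bar>)\<^sup>2 \<le> (2 * F)\<^sup>2"
  proof -
    have "(\<bar>mb ?C\<bar> + \<bar>mc ?C\<bar>)\<^sup>2 = (mb ?C)\<^sup>2 + (mc ?C)\<^sup>2 + 2 * \<bar>mb ?C * mc ?C\<bar>"
      by (simp add: power2_sum abs_mult)
    moreover have "(mb ?C + mc ?C)\<^sup>2 = (mb ?C)\<^sup>2 + (mc ?C)\<^sup>2 + 2 * (mb ?C * mc ?C)" by (simp add: power2_sum)
    ultimately show ?thesis using F2 disc by (cases "mb ?C * mc ?C \<ge> 0") (use zero_le_power2[of "ma ?C - md ?C"] in linarith)+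
  qed
  then have bc: "\<bar>mb ?C\<bar> + \<bar>mc ?C\<bar> \<le> 2 * F" using le[of "\<bar>mb ?C\<bar> + \<bar>mc ?C\<bar>"] by linarith
  have "\<bar>mc ?C * u + mb ?C / u\<bar> \<le> \<bar>mc ?C\<bar> * u + \<bar>mb ?C\<bar> * u"
  proof -
    have "\<bar>mb ?C / u\<bar> \<le> \<bar>mb ?C\<bar> * u"
    proof -
      have "\<bar>mb ?C\<bar> / u \<le> \<bar>mb ?C\<bar> / 1" using u by (intro divide_left_mono) auto
      also have "\<dots> \<le> \<bar>mb ?C\<bar> * u" using u by (simp add: mult_le_cancel_left1)
      finally show ?thesis using u by (simp add: abs_divide)
    qed
    moreover have "\<bar>mc ?C * u\<bar> = \<bar>mc ?C\<bar> * u" using u by (simp add: abs_mult)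
    ultimately show ?thesis by linarith
  qed
  also have "\<dots> = (\<bar>mb ?C\<bar> + \<bar>mc ?C\<bar>) * u" by (simp add: algebra_simps)
  also have "\<dots> \<le> 2 * F * u" using bc u by (intro mult_right_mono) auto
  finally have 1: "\<bar>mc ?C * u + mb ?C / u\<bar> \<le> 2 * F * u" .
  have 2: "\<bar>ma ?C - md ?C\<bar> \<le> 2 * F * u" using ad u F0 mult_left_mono[OF u, of "2 * F"] by linarith
  have "(mc ?C * u + mb ?C / u)\<^sup>2 \<le> (2 * F * u)\<^sup>2" "(ma ?C - md ?C)\<^sup>2 \<le> (2 * F * u)\<^sup>2"
    using 1 2 by (metis abs_ge_zero power2_abs power_mono)+
  then have "(mdisp A w)\<^sup>2 \<le> (2 * F * u)\<^sup>2"
  proof -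
    have "(x + y) / 4 \<le> k" if "x \<le> k" "y \<le> k" "0 \<le> k" for x y k :: real using that by simp
    moreover have "(mdisp ?C (of_real u * \<i>))\<^sup>2 = ((mc ?C * u + mb ?C / u)\<^sup>2 + (ma ?C - md ?C)\<^sup>2) / 4"
      using u by (intro mdisp_axis) simp
    ultimately show ?thesis unfolding Fw[symmetric]
      using \<open>(mc ?C * u + mb ?C / u)\<^sup>2 \<le> _\<close> \<open>(ma ?C - md ?C)\<^sup>2 \<le> _\<close> zero_le_power2 by metis
  qed
  then have "mdisp A w \<le> 2 * F * u" by (rule power2_le_imp_le) (use F0 u in simp)
  then show ?thesis by (simp add: F_def u_def mult_ac)
qed

text \<open>Conjugation by a rotation matrix of angle \<phi> turns the vector (b + c, a - d) by
  twice that angle, so half of its argument makes the second component vanish. For a hyperbolic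
  matrix the imaginary axis is then perpendicular to its axis.\<close>

lemma exists_good_rotation:
  assumes A: "A \<in> SL2"
  shows "\<exists>R\<in>SL2. act R \<i> = \<i> \<and> ma (mconj R A) = md (mconj R A)"
proof -
  define w where "w = Complex (mb A + mc A) (ma A - md A)"
  define \<phi> where "\<phi> = Arg w / 2"
  define C S where "C = cos \<phi>" and "S = sin \<phi>"
  have CS: "C * C + S * S = 1" unfolding C_def S_def using sin_cos_squared_add2[of \<phi>] by (simp add: power2_eq_square)
  let ?R = "Mat C S (- S) C"
  have R: "?R \<in> SL2" using CS by (simp add: SL2_def)
  have "of_real (- S) * \<i> + complex_of_real C \<noteq> 0" using denom_nz[OF R, of \<i>] by simp
  moreover have "of_real C * \<i> + complex_of_real S = \<i> * (of_real (- S) * \<i> + of_real C)"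
    by (simp add: algebra_simps)
  ultimately have Ri: "act ?R \<i> = \<i>" by (simp add: act_def)
  have "w = rcis (cmod w) (2 * \<phi>)" by (simp add: \<phi>_def rcis_cmod_Arg)
  then have w: "mb A + mc A = cmod w * cos (2 * \<phi>)" "ma A - md A = cmod w * sin (2 * \<phi>)"
    by (metis w_def complex.sel Re_rcis, metis w_def complex.sel Im_rcis)
  have "ma (mconj ?R A) - md (mconj ?R A) = (ma A - md A) * (C * C - S * S) - (mb A + mc A) * (2 * S * C)"
    by (simp add: mconj_def mmul_def madj_def algebra_simps)
  also have "C * C - S * S = cos (2 * \<phi>)" unfolding C_def S_def cos_double by (simp add: power2_eq_square)
  also have "2 * S * C = sin (2 * \<phi>)" unfolding C_def S_def sin_double by simp
  also have "(ma A - md A) * cos (2 * \<phi>) - (mb A + mc A) * sin (2 * \<phi>) = 0" unfolding w by simp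
  finally show ?thesis using R Ri by (intro bexI[of _ ?R]) auto
qed

lemma mconj_mconj: "P \<in> SL2 \<Longrightarrow> Q \<in> SL2 \<Longrightarrow> mconj Q (mconj P M) = mconj (P \<odot> Q) M"
  by (simp add: mconj_def madj_mmul mmul_assoc)

text \<open>The path leads straight away from the axis or the fixed point at infinity of
  \<open>A\<close>. With a = d and |b| \<le> |c|, the displacement at \<open>u\<close> times
  \<open>\<i>\<close> is (|c| u + |b| / u) / 2, which is at least u / 2 times its value at u = 1. So
  the value \<open>f1\<close> is attained no later than u = 2 f1 / f.\<close>

lemma mdisp_exit:
  assumes A: "A \<in> SL2" "\<bar>mtr A\<bar> \<ge> 2" and q: "Im q > 0" and f: "0 < mdisp A q" "mdisp A q \<le> f1"
  shows "\<exists>q'. Im q' > 0 \<and> mdisp A q' = f1 \<and> hyp_dist q q' \<le> ln (2 * f1 / mdisp A q)"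
proof -
  obtain P where P: "P \<in> SL2" "act P \<i> = q" using exists_act_i q by blast
  obtain R where R: "R \<in> SL2" "act R \<i> = \<i>" "ma (mconj R (mconj P A)) = md (mconj R (mconj P A))"
    using exists_good_rotation[of "mconj P A"] P A by auto
  have "\<exists>Q\<in>SL2. act Q \<i> = q \<and> ma (mconj Q A) = md (mconj Q A) \<and> \<bar>mb (mconj Q A)\<bar> \<le> \<bar>mc (mconj Q A)\<bar>"
  proof (cases "\<bar>mb (mconj (P \<odot> R) A)\<bar> \<le> \<bar>mc (mconj (P \<odot> R) A)\<bar>")
    case True
    then show ?thesis using P R by (intro bexI[of _ "P \<odot> R"]) (auto simp: mconj_mconj act_mmul)
  next
    case False
    \<comment> \<open>The half turn about \<open>\<i>\<close> exchanges b and c up to sign, that is,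
      it reverses the direction of the path.\<close>
    let ?J = "Mat 0 1 (-1) 0"
    have J: "?J \<in> SL2" by (simp add: SL2_def)
    have Ji: "act ?J \<i> = \<i>" by (simp add: act_def)
    have "mconj ?J M = Mat (md M) (- mc M) (- mb M) (ma M)" for M by (simp add: mconj_def mmul_def madj_def)
    then have "mconj (P \<odot> R \<odot> ?J) A = Mat (md (mconj (P \<odot> R) A)) (- mc (mconj (P \<odot> R) A)) (- mb (mconj (P \<odot> R) A)) (ma (mconj (P \<odot> R) A))"
      using P R J by (simp flip: mconj_mconj[of "P \<odot> R" ?J])
    then show ?thesis using P R J Ji False by (intro bexI[of _ "P \<odot> R \<odot> ?J"]) (auto simp: mconj_mconj act_mmul)
  qed
  then obtain Q where Q: "Q \<in> SL2" "act Q \<i> = q" "ma (mconj Q A) = md (mconj Q A)" "\<bar>mb (mconj Q A)\<bar> \<le> \<bar>mc (mconj Q A)\<bar>" by blast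
  define B where "B = mconj Q A"
  have B: "B \<in> SL2" "ma B = md B" "\<bar>mb B\<bar> \<le> \<bar>mc B\<bar>" using Q A by (auto simp: B_def)
  have "(mtr B)\<^sup>2 \<ge> 4" using power_mono[OF A(2), of 2] Q by (simp add: B_def)
  then have bc: "mb B * mc B \<ge> 0" using B unfolding SL2_def mtr_def by (simp add: power2_eq_square algebra_simps)
  have Fu: "mdisp B (of_real u * \<i>) = (\<bar>mc B\<bar> * u + \<bar>mb B\<bar> / u) / 2" if "u \<ge> 1" for u
  proof -
    have "(mdisp B (of_real u * \<i>))\<^sup>2 = ((mc B * u + mb B / u) / 2)\<^sup>2"
      using mdisp_axis[of u B] that B(2) by (simp add: power_divide)
    then have "sqrt ((mdisp B (of_real u * \<i>))\<^sup>2) = sqrt (((mc B * u + mb B / u) / 2)\<^sup>2)" by simp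
    then have "\<bar>mdisp B (of_real u * \<i>)\<bar> = \<bar>(mc B * u + mb B / u) / 2\<bar>" by (simp only: real_sqrt_abs)
    moreover have "0 \<le> mdisp B (of_real u * \<i>)" using that by (intro mdisp_nonneg) simp
    ultimately have "mdisp B (of_real u * \<i>) = \<bar>mc B * u + mb B / u\<bar> / 2" by (simp add: abs_divide)
    also have "\<bar>mc B * u + mb B / u\<bar> = \<bar>mc B\<bar> * u + \<bar>mb B\<bar> / u"
    proof -
      have "(mc B * u) * (mb B / u) \<ge> 0" using bc that by (simp add: mult.commute)
      then have "\<bar>mc B * u + mb B / u\<bar> = \<bar>mc B * u\<bar> + \<bar>mb B / u\<bar>"
        by (smt (verit) mult_neg_pos mult_pos_neg)
      then show ?thesis using that by (simp add: abs_mult abs_divide)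
    qed
    finally show ?thesis .
  qed
  have Fq: "mdisp A q = (\<bar>mc B\<bar> + \<bar>mb B\<bar>) / 2" using Fu[of 1] mdisp_mconj[OF Q(1) A(1), of \<i>] Q by (simp add: B_def)
  define f where "f = mdisp A q"
  have f': "f > 0" "f \<le> f1" using f by (auto simp: f_def)
  have cf: "f \<le> \<bar>mc B\<bar>" using Fq B(3) by (simp add: f_def)
  define U where "U = 2 * f1 / f"
  have U: "U \<ge> 1" using f' by (simp add: U_def field_simps)
  have "\<exists>u\<ge>1. u \<le> U \<and> (\<bar>mc B\<bar> * u + \<bar>mb B\<bar> / u) / 2 = f1"
  proof (rule IVT')
    show "(\<bar>mc B\<bar> * 1 + \<bar>mb B\<bar> / 1) / 2 \<le> f1" using Fq f by simp
    have "f1 = f * U / 2" using f' by (simp add: U_def)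
    also have "\<dots> \<le> \<bar>mc B\<bar> * U / 2" using cf U by (intro divide_right_mono mult_right_mono) auto
    also have "\<dots> \<le> (\<bar>mc B\<bar> * U + \<bar>mb B\<bar> / U) / 2" using U by simp
    finally show "f1 \<le> (\<bar>mc B\<bar> * U + \<bar>mb B\<bar> / U) / 2" .
    show "continuous_on {1..U} (\<lambda>u. (\<bar>mc B\<bar> * u + \<bar>mb B\<bar> / u) / 2)" by (intro continuous_intros) auto
  qed (use U in auto)
  then obtain u where u: "u \<ge> 1" "u \<le> U" "(\<bar>mc B\<bar> * u + \<bar>mb B\<bar> / u) / 2 = f1" by blast
  let ?q' = "act Q (of_real u * \<i>)"
  have "mdisp A ?q' = f1" using mdisp_mconj[OF Q(1) A(1), of "of_real u * \<i>"] Fu[OF u(1)] u by (simp add: B_def)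
  moreover have "hyp_dist q ?q' \<le> ln U"
  proof -
    have "hyp_dist q ?q' = hyp_dist \<i> (of_real u * \<i>)" using hyp_dist_act[OF Q(1), of \<i> "of_real u * \<i>"] Q u by simp
    also have "\<dots> = ln u" using hyp_dist_vertical[of 1 u] u by simp
    finally show ?thesis using u by simp
  qed
  moreover have "Im ?q' > 0" using Q u by simp
  ultimately show ?thesis unfolding U_def f_def by blast
qed

section \<open>Thick and thin parts\<close>

locale finite_area_covering = covering +
  assumes finite_area: "finite_area X"
begin

definition \<Gamma>' :: "mat2 set" where "\<Gamma>' = {M \<in> \<Gamma>. M \<noteq> mid \<and> M \<noteq> mneg mid}"

lemma \<Gamma>'_\<Gamma>: "M \<in> \<Gamma>' \<Longrightarrow> M \<in> \<Gamma>" by (simp add: \<Gamma>'_def)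

lemma \<Gamma>'_SL2: "M \<in> \<Gamma>' \<Longrightarrow> M \<in> SL2" using \<Gamma>'_\<Gamma> by simp

lemma \<Gamma>'_trace: "M \<in> \<Gamma>' \<Longrightarrow> \<bar>mtr M\<bar> \<ge> 2" using \<Gamma>_trace by (simp add: \<Gamma>'_def)

lemma \<Gamma>'_mneg: "M \<in> \<Gamma>' \<Longrightarrow> mneg M \<in> \<Gamma>'"
  unfolding \<Gamma>'_def using \<Gamma>_mneg mneg_mneg by (metis (mono_tags, lifting) mem_Collect_eq)

lemma \<Gamma>'_mdisp_pos: "M \<in> \<Gamma>' \<Longrightarrow> Im z > 0 \<Longrightarrow> 0 < mdisp M z"
  using mdisp_nonneg[of z M] mdisp_eq_0_iff[of M z] \<Gamma>_free[of M z] by (auto simp: \<Gamma>'_def less_le)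

lemma \<Gamma>'_mconj:
  assumes "M \<in> \<Gamma>'" "g \<in> \<Gamma>" shows "mconj g M \<in> \<Gamma>'"
proof -
  have "mconj g M \<in> \<Gamma>" using assms \<Gamma>'_\<Gamma> by (simp add: mconj_def)
  moreover have "M = g \<odot> mconj g M \<odot> madj g" using assms by (simp add: mconj_def mmul_assoc)
  then have "mconj g M \<noteq> mid" "mconj g M \<noteq> mneg mid" using assms by (auto simp: \<Gamma>'_def)
  ultimately show ?thesis by (simp add: \<Gamma>'_def)
qed

text \<open>A Margulis constant on the scale of \<^const>\<open>mdisp\<close>: by \<open>comm_mdisp\<close>, commutators of elements with
  smaller displacement are even shorter, so that a shortest element commutes with all short ones.\<close>

abbreviation f1 :: real where "f1 \<equiv> 1 / 1024"

text \<open>Of the two matrices of a shortest element, the one with positive trace is taken, as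
  \<open>entries_bound\<close> and \<open>chebU_ge\<close> require.\<close>

definition minimal_at :: "mat2 \<Rightarrow> complex \<Rightarrow> bool" where
  "minimal_at T z \<longleftrightarrow> T \<in> \<Gamma>' \<and> mtr T \<ge> 2 \<and> (\<forall>B\<in>\<Gamma>'. mdisp T z \<le> mdisp B z)"

lemma hyp_dist_le_mdisp:
  assumes "M \<in> SL2" "Im z > 0"
  shows "hyp_dist z (act M z) \<le> 2 * mdisp M z"
  using le_sinh[of "hyp_dist z (act M z) / 2"] sinh_half_displacement[OF assms] assms by simp

lemma exists_minimal:
  assumes z: "Im z > 0" and M: "M \<in> \<Gamma>'" "mdisp M z < f1"
  shows "\<exists>T. minimal_at T z \<and> mdisp T z < f1"
proof -
  let ?S = "{M \<in> \<Gamma>'. mdisp M z < f1}"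
  have "?S \<subseteq> {M \<in> \<Gamma>. hyp_dist z (act M z) \<le> 1}"
  proof
    fix M assume M: "M \<in> ?S"
    then have "hyp_dist z (act M z) \<le> 2 * mdisp M z" using z \<Gamma>'_SL2 by (intro hyp_dist_le_mdisp) auto
    then show "M \<in> {M \<in> \<Gamma>. hyp_dist z (act M z) \<le> 1}" using M \<Gamma>'_\<Gamma> by auto
  qed
  then have fin: "finite ?S" using \<Gamma>_discrete[OF z] finite_subset by blast
  have "?S \<noteq> {}" using M by blast
  then obtain T where T: "T \<in> ?S" "\<And>B. B \<in> ?S \<Longrightarrow> mdisp T z \<le> mdisp B z"
    using ex_min_if_finite[of "(\<lambda>M. mdisp M z) ` ?S"] fin by (force simp: not_less)
  have min: "mdisp T z \<le> mdisp B z" if "B \<in> \<Gamma>'" for B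
    using T that by (cases "mdisp B z < f1") auto
  show ?thesis
  proof (cases "mtr T \<ge> 2")
    case True
    then show ?thesis using T min by (auto simp: minimal_at_def)
  next
    case False
    then have "mtr (mneg T) \<ge> 2" using \<Gamma>'_trace[of T] T by (auto simp: mtr_def mneg_def)
    then show ?thesis using T min \<Gamma>'_mneg[of T] by (auto simp: minimal_at_def intro!: exI[of _ "mneg T"])
  qed
qed

text \<open>The commutator moves \<open>z\<close> less than \<open>T\<close>, so by minimality it is
  plus or minus the identity. The negative sign would make \<open>B\<close> the negative of one of
  its conjugates, against its positive trace.\<close>

lemma minimal_commute:
  assumes z: "Im z > 0" and T: "minimal_at T z" "mdisp T z \<le> f1" and B: "B \<in> \<Gamma>'" "mdisp B z \<le> f1"
  shows "T \<odot> B = B \<odot> T"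
proof -
  have T': "T \<in> \<Gamma>'" "mtr T \<ge> 2" "T \<in> SL2" using T \<Gamma>'_SL2 by (auto simp: minimal_at_def)
  have *: "T \<odot> B = B \<odot> T" if B: "B \<in> \<Gamma>'" "mdisp B z \<le> f1" "mtr B \<ge> 2" for B
  proof -
    have BS: "B \<in> SL2" using B \<Gamma>'_SL2 by simp
    have "mdisp (comm T B) z \<le> mdisp T z / 4" by (rule comm_mdisp) (use T T' B BS z in auto)
    then have "mdisp (comm T B) z < mdisp T z" using \<Gamma>'_mdisp_pos[OF T'(1) z] by linarith
    then have "comm T B \<notin> \<Gamma>'" using T by (auto simp: minimal_at_def)
    moreover have "comm T B \<in> \<Gamma>" unfolding comm_def using T' B \<Gamma>'_\<Gamma> by simp
    ultimately have "comm T B = mid \<or> comm T B = mneg mid" by (auto simp: \<Gamma>'_def)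
    then have "comm T B \<odot> (B \<odot> T) = B \<odot> T \<or> comm T B \<odot> (B \<odot> T) = mneg (B \<odot> T)" by auto
    moreover have "comm T B \<odot> (B \<odot> T) = T \<odot> B" unfolding comm_def using T' BS by (simp add: mmul_assoc)
    ultimately have "T \<odot> B = B \<odot> T \<or> T \<odot> B = mneg (B \<odot> T)" by simp
    moreover have "T \<odot> B \<noteq> mneg (B \<odot> T)"
    proof
      assume "T \<odot> B = mneg (B \<odot> T)"
      then have "madj T \<odot> (T \<odot> B) = madj T \<odot> mneg (B \<odot> T)" by simp
      then have "B = mneg (mconj T B)" using T' by (simp add: mconj_def mmul_assoc)
      then have "mtr B = - mtr (mconj T B)" by (metis mtr_def mneg_def mat2.sel(1,4) minus_add_distrib)
      then show False using T' B by simp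
    qed
    ultimately show ?thesis by blast
  qed
  show ?thesis
  proof (cases "mtr B \<ge> 2")
    case True
    then show ?thesis using * B by blast
  next
    case False
    then have "mtr (mneg B) \<ge> 2" using \<Gamma>'_trace[of B] B by (auto simp: mtr_def mneg_def)
    then have "T \<odot> mneg B = mneg B \<odot> T" using *[of "mneg B"] B \<Gamma>'_mneg[of B] by simp
    then have "mneg (T \<odot> B) = mneg (B \<odot> T)" by simp
    then show ?thesis by (metis mneg_mneg)
  qed
qed

definition thick :: "complex \<Rightarrow> bool" where
  "thick z \<longleftrightarrow> Im z > 0 \<and> (\<forall>M\<in>\<Gamma>'. f1 \<le> mdisp M z)"

text \<open>An element shorter than \<open>f1\<close> at the exit point would commute with
  \<open>T\<close>, so its displacement would be a constant multiple of that of \<open>T\<close>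
  with factor below 1, contradicting minimality of \<open>T\<close> at \<open>q\<close>.\<close>

lemma exit_thick:
  assumes q: "Im q > 0" and T: "minimal_at T q" "mdisp T q < f1"
  shows "\<exists>q'. thick q' \<and> mdisp T q' = f1 \<and> hyp_dist q q' \<le> ln (2 * f1 / mdisp T q)"
proof -
  have T': "T \<in> \<Gamma>'" "T \<in> SL2" "mtr T \<ge> 2" using T \<Gamma>'_SL2 by (auto simp: minimal_at_def)
  obtain q' where q': "Im q' > 0" "mdisp T q' = f1" "hyp_dist q q' \<le> ln (2 * f1 / mdisp T q)"
    using mdisp_exit[of T q f1] T' T q \<Gamma>'_mdisp_pos[OF T'(1) q] by auto
  have "f1 \<le> mdisp M q'" if MG: "M \<in> \<Gamma>'" for M
  proof (rule ccontr)
    assume "\<not> f1 \<le> mdisp M q'"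
    then obtain B where B: "minimal_at B q'" "mdisp B q' < f1" using exists_minimal[OF q'(1) MG] by auto
    have "B \<odot> T = T \<odot> B" by (rule minimal_commute[OF q'(1) B(1)]) (use T' B q' in auto)
    then obtain t where t: "\<And>z. Im z > 0 \<Longrightarrow> mdisp B z = \<bar>t\<bar> * mdisp T z"
      using commute_mdisp[of T B] T' by (auto simp: \<Gamma>'_def)
    have "\<bar>t\<bar> < 1" using t[OF q'(1)] q' B by simp
    then have "mdisp B q < mdisp T q" using t[OF q] \<Gamma>'_mdisp_pos[OF T'(1) q] by simp
    moreover have "B \<in> \<Gamma>'" using B by (simp add: minimal_at_def)
    ultimately show False using T by (force simp: minimal_at_def)
  qed
  then show ?thesis using q' unfolding thick_def by blast
qed

lemma thick_displacement:
  assumes "thick z" "M \<in> \<Gamma>'"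
  shows "2 * arsinh f1 \<le> hyp_dist z (act M z)"
proof -
  have "sinh (arsinh f1) \<le> sinh (hyp_dist z (act M z) / 2)"
    using assms \<Gamma>'_SL2 by (simp add: sinh_half_displacement thick_def)
  then show ?thesis by (simp only: sinh_real_le_iff)
qed

text \<open>Thick points are moved by at least 4 \<rho>. This makes \<open>\<pi>\<close> isometric,
  and not merely injective, on balls of radius \<rho>, as \<open>hyp_chart\<close> demands.\<close>

definition \<rho> :: real where "\<rho> = arsinh f1 / 2"

lemma \<rho>_pos: "\<rho> > 0"
proof -
  have "arsinh (0::real) < arsinh f1" by (subst sinh_real_less_iff[symmetric]) simp
  then show ?thesis by (simp add: \<rho>_def)
qed

lemma thick_isometric:
  assumes z: "thick z" and uv: "u \<in> hball z \<rho>" "v \<in> hball z \<rho>"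
  shows "dist (\<pi> u) (\<pi> v) = hyp_dist u v"
proof (rule antisym)
  have Im: "Im z > 0" "Im u > 0" "Im v > 0" using z uv by (auto simp: thick_def hball_def)
  show "dist (\<pi> u) (\<pi> v) \<le> hyp_dist u v" using Im by (intro dist_pi_le)
  show "hyp_dist u v \<le> dist (\<pi> u) (\<pi> v)"
  proof (rule dist_pi_ge[OF Im(2,3)])
    fix M assume M: "M \<in> \<Gamma>"
    show "hyp_dist u v \<le> hyp_dist u (act M v)"
    proof (cases "M \<in> \<Gamma>'")
      case False
      then have "M = mid \<or> M = mneg mid" using M by (auto simp: \<Gamma>'_def)
      then show ?thesis by auto
    next
      case True
      have d: "hyp_dist z u < \<rho>" "hyp_dist z v < \<rho>" using uv by (auto simp: hball_def)
      have "hyp_dist z (act M z) \<le> hyp_dist z u + hyp_dist u (act M z)" using Im M by (intro hyp_dist_triangle) auto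
      also have "hyp_dist u (act M z) \<le> hyp_dist u (act M v) + hyp_dist (act M v) (act M z)" using Im M by (intro hyp_dist_triangle) auto
      also have "hyp_dist (act M v) (act M z) = hyp_dist z v" using Im M by (simp add: hyp_dist_commute)
      finally have "2 * \<rho> \<le> hyp_dist u (act M v)" using d thick_displacement[OF z True] by (simp add: \<rho>_def)
      moreover have "hyp_dist u v \<le> hyp_dist u z + hyp_dist z v" using Im by (intro hyp_dist_triangle) auto
      ultimately show ?thesis using d by (simp add: hyp_dist_commute)
    qed
  qed
qed

lemma thick_chart:
  assumes z: "thick z"
  shows "hyp_chart X (\<pi> ` hball z \<rho>) (inv_into (hball z \<rho>) \<pi>)"
    and "inv_into (hball z \<rho>) \<pi> ` (\<pi> ` hball z \<rho>) = hball z \<rho>"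
proof -
  have Imz: "Im z > 0" using z by (simp add: thick_def)
  have inj: "inj_on \<pi> (hball z \<rho>)"
  proof (rule inj_onI)
    fix u v assume uv: "u \<in> hball z \<rho>" "v \<in> hball z \<rho>" "\<pi> u = \<pi> v"
    then have "hyp_dist u v = 0" using thick_isometric[OF z uv(1,2)] by simp
    then show "u = v" using uv by (auto simp: hball_def)
  qed
  show im: "inv_into (hball z \<rho>) \<pi> ` (\<pi> ` hball z \<rho>) = hball z \<rho>"
    using inj by (simp add: image_image)
  show "hyp_chart X (\<pi> ` hball z \<rho>) (inv_into (hball z \<rho>) \<pi>)"
    unfolding hyp_chart_def im
  proof (intro conjI ballI)
    show "openin (top_of_set X) (\<pi> ` hball z \<rho>)" using Imz by (intro openin_pi_image hball_upper) simp
    show "open (hball z \<rho>)" using Imz by simp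
    show "hball z \<rho> \<subseteq> upper_half_plane" using hball_upper by (simp add: upper_half_plane_def)
    fix x y assume "x \<in> \<pi> ` hball z \<rho>" "y \<in> \<pi> ` hball z \<rho>"
    then obtain u v where uv: "u \<in> hball z \<rho>" "v \<in> hball z \<rho>" "x = \<pi> u" "y = \<pi> v" by blast
    then show "hyp_dist (inv_into (hball z \<rho>) \<pi> x) (inv_into (hball z \<rho>) \<pi> y) = dist x y"
      using inj thick_isometric[OF z uv(1,2)] by simp
  qed
qed

definition near :: "complex \<Rightarrow> real \<Rightarrow> bool" where
  "near z t \<longleftrightarrow> (\<exists>g\<in>\<Gamma>. hyp_dist z (act g \<i>) \<le> t)"

text \<open>Otherwise there are infinitely many disjoint embedded disks of the same radius.\<close>

lemma thick_bounded: "\<exists>R\<ge>0. \<forall>z. thick z \<longrightarrow> near z R"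
proof (rule ccontr)
  assume "\<not> ?thesis"
  then have "\<forall>R. \<exists>z. thick z \<and> \<not> near z (max R 0)" by (metis max.cobounded2)
  then obtain h where h: "\<And>R. thick (h R)" "\<And>R. \<not> near (h R) (max R 0)" by metis
  \<comment> \<open>The sequence \<open>r\<close> dominates the distance from each earlier centre to
    \<open>\<i>\<close> plus 2 \<rho>. If a later disk met an earlier one, its centre would be
    within that distance of the orbit.\<close>
  define r where "r = rec_nat 0 (\<lambda>_ x. max x (hyp_dist (h x) \<i> + 2 * \<rho>))"
  have r: "r 0 = 0" "r (Suc n) = max (r n) (hyp_dist (h (r n)) \<i> + 2 * \<rho>)" for n by (simp_all add: r_def)
  have r_mono: "r m \<le> r n" if "m \<le> n" for m n using that by (rule lift_Suc_mono_le[rotated]) (simp add: r)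
  define z where "z = (\<lambda>n. h (r n))"
  have zt: "thick (z n)" for n by (simp add: z_def h)
  then have Imz: "Im (z n) > 0" for n by (simp add: thick_def)
  define U where "U = (\<lambda>n. \<pi> ` hball (z n) \<rho>)"
  have disj1: "U m \<inter> U n = {}" if "m < n" for m n
  proof (rule ccontr)
    assume "U m \<inter> U n \<noteq> {}"
    then obtain u v where uv: "u \<in> hball (z m) \<rho>" "v \<in> hball (z n) \<rho>" "\<pi> u = \<pi> v" unfolding U_def by auto
    then have Im: "Im u > 0" "Im v > 0" using hball_Im by auto
    obtain M where M: "M \<in> \<Gamma>" "act M u = v" using pi_eqE[OF Im uv(3)] by blast
    have "hyp_dist (z n) (act M \<i>) \<le> hyp_dist (z n) v + hyp_dist v (act M \<i>)"
      using Im Imz M by (intro hyp_dist_triangle) auto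
    also have "hyp_dist v (act M \<i>) \<le> hyp_dist v (act M (z m)) + hyp_dist (act M (z m)) (act M \<i>)"
      using Im Imz M by (intro hyp_dist_triangle) auto
    also have "hyp_dist v (act M (z m)) = hyp_dist u (z m)" using M Im Imz by (simp flip: M(2))
    also have "hyp_dist (act M (z m)) (act M \<i>) = hyp_dist (z m) \<i>" using M Imz by simp
    finally have "hyp_dist (z n) (act M \<i>) \<le> hyp_dist (z m) \<i> + 2 * \<rho>"
      using uv by (auto simp: hball_def hyp_dist_commute)
    also have "\<dots> \<le> r (Suc m)" by (simp add: r z_def)
    also have "\<dots> \<le> r n" using that by (intro r_mono) simp
    finally have "near (z n) (max (r n) 0)" using M(1) unfolding near_def by (intro bexI[of _ M]) auto
    then show False using h by (simp add: z_def)
  qed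
  have disj: "disjoint_family_on U {..<n}" for n
    using disj1 unfolding disjoint_family_on_def by (metis inf_commute linorder_neqE_nat)
  obtain \<mu> where \<mu>: "is_area_measure X \<mu>" "emeasure \<mu> X < \<infinity>" using finite_area by (auto simp: finite_area_def)
  define a where "a = unit_ball_vol 2 * (sinh \<rho>)\<^sup>2 * exp (- 2 * \<rho>)"
  have a: "a > 0" unfolding a_def using \<rho>_pos unit_ball_vol_pos[of 2] by simp
  have sets: "U n \<in> sets \<mu>" for n
  proof -
    have "openin (top_of_set X) (U n)" using openin_pi_image[OF open_hball hball_upper] Imz by (simp add: U_def)
    then obtain V where "open V" "U n = X \<inter> V" by (auto simp: openin_open)
    then show ?thesis using \<mu>(1) by (auto simp: is_area_measure_def sets_restrict_space)
  qed
  have ge: "ennreal a \<le> emeasure \<mu> (U n)" for n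
  proof -
    have "emeasure \<mu> (U n) = emeasure hyp_area (hball (z n) \<rho>)"
      using \<mu>(1) thick_chart[OF zt[of n]] sets[of n] unfolding is_area_measure_def U_def by (metis order_refl)
    then show ?thesis using hyp_area_hball[OF Imz \<rho>_pos] by (simp add: a_def)
  qed
  have sp: "space \<mu> = X" using \<mu>(1) sets_eq_imp_space_eq[of \<mu> "restrict_space borel X"]
    by (simp add: is_area_measure_def space_restrict_space)
  have bound: "ennreal (real n * a) \<le> emeasure \<mu> X" for n
  proof -
    have "ennreal (real n * a) = (\<Sum>i<n. ennreal a)" using a by (simp add: ennreal_mult ennreal_of_nat_eq_real_of_nat)
    also have "\<dots> \<le> (\<Sum>i<n. emeasure \<mu> (U i))" by (intro sum_mono ge)
    also have "\<dots> = emeasure \<mu> (\<Union>i<n. U i)" using sets disj by (intro sum_emeasure) auto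
    also have "\<dots> \<le> emeasure \<mu> X" using emeasure_space[of \<mu>] sp by simp
    finally show ?thesis .
  qed
  obtain m where m: "emeasure \<mu> X = ennreal m" "m \<ge> 0" using \<mu>(2) by (cases "emeasure \<mu> X") auto
  obtain n :: nat where "real n > m / a" using reals_Archimedean2 by blast
  then have "m < real n * a" using a by (simp add: field_simps)
  moreover have "real n * a \<le> m" using bound[of n] m by (simp add: ennreal_le_iff)
  ultimately show False by simp
qed

text \<open>A common form of the dichotomy for the distance estimate in
  \<open>truncated_near\<close> and for the choice of orbit points. That \<open>T\<close> has
  displacement exactly \<open>f1\<close> at \<open>q'\<close> fixes the scale on which
  \<open>q\<close> and \<open>q'\<close> are compared.\<close>

lemma thick_or_thin:
  obtains R where "R \<ge> 0" and "\<And>z. Im z > 0 \<Longrightarrow> near z R \<or>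
    (\<exists>T q'. minimal_at T z \<and> mdisp T z < f1 \<and> Im q' > 0 \<and> mdisp T q' = f1 \<and>
       hyp_dist z q' \<le> ln (2 * f1 / mdisp T z) \<and> near q' R)"
proof -
  obtain R where R: "R \<ge> 0" "\<And>z. thick z \<Longrightarrow> near z R" using thick_bounded by blast
  show ?thesis
  proof (rule that[OF R(1)])
    fix z assume z: "Im z > 0"
    show "near z R \<or> (\<exists>T q'. minimal_at T z \<and> mdisp T z < f1 \<and> Im q' > 0 \<and> mdisp T q' = f1 \<and>
       hyp_dist z q' \<le> ln (2 * f1 / mdisp T z) \<and> near q' R)"
    proof (cases "thick z")
      case True
      then show ?thesis using R by blast
    next
      case False
      then obtain M where "M \<in> \<Gamma>'" "mdisp M z < f1" using z by (auto simp: thick_def not_le)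
      then obtain T where T: "minimal_at T z" "mdisp T z < f1" using exists_minimal[OF z] by blast
      obtain q' where "thick q'" "mdisp T q' = f1" "hyp_dist z q' \<le> ln (2 * f1 / mdisp T z)" using exit_thick[OF z T] by blast
      then show ?thesis using T R(2) unfolding thick_def by blast
    qed
  qed
qed

end

section \<open>Cusps\<close>

lemma hyp_dist_scale:
  assumes "s > 0" "Im z > 0" "Im w > 0"
  shows "hyp_dist (of_real s * z) (of_real s * w) = hyp_dist z w"
proof -
  have "of_real s * z - of_real s * w = of_real s * (z - w)" by (simp add: algebra_simps)
  then have "cmod (of_real s * z - of_real s * w) = s * cmod (z - w)" using assms by (simp only: norm_mult norm_of_real abs_of_pos)
  then show ?thesis unfolding hyp_dist_def using assms by (simp add: power_mult_distrib power2_eq_square mult.assoc)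
qed

definition transl :: "real \<Rightarrow> mat2" where "transl t = Mat 1 t 0 1"

lemma act_transl [simp]: "act (transl t) z = z + of_real t" by (simp add: transl_def act_def)

lemma transl_mmul [simp]: "transl s \<odot> transl t = transl (s + t)" by (simp add: transl_def mmul_def add.commute)

lemma madj_transl [simp]: "madj (transl t) = transl (- t)" by (simp add: transl_def madj_def)

lemma transl_0 [simp]: "transl 0 = mid" by (simp add: transl_def mid_def)

lemma mdisp_transl: "mdisp (transl t) z = \<bar>t\<bar> / (2 * Im z)"
  by (simp add: mdisp_def transl_def)

text \<open>The double fixed point is moved to infinity, and a dilation normalises the resulting
  translation. Its sign remains, since the translations by 1 and -1 are not conjugate in
  SL(2,R).\<close>

lemma parabolic_normal_form:
  assumes T: "T \<in> SL2" "mtr T = 2" "T \<noteq> mid"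
  shows "\<exists>P\<in>SL2. mconj P T = transl 1 \<or> mconj P T = transl (-1)"
proof -
  have det: "ma T * md T - mb T * mc T = 1" and tr: "ma T + md T = 2" using T by (auto simp: SL2_def mtr_def)
  have "\<exists>P\<in>SL2. \<exists>b. mconj P T = transl b"
  proof (cases "mc T = 0")
    case True
    have "md T = 2 - ma T" using tr by simp
    then have "ma T * (2 - ma T) = 1" using det True by simp
    then have "(ma T - 1)\<^sup>2 = 0" by (simp add: power2_eq_square algebra_simps)
    then have "ma T = 1" by simp
    then have "mconj mid T = transl (mb T)" using True tr by (cases T) (simp add: mconj_def madj_def mid_def mmul_def transl_def)
    then show ?thesis by (intro bexI[of _ mid] exI) auto
  next
    case c: False
    \<comment> \<open>The double root of the fixed point polynomial; \<open>?P\<close> sends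
      infinity to it.\<close>
    define x where "x = (ma T - md T) / (2 * mc T)"
    let ?P = "Mat x (-1) 1 0"
    have P: "?P \<in> SL2" by (simp add: SL2_def)
    have cx: "mc T * x = (ma T - md T) / 2" using c by (simp add: x_def)
    then have e1: "mc T * x + md T = 1" "ma T - x * mc T = 1" using tr by (simp_all add: field_simps)
    have "4 * mc T * (mc T * x * x + (md T - ma T) * x - mb T) = 4 * (mc T * x) * (mc T * x) + 4 * (md T - ma T) * (mc T * x) - 4 * mb T * mc T"
      by (simp add: algebra_simps)
    also have "\<dots> = - ((ma T + md T)\<^sup>2 - 4 * (ma T * md T - mb T * mc T))" unfolding cx by (simp add: power2_eq_square field_simps)
    also have "\<dots> = 0" using det tr by simp
    finally have e2: "mc T * x * x + (md T - ma T) * x - mb T = 0" using c by simp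
    have "mconj ?P T = transl (- mc T)"
      using e1 e2 by (simp add: mconj_def madj_def mmul_def transl_def algebra_simps)
    then show ?thesis using P by blast
  qed
  then obtain P b where P: "P \<in> SL2" "mconj P T = transl b" by blast
  have b: "b \<noteq> 0"
  proof
    assume "b = 0"
    then have "P \<odot> mconj P T \<odot> madj P = mid" using P by simp
    then show False using T P by (simp add: mconj_def mmul_assoc)
  qed
  define s where "s = sqrt \<bar>b\<bar>"
  have s: "s > 0" "s * s = \<bar>b\<bar>" using b by (simp_all add: s_def)
  let ?D = "Mat s 0 0 (1 / s)"
  have D: "?D \<in> SL2" using s by (simp add: SL2_def)
  have "mconj ?D (transl b) = transl (b / (s * s))" using s(1) by (simp add: mconj_def madj_def mmul_def transl_def)
  then have "mconj (P \<odot> ?D) T = transl (sgn b)" using P D b s by (simp flip: mconj_mconj) (simp add: sgn_if abs_if)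
  then show ?thesis using P D b by (intro bexI[of _ "P \<odot> ?D"]) (auto simp: sgn_if split: if_splits)
qed

context finite_area_covering
begin

text \<open>The stabiliser of the cusp is generated by the unit translation, and all other elements have
  lower left entry at least 4 in absolute value, because no product with a translation is elliptic.\<close>

lemma cusp_elements:
  assumes P: "P \<in> SL2" and T: "T \<in> \<Gamma>" "mconj P T = transl 1"
    and no_short: "\<forall>M\<in>\<Gamma>. \<forall>t. mconj P M = transl t \<longrightarrow> \<not> (0 < t \<and> t < 1)"
  shows "\<exists>M\<in>\<Gamma>. mconj P M = transl (of_int k)"
    and "M \<in> \<Gamma> \<Longrightarrow> Im z \<ge> 1 \<Longrightarrow> Im (act (mconj P M) z) \<ge> 1 \<Longrightarrow> \<exists>k::int. act (mconj P M) z = z + of_int k"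
proof -
  have ns: False if "M \<in> \<Gamma>" "mconj P M = transl t" "0 < t" "t < 1" for M t using no_short that by blast
  have int_nat: "\<exists>M\<in>\<Gamma>. mconj P M = transl (of_nat n)" for n
  proof (induction n)
    case 0
    then show ?case using P by (intro bexI[of _ mid]) (simp_all add: mconj_def)
  next
    case (Suc n)
    then obtain M where "M \<in> \<Gamma>" "mconj P M = transl (of_nat n)" by blast
    then show ?case using P T by (intro bexI[of _ "T \<odot> M"]) (simp_all add: mconj_mmul)
  qed
  have int: "\<exists>M\<in>\<Gamma>. mconj P M = transl (of_int k)" for k :: int
  proof (cases "k \<ge> 0")
    case True
    then show ?thesis using int_nat[of "nat k"] by simp
  next
    case False
    then obtain M where "M \<in> \<Gamma>" "mconj P M = transl (of_nat (nat (- k)))" using int_nat by blast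
    then show ?thesis using False P by (intro bexI[of _ "madj M"]) (simp_all add: mconj_madj)
  qed
  then show "\<exists>M\<in>\<Gamma>. mconj P M = transl (of_int k)" .
  have t_int: "\<exists>k::int. t = of_int k" if M: "M \<in> \<Gamma>" "mconj P M = transl t" for M t
  proof -
    obtain N where N: "N \<in> \<Gamma>" "mconj P N = transl (of_int (- \<lfloor>t\<rfloor>))" using int by blast
    have "mconj P (N \<odot> M) = transl (t - of_int \<lfloor>t\<rfloor>)" using P M N by (simp add: mconj_mmul)
    then have "\<not> (0 < t - of_int \<lfloor>t\<rfloor>)" using ns[of "N \<odot> M" "t - of_int \<lfloor>t\<rfloor>"] M N by auto linarith
    moreover have "of_int \<lfloor>t\<rfloor> \<le> t" by simp
    ultimately have "t = of_int \<lfloor>t\<rfloor>" by linarith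
    then show ?thesis by blast
  qed
  assume M: "M \<in> \<Gamma>" and z: "Im z \<ge> 1" "Im (act (mconj P M) z) \<ge> 1"
  define N where "N = mconj P M"
  have N: "N \<in> SL2" using P M by (simp add: N_def)
  have det: "ma N * md N - mb N * mc N = 1" using N by (simp add: SL2_def)
  have c: "mc N = 0"
  proof (rule ccontr)
    assume c: "mc N \<noteq> 0"
    have tr: "\<bar>mtr N + of_int k * mc N\<bar> \<ge> 2" for k :: int
    proof -
      obtain S where S: "S \<in> \<Gamma>" "mconj P S = transl (of_int k)" using int by blast
      have e: "mconj P (S \<odot> M) = transl (of_int k) \<odot> N" using P S by (simp add: mconj_mmul N_def)
      have "mc (mconj P (S \<odot> M)) = mc N" unfolding e by (simp add: mmul_def transl_def)
      then have "S \<odot> M \<noteq> mid" "S \<odot> M \<noteq> mneg mid" using c P by (auto simp: mconj_def mid_def mneg_def madj_def mmul_def)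
      then have "\<bar>mtr (S \<odot> M)\<bar> \<ge> 2" using \<Gamma>_trace[of "S \<odot> M"] S M by simp
      moreover have "mtr (S \<odot> M) = mtr (mconj P (S \<odot> M))" using P by simp
      then have "mtr (S \<odot> M) = mtr N + of_int k * mc N" unfolding e by (simp add: mtr_def mmul_def transl_def)
      ultimately show ?thesis by simp
    qed
    \<comment> \<open>Rounding picks the member closest to 0 of the arithmetic progression of
      traces; it is at most |mc N| / 2 in absolute value. The resulting bound 4 on |mc N| pushes
      every point of height at least 1 below height 1.\<close>
    define k where "k = round (- mtr N / mc N)"
    have "\<bar>of_int k - (- mtr N / mc N)\<bar> \<le> 1 / 2" unfolding k_def by (rule of_int_round_abs_le)
    then have "\<bar>of_int k - (- mtr N / mc N)\<bar> * \<bar>mc N\<bar> \<le> 1 / 2 * \<bar>mc N\<bar>" by (rule mult_right_mono) simp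
    moreover have "(of_int k - (- mtr N / mc N)) * mc N = mtr N + of_int k * mc N" using c by (simp add: field_simps)
    ultimately have "\<bar>mtr N + of_int k * mc N\<bar> \<le> \<bar>mc N\<bar> / 2" by (metis abs_mult mult.commute times_divide_eq_right mult_1_right)
    then have c4: "\<bar>mc N\<bar> \<ge> 4" using tr[of k] by simp
    let ?D = "of_real (mc N) * z + complex_of_real (md N)"
    have "\<bar>mc N\<bar> * Im z \<le> cmod ?D"
      using abs_Im_le_cmod[of ?D] z by (simp add: abs_mult)
    moreover have "4 * Im z \<le> \<bar>mc N\<bar> * Im z" using c4 z by (intro mult_right_mono) auto
    ultimately have "4 * Im z \<le> cmod ?D" by linarith
    then have "(4 * Im z)\<^sup>2 \<le> (cmod ?D)\<^sup>2" using z by (intro power_mono) auto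
    moreover have "Im z < (4 * Im z)\<^sup>2"
    proof -
      have "Im z * 1 \<le> Im z * Im z" using z by (intro mult_left_mono) auto
      then show ?thesis using z by (simp add: power2_eq_square)
    qed
    ultimately have "Im z / (cmod ?D)\<^sup>2 < 1" using z by (subst divide_less_eq_1_pos) linarith+
    then show False using z(2) Im_act[OF N, of z] z by (simp add: N_def)
  qed
  then have ad: "ma N * md N = 1" using det by simp
  have a0: "ma N \<noteq> 0" using ad by auto
  have dN: "md N = 1 / ma N" using ad a0 by (simp add: field_simps)
  \<comment> \<open>Conjugating the unit translation by \<open>N\<close> or by its inverse
    multiplies it by the square of a diagonal entry; one of the two would be shorter than 1.\<close>
  have "\<bar>ma N\<bar> = 1"
  proof (rule ccontr)
    assume "\<bar>ma N\<bar> \<noteq> 1"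
    then consider "\<bar>ma N\<bar> < 1" | "\<bar>ma N\<bar> > 1" by linarith
    then show False
    proof cases
      case 1
      have "mconj P (M \<odot> T \<odot> madj M) = N \<odot> transl 1 \<odot> madj N" using P T by (simp add: mconj_mmul mconj_madj N_def)
      also have "\<dots> = transl (ma N * ma N)" using c ad by (simp add: mmul_def madj_def transl_def algebra_simps)
      finally have "mconj P (M \<odot> T \<odot> madj M) = transl (ma N * ma N)" .
      moreover have "0 < ma N * ma N" using a0 by (metis not_real_square_gt_zero)
      moreover have "ma N * ma N < 1" using 1 by (metis abs_mult_self_eq abs_square_less_1 power2_eq_square)
      ultimately show False using ns[of "M \<odot> T \<odot> madj M" "ma N * ma N"] M T by simp
    next
      case 2
      have "mconj P (madj M \<odot> T \<odot> M) = madj N \<odot> transl 1 \<odot> N" using P T by (simp add: mconj_mmul mconj_madj N_def)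
      also have "\<dots> = transl (md N * md N)" using c ad by (simp add: mmul_def madj_def transl_def algebra_simps)
      finally have "mconj P (madj M \<odot> T \<odot> M) = transl (md N * md N)" .
      moreover have "0 < md N * md N" using a0 dN by (metis not_real_square_gt_zero divide_eq_0_iff one_neq_zero)
      moreover have "\<bar>md N\<bar> < 1" using 2 dN by (simp add: abs_divide)
      then have "md N * md N < 1" by (metis abs_mult_self_eq abs_square_less_1 power2_eq_square)
      ultimately show False using ns[of "madj M \<odot> T \<odot> M" "md N * md N"] M T by simp
    qed
  qed
  then consider "ma N = 1" | "ma N = -1" by linarith
  then show "\<exists>k::int. act (mconj P M) z = z + of_int k"
  proof cases
    case 1
    then have e: "N = transl (mb N)" using c dN by (cases N) (simp add: transl_def)
    obtain k :: int where k: "mb N = of_int k" using t_int[OF M, of "mb N"] e by (auto simp: N_def)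
    have "act N z = z + of_real (mb N)" by (subst e) simp
    then show ?thesis using k unfolding N_def[symmetric] by (metis of_real_of_int_eq)
  next
    case 2
    then have e: "N = mneg (transl (- mb N))" using c dN by (cases N) (simp add: transl_def mneg_def)
    have "mconj P (mneg M) = mneg N" by (simp add: N_def mconj_def)
    also have "\<dots> = transl (- mb N)" by (metis e mneg_mneg)
    finally obtain k :: int where "- mb N = of_int k" using t_int[of "mneg M" "- mb N"] M by auto
    moreover have "act N z = z + of_real (- mb N)" by (subst e) simp
    ultimately show ?thesis unfolding N_def[symmetric] by (metis of_real_of_int_eq)
  qed
qed

text \<open>In the normalised picture the region of area \<xi> is the part above height 1 / \<xi>
  modulo the unit translation; multiplication by \<xi> brings it to the form of
  \<open>cusp_region\<close>. As \<xi> \<le> 1, it lies above height 1, where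
  \<open>cusp_elements\<close> determines the fibres.\<close>

lemma cusp_region_of_parabolic:
  assumes P: "P \<in> SL2" and T: "T \<in> \<Gamma>" "mconj P T = transl 1"
    and no_short: "\<forall>M\<in>\<Gamma>. \<forall>t. mconj P M = transl t \<longrightarrow> \<not> (0 < t \<and> t < 1)"
    and \<xi>: "0 < \<xi>" "\<xi> \<le> 1"
  shows "cusp_region X \<xi> ((\<lambda>z. \<pi> (act P (z / of_real \<xi>))) ` horoball)"
proof -
  define f where "f = (\<lambda>z. \<pi> (act P (z / of_real \<xi>)))"
  have Imz: "Im (z / of_real \<xi>) \<ge> 1" if "z \<in> horoball" for z
    using that \<xi> by (simp add: horoball_def field_simps)
  have Imz0: "Im (z / of_real \<xi>) > 0" if "z \<in> horoball" for z
    using Imz[OF that] by linarith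
  have fib: "f z = f w \<longleftrightarrow> (\<exists>k::int. w = z + of_real (of_int k * \<xi>))" if zw: "z \<in> horoball" "w \<in> horoball" for z w
  proof
    assume "f z = f w"
    then obtain M where M: "M \<in> \<Gamma>" "act M (act P (z / of_real \<xi>)) = act P (w / of_real \<xi>)"
      using pi_eqE[of "act P (z / of_real \<xi>)" "act P (w / of_real \<xi>)"] P Imz0 zw unfolding f_def by auto
    then have "act (mconj P M) (z / of_real \<xi>) = w / of_real \<xi>"
      using P Imz0[OF zw(1)] Imz0[OF zw(2)] by (simp add: mconj_def act_mmul mmul_assoc)
    then obtain k :: int where "w / of_real \<xi> = z / of_real \<xi> + of_int k"
      using cusp_elements(2)[OF P T no_short M(1) Imz[OF zw(1)]] Imz[OF zw(2)] by metis
    then have "w = z + of_real (of_int k * \<xi>)" using \<xi> by (simp add: field_simps)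
    then show "\<exists>k::int. w = z + of_real (of_int k * \<xi>)" ..
  next
    assume "\<exists>k::int. w = z + of_real (of_int k * \<xi>)"
    then obtain k :: int where "w = z + of_real (of_int k * \<xi>)" ..
    then have w: "w / of_real \<xi> = z / of_real \<xi> + of_real (of_int k)" using \<xi> by (simp add: field_simps)
    obtain M where M: "M \<in> \<Gamma>" "mconj P M = transl (of_int k)" using cusp_elements(1)[OF P T no_short] by blast
    have "w / of_real \<xi> = act (mconj P M) (z / of_real \<xi>)" unfolding w M by simp
    then have "act P (w / of_real \<xi>) = act M (act P (z / of_real \<xi>))"
      using P M(1) Imz0[OF zw(1)] by (simp add: mconj_def act_mmul mmul_assoc)
    then show "f z = f w" unfolding f_def using M(1) P Imz0[OF zw(1)] by simp
  qed
  have loc: "\<exists>r>0. \<forall>w\<in>horoball. \<forall>w'\<in>horoball. hyp_dist z w < r \<and> hyp_dist z w' < r \<longrightarrow> dist (f w) (f w') = hyp_dist w w'"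
    if z: "z \<in> horoball" for z
  proof -
    have sc: "hyp_dist (act P (u / of_real \<xi>)) (act P (v / of_real \<xi>)) = hyp_dist u v" if "u \<in> horoball" "v \<in> horoball" for u v
    proof -
      have "hyp_dist (act P (u / of_real \<xi>)) (act P (v / of_real \<xi>)) = hyp_dist (u / of_real \<xi>) (v / of_real \<xi>)"
        using P Imz0 that by (intro hyp_dist_act) auto
      also have "\<dots> = hyp_dist (of_real (1/\<xi>) * u) (of_real (1/\<xi>) * v)" by simp
      also have "\<dots> = hyp_dist u v" using \<xi> that by (intro hyp_dist_scale) (auto simp: horoball_def)
      finally show ?thesis .
    qed
    have Im: "Im (act P (z / of_real \<xi>)) > 0" using P Imz0[OF z] by simp
    obtain r where r: "r > 0" "\<forall>w\<in>hball (act P (z / of_real \<xi>)) r. \<forall>w'\<in>hball (act P (z / of_real \<xi>)) r. dist (\<pi> w) (\<pi> w') = hyp_dist w w'"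
      using pi_local[OF Im] by blast
    have "dist (f w) (f w') = hyp_dist w w'" if w: "w \<in> horoball" "w' \<in> horoball" "hyp_dist z w < r" "hyp_dist z w' < r" for w w'
    proof -
      have "act P (w / of_real \<xi>) \<in> hball (act P (z / of_real \<xi>)) r" "act P (w' / of_real \<xi>) \<in> hball (act P (z / of_real \<xi>)) r"
        using w P Imz0 sc z by (auto simp: hball_def)
      then show ?thesis unfolding f_def using r(2) sc w by simp
    qed
    then show ?thesis using r(1) by blast
  qed
  have "f ` horoball \<subseteq> X" unfolding f_def using pi_in P Imz0 by auto
  then show ?thesis unfolding cusp_region_def f_def[symmetric] using fib loc by (intro conjI exI[of _ f]) auto
qed

text \<open>The displacement of \<open>T\<close> is 1 / (2 Im z0) for the normalised lift
  \<open>z0\<close>. A value below \<xi> / 2 puts \<open>z0\<close> strictly above height 1 / \<xi>,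
  in the interior of a cusp region. Minimality of \<open>T\<close> excludes shorter translations of
  the same cusp.\<close>

lemma parabolic_not_truncated:
  assumes q: "Im q > 0" and T: "minimal_at T q" "mtr T = 2" and \<xi>: "0 < \<xi>" "\<xi> \<le> 1" and small: "mdisp T q < \<xi> / 2"
  shows "\<pi> q \<notin> truncated X \<xi>"
proof -
  have T': "T \<in> \<Gamma>'" "T \<in> SL2" "T \<noteq> mid" using T \<Gamma>'_SL2 by (auto simp: minimal_at_def \<Gamma>'_def)
  obtain P where P: "P \<in> SL2" "mconj P T = transl 1 \<or> mconj P T = transl (-1)"
    using parabolic_normal_form[OF T'(2) T(2) T'(3)] by blast
  define z0 where "z0 = act (madj P) q"
  have z0: "Im z0 > 0" "act P z0 = q" using P q by (auto simp: z0_def)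
  have disp: "mdisp (mconj P M) z0 = mdisp M q" if "M \<in> SL2" for M
    using mdisp_mconj[OF P(1) that z0(1)] z0 by simp
  have Tq: "mdisp T q = 1 / (2 * Im z0)" using disp[OF T'(2)] P(2) by (auto simp: mdisp_transl)
  obtain S where S: "S \<in> \<Gamma>" "mconj P S = transl 1"
  proof (cases "mconj P T = transl 1")
    case True
    then show ?thesis using that \<Gamma>'_\<Gamma>[OF T'(1)] by blast
  next
    case False
    then have "mconj P (madj T) = transl 1" using P by (simp add: mconj_madj)
    then show ?thesis using that[of "madj T"] \<Gamma>'_\<Gamma>[OF T'(1)] by simp
  qed
  have False if M: "M \<in> \<Gamma>" "mconj P M = transl t" "0 < t" "t < 1" for M t
  proof -
    have "M \<noteq> mid" "M \<noteq> mneg mid" using M P by (auto simp: mconj_def transl_def mid_def mneg_def madj_def mmul_def SL2_def algebra_simps)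
    then have "M \<in> \<Gamma>'" using M by (simp add: \<Gamma>'_def)
    then have "mdisp T q \<le> mdisp M q" using T by (simp add: minimal_at_def)
    also have "mdisp M q = t / (2 * Im z0)" using disp[of M] M by (simp add: mdisp_transl)
    also have "\<dots> < 1 / (2 * Im z0)" using M z0 by (intro divide_strict_right_mono) auto
    finally show False using Tq by simp
  qed
  then have no_short: "\<forall>M\<in>\<Gamma>. \<forall>t. mconj P M = transl t \<longrightarrow> \<not> (0 < t \<and> t < 1)" by blast
  define C where "C = (\<lambda>z. \<pi> (act P (z / of_real \<xi>))) ` horoball"
  have C: "cusp_region X \<xi> C" unfolding C_def by (rule cusp_region_of_parabolic[OF P(1) S no_short \<xi>])
  define S' where "S' = {w. Im w > 1 / \<xi>}"
  have S'pos: "Im w > 0" if "w \<in> S'" for w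
  proof -
    have "0 < 1 / \<xi>" using \<xi> by simp
    also have "\<dots> < Im w" using that by (simp add: S'_def)
    finally show ?thesis .
  qed
  have "openin (top_of_set X) ((\<lambda>z. \<pi> (act P z)) ` S')"
  proof -
    have "open (act P ` S')"
    proof (subst open_iff_hball)
      show "act P ` S' \<subseteq> {z. Im z > 0}" using S'pos P by auto
      show "\<forall>z\<in>act P ` S'. \<exists>r>0. hball z r \<subseteq> act P ` S'"
      proof
        fix z assume "z \<in> act P ` S'"
        then obtain w where w: "w \<in> S'" "z = act P w" by blast
        have "open S'" by (simp add: S'_def open_halfspace_Im_gt)
        then obtain r where r: "r > 0" "hball w r \<subseteq> S'" using exists_hball_subset[OF _ w(1) S'pos[OF w(1)]] by blast
        have "hball z r \<subseteq> act P ` S'"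
        proof
          fix v assume v: "v \<in> hball z r"
          then have "act (madj P) v \<in> hball (act (madj P) z) r" using act_hball[of "madj P" z v r] P w S'pos by simp
          then have "act (madj P) v \<in> S'" using r w P S'pos[OF w(1)] by auto
          moreover have "v = act P (act (madj P) v)" using P hball_Im[OF v] by simp
          ultimately show "v \<in> act P ` S'" by blast
        qed
        then show "\<exists>r>0. hball z r \<subseteq> act P ` S'" using r by blast
      qed
    qed
    then have "openin (top_of_set X) (\<pi> ` (act P ` S'))" using S'pos P by (intro openin_pi_image) auto
    then show ?thesis by (simp add: image_image)
  qed
  moreover have "Im z0 > 1 / \<xi>" using small Tq z0 \<xi> by (simp add: field_simps)
  then have "\<pi> q \<in> (\<lambda>z. \<pi> (act P z)) ` S'" using z0 by (intro image_eqI[of _ _ z0]) (auto simp: S'_def)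
  ultimately obtain e where e: "e > 0" "\<forall>y\<in>X. dist (\<pi> q) y < e \<longrightarrow> y \<in> (\<lambda>z. \<pi> (act P z)) ` S'"
    using openin_dist by blast
  have sub: "(\<lambda>z. \<pi> (act P z)) ` S' \<subseteq> C"
  proof
    fix y assume "y \<in> (\<lambda>z. \<pi> (act P z)) ` S'"
    then obtain w where w: "w \<in> S'" "y = \<pi> (act P w)" by blast
    have "of_real \<xi> * w \<in> horoball" using w \<xi> by (simp add: S'_def horoball_def field_simps)
    then show "y \<in> C" unfolding C_def w using \<xi> by (intro image_eqI[of _ _ "of_real \<xi> * w"]) auto
  qed
  show ?thesis
  proof
    assume "\<pi> q \<in> truncated X \<xi>"
    then have "\<pi> q \<in> closure (X - \<Union>{C. cusp_region X \<xi> C})" by (simp add: truncated_def)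
    then obtain y where y: "y \<in> X - \<Union>{C. cusp_region X \<xi> C}" "dist y (\<pi> q) < e"
      using e(1) unfolding closure_approachable by blast
    then have "y \<in> C" using e sub by (auto simp: dist_commute)
    then show False using y C by blast
  qed
qed

end

section \<open>Gromov products\<close>

text \<open>The Gromov product of \<open>x\<close> and \<open>y\<close> with base point
  \<open>w\<close>, the last argument: roughly the length along which the geodesics from
  \<open>w\<close> to \<open>x\<close> and to \<open>y\<close> run together. A bounded value says
  that a path from \<open>x\<close> through \<open>w\<close> to \<open>y\<close> hardly backtracks
  at \<open>w\<close>.\<close>

definition gp :: "complex \<Rightarrow> complex \<Rightarrow> complex \<Rightarrow> real" where
  "gp x y w = (hyp_dist x w + hyp_dist y w - hyp_dist x y) / 2"

lemma gp_commute: "gp x y w = gp y x w" by (simp add: gp_def hyp_dist_commute)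

lemma gp_le:
  assumes "Im x > 0" "Im y > 0" "Im w > 0"
  shows "gp x y w \<le> hyp_dist y w"
  using hyp_dist_triangle[OF assms] unfolding gp_def by argo

text \<open>The four-point inequality, halved. Typical use: if \<open>y\<close> and \<open>z\<close>
  share a long stretch seen from \<open>w\<close>, then a point that separates early from
  \<open>y\<close> also separates early from \<open>z\<close>.\<close>

lemma gp_hyperbolic:
  assumes "Im x > 0" "Im y > 0" "Im z > 0" "Im w > 0"
  shows "gp x z w \<le> gp x y w + 2 \<or> gp y z w \<le> gp x y w + 2"
proof -
  have "hyp_dist x y + hyp_dist z w \<le> max (hyp_dist x z + hyp_dist y w) (hyp_dist x w + hyp_dist y z) + 4"
    using assms by (rule hyp_dist_four_point)
  then show ?thesis unfolding gp_def max_def by argo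
qed

lemma gp_act: "M \<in> SL2 \<Longrightarrow> Im x > 0 \<Longrightarrow> Im y > 0 \<Longrightarrow> Im w > 0 \<Longrightarrow> gp (act M x) (act M y) (act M w) = gp x y w"
  by (simp add: gp_def)

section \<open>Distance to the orbit, and orbit points in prescribed directions\<close>

context finite_area_covering
begin

lemma near_mono: "near z s \<Longrightarrow> s \<le> t \<Longrightarrow> near z t"
  unfolding near_def by force

lemma near_triangle:
  assumes "near z s" "Im z > 0" "Im w > 0"
  shows "near w (hyp_dist w z + s)"
proof -
  obtain g where g: "g \<in> \<Gamma>" "hyp_dist z (act g \<i>) \<le> s" using assms by (auto simp: near_def)
  have "hyp_dist w (act g \<i>) \<le> hyp_dist w z + hyp_dist z (act g \<i>)" using assms g by (intro hyp_dist_triangle) auto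
  then show ?thesis using g unfolding near_def by force
qed

lemma near_nonneg: "near z s \<Longrightarrow> Im z > 0 \<Longrightarrow> 0 \<le> s"
  unfolding near_def by (metis \<Gamma>_SL2 Im_act_pos dual_order.trans hyp_dist_nonneg imaginary_unit.sel(2) zero_less_one)

lemma mdisp_le_hyp_dist_i:
  assumes "M \<in> SL2" "Im z > 0"
  shows "hyp_dist \<i> (act M \<i>) \<le> 2 * hyp_dist z \<i> + 2 * mdisp M z"
proof -
  have "hyp_dist \<i> (act M \<i>) \<le> hyp_dist \<i> z + hyp_dist z (act M \<i>)" using assms by (intro hyp_dist_triangle) auto
  also have "hyp_dist z (act M \<i>) \<le> hyp_dist z (act M z) + hyp_dist (act M z) (act M \<i>)" using assms by (intro hyp_dist_triangle) auto
  finally show ?thesis using assms hyp_dist_le_mdisp[OF assms] by (simp add: hyp_dist_commute)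
qed

text \<open>The exit distance is the logarithm of the inverse displacement, so a lower bound of
  order \<xi> for the shortest element \<open>T\<close> suffices. For parabolic \<open>T\<close> it
  comes from \<open>parabolic_not_truncated\<close>; a hyperbolic \<open>T\<close> is conjugate to
  one of finitely many elements, because its exit point is close to the orbit, and its displacement
  is bounded below through its trace.\<close>

lemma truncated_near:
  "\<exists>R\<ge>0. \<forall>q \<xi>. Im q > 0 \<and> 0 < \<xi> \<and> \<xi> \<le> 1 \<and> \<pi> q \<in> truncated X \<xi> \<longrightarrow> near q (R + ln (1 / \<xi>))"
proof -
  obtain R where R: "R \<ge> 0" and tt: "\<And>z. Im z > 0 \<Longrightarrow> near z R \<or>
    (\<exists>T q'. minimal_at T z \<and> mdisp T z < f1 \<and> Im q' > 0 \<and> mdisp T q' = f1 \<and>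
       hyp_dist z q' \<le> ln (2 * f1 / mdisp T z) \<and> near q' R)"
    by (rule thick_or_thin) blast
  let ?S = "{M \<in> \<Gamma>. hyp_dist \<i> (act M \<i>) \<le> 2 * R + 1}"
  \<comment> \<open>For a hyperbolic \<open>M\<close> the value is the square of \<open>sinh\<close>
    of half its translation length; the 1 keeps the set nonempty.\<close>
  let ?V = "insert 1 ((\<lambda>M. ((mtr M)\<^sup>2 - 4) / 4) ` {M \<in> ?S. (mtr M)\<^sup>2 > 4})"
  have fin: "finite ?S" using \<Gamma>_discrete[of \<i>] by simp
  have finV: "finite ?V" by (intro finite.insertI finite_imageI finite_subset[OF _ fin]) auto
  define \<tau> where "\<tau> = sqrt (Min ?V)"
  have "Min ?V > 0" using finV by (subst Min_gr_iff) auto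
  then have \<tau>: "\<tau> > 0" "\<tau>\<^sup>2 = Min ?V" by (simp_all add: \<tau>_def)
  have \<tau>le: "\<tau>\<^sup>2 \<le> ((mtr M)\<^sup>2 - 4) / 4" if "M \<in> ?S" "(mtr M)\<^sup>2 > 4" for M
    unfolding \<tau>(2) using finV that by (intro Min_le) auto
  define m where "m = min \<tau> (1/2)"
  have m: "m > 0" "m \<le> \<tau>" "m \<le> 1/2" using \<tau> by (auto simp: m_def)
  have "near q (R + ln (1 / m) + ln (1 / \<xi>))" if q: "Im q > 0" "0 < \<xi>" "\<xi> \<le> 1" "\<pi> q \<in> truncated X \<xi>" for q \<xi>
  proof -
    have l: "0 \<le> ln (1 / m)" "0 \<le> ln (1 / \<xi>)" using m q by (auto simp: ln_ge_zero)
    show ?thesis using tt[OF q(1)]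
    proof (elim disjE exE conjE)
      assume "near q R" then show ?thesis by (rule near_mono) (use l in simp)
    next
      fix T q' assume T: "minimal_at T q" "mdisp T q < f1" "Im q' > 0" "mdisp T q' = f1"
          "hyp_dist q q' \<le> ln (2 * f1 / mdisp T q)" "near q' R"
      have T': "T \<in> \<Gamma>'" "T \<in> \<Gamma>" "T \<in> SL2" "mtr T \<ge> 2" using T(1) \<Gamma>'_SL2 \<Gamma>'_\<Gamma> by (auto simp: minimal_at_def)
      have fpos: "mdisp T q > 0" using \<Gamma>'_mdisp_pos[OF T'(1) q(1)] .
      have ge: "m * \<xi> \<le> mdisp T q"
      proof (cases "mtr T = 2")
        case True
        then have "\<not> mdisp T q < \<xi> / 2" using parabolic_not_truncated[OF q(1) T(1) True q(2,3)] q(4) by blast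
        moreover have "m * \<xi> \<le> 1/2 * \<xi>" using m q by (intro mult_right_mono) auto
        ultimately show ?thesis by simp
      next
        case False
        obtain g where g: "g \<in> \<Gamma>" "hyp_dist q' (act g \<i>) \<le> R" using T(6) by (auto simp: near_def)
        let ?M = "mconj g T"
        have M: "?M \<in> \<Gamma>'" using \<Gamma>'_mconj T' g by blast
        define w where "w = act (madj g) q'"
        have w: "Im w > 0" "act g w = q'" using g T(3) by (auto simp: w_def)
        have "hyp_dist w \<i> = hyp_dist (act g w) (act g \<i>)" using g w by (subst hyp_dist_act) auto
        then have wi: "hyp_dist w \<i> \<le> R" using w g by simp
        have "mdisp ?M w = f1" using mdisp_mconj[of g T w] g T' w T by simp
        then have "hyp_dist \<i> (act ?M \<i>) \<le> 2 * R + 1"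
          using mdisp_le_hyp_dist_i[OF \<Gamma>'_SL2[OF M] w(1)] wi by simp
        then have MS: "?M \<in> ?S" using M \<Gamma>'_\<Gamma> by blast
        have tr: "mtr ?M = mtr T" using g by simp
        have "(mtr T)\<^sup>2 > 2\<^sup>2" using T' False by (intro power_strict_mono) auto
        then have "\<tau>\<^sup>2 \<le> ((mtr T)\<^sup>2 - 4) / 4" using \<tau>le[OF MS] tr by simp
        also have "\<dots> \<le> (mdisp T q)\<^sup>2" using trace_le_mdisp[OF T'(3) q(1)] by simp
        finally have "\<tau> \<le> mdisp T q" by (rule power2_le_imp_le) (use fpos in simp)
        moreover have "m * \<xi> \<le> m * 1" using m q by (intro mult_left_mono) auto
        ultimately show ?thesis using m(2) by linarith
      qed
      have "2 * f1 / mdisp T q \<le> 1 / mdisp T q" using fpos by (intro divide_right_mono) auto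
      also have "\<dots> \<le> 1 / (m * \<xi>)" using ge m q fpos by (intro divide_left_mono mult_pos_pos) auto
      also have "\<dots> = (1/m) * (1/\<xi>)" by simp
      finally have "ln (2 * f1 / mdisp T q) \<le> ln ((1/m) * (1/\<xi>))" using fpos m q by (subst ln_le_cancel_iff) auto
      also have "\<dots> = ln (1/m) + ln (1/\<xi>)" using m q by (intro ln_mult_pos) auto
      finally have "hyp_dist q q' + R \<le> R + ln (1 / m) + ln (1 / \<xi>)" using T(5) by simp
      then show ?thesis using near_triangle[OF T(6) T(3) q(1)] near_mono by blast
    qed
  qed
  moreover have "R + ln (1 / m) \<ge> 0" using R m by (simp add: ln_ge_zero add_nonneg_nonneg)
  ultimately show ?thesis by (intro exI[of _ "R + ln (1 / m)"]) auto
qed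

lemma exists_systole: "\<exists>s>0. s \<le> 1 \<and> (\<forall>M\<in>\<Gamma>'. s \<le> mdisp M \<i>)"
proof -
  let ?S = "{M \<in> \<Gamma>. hyp_dist \<i> (act M \<i>) \<le> 2}"
  let ?V = "insert 1 ((\<lambda>M. mdisp M \<i>) ` {M \<in> ?S. M \<in> \<Gamma>'})"
  have fin: "finite ?S" using \<Gamma>_discrete[of \<i> 2] by simp
  have finV: "finite ?V" by (intro finite.insertI finite_imageI finite_subset[OF _ fin]) auto
  define s where "s = Min ?V"
  have s0: "s > 0" unfolding s_def using finV \<Gamma>'_mdisp_pos by (subst Min_gr_iff) auto
  have s1: "s \<le> 1" unfolding s_def using finV by (intro Min_le) auto
  have "s \<le> mdisp M \<i>" if M: "M \<in> \<Gamma>'" for M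
  proof (cases "mdisp M \<i> \<le> 1")
    case True
    then have "hyp_dist \<i> (act M \<i>) \<le> 2" using hyp_dist_le_mdisp[OF \<Gamma>'_SL2[OF M], of \<i>] by simp
    then have "mdisp M \<i> \<in> ?V" using M \<Gamma>'_\<Gamma> by auto
    then show ?thesis unfolding s_def using finV by (intro Min_le)
  next
    case False
    then show ?thesis using s1 by simp
  qed
  then show ?thesis using s0 s1 by blast
qed

lemma mpow_\<Gamma>: "M \<in> \<Gamma> \<Longrightarrow> mpow M n \<in> \<Gamma>" by (induction n) auto

text \<open>The displacements of the powers are unbounded and increase by at most 1 from one power
  to the next, so the first one to reach 1 is at most 2.\<close>

lemma exists_power_displacement:
  assumes T: "T \<in> \<Gamma>'" "mtr T \<ge> 2" and q: "Im q > 0" and d: "hyp_dist q (act T q) \<le> 1"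
  shows "\<exists>k. 1 \<le> hyp_dist q (act (mpow T k) q) \<and> hyp_dist q (act (mpow T k) q) \<le> 2"
proof -
  have T': "T \<in> SL2" using T \<Gamma>'_SL2 by blast
  let ?d = "\<lambda>k. hyp_dist q (act (mpow T k) q)"
  have f: "mdisp T q > 0" using \<Gamma>'_mdisp_pos T q by blast
  have "\<exists>k. 1 \<le> ?d k"
  proof (rule ccontr)
    assume "\<not> ?thesis"
    then have lt: "?d k < 1" for k by (simp add: not_le)
    obtain k :: nat where k: "real k > sinh (1/2) / mdisp T q" using reals_Archimedean2 by blast
    have "sinh (?d k / 2) \<le> sinh (1/2)" unfolding sinh_real_le_iff using lt[of k] by simp
    moreover have "sinh (?d k / 2) = \<bar>chebU (mtr T) k\<bar> * mdisp T q"
      using sinh_half_displacement[of "mpow T k" q] mdisp_mpow[OF T' q] T' q by simp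
    moreover have "real k * mdisp T q \<le> \<bar>chebU (mtr T) k\<bar> * mdisp T q"
      using chebU_ge_of_nat[OF T(2), of k] f by (intro mult_right_mono) auto
    moreover have "sinh (1/2) < real k * mdisp T q" using k f by (simp add: field_simps)
    ultimately show False by linarith
  qed
  then obtain k where k: "1 \<le> ?d k" "\<forall>j<k. \<not> 1 \<le> ?d j" using exists_least_iff[of "\<lambda>k. 1 \<le> ?d k"] by auto
  have "k \<noteq> 0" using k(1) by (intro notI) simp
  then obtain j where j: "k = Suc j" using not0_implies_Suc by blast
  have "?d k = hyp_dist q (act T (act (mpow T j) q))" using T' q by (simp add: j act_mmul)
  also have "\<dots> \<le> hyp_dist q (act T q) + hyp_dist (act T q) (act T (act (mpow T j) q))"
    using T' q by (intro hyp_dist_triangle) auto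
  also have "hyp_dist (act T q) (act T (act (mpow T j) q)) = ?d j" using T' q by (intro hyp_dist_act) auto
  finally have "?d k \<le> 2" using d k(2) j by (auto simp: not_le)
  then show ?thesis using k by blast
qed

text \<open>In a thin region the orbit point below \<open>q\<close> and its translate by a power of the short element
  lie in essentially opposite directions, and at most one of them is near the direction of \<open>u\<close>.\<close>

lemma orbit_point_avoiding:
  "\<exists>C\<ge>0. \<forall>q u t. Im q > 0 \<and> Im u > 0 \<and> near q t \<longrightarrow>
     (\<exists>g\<in>\<Gamma>. hyp_dist q (act g \<i>) \<le> t + C \<and> gp u (act g \<i>) q \<le> C)"
proof -
  obtain R where R: "R \<ge> 0" and tt: "\<And>z. Im z > 0 \<Longrightarrow> near z R \<or>
    (\<exists>T q'. minimal_at T z \<and> mdisp T z < f1 \<and> Im q' > 0 \<and> mdisp T q' = f1 \<and>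
       hyp_dist z q' \<le> ln (2 * f1 / mdisp T z) \<and> near q' R)"
    by (rule thick_or_thin) blast
  obtain s where s: "s > 0" "s \<le> 1" "\<forall>M\<in>\<Gamma>'. s \<le> mdisp M \<i>" using exists_systole by blast
  define C where "C = 2 * R + 5 + ln (2 / s)"
  have ls: "ln (2 / s) \<ge> 0" using s by (simp add: ln_ge_zero)
  have "\<exists>g\<in>\<Gamma>. hyp_dist q (act g \<i>) \<le> t + C \<and> gp u (act g \<i>) q \<le> C"
    if q: "Im q > 0" "Im u > 0" "near q t" for q u t
    using tt[OF q(1)]
  proof (elim disjE exE conjE)
    assume "near q R"
    then obtain g where g: "g \<in> \<Gamma>" "hyp_dist q (act g \<i>) \<le> R" by (auto simp: near_def)
    have "gp u (act g \<i>) q \<le> R" using gp_le[of u "act g \<i>" q] g q by (simp add: hyp_dist_commute)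
    moreover have "t \<ge> 0" using near_nonneg q by blast
    ultimately show ?thesis using g R ls unfolding C_def by (intro bexI[of _ g]) auto
  next
    fix T q' assume T: "minimal_at T q" "mdisp T q < f1" "Im q' > 0" "mdisp T q' = f1"
          "hyp_dist q q' \<le> ln (2 * f1 / mdisp T q)" "near q' R"
    have T': "T \<in> \<Gamma>'" "T \<in> \<Gamma>" "T \<in> SL2" "mtr T \<ge> 2" using T(1) \<Gamma>'_SL2 \<Gamma>'_\<Gamma> by (auto simp: minimal_at_def)
    define f where "f = mdisp T q"
    have f: "f > 0" using \<Gamma>'_mdisp_pos[OF T'(1) q(1)] by (simp add: f_def)
    define D where "D = hyp_dist q q'"
    have D: "D \<le> ln (2 * f1 / f)" "D \<ge> 0" using T q by (auto simp: D_def f_def)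
    \<comment> \<open>At the orbit point near \<open>q\<close> the displacement of \<open>T\<close>
      is at least \<open>s\<close>, and displacement changes at most exponentially with distance. So
      it is not too small at \<open>q\<close>, and the exit point is not farther than the orbit up
      to a constant.\<close>
    have Dt: "D \<le> t + ln (2 / s)"
    proof -
      obtain g where g: "g \<in> \<Gamma>" "hyp_dist q (act g \<i>) \<le> t" using q by (auto simp: near_def)
      have "s \<le> mdisp (mconj g T) \<i>" using s \<Gamma>'_mconj T' g by blast
      also have "\<dots> = mdisp T (act g \<i>)" using mdisp_mconj[of g T \<i>] g T' by simp
      also have "\<dots> \<le> 2 * exp (hyp_dist q (act g \<i>)) * f" unfolding f_def using T' q g by (intro mdisp_growth) auto
      also have "\<dots> \<le> 2 * exp t * f" using g f by (intro mult_right_mono mult_left_mono) auto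
      finally have "1 / f \<le> exp t * (2 / s)" using f s by (simp add: field_simps)
      moreover have "2 * f1 / f \<le> 1 / f" using f by (intro divide_right_mono) auto
      ultimately have "2 * f1 / f \<le> exp t * (2 / s)" by linarith
      then have "ln (2 * f1 / f) \<le> ln (exp t * (2 / s))" using f s by (subst ln_le_cancel_iff) auto
      also have "\<dots> = t + ln (2 / s)" using s by (subst ln_mult_pos) auto
      finally show ?thesis using D by simp
    qed
    have "hyp_dist q (act T q) \<le> 1" using hyp_dist_le_mdisp[OF T'(3) q(1)] T(2) by simp
    then obtain k where k: "1 \<le> hyp_dist q (act (mpow T k) q)" "hyp_dist q (act (mpow T k) q) \<le> 2"
      using exists_power_displacement T' q by blast
    define B where "B = mpow T k"
    have B: "B \<in> \<Gamma>" "B \<in> SL2" using T' mpow_\<Gamma> by (auto simp: B_def)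
    obtain g where g: "g \<in> \<Gamma>" "hyp_dist q' (act g \<i>) \<le> R" using T(6) by (auto simp: near_def)
    let ?w0 = "act g \<i>" and ?w1 = "act B (act g \<i>)"
    \<comment> \<open>The power \<open>B\<close> moves \<open>q\<close> by about 1, while at
      \<open>q'\<close> its \<open>mdisp\<close> is f1 / f \<ge> exp D / 2 times as large. Hence it
      moves \<open>q'\<close> by nearly twice the distance \<open>D\<close> from \<open>q\<close>,
      which means that \<open>q'\<close> and its image lie in opposite directions seen from
      \<open>q\<close>.\<close>
    have far: "2 * (D - ln 2) \<le> hyp_dist q' (act B q')"
    proof -
      have "1 / 2 \<le> sinh (hyp_dist q (act B q) / 2)" using k le_sinh[of "hyp_dist q (act B q) / 2"] unfolding B_def by linarith
      then have "1 / 2 \<le> mdisp B q" using sinh_half_displacement[OF B(2) q(1)] by simp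
      also have "mdisp B q = \<bar>chebU (mtr T) k\<bar> * f" unfolding B_def f_def using mdisp_mpow[OF T'(3) q(1)] .
      finally have c: "1 / (2 * f) \<le> \<bar>chebU (mtr T) k\<bar>" using f by (simp add: field_simps)
      have "sinh (hyp_dist q' (act B q') / 2) = \<bar>chebU (mtr T) k\<bar> * f1"
        using sinh_half_displacement[OF B(2) T(3)] mdisp_mpow[OF T'(3) T(3)] T(4) by (simp add: B_def)
      also have "\<dots> \<ge> 1 / (2 * f) * f1" using c by (intro mult_right_mono) auto
      finally have "f1 / f \<le> 2 * sinh (hyp_dist q' (act B q') / 2)" using f by (simp add: field_simps)
      also have "\<dots> \<le> exp (hyp_dist q' (act B q') / 2)" by (simp add: sinh_def)
      finally have "ln (f1 / f) \<le> hyp_dist q' (act B q') / 2" using f by (metis exp_gt_zero ln_exp ln_le_cancel_iff divide_pos_pos zero_less_divide_1_iff zero_less_numeral)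
      moreover have e: "ln (2 * f1 / f) = ln 2 + ln (f1 / f)" using ln_mult_pos[of 2 "f1 / f"] f by simp
      have "D \<le> ln 2 + ln (f1 / f)" using D(1) unfolding e .
      ultimately have "D - ln 2 \<le> hyp_dist q' (act B q') / 2" by linarith
      then show ?thesis by simp
    qed
    have w: "Im ?w0 > 0" "Im ?w1 > 0" using g B by auto
    have d0: "hyp_dist q ?w0 \<le> D + R" using hyp_dist_triangle[of q q' ?w0] q T(3) w g by (simp add: D_def)
    have d1: "hyp_dist q ?w1 \<le> 2 + D + R"
    proof -
      have "hyp_dist q ?w1 \<le> hyp_dist q (act B q) + hyp_dist (act B q) ?w1" using q B w by (intro hyp_dist_triangle) auto
      also have "hyp_dist (act B q) ?w1 = hyp_dist q ?w0" using q B w by (intro hyp_dist_act) auto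
      finally show ?thesis using k d0 by (simp add: B_def)
    qed
    have d01: "2 * (D - ln 2) - 2 * R \<le> hyp_dist ?w0 ?w1"
    proof -
      have "hyp_dist q' (act B q') \<le> hyp_dist q' ?w0 + hyp_dist ?w0 (act B q')" using q B w T(3) by (intro hyp_dist_triangle) auto
      also have "hyp_dist ?w0 (act B q') \<le> hyp_dist ?w0 ?w1 + hyp_dist ?w1 (act B q')" using q B w T(3) by (intro hyp_dist_triangle) auto
      also have "hyp_dist ?w1 (act B q') = hyp_dist q' ?w0" using q B w T(3) by (simp add: hyp_dist_commute)
      finally show ?thesis using far g by simp
    qed
    have "ln (2::real) \<le> 1" using ln_le_minus_one[of "2::real"] by simp
    then have "gp ?w0 ?w1 q \<le> 2 * R + 2" using d0 d1 d01 unfolding gp_def by (simp add: hyp_dist_commute)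
    moreover have "gp ?w0 u q \<le> gp ?w0 ?w1 q + 2 \<or> gp ?w1 u q \<le> gp ?w0 ?w1 q + 2"
      using w q by (intro gp_hyperbolic) auto
    ultimately have "gp u ?w0 q \<le> C \<or> gp u ?w1 q \<le> C" using ls by (auto simp: C_def gp_commute)
    moreover have "hyp_dist q ?w0 \<le> t + C" "hyp_dist q ?w1 \<le> t + C" using d0 d1 Dt R by (simp_all add: C_def)
    moreover have "?w1 = act (B \<odot> g) \<i>" "B \<odot> g \<in> \<Gamma>" using B g by (simp_all add: act_mmul)
    ultimately show ?thesis using g(1) by metis
  qed
  moreover have "C \<ge> 0" using R ls by (simp add: C_def)
  ultimately show ?thesis by (intro exI[of _ C]) blast
qed

end

section \<open>Test directions and connecting elements\<close>

lemma gp2: "2 * gp x y w = hyp_dist x w + hyp_dist y w - hyp_dist x y"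
  by (simp add: gp_def)

text \<open>Test points on the horocycle of height exp (-s): for \<open>x\<close> in a bounded range
  they are at distance \<open>s\<close> from \<open>\<i>\<close> up to a constant, and two of them
  have Gromov product at most a constant minus ln |x - y|, whatever \<open>s\<close> is.\<close>

definition gpt :: "real \<Rightarrow> real \<Rightarrow> complex" where "gpt s x = Complex x (exp (- s))"

lemma Im_gpt [simp]: "Im (gpt s x) > 0" by (simp add: gpt_def)

lemma ln2_le_1: "ln (2::real) \<le> 1"
  using ln_le_minus_one[of "2::real"] by simp

lemma hyp_dist_gpt:
  assumes "s \<ge> 0" "0 \<le> x" "x \<le> 6"
  shows "s \<le> hyp_dist \<i> (gpt s x)" "hyp_dist \<i> (gpt s x) \<le> s + 6"
proof -
  show "s \<le> hyp_dist \<i> (gpt s x)" using abs_ln_Im_le_hyp_dist(1)[of \<i> "gpt s x"] assms by (simp add: gpt_def)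
  let ?d = "hyp_dist \<i> (gpt s x)"
  have e: "sqrt (exp (- s)) = exp (- s / 2)"
    by (rule real_sqrt_unique) (simp_all add: power2_eq_square flip: exp_add)
  have "cmod (\<i> - cnj (gpt s x)) \<le> cmod (\<i> * of_real (1 + exp (- s))) + cmod (of_real x)"
  proof -
    have "\<i> - cnj (gpt s x) = \<i> * of_real (1 + exp (- s)) - of_real x" by (simp add: gpt_def complex_eq_iff)
    then show ?thesis by (simp only: norm_triangle_ineq4)
  qed
  also have "cmod (\<i> * of_real (1 + exp (- s))) = \<bar>1 + exp (- s)\<bar>" by (simp only: norm_mult norm_ii norm_of_real mult_1)
  also have "\<bar>1 + exp (- s)\<bar> \<le> 2" using assms by simp
  finally have "cmod (\<i> - cnj (gpt s x)) \<le> 8" using assms by simp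
  then have "cmod (\<i> - cnj (gpt s x)) / (2 * exp (- s / 2)) \<le> 8 / (2 * exp (- s / 2))"
    by (intro divide_right_mono) auto
  moreover have "cosh (?d / 2) = cmod (\<i> - cnj (gpt s x)) / (2 * exp (- s / 2))"
    using cosh_half_hyp_dist[of \<i> "gpt s x"] e by (simp add: gpt_def)
  ultimately have "cosh (?d / 2) \<le> 8 / (2 * exp (- s / 2))" by simp
  moreover have "exp (?d / 2) \<le> 2 * cosh (?d / 2)" by (simp add: cosh_def)
  ultimately have "exp (?d / 2) \<le> 8 * exp (s / 2)" by (simp add: exp_minus field_simps)
  also have "\<dots> = exp (ln 8 + s / 2)" by (simp add: exp_add)
  finally have "?d / 2 \<le> ln 8 + s / 2" by simp
  moreover have "ln (8::real) = 3 * ln 2" using ln_realpow[of "2::real" 3] by simp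
  ultimately show "?d \<le> s + 6" using ln2_le_1 by simp
qed

lemma hyp_dist_gpt_gpt:
  assumes "x \<noteq> y"
  shows "2 * ln \<bar>x - y\<bar> + 2 * s \<le> hyp_dist (gpt s x) (gpt s y)"
proof -
  let ?d = "hyp_dist (gpt s x) (gpt s y)"
  have "gpt s x - gpt s y = of_real (x - y)" by (simp add: gpt_def complex_eq_iff)
  then have "cmod (gpt s x - gpt s y) = \<bar>x - y\<bar>" by (simp only: norm_of_real)
  then have "sinh (?d / 2) = \<bar>x - y\<bar> / (2 * exp (- s))" by (simp add: sinh_half_hyp_dist gpt_def)
  moreover have "2 * sinh (?d / 2) \<le> exp (?d / 2)" by (simp add: sinh_def)
  ultimately have "\<bar>x - y\<bar> * exp s \<le> exp (?d / 2)" by (simp add: exp_minus field_simps)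
  then have "ln (\<bar>x - y\<bar> * exp s) \<le> ln (exp (?d / 2))" using assms by (subst ln_le_cancel_iff) auto
  moreover have "ln (\<bar>x - y\<bar> * exp s) = ln \<bar>x - y\<bar> + s" using assms by (subst ln_mult_pos) auto
  ultimately show ?thesis by simp
qed

lemma gp_gpt:
  assumes "s \<ge> 0" "0 \<le> x" "x \<le> 6" "0 \<le> y" "y \<le> 6" "x \<noteq> y"
  shows "gp (gpt s x) (gpt s y) \<i> \<le> 6 - ln \<bar>x - y\<bar>"
  using gp2[of "gpt s x" "gpt s y" \<i>] hyp_dist_gpt(2)[of s x] hyp_dist_gpt(2)[of s y] hyp_dist_gpt_gpt[of x y s] assms
  by (simp add: hyp_dist_commute)

lemma gpt_avoid:
  assumes "s \<ge> 0" "0 \<le> x" "x \<le> 6" "0 \<le> y" "y \<le> 6" "1 \<le> \<bar>x - y\<bar>" "Im p > 0"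
  shows "gp p (gpt s x) \<i> \<le> 8 \<or> gp p (gpt s y) \<i> \<le> 8"
proof -
  have "ln \<bar>x - y\<bar> \<ge> 0" using assms by simp
  moreover have "x \<noteq> y" using assms(6) by auto
  ultimately have "gp (gpt s x) (gpt s y) \<i> \<le> 6" using gp_gpt[OF assms(1-5)] by linarith
  then show ?thesis using gp_hyperbolic[of "gpt s x" "gpt s y" p \<i>] assms by (auto simp: gp_commute)
qed

text \<open>The intervals [0,1], [2,3] and [4,5] are at distance 1 from each other, so by
  \<open>gpt_avoid\<close> a given point can spoil only one of them. Two points leave one interval
  intact.\<close>

lemma gpt_interval:
  assumes s: "s \<ge> 0" and pq: "Im p > 0" "Im q > 0"
  shows "\<exists>a. 0 \<le> a \<and> a \<le> 4 \<and> (\<forall>x. a \<le> x \<and> x \<le> a + 1 \<longrightarrow> gp p (gpt s x) \<i> \<le> 8 \<and> gp q (gpt s x) \<i> \<le> 8)"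
proof -
  define bad where "bad = (\<lambda>p a. \<exists>x. a \<le> x \<and> x \<le> a + 1 \<and> \<not> gp p (gpt s x) \<i> \<le> 8)"
  have *: "\<not> (bad p a \<and> bad p b)" if "0 \<le> a" "a + 2 \<le> b" "b \<le> 4" "Im p > 0" for p a b
  proof
    assume "bad p a \<and> bad p b"
    then obtain x y where "a \<le> x" "x \<le> a + 1" "\<not> gp p (gpt s x) \<i> \<le> 8" "b \<le> y" "y \<le> b + 1" "\<not> gp p (gpt s y) \<i> \<le> 8"
      unfolding bad_def by blast
    then show False using gpt_avoid[of s x y p] that s by auto
  qed
  have "(\<not> bad p 0 \<and> \<not> bad q 0) \<or> (\<not> bad p 2 \<and> \<not> bad q 2) \<or> (\<not> bad p 4 \<and> \<not> bad q 4)"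
    using *[of 0 2 p] *[of 0 4 p] *[of 2 4 p] *[of 0 2 q] *[of 0 4 q] *[of 2 4 q] pq by auto
  then have "\<exists>a. 0 \<le> a \<and> a \<le> 4 \<and> \<not> bad p a \<and> \<not> bad q a"
  proof (elim disjE)
    assume "\<not> bad p 0 \<and> \<not> bad q 0" then show ?thesis by (intro exI[of _ 0]) simp
  next
    assume "\<not> bad p 2 \<and> \<not> bad q 2" then show ?thesis by (intro exI[of _ 2]) simp
  next
    assume "\<not> bad p 4 \<and> \<not> bad q 4" then show ?thesis by (intro exI[of _ 4]) simp
  qed
  then show ?thesis unfolding bad_def by blast
qed

lemma pigeonhole_bin:
  fixes b :: "nat \<Rightarrow> nat"
  assumes "\<And>m. m < n \<Longrightarrow> b m \<le> K" "n > (K + 1) * B"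
  shows "\<exists>k. card {m. m < n \<and> b m = k} > B"
proof (rule ccontr)
  assume "\<not> ?thesis"
  then have le: "card {m. m < n \<and> b m = k} \<le> B" for k by (simp add: not_less)
  have "{..<n} \<subseteq> (\<Union>k\<in>{..K}. {m. m < n \<and> b m = k})" using assms(1) by auto
  then have "card {..<n} \<le> card (\<Union>k\<in>{..K}. {m. m < n \<and> b m = k})" by (intro card_mono) auto
  also have "\<dots> \<le> (\<Sum>k\<in>{..K}. card {m. m < n \<and> b m = k})" by (intro card_UN_le) auto
  also have "\<dots> \<le> (\<Sum>k\<in>{..K}. B)" by (intro sum_mono le)
  finally show False using assms(2) by simp
qed

lemma exists_dominating_ln:
  fixes a b :: real
  shows "\<exists>n::nat. n \<ge> 1 \<and> real n > (2 * ln (real n) + a) * b"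
proof -
  have "(\<lambda>n. (2 * (ln (real n) / real n) + a * (1 / real n)) * b) \<longlonglongrightarrow> (2 * 0 + a * 0) * b"
    by (intro tendsto_intros lim_ln_over_n lim_1_over_n)
  then have "\<forall>\<^sub>F n in sequentially. (2 * (ln (real n) / real n) + a * (1 / real n)) * b < 1"
    by (intro order_tendstoD) auto
  moreover have "\<forall>\<^sub>F n in sequentially. n \<ge> (1::nat)" by (rule eventually_ge_at_top)
  ultimately have "\<forall>\<^sub>F n in sequentially. n \<ge> 1 \<and> (2 * (ln (real n) / real n) + a * (1 / real n)) * b < 1"
    by eventually_elim simp
  then obtain n :: nat where n: "n \<ge> 1" "(2 * (ln (real n) / real n) + a * (1 / real n)) * b < 1"
    unfolding eventually_sequentially by (meson order_refl)
  have "(2 * (ln (real n) / real n) + a * (1 / real n)) * b = ((2 * ln (real n) + a) * b) / real n"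
    using n by (simp add: field_simps)
  then have "(2 * ln (real n) + a) * b < real n" using n by (simp add: divide_less_eq)
  then show ?thesis using n by blast
qed

context finite_area_covering
begin

text \<open>The way back to \<open>\<i>\<close> is the direction to be avoided at \<open>z\<close>.
  The orbit point then lies beyond \<open>z\<close> as seen from \<open>\<i>\<close>, and nearly the
  whole segment from \<open>\<i>\<close> to \<open>z\<close> is shared.\<close>

lemma orbit_point_towards:
  "\<exists>C\<ge>0. \<forall>z. Im z > 0 \<longrightarrow> (\<exists>g\<in>\<Gamma>. hyp_dist \<i> (act g \<i>) \<le> 2 * hyp_dist \<i> z + C \<and> hyp_dist \<i> z - C \<le> gp z (act g \<i>) \<i>)"
proof -
  obtain C where C: "C \<ge> 0" "\<And>q u t. Im q > 0 \<Longrightarrow> Im u > 0 \<Longrightarrow> near q t \<Longrightarrow>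
     \<exists>g\<in>\<Gamma>. hyp_dist q (act g \<i>) \<le> t + C \<and> gp u (act g \<i>) q \<le> C" using orbit_point_avoiding by blast
  have "\<exists>g\<in>\<Gamma>. hyp_dist \<i> (act g \<i>) \<le> 2 * hyp_dist \<i> z + C \<and> hyp_dist \<i> z - C \<le> gp z (act g \<i>) \<i>" if z: "Im z > 0" for z
  proof -
    have "near z (hyp_dist z \<i>)" unfolding near_def by (intro bexI[of _ mid]) auto
    then obtain g where g: "g \<in> \<Gamma>" "hyp_dist z (act g \<i>) \<le> hyp_dist z \<i> + C" "gp \<i> (act g \<i>) z \<le> C" using C(2)[of z \<i>] z by auto
    have "hyp_dist \<i> (act g \<i>) \<le> hyp_dist \<i> z + hyp_dist z (act g \<i>)" using z g by (intro hyp_dist_triangle) auto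
    moreover have "gp z (act g \<i>) \<i> = hyp_dist \<i> z - gp \<i> (act g \<i>) z"
      using gp2[of z "act g \<i>" \<i>] gp2[of \<i> "act g \<i>" z] by (simp add: hyp_dist_commute)
    ultimately show ?thesis using g by (intro bexI[of _ g]) (auto simp: hyp_dist_commute)
  qed
  then show ?thesis using C by blast
qed

text \<open>The connecting element is \<open>g' g\<^sup>-\<^sup>1\<close> for two orbit points \<open>g \<i>\<close>, \<open>g' \<i>\<close> at nearly the same distance
  which avoid both prescribed directions. There are exponentially many such orbit points in a ball, but
  only linearly many distances, hence some product \<open>g' g\<^sup>-\<^sup>1\<close> is long, so that it starts
  like \<open>g'\<close> and its inverse starts like \<open>g\<close>.\<close>

lemma connecting_element:
  fixes L1 :: real
  shows "\<exists>L2. \<forall>p q. Im p > 0 \<and> Im q > 0 \<longrightarrow> (\<exists>f\<in>\<Gamma>. gp p (act f \<i>) \<i> \<le> 12 \<and> gp q (act (madj f) \<i>) \<i> \<le> 12 \<and>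
     L1 \<le> hyp_dist \<i> (act f \<i>) \<and> hyp_dist \<i> (act f \<i>) \<le> L2)"
proof -
  obtain C where C: "C \<ge> 0" "\<And>z. Im z > 0 \<Longrightarrow>
     \<exists>g\<in>\<Gamma>. hyp_dist \<i> (act g \<i>) \<le> 2 * hyp_dist \<i> z + C \<and> hyp_dist \<i> z - C \<le> gp z (act g \<i>) \<i>"
    using orbit_point_towards by blast
  \<comment> \<open>With length above 25 and distances \<open>l\<close> that differ by at most 1,
    twice the Gromov product of \<open>G i\<close> and the product element exceeds 24, which is what
    \<open>key\<close> needs.\<close>
  define C4 where "C4 = max L1 25"
  let ?Ball = "{M \<in> \<Gamma>. hyp_dist \<i> (act M \<i>) \<le> C4}"
  define B where "B = card ?Ball"
  have finB: "finite ?Ball" by (rule \<Gamma>_discrete) simp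
  \<comment> \<open>There are about 2 ln n + O(1) classes of distances. So \<open>n\<close> test
    points put more than \<open>B\<close> of them into one class, where \<open>B\<close> counts the
    elements that are too short.\<close>
  obtain n :: nat where n: "n \<ge> 1" "real n > (2 * ln (real n) + (3 * C + 35)) * real B"
    using exists_dominating_ln by blast
  \<comment> \<open>The depth exceeds ln n, so that test points 1 / n apart have distinct orbit
    points although these follow them only up to a constant.\<close>
  define s where "s = C + 11 + ln (real n)"
  have lnn: "ln (real n) \<ge> 0" using n by simp
  have s: "s \<ge> 0" using C lnn by (simp add: s_def)
  define \<Lambda> where "\<Lambda> = 2 * (s + 6) + C"
  have \<Lambda>0: "\<Lambda> \<ge> 0" using s C by (simp add: \<Lambda>_def)
  define K where "K = nat \<lfloor>\<Lambda>\<rfloor>"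
  have K: "real K \<le> \<Lambda>" using \<Lambda>0 by (simp add: K_def)
  have nK: "n > (K + 1) * B"
  proof -
    have "real ((K + 1) * B) = (real K + 1) * real B" by (simp add: algebra_simps)
    also have "\<dots> \<le> (\<Lambda> + 1) * real B" using K by (intro mult_right_mono) auto
    also have "\<Lambda> + 1 = 2 * ln (real n) + (3 * C + 35)" by (simp add: \<Lambda>_def s_def)
    finally show ?thesis using n(2) by linarith
  qed
  have "\<exists>f\<in>\<Gamma>. gp p (act f \<i>) \<i> \<le> 12 \<and> gp q (act (madj f) \<i>) \<i> \<le> 12 \<and> L1 \<le> hyp_dist \<i> (act f \<i>) \<and> hyp_dist \<i> (act f \<i>) \<le> 2 * \<Lambda>"
    if pq: "Im p > 0" "Im q > 0" for p q
  proof -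
    obtain a where a: "0 \<le> a" "a \<le> 4" and av: "\<And>x. a \<le> x \<Longrightarrow> x \<le> a + 1 \<Longrightarrow> gp p (gpt s x) \<i> \<le> 8"
        "\<And>x. a \<le> x \<Longrightarrow> x \<le> a + 1 \<Longrightarrow> gp q (gpt s x) \<i> \<le> 8"
      using gpt_interval[OF s pq] by blast
    define x where "x = (\<lambda>m::nat. a + real m / real n)"
    have x: "a \<le> x m" "x m \<le> a + 1" "0 \<le> x m" "x m \<le> 6" if "m < n" for m
    proof -
      have "real m / real n \<le> 1" "0 \<le> real m / real n" using that by (auto simp: divide_le_eq)
      then show "a \<le> x m" "x m \<le> a + 1" "0 \<le> x m" "x m \<le> 6" using a unfolding x_def by linarith+
    qed
    have "\<forall>m. \<exists>g. g \<in> \<Gamma> \<and> hyp_dist \<i> (act g \<i>) \<le> 2 * hyp_dist \<i> (gpt s (x m)) + C \<and> hyp_dist \<i> (gpt s (x m)) - C \<le> gp (gpt s (x m)) (act g \<i>) \<i>"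
      using C(2)[OF Im_gpt] by blast
    then obtain G where G0: "\<forall>m. G m \<in> \<Gamma> \<and> hyp_dist \<i> (act (G m) \<i>) \<le> 2 * hyp_dist \<i> (gpt s (x m)) + C \<and> hyp_dist \<i> (gpt s (x m)) - C \<le> gp (gpt s (x m)) (act (G m) \<i>) \<i>"
      by (rule choice[THEN exE])
    have G: "G m \<in> \<Gamma>" for m using G0 by blast
    have ImG: "Im (act (G m) \<i>) > 0" for m using G by simp
    define l where "l = (\<lambda>m. hyp_dist \<i> (act (G m) \<i>))"
    have l0: "0 \<le> l m" for m unfolding l_def using ImG by simp
    have l\<Lambda>: "l m \<le> \<Lambda>" if "m < n" for m
      using G0[rule_format, of m] hyp_dist_gpt(2)[OF s x(3,4)[OF that]] by (simp add: l_def \<Lambda>_def)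
    have Ggp: "11 + ln (real n) \<le> gp (gpt s (x m)) (act (G m) \<i>) \<i>" if "m < n" for m
      using G0[rule_format, of m] hyp_dist_gpt(1)[OF s x(3,4)[OF that]] by (simp add: s_def)
    have av10: "gp u (act (G m) \<i>) \<i> \<le> 10" if "m < n" "gp u (gpt s (x m)) \<i> \<le> 8" "Im u > 0" for u m
      using gp_hyperbolic[of u "gpt s (x m)" "act (G m) \<i>" \<i>] Ggp[OF that(1)] that ImG lnn by auto
    have dist: "G m \<noteq> G m'" if "m < n" "m' < n" "m \<noteq> m'" for m m'
    proof
      assume e: "G m = G m'"
      have xd: "x m - x m' = (real m - real m') / real n" by (simp add: x_def diff_divide_distrib)
      have "1 \<le> \<bar>real m - real m'\<bar>" using that by linarith
      then have ge: "1 / real n \<le> \<bar>x m - x m'\<bar>" unfolding xd using n by (simp add: divide_right_mono)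
      then have ne: "x m \<noteq> x m'" using n by auto
      have "ln (1 / real n) \<le> ln \<bar>x m - x m'\<bar>" using ge n ne by (subst ln_le_cancel_iff) auto
      then have "- ln (real n) \<le> ln \<bar>x m - x m'\<bar>" using n by (simp add: ln_div)
      then have "gp (gpt s (x m)) (gpt s (x m')) \<i> \<le> 6 + ln (real n)"
        using gp_gpt[OF s x(3,4)[OF that(1)] x(3,4)[OF that(2)] ne] by linarith
      then show False
        using gp_hyperbolic[of "gpt s (x m)" "gpt s (x m')" "act (G m) \<i>" \<i>] Ggp[OF that(1)] Ggp[OF that(2)] ImG e by auto
    qed
    define b where "b = (\<lambda>m. nat \<lfloor>l m\<rfloor>)"
    have "b m \<le> K" if "m < n" for m unfolding b_def K_def using l\<Lambda>[OF that] by (intro nat_mono floor_mono)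
    then obtain k where k: "card {m. m < n \<and> b m = k} > B" using pigeonhole_bin[OF _ nK] by blast
    define J where "J = {m. m < n \<and> b m = k}"
    have J: "card J > B" "finite J" using k by (auto simp: J_def)
    then have "J \<noteq> {}" by auto
    then obtain m0 where m0: "m0 \<in> J" by blast
    have "inj_on (\<lambda>m. G m0 \<odot> madj (G m)) J"
    proof (rule inj_onI)
      fix m m' assume mm: "m \<in> J" "m' \<in> J" "G m0 \<odot> madj (G m) = G m0 \<odot> madj (G m')"
      then have "madj (G m0) \<odot> (G m0 \<odot> madj (G m)) = madj (G m0) \<odot> (G m0 \<odot> madj (G m'))" by simp
      then have "madj (G m) = madj (G m')" using G by simp
      then have "G m = G m'" by (metis madj_madj)
      then show "m = m'" using dist mm by (auto simp: J_def)
    qed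
    then have "card ((\<lambda>m. G m0 \<odot> madj (G m)) ` J) > card ?Ball" using J by (simp add: card_image B_def)
    then have "\<not> (\<lambda>m. G m0 \<odot> madj (G m)) ` J \<subseteq> ?Ball" using card_mono[OF finB] by (meson not_le)
    then obtain m where m: "m \<in> J" "G m0 \<odot> madj (G m) \<notin> ?Ball" by blast
    define f where "f = G m0 \<odot> madj (G m)"
    have f: "f \<in> \<Gamma>" unfolding f_def using G by simp
    have fl: "hyp_dist \<i> (act f \<i>) > C4" using m(2) f unfolding f_def by auto
    have mn: "m < n" "m0 < n" "\<bar>l m - l m0\<bar> \<le> 1"
    proof -
      show "m < n" "m0 < n" using m m0 by (auto simp: J_def)
      have "nat \<lfloor>l m\<rfloor> = nat \<lfloor>l m0\<rfloor>" using m m0 by (auto simp: J_def b_def)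
      then have "\<lfloor>l m\<rfloor> = \<lfloor>l m0\<rfloor>" using l0[of m] l0[of m0] by (simp add: eq_nat_nat_iff)
      then show "\<bar>l m - l m0\<bar> \<le> 1" by linarith
    qed
    have inv: "hyp_dist \<i> (act (madj M) \<i>) = hyp_dist \<i> (act M \<i>)" if "M \<in> SL2" for M
      using hyp_dist_act[of M \<i> "act (madj M) \<i>"] that by (simp add: hyp_dist_commute)
    \<comment> \<open>The orbit points of \<open>h\<close> and of \<open>G i\<close> share more than
      12, while \<open>u\<close> shares at most 10 with \<open>G i\<close>; hence \<open>u\<close>
      shares at most 10 + 2 with \<open>h\<close>.\<close>
    have key: "gp u (act h \<i>) \<i> \<le> 12" if h: "h = G i \<odot> madj (G j)" "hyp_dist \<i> (act h \<i>) > C4" and u: "gp u (act (G i) \<i>) \<i> \<le> 10" "Im u > 0"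
       and ij: "\<bar>l i - l j\<bar> \<le> 1" for u h i j
    proof -
      have Gi: "G i \<in> SL2" "G j \<in> SL2" using G by auto
      have hi: "act h \<i> = act (G i) (act (madj (G j)) \<i>)" using Gi by (simp add: h act_mmul)
      have "hyp_dist (act (G i) \<i>) (act h \<i>) = l j" unfolding hi using Gi by (simp add: l_def inv)
      then have "2 * gp (act (G i) \<i>) (act h \<i>) \<i> = l i + hyp_dist \<i> (act h \<i>) - l j"
        using gp2[of "act (G i) \<i>" "act h \<i>" \<i>] by (simp add: l_def hyp_dist_commute)
      then have "gp (act (G i) \<i>) (act h \<i>) \<i> \<ge> 12" "gp (act (G i) \<i>) (act h \<i>) \<i> > 12 \<or> gp (act (G i) \<i>) (act h \<i>) \<i> \<le> 12"
        using h(2) ij unfolding C4_def by linarith+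
      moreover have "gp (act (G i) \<i>) (act h \<i>) \<i> > 12"
        using \<open>2 * gp (act (G i) \<i>) (act h \<i>) \<i> = _\<close> h(2) ij unfolding C4_def by linarith
      moreover have "gp u (act h \<i>) \<i> \<le> gp u (act (G i) \<i>) \<i> + 2 \<or> gp (act (G i) \<i>) (act h \<i>) \<i> \<le> gp u (act (G i) \<i>) \<i> + 2"
        using u Gi ImG by (intro gp_hyperbolic) (auto simp: h)
      ultimately show ?thesis using u by linarith
    qed
    have "gp p (act f \<i>) \<i> \<le> 12"
      by (rule key[OF f_def fl]) (use av10[OF mn(2) av(1)[OF x(1,2)[OF mn(2)]]] pq mn in auto)
    moreover have fm: "madj f = G m \<odot> madj (G m0)" unfolding f_def by (simp add: madj_mmul)
    have "gp q (act (madj f) \<i>) \<i> \<le> 12"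
    proof (rule key[OF fm])
      show "hyp_dist \<i> (act (madj f) \<i>) > C4" using fl f inv by simp
    qed (use av10[OF mn(1) av(2)[OF x(1,2)[OF mn(1)]]] pq mn in auto)
    moreover have "hyp_dist \<i> (act f \<i>) \<le> 2 * \<Lambda>"
    proof -
      have "hyp_dist \<i> (act f \<i>) \<le> hyp_dist \<i> (act (G m0) \<i>) + hyp_dist (act (G m0) \<i>) (act f \<i>)" using G f by (intro hyp_dist_triangle) auto
      also have "hyp_dist (act (G m0) \<i>) (act f \<i>) = l m" unfolding f_def using G by (simp add: act_mmul l_def inv)
      finally show ?thesis using l\<Lambda>[OF mn(1)] l\<Lambda>[OF mn(2)] by (simp add: l_def)
    qed
    moreover have "L1 \<le> hyp_dist \<i> (act f \<i>)" using fl unfolding C4_def by simp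
    ultimately show ?thesis using f by blast
  qed
  then show ?thesis by blast
qed

end

section \<open>Broken geodesics\<close>

lemma gp_shift: "gp y z x = hyp_dist x y - gp x z y"
  using gp2[of y z x] gp2[of x z y] by (simp add: hyp_dist_commute)

text \<open>The bound 2 C + 9 makes every side longer by at least 1 than the loss 2 (C + 4) at a
  corner.\<close>

locale broken_geodesic =
  fixes x :: "nat \<Rightarrow> complex" and C L :: real
  assumes Im_x [simp]: "\<And>k. Im (x k) > 0"
    and C: "C \<ge> 0"
    and side: "\<And>k. L \<le> hyp_dist (x k) (x (Suc k))"
    and corner: "\<And>k. gp (x k) (x (Suc (Suc k))) (x (Suc k)) \<le> C"
    and L: "2 * C + 9 \<le> L"
begin

text \<open>By induction the path beyond the next vertex follows the next side for at least L - (C +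
  2). This is too long for the second alternative of \<open>gp_hyperbolic\<close>, so the corner
  bound extends to all later vertices at a cost of 2 that does not accumulate.\<close>

lemma gp_forward: "gp (x k) (x (Suc (Suc k) + n)) (x (Suc k)) \<le> C + 2"
proof (induction n arbitrary: k)
  case 0
  then show ?case using corner[of k] by simp
next
  case (Suc n)
  have "gp (x (Suc (Suc k))) (x (Suc (Suc k) + Suc n)) (x (Suc k)) \<ge> L - (C + 2)"
    using Suc[of "Suc k"] side[of "Suc k"] gp_shift[of "x (Suc (Suc k))" "x (Suc (Suc k) + Suc n)" "x (Suc k)"] by simp
  moreover have "gp (x k) (x (Suc (Suc k) + Suc n)) (x (Suc k)) \<le> gp (x k) (x (Suc (Suc k))) (x (Suc k)) + 2 \<or>
      gp (x (Suc (Suc k))) (x (Suc (Suc k) + Suc n)) (x (Suc k)) \<le> gp (x k) (x (Suc (Suc k))) (x (Suc k)) + 2"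
    by (intro gp_hyperbolic) auto
  ultimately show ?case using corner[of k] L by linarith
qed

lemma gp_backward: "gp (x k) (x (Suc (Suc (k + n)))) (x (Suc (k + n))) \<le> C + 2"
proof (induction n)
  case 0
  then show ?case using corner[of k] by simp
next
  case (Suc n)
  let ?m = "Suc (k + n)"
  have "gp (x ?m) (x k) (x (Suc ?m)) \<ge> L - (C + 2)"
    using Suc side[of ?m] gp_shift[of "x ?m" "x k" "x (Suc ?m)"] by (simp add: gp_commute hyp_dist_commute)
  moreover have "gp (x (Suc (Suc ?m))) (x k) (x (Suc ?m)) \<le> gp (x (Suc (Suc ?m))) (x ?m) (x (Suc ?m)) + 2 \<or>
      gp (x ?m) (x k) (x (Suc ?m)) \<le> gp (x (Suc (Suc ?m))) (x ?m) (x (Suc ?m)) + 2"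
    by (intro gp_hyperbolic) auto
  ultimately show ?case using corner[of ?m] L by (simp add: gp_commute)
qed

lemma gp_between:
  assumes "j < k" "k < m"
  shows "gp (x j) (x m) (x k) \<le> C + 4"
proof -
  obtain a where a: "k = Suc (j + a)" using assms(1) less_iff_Suc_add by blast
  have 1: "gp (x j) (x (Suc k)) (x k) \<le> C + 2" using gp_backward[of j a] by (simp add: a)
  show ?thesis
  proof (cases "m = Suc k")
    case True
    then show ?thesis using 1 by simp
  next
    case False
    then obtain n where m: "m = Suc (Suc k) + n" using assms(2) by (metis Suc_lessI add_Suc less_iff_Suc_add)
    have "gp (x (Suc k)) (x m) (x k) \<ge> L - (C + 2)"
      using gp_forward[of k n] side[of k] gp_shift[of "x (Suc k)" "x m" "x k"] by (simp add: m)
    moreover have "gp (x j) (x m) (x k) \<le> gp (x j) (x (Suc k)) (x k) + 2 \<or> gp (x (Suc k)) (x m) (x k) \<le> gp (x j) (x (Suc k)) (x k) + 2"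
      by (intro gp_hyperbolic) auto
    ultimately show ?thesis using 1 L by linarith
  qed
qed

lemma hyp_dist_between:
  assumes "j < k" "k < m"
  shows "hyp_dist (x j) (x k) + hyp_dist (x k) (x m) - 2 * (C + 4) \<le> hyp_dist (x j) (x m)"
  using gp_between[OF assms] gp2[of "x j" "x m" "x k"] by (simp add: hyp_dist_commute)

lemma hyp_dist_ge: "L \<le> hyp_dist (x j) (x (Suc j + n))"
proof (induction n arbitrary: j)
  case 0
  then show ?case using side by simp
next
  case (Suc n)
  have "gp (x j) (x (Suc (Suc j) + n)) (x (Suc j)) \<le> C + 2" by (rule gp_forward)
  then have "hyp_dist (x j) (x (Suc j)) + hyp_dist (x (Suc j)) (x (Suc (Suc j) + n)) - 2 * (C + 2) \<le> hyp_dist (x j) (x (Suc (Suc j) + n))"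
    using gp2[of "x j" "x (Suc (Suc j) + n)" "x (Suc j)"] by (simp add: hyp_dist_commute)
  moreover have "L \<le> hyp_dist (x (Suc j)) (x (Suc (Suc j) + n))" using Suc[of "Suc j"] .
  ultimately show ?case using side[of j] L C by simp
qed

text \<open>Splitting the path after its first period loses at most 2 (C + 4), so every further
  period contributes its displacement minus this loss.\<close>

lemma periodic_growth:
  assumes G: "G \<in> SL2" and per: "\<And>k. x (k + p) = act G (x k)" and p: "p > 0"
  shows "real n * (hyp_dist (x k) (act G (x k)) - 2 * (C + 4)) \<le> hyp_dist (x k) (act (mpow G n) (x k))"
    and "1 \<le> hyp_dist (x k) (act G (x k)) - 2 * (C + 4)"
proof -
  have pw: "act (mpow G n) (x k) = x (k + n * p)" for n k
  proof (induction n)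
    case (Suc n)
    have "act (mpow G (Suc n)) (x k) = act G (x (k + n * p))" using G Suc by (simp add: act_mmul)
    also have "\<dots> = x (k + n * p + p)" by (simp add: per)
    finally show ?case by (simp add: add.assoc add.commute add.left_commute)
  qed simp
  show "real n * (hyp_dist (x k) (act G (x k)) - 2 * (C + 4)) \<le> hyp_dist (x k) (act (mpow G n) (x k))"
  proof (induction n)
    case (Suc n)
    show ?case
    proof (cases "n = 0")
      case True
      then show ?thesis using C by simp
    next
      case False
      have "hyp_dist (x k) (x (k + p)) + hyp_dist (x (k + p)) (x (k + Suc n * p)) - 2 * (C + 4) \<le> hyp_dist (x k) (x (k + Suc n * p))"
        using p False by (intro hyp_dist_between) auto
      moreover have "hyp_dist (x (k + p)) (x (k + Suc n * p)) = hyp_dist (x k) (x (k + n * p))"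
      proof -
        have "x (k + Suc n * p) = act G (x (k + n * p))" using per[of "k + n * p"] by (simp add: algebra_simps)
        then show ?thesis using per[of k] G by simp
      qed
      ultimately show ?thesis using Suc unfolding pw per by (simp add: algebra_simps)
    qed
  qed simp
  obtain p' where "p = Suc p'" using p gr0_implies_Suc by blast
  then have "L \<le> hyp_dist (x k) (act G (x k))" using hyp_dist_ge[of k p'] per[of k] by simp
  then show "1 \<le> hyp_dist (x k) (act G (x k)) - 2 * (C + 4)" using L by simp
qed

end

text \<open>An explicit diagonalisation: a rotation equalises the diagonal entries, a dilation
  equalises the other two, which become \<beta>, and \<open>?J\<close> diagonalises the resulting
  symmetric matrix. The number \<open>l\<close> is the translation length.\<close>

lemma hyperbolic_diagonal:
  assumes G: "G \<in> SL2" "mtr G > 2"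
  shows "\<exists>P\<in>SL2. \<exists>l>0. mconj P G = Mat (exp (l / 2)) 0 0 (exp (- l / 2))"
proof -
  obtain R where R: "R \<in> SL2" "ma (mconj R G) = md (mconj R G)" using exists_good_rotation[OF G(1)] by blast
  define B where "B = mconj R G"
  have B: "B \<in> SL2" "ma B = md B" using R G by (auto simp: B_def)
  have a1: "ma B > 1" using B G R mtr_mconj[OF R(1), of G] by (simp add: mtr_def B_def)
  have bc: "mb B * mc B = ma B * ma B - 1" using B by (simp add: SL2_def)
  have "ma B * ma B > 1" using a1 by (metis less_1_mult)
  then have bc0: "mb B * mc B > 0" using bc by simp
  then have r0: "mb B / mc B > 0" by (metis divide_pos_pos divide_neg_neg zero_less_mult_iff)
  have c0: "mc B \<noteq> 0" using bc0 by auto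
  define s where "s = sqrt (sqrt (mb B / mc B))"
  have s: "s > 0" "s ^ 4 = mb B / mc B"
  proof -
    show "s > 0" using r0 by (simp add: s_def)
    have "s ^ 4 = (s\<^sup>2)\<^sup>2" by simp
    then show "s ^ 4 = mb B / mc B" using r0 by (simp add: s_def)
  qed
  define \<beta> where "\<beta> = mc B * (s * s)"
  have \<beta>: "mb B / (s * s) = \<beta>"
  proof -
    have "mb B = mc B * s ^ 4" using s c0 by simp
    then show ?thesis using s(1) by (simp add: \<beta>_def power4_eq_xxxx)
  qed
  have \<beta>2: "\<beta> * \<beta> = ma B * ma B - 1"
  proof -
    have "\<beta> * \<beta> = (mb B / (s * s)) * (mc B * (s * s))" using \<beta> by (simp add: \<beta>_def)
    also have "\<dots> = mb B * mc B" using s(1) by simp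
    finally show ?thesis using bc by simp
  qed
  let ?D = "Mat s 0 0 (1 / s)" and ?J = "Mat (1 / sqrt 2) (- (1 / sqrt 2)) (1 / sqrt 2) (1 / sqrt 2)"
  have DJ: "?D \<in> SL2" "?J \<in> SL2" using s by (simp_all add: SL2_def)
  have mD: "mconj ?D B = Mat (ma B) \<beta> \<beta> (ma B)" using s(1) \<beta> B(2)
    by (simp add: mconj_def madj_def mmul_def \<beta>_def)
  have "mconj ?J (Mat (ma B) \<beta> \<beta> (ma B)) = Mat (ma B + \<beta>) 0 0 (ma B - \<beta>)"
    by (simp add: mconj_def madj_def mmul_def field_simps)
  then have 1: "mconj (R \<odot> ?D \<odot> ?J) G = Mat (ma B + \<beta>) 0 0 (ma B - \<beta>)"
    using R DJ mD by (simp add: B_def flip: mconj_mconj)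
  have prod: "(ma B + \<beta>) * (ma B - \<beta>) = 1" using \<beta>2 by (simp add: algebra_simps)
  have \<beta>0: "\<beta> \<noteq> 0" using c0 s(1) by (simp add: \<beta>_def)
  have "\<exists>P\<in>SL2. \<exists>u>1. mconj P G = Mat u 0 0 (1 / u)"
  proof (cases "\<beta> > 0")
    case True
    have u: "ma B + \<beta> > 1" using True a1 by simp
    have "ma B - \<beta> = 1 / (ma B + \<beta>)" using prod u by (simp add: field_simps)
    then show ?thesis using 1 u R DJ by (intro bexI[of _ "R \<odot> ?D \<odot> ?J"] exI[of _ "ma B + \<beta>"]) auto
  next
    case False
    then have u: "ma B - \<beta> > 1" using \<beta>0 a1 by simp
    \<comment> \<open>Exchanging the two ends of the axis puts the larger eigenvalue first.\<close>
    let ?S = "Mat 0 1 (-1) 0"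
    have S: "?S \<in> SL2" by (simp add: SL2_def)
    have "ma B + \<beta> = 1 / (ma B - \<beta>)" using prod u by (simp add: field_simps)
    moreover have "mconj (R \<odot> ?D \<odot> ?J \<odot> ?S) G = mconj ?S (mconj (R \<odot> ?D \<odot> ?J) G)" using R DJ S by (subst mconj_mconj) auto
    then have "mconj (R \<odot> ?D \<odot> ?J \<odot> ?S) G = Mat (ma B - \<beta>) 0 0 (ma B + \<beta>)" unfolding 1 by (simp add: mconj_def madj_def mmul_def)
    ultimately show ?thesis using u R DJ S by (intro bexI[of _ "R \<odot> ?D \<odot> ?J \<odot> ?S"] exI[of _ "ma B - \<beta>"]) auto
  qed
  then obtain P u where P: "P \<in> SL2" "u > 1" "mconj P G = Mat u 0 0 (1 / u)" by blast
  have "exp (2 * ln u / 2) = u" "exp (- (2 * ln u) / 2) = 1 / u" using P by (simp_all add: exp_minus field_simps)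
  then show ?thesis using P by (intro bexI[of _ P] exI[of _ "2 * ln u"]) simp_all
qed

lemma hline_mconj:
  assumes P: "P \<in> SL2" "G \<in> SL2" "mconj P G = Mat (exp (l / 2)) 0 0 (exp (- l / 2))"
  shows "act G (hline P s) = hline P (s + l)"
proof -
  have "act G (hline P s) = act (P \<odot> mconj P G) (of_real (exp s) * \<i>)"
  proof -
    have "P \<odot> mconj P G = G \<odot> P" using P(1) by (simp add: mconj_def mmul_assoc)
    then show ?thesis using P(1,2) by (simp add: hline_def act_mmul)
  qed
  also have "\<dots> = act P (act (mconj P G) (of_real (exp s) * \<i>))"
    by (rule act_mmul[OF P(1) mconj_in[OF P(1,2)]]) simp
  also have "act (mconj P G) (of_real (exp s) * \<i>) = of_real (exp (l / 2) * exp s / exp (- l / 2)) * \<i>"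
    unfolding P(3) by (simp add: act_def del: of_real_exp)
  also have "exp (l / 2) * exp s / exp (- l / 2) = exp (s + l)" by (simp flip: exp_add exp_diff)
  finally show ?thesis by (simp add: hline_def)
qed

text \<open>For trace 2 the displacement of the n-th power is linear in n on the scale of
  \<open>sinh\<close>, so the distances grow only logarithmically.\<close>

lemma linear_growth_hyperbolic:
  assumes G: "G \<in> SL2" "mtr G \<ge> 2" and z: "Im z > 0" and \<tau>: "\<tau> > 0"
    and growth: "\<And>n. real n * \<tau> \<le> hyp_dist z (act (mpow G n) z)"
  shows "mtr G > 2"
proof (rule ccontr)
  assume "\<not> ?thesis"
  then have tr: "mtr G = 2" using G by simp
  define F where "F = mdisp G z"
  have le: "sinh (real n * (\<tau> / 2)) \<le> real n * F" for n
  proof -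
    have "sinh (real n * (\<tau> / 2)) \<le> sinh (hyp_dist z (act (mpow G n) z) / 2)" unfolding sinh_real_le_iff using growth[of n] by simp
    also have "\<dots> = \<bar>chebU 2 n\<bar> * F" using sinh_half_displacement[of "mpow G n" z] mdisp_mpow[OF G(1) z] G z by (simp add: tr F_def)
    finally show ?thesis using chebU_2[of n] by simp
  qed
  have sinh_ge: "y\<^sup>2 / 4 \<le> sinh y + 1" if "y \<ge> 0" for y :: real
  proof -
    have "1 + y + y\<^sup>2 / 2 \<le> exp y" using exp_lower_Taylor_quadratic[OF that] .
    moreover have "exp (- y) \<le> 1" using that by simp
    moreover have "2 * sinh y = exp y - exp (- y)" by (simp add: sinh_def)
    ultimately show ?thesis using that by linarith
  qed
  define a where "a = \<tau> / 2"
  have a: "a > 0" using \<tau> by (simp add: a_def)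
  obtain n :: nat where n: "real n > 4 * (\<bar>F\<bar> + 1) / a\<^sup>2" using reals_Archimedean2 by blast
  have n0: "real n \<ge> 1"
  proof -
    have "0 < 4 * (\<bar>F\<bar> + 1) / a\<^sup>2" using a by (intro divide_pos_pos) auto
    then have "0 < real n" using n by linarith
    then show ?thesis by simp
  qed
  have "4 * (\<bar>F\<bar> + 1) < real n * a\<^sup>2" using n a by (simp add: field_simps)
  then have "real n * (4 * (\<bar>F\<bar> + 1)) < real n * (real n * a\<^sup>2)" using n0 by (intro mult_strict_left_mono) auto
  also have "real n * (real n * a\<^sup>2) = (real n * a)\<^sup>2" by (simp add: power2_eq_square)
  also have "\<dots> \<le> 4 * (sinh (real n * a) + 1)" using sinh_ge[of "real n * a"] a by simp
  also have "\<dots> \<le> 4 * (real n * F + 1)" using le[of n] by (simp add: a_def)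
  also have "\<dots> \<le> 4 * (real n * \<bar>F\<bar> + real n)" 
  proof -
    have "real n * F \<le> real n * \<bar>F\<bar>" by (intro mult_left_mono) auto
    then have "real n * F + 1 \<le> real n * \<bar>F\<bar> + real n" using n0 by (rule add_mono)
    then show ?thesis by (rule mult_left_mono) simp
  qed
  finally show False by (simp add: algebra_simps)
qed

text \<open>The quotient |w| / Im w is \<open>cosh\<close> of the distance to the imaginary axis,
  and sinh (D / 2) is this quotient times sinh (l / 2). Asymptotically each power adds
  \<open>l\<close>, so the growth hypothesis forces l \<ge> D - c; then D and l differ by at most
  \<open>c\<close> and the quotient is bounded.\<close>

lemma axis_close:
  assumes P: "P \<in> SL2" "G \<in> SL2" "l > 0" "mconj P G = Mat (exp (l / 2)) 0 0 (exp (- l / 2))"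
    and z: "Im z > 0" and c: "c \<ge> 0" "1 \<le> hyp_dist z (act G z) - c"
    and growth: "\<And>n. real n * (hyp_dist z (act G z) - c) \<le> hyp_dist z (act (mpow G n) z)"
  shows "cmod (act (madj P) z) / Im (act (madj P) z) \<le> 2 * exp (c / 2)"
    and "l \<le> hyp_dist z (act G z)"
proof -
  define D where "D = hyp_dist z (act G z)"
  define w where "w = act (madj P) z"
  have w: "Im w > 0" "act P w = z" using P z by (auto simp: w_def)
  have "mdisp (mconj P G) w = cmod w / Im w * sinh (l / 2)"
  proof -
    have "mdisp (mconj P G) w = cmod (of_real (exp (- l / 2) - exp (l / 2)) * w) / (2 * Im w)"
      unfolding P(4) by (simp add: mdisp_def)
    also have "cmod (of_real (exp (- l / 2) - exp (l / 2)) * w) = \<bar>exp (- l / 2) - exp (l / 2)\<bar> * cmod w"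
      by (simp only: norm_mult norm_of_real)
    also have "\<bar>exp (- l / 2) - exp (l / 2)\<bar> = 2 * sinh (l / 2)" using P(3) by (simp add: sinh_def)
    finally show ?thesis by simp
  qed
  then have sD: "sinh (D / 2) = cmod w / Im w * sinh (l / 2)"
    using mdisp_mconj[OF P(1,2) w(1)] sinh_half_displacement[OF P(2) z] w by (simp add: D_def)
  have sl: "sinh (l / 2) > 0" using P by simp
  have "Im w \<le> cmod w" using abs_Im_le_cmod[of w] w by simp
  then have "1 \<le> cmod w / Im w" using w by simp
  then have "1 * sinh (l / 2) \<le> sinh (D / 2)" unfolding sD using sl by (intro mult_right_mono) auto
  then have "sinh (l / 2) \<le> sinh (D / 2)" by simp
  then show "l \<le> hyp_dist z (act G z)" unfolding sinh_real_le_iff D_def by simp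
  have zo: "hyp_dist z (act (mpow G n) z) \<le> 2 * hyp_dist z (act P \<i>) + real n * l" for n
  proof -
    have pn: "act (mpow G n) (act P \<i>) = hline P (real n * l)"
    proof (induction n)
      case 0
      then show ?case by (simp add: hline_def)
    next
      case (Suc n)
      then show ?case using P hline_mconj[OF P(1,2,4)] by (simp add: act_mmul algebra_simps)
    qed
    have "hyp_dist z (act (mpow G n) z) \<le> hyp_dist z (act P \<i>) + hyp_dist (act P \<i>) (act (mpow G n) z)"
      using P z by (intro hyp_dist_triangle) auto
    also have "hyp_dist (act P \<i>) (act (mpow G n) z) \<le> hyp_dist (act P \<i>) (act (mpow G n) (act P \<i>)) + hyp_dist (act (mpow G n) (act P \<i>)) (act (mpow G n) z)"
      using P z by (intro hyp_dist_triangle) auto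
    also have "hyp_dist (act (mpow G n) (act P \<i>)) (act (mpow G n) z) = hyp_dist z (act P \<i>)" using P z by (simp add: hyp_dist_commute)
    also have "hyp_dist (act P \<i>) (act (mpow G n) (act P \<i>)) = real n * l"
      unfolding pn using hyp_dist_hline[OF P(1), of 0 "real n * l"] P(3) by (simp add: hline_def)
    finally show ?thesis by simp
  qed
  have lD: "D - c \<le> l"
  proof (rule ccontr)
    assume "\<not> ?thesis"
    then have pos: "D - c - l > 0" by simp
    obtain n :: nat where "real n > 2 * hyp_dist z (act P \<i>) / (D - c - l)" using reals_Archimedean2 by blast
    then have "2 * hyp_dist z (act P \<i>) < real n * (D - c - l)" using pos by (simp add: field_simps)
    moreover have "real n * (D - c) \<le> 2 * hyp_dist z (act P \<i>) + real n * l" using growth[of n] zo[of n] by (simp add: D_def)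
    ultimately show False by (simp add: algebra_simps)
  qed
  have l1: "l \<ge> 1" using lD c by (simp add: D_def)
  have "exp (l / 2) / 4 \<le> sinh (l / 2)"
  proof -
    have "exp (- (l / 2)) * 2 \<le> exp (l / 2)"
    proof -
      have "(2::real) \<le> exp 1" using exp_ge_add_one_self[of 1] by simp
      also have "\<dots> \<le> exp l" using l1 by simp
      finally have "exp (- (l / 2)) * 2 \<le> exp (- (l / 2)) * exp l" by simp
      also have "\<dots> = exp (l / 2)" by (simp flip: exp_add)
      finally show ?thesis .
    qed
    moreover have "sinh (l / 2) = (exp (l / 2) - exp (- (l / 2))) / 2" by (simp add: sinh_def)
    ultimately show ?thesis by simp
  qed
  then have "cmod w / Im w * (exp (l / 2) / 4) \<le> sinh (D / 2)" unfolding sD using w by (intro mult_left_mono) auto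
  also have "\<dots> \<le> exp (D / 2) / 2" by (simp add: sinh_def)
  also have "\<dots> \<le> exp ((l + c) / 2) / 2" using lD by simp
  also have "exp ((l + c) / 2) = exp (l / 2) * exp (c / 2)" by (simp add: add_divide_distrib exp_add)
  finally have *: "cmod w / Im w * (exp (l / 2) / 4) \<le> exp (l / 2) * exp (c / 2) / 2" .
  have "k \<le> 2 * e" if "k * (E / 4) \<le> E * e / 2" "E > 0" for k e E :: real
  proof -
    have "k * E \<le> (2 * e) * E" using that(1) by (simp add: algebra_simps)
    then show ?thesis using that(2) by simp
  qed
  from this[OF *] show "cmod (act (madj P) z) / Im (act (madj P) z) \<le> 2 * exp (c / 2)" unfolding w_def[symmetric] by simp
qed

text \<open>Along a unit speed geodesic, \<open>Re / Im\<close> (the hyperbolic sine of the signed distance to the imaginary axis) is a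
  combination of \<open>exp s\<close> and \<open>exp (- s)\<close>, so it is exponentially small away from the ends.\<close>

lemma Re_div_Im_hline:
  assumes "Q \<in> SL2"
  shows "Re (hline Q s) / Im (hline Q s) = ma Q * mc Q * exp s + mb Q * md Q * exp (- s)"
proof -
  let ?u = "exp s"
  let ?D = "of_real (mc Q) * (of_real ?u * \<i>) + complex_of_real (md Q)"
  have D: "?D \<noteq> 0" using denom_nz[OF assms, of "of_real ?u * \<i>"] by simp
  have D2: "(cmod ?D)\<^sup>2 = (mc Q * ?u)\<^sup>2 + (md Q)\<^sup>2" by (simp add: cmod_power2 add.commute del: of_real_exp)
  have "Re (hline Q s) = (ma Q * mc Q * ?u\<^sup>2 + mb Q * md Q) / (cmod ?D)\<^sup>2"
    unfolding hline_def act_def Re_divide D2 by (simp add: power2_eq_square algebra_simps del: of_real_exp)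
  moreover have "Im (hline Q s) = ?u / (cmod ?D)\<^sup>2"
    unfolding hline_def using Im_act[OF assms, of "of_real ?u * \<i>"] by (simp del: of_real_exp)
  ultimately have "Re (hline Q s) / Im (hline Q s) = (ma Q * mc Q * ?u\<^sup>2 + mb Q * md Q) / ?u"
    using D by simp
  also have "\<dots> = ma Q * mc Q * exp s + mb Q * md Q * exp (- s)" by (simp add: exp_minus field_simps power2_eq_square)
  finally show ?thesis .
qed

text \<open>Such a combination is determined by its end values, through f s * sinh T = f 0 * sinh (T
  - s) + f T * sinh s. The factor 4 comes from sinh T \<ge> exp T / 4.\<close>

lemma exp_combination_small:
  fixes \<alpha> \<beta> S L T s :: real
  defines "f \<equiv> \<lambda>s. \<alpha> * exp s + \<beta> * exp (- s)"
  assumes S: "\<bar>f 0\<bar> \<le> S" "\<bar>f T\<bar> \<le> S" and T: "1 \<le> T" and s: "L \<le> s" "s \<le> T - L" "0 \<le> L"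
  shows "\<bar>f s\<bar> \<le> 4 * S * exp (- L)"
proof -
  have S0: "S \<ge> 0" using S by simp
  have id: "f s * sinh T = f 0 * sinh (T - s) + f T * sinh s"
  proof -
    have "f s * (exp T - exp (- T)) = f 0 * (exp (T - s) - exp (- (T - s))) + f T * (exp s - exp (- s))"
      unfolding f_def by (simp add: algebra_simps flip: exp_add)
    then show ?thesis by (simp add: sinh_def algebra_simps)
  qed
  have sh: "sinh y \<le> exp y / 2" for y :: real by (simp add: sinh_def)
  have sn: "0 \<le> sinh (T - s)" "0 \<le> sinh s" using s by simp_all
  have "sinh (T - s) + sinh s \<le> exp (T - s) / 2 + exp s / 2" by (intro add_mono sh)
  also have "\<dots> \<le> exp (T - L) / 2 + exp (T - L) / 2" using s by (intro add_mono divide_right_mono) auto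
  finally have 1: "sinh (T - s) + sinh s \<le> exp (T - L)" by simp
  have 2: "exp T / 4 \<le> sinh T"
  proof -
    have "(2::real) \<le> exp 1" using exp_ge_add_one_self[of 1] by simp
    also have "\<dots> \<le> exp (2 * T)" using T by simp
    finally have "exp (- T) * 2 \<le> exp (- T) * exp (2 * T)" by simp
    also have "\<dots> = exp T" by (simp flip: exp_add)
    finally have "exp (- T) * 2 \<le> exp T" .
    moreover have "sinh T = (exp T - exp (- T)) / 2" by (simp add: sinh_def)
    ultimately show ?thesis by simp
  qed
  have "\<bar>f s\<bar> * sinh T = \<bar>f 0 * sinh (T - s) + f T * sinh s\<bar>" using id T by (metis abs_mult abs_of_nonneg sinh_real_nonneg_iff order_trans zero_le_one)
  also have "\<dots> \<le> \<bar>f 0\<bar> * sinh (T - s) + \<bar>f T\<bar> * sinh s" using sn by (metis abs_mult abs_of_nonneg abs_triangle_ineq)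
  also have "\<dots> \<le> S * sinh (T - s) + S * sinh s" using S sn by (intro add_mono mult_right_mono) auto
  also have "\<dots> = S * (sinh (T - s) + sinh s)" by (simp add: algebra_simps)
  also have "\<dots> \<le> S * exp (T - L)" using 1 S0 by (intro mult_left_mono)
  finally have "\<bar>f s\<bar> * sinh T \<le> S * exp (T - L)" .
  moreover have "\<bar>f s\<bar> * (exp T / 4) \<le> \<bar>f s\<bar> * sinh T" using 2 by (intro mult_left_mono) auto
  moreover have "exp (T - L) = exp T * exp (- L)" by (simp flip: exp_add)
  ultimately have "\<bar>f s\<bar> * (exp T / 4) \<le> S * (exp T * exp (- L))" by (metis order_trans)
  then have "\<bar>f s\<bar> * exp T \<le> (4 * S * exp (- L)) * exp T" by (simp add: algebra_simps)
  then show ?thesis by simp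
qed

text \<open>In coordinates where \<open>P\<close> is the imaginary axis, each point is compared with
  the axis point of the same height, whose distance is at most |Re| / Im. This quantity is at most
  \<open>S\<close> at the ends, hence exponentially small at depth \<open>L\<close>.\<close>

lemma axis_close_middle:
  assumes P: "P \<in> SL2" and Q: "Q \<in> SL2"
    and ends: "cmod (act (madj P) (hline Q a)) / Im (act (madj P) (hline Q a)) \<le> S"
      "cmod (act (madj P) (hline Q b)) / Im (act (madj P) (hline Q b)) \<le> S"
    and s: "a + L \<le> s" "s \<le> b - L" "0 \<le> L" "1 \<le> b - a"
  shows "\<exists>r. hyp_dist (hline Q s) (hline P r) \<le> 4 * S * exp (- L)"
proof -
  let ?Q = "madj P \<odot> Q"
  have Q': "?Q \<in> SL2" using P Q by simp
  define \<phi> where "\<phi> = (\<lambda>s. Re (hline ?Q s) / Im (hline ?Q s))"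
  have hQ: "act (madj P) (hline Q s) = hline ?Q s" for s using P Q by (simp add: act_hline)
  have le: "\<bar>\<phi> t\<bar> \<le> cmod (hline ?Q t) / Im (hline ?Q t)" for t
    unfolding \<phi>_def abs_divide using Im_hline_pos[OF Q', of t] abs_Re_le_cmod[of "hline ?Q t"] by (simp add: divide_right_mono)
  define \<alpha> \<beta> where "\<alpha> = ma ?Q * mc ?Q * exp a" and "\<beta> = mb ?Q * md ?Q * exp (- a)"
  have \<phi>: "\<phi> (t + a) = \<alpha> * exp t + \<beta> * exp (- t)" for t
    unfolding \<phi>_def Re_div_Im_hline[OF Q'] \<alpha>_def \<beta>_def by (simp add: exp_add exp_diff exp_minus field_simps)
  have e1: "\<bar>\<alpha> * exp 0 + \<beta> * exp (- 0)\<bar> \<le> S" using le[of a] ends(1) \<phi>[of 0] unfolding hQ by simp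
  have e2: "\<bar>\<alpha> * exp (b - a) + \<beta> * exp (- (b - a))\<bar> \<le> S" using le[of b] ends(2) \<phi>[of "b - a"] unfolding hQ by simp
  have "\<bar>\<alpha> * exp (s - a) + \<beta> * exp (- (s - a))\<bar> \<le> 4 * S * exp (- L)"
    by (rule exp_combination_small[OF e1 e2]) (use s in auto)
  then have small: "\<bar>\<phi> s\<bar> \<le> 4 * S * exp (- L)" using \<phi>[of "s - a"] by simp
  define w where "w = hline ?Q s"
  have w: "Im w > 0" using Q' by (simp add: w_def)
  have "hline Q s = act P w" unfolding w_def using P Q by (simp flip: hQ)
  moreover have "hline P (ln (Im w)) = act P (of_real (Im w) * \<i>)" unfolding hline_def using w by simp
  ultimately have "hyp_dist (hline Q s) (hline P (ln (Im w))) = hyp_dist w (of_real (Im w) * \<i>)" using P w by simp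
  also have "\<dots> \<le> cmod (w - of_real (Im w) * \<i>) / sqrt (Im w * Im (of_real (Im w) * \<i>))"
    using w by (intro hyp_dist_le_euclidean) auto
  also have "w - of_real (Im w) * \<i> = of_real (Re w)" by (simp add: complex_eq_iff)
  also have "cmod (of_real (Re w)) / sqrt (Im w * Im (of_real (Im w) * \<i>)) = \<bar>\<phi> s\<bar>"
    using w by (simp add: \<phi>_def w_def abs_divide)
  finally show ?thesis using small order_trans by blast
qed

section \<open>Geodesics on the surface\<close>

lemma curve_length_le:
  assumes "v \<ge> 0" and lip: "\<And>s t. 0 \<le> s \<Longrightarrow> s \<le> t \<Longrightarrow> t \<le> 1 \<Longrightarrow> dist (c s) (c t) \<le> v * (t - s)"
  shows "curve_length c \<le> ennreal v"
  unfolding curve_length_def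
proof (rule SUP_least)
  fix ts assume "ts \<in> {ts. sorted ts \<and> set ts \<subseteq> {0..1::real}}"
  then have ts: "sorted ts" "set ts \<subseteq> {0..1}" by auto
  have nth: "ts ! i \<in> {0..1}" if "i < length ts" for i using that ts(2) nth_mem by blast
  let ?n = "length ts - 1"
  have tele: "(\<Sum>i<k. ts ! Suc i - ts ! i) = ts ! k - ts ! 0" for k by (induction k) auto
  have "(\<Sum>i<?n. ennreal (dist (c (ts ! i)) (c (ts ! Suc i)))) \<le> (\<Sum>i<?n. ennreal (v * (ts ! Suc i - ts ! i)))"
  proof (intro sum_mono ennreal_leI lip)
    fix i assume "i \<in> {..<?n}"
    then have i: "i < length ts" "Suc i < length ts" by auto
    show "0 \<le> ts ! i" "ts ! Suc i \<le> 1" using nth i by auto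
    show "ts ! i \<le> ts ! Suc i" using ts(1) i by (simp add: sorted_nth_mono)
  qed
  also have "\<dots> = ennreal (\<Sum>i<?n. v * (ts ! Suc i - ts ! i))"
    using ts(1) assms(1) by (intro sum_ennreal mult_nonneg_nonneg) (auto simp: sorted_nth_mono)
  also have "(\<Sum>i<?n. v * (ts ! Suc i - ts ! i)) = v * (ts ! ?n - ts ! 0)"
    unfolding sum_distrib_left[symmetric] tele ..
  also have "ennreal \<dots> \<le> ennreal v"
  proof (cases "ts = []")
    case False
    then have "ts ! ?n \<le> 1" "0 \<le> ts ! 0" using nth by auto
    then have "v * (ts ! ?n - ts ! 0) \<le> v * 1" using assms(1) by (intro mult_left_mono) auto
    then show ?thesis by (intro ennreal_leI) simp
  qed (use assms(1) in simp)
  finally show "(\<Sum>i<?n. ennreal (dist (c (ts ! i)) (c (ts ! Suc i)))) \<le> ennreal v" .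
qed

lemma len_le:
  assumes "v \<ge> 0" "\<And>s t. 0 \<le> s \<Longrightarrow> s \<le> t \<Longrightarrow> t \<le> 1 \<Longrightarrow> dist (c s) (c t) \<le> v * (t - s)"
  shows "len c \<le> v"
  unfolding len_def using curve_length_le[of v c] assms by (intro enn2real_leI) auto

lemma hline_shift:
  assumes "M \<in> SL2"
  shows "\<exists>N\<in>SL2. \<forall>u. hline N u = hline M (u + s)"
proof -
  define T where "T = Mat (exp (s/2)) 0 0 (exp (-s/2))"
  have T: "T \<in> SL2" by (simp add: SL2_def T_def flip: exp_add)
  have actT: "act T (of_real (exp u) * \<i>) = of_real (exp (u + s)) * \<i>" for u
  proof -
    have "exp (u + s) = exp (s/2) * exp u / exp (-s/2)" by (simp flip: exp_add exp_diff)
    then show ?thesis by (simp add: act_def T_def del: of_real_exp)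
  qed
  have "hline (M \<odot> T) u = hline M (u + s)" for u
    unfolding hline_def using assms T by (simp add: act_mmul actT del: of_real_exp)
  then show ?thesis using assms T by (intro bexI[of _ "M \<odot> T"]) auto
qed

lemma hline_eqI:
  assumes "M \<in> SL2" "N \<in> SL2" "a \<noteq> b" "hline M a = hline N a" "hline M b = hline N b"
  shows "hline M s = hline N s"
proof -
  have "M = N \<or> M = mneg N"
    by (rule act_eqI[of _ _ "of_real (exp a) * \<i>" "of_real (exp b) * \<i>"])
       (use assms in \<open>simp_all add: hline_def del: of_real_exp\<close>)
  then show ?thesis by (auto simp: hline_def)
qed

lemma exists_hline_param:
  assumes "v > 0" "a < b" and Im: "\<And>s. s \<in> {a..b} \<Longrightarrow> Im (\<sigma> s) > 0"
    and iso: "\<And>s s'. s \<in> {a..b} \<Longrightarrow> s' \<in> {a..b} \<Longrightarrow> hyp_dist (\<sigma> s) (\<sigma> s') = v * \<bar>s - s'\<bar>"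
  shows "\<exists>Q\<in>SL2. \<forall>s\<in>{a..b}. \<sigma> s = hline Q (v * s)"
proof -
  obtain R where R: "R \<in> SL2" "hline R 0 = \<sigma> a" "hline R (hyp_dist (\<sigma> a) (\<sigma> b)) = \<sigma> b"
    using exists_hline[of "\<sigma> a" "\<sigma> b"] Im assms by auto
  have d: "hyp_dist (\<sigma> a) (\<sigma> b) = v * (b - a)" using iso[of a b] assms by simp
  obtain Q where Q: "Q \<in> SL2" "\<And>u. hline Q u = hline R (u + (- v * a))" using hline_shift[OF R(1)] by metis
  have "\<sigma> s = hline Q (v * s)" if s: "s \<in> {a..b}" for s
  proof -
    have "\<sigma> s = hline R (v * (s - a))"
    proof (rule hline_unique[OF R(1), of _ 0 _ "v * (b - a)"])
      show "Im (\<sigma> s) > 0" using Im s by simp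
      show "0 \<le> v * (s - a)" "v * (s - a) \<le> v * (b - a)" using s assms by auto
      show "hyp_dist (hline R 0) (\<sigma> s) = v * (s - a) - 0" using iso[of a s] s R by simp
      show "hyp_dist (\<sigma> s) (hline R (v * (b - a))) = v * (b - a) - v * (s - a)"
        using iso[of s b] s R(3) assms unfolding d by (simp add: algebra_simps)
    qed
    then show ?thesis using Q(2) by (simp add: algebra_simps)
  qed
  then show ?thesis using Q by blast
qed

context covering
begin

text \<open>A deck transformation matches the two lines at one point. Local injectivity of
  \<open>\<pi>\<close> matches them at a second one nearby, and two points determine the line with
  its parametrisation.\<close>

lemma \<Gamma>_hline_eq:
  assumes Q: "Q \<in> SL2" "S \<in> SL2" and v: "v > 0" and ab: "a < b"
    and eq: "\<And>s. s \<in> {a..b} \<Longrightarrow> \<pi> (hline Q (v * s)) = \<pi> (hline S (v * s))"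
  shows "\<pi> (hline Q u) = \<pi> (hline S u)"
proof -
  let ?z = "hline S (v * a)"
  have "\<pi> (hline Q (v * a)) = \<pi> ?z" using eq ab by simp
  then obtain g where g: "g \<in> \<Gamma>" "act g (hline Q (v * a)) = ?z" using pi_eqE[of "hline Q (v * a)" ?z] Q by auto
  have gQ: "act g (hline Q s) = hline (g \<odot> Q) s" for s using g Q by (simp add: act_hline)
  obtain r where r: "r > 0" "\<forall>w\<in>hball ?z r. \<forall>w'\<in>hball ?z r. dist (\<pi> w) (\<pi> w') = hyp_dist w w'"
    using pi_local[of ?z] Q by auto
  define s where "s = min b (a + r / (2 * v))"
  have s: "a < s" "s \<le> b" "v * (s - a) < r"
  proof -
    show "a < s" "s \<le> b" using ab r v by (auto simp: s_def)
    have "v * (s - a) \<le> v * (r / (2 * v))" using v by (intro mult_left_mono) (auto simp: s_def)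
    then show "v * (s - a) < r" using v r by simp
  qed
  have d: "\<bar>v * a - v * s\<bar> < r"
  proof -
    have "\<bar>v * a - v * s\<bar> = v * (s - a)" using s(1) v by (simp add: abs_if algebra_simps)
    then show ?thesis using s by simp
  qed
  have "hline S (v * s) \<in> hball ?z r" using Q d by (simp add: hball_def)
  moreover have "hline (g \<odot> Q) (v * s) \<in> hball ?z r"
    using g Q d hyp_dist_hline[of "g \<odot> Q" "v * a" "v * s"] by (simp add: hball_def flip: gQ)
  moreover have "\<pi> (hline (g \<odot> Q) (v * s)) = \<pi> (hline S (v * s))" using eq[of s] s g Q by (simp flip: gQ)
  ultimately have "hyp_dist (hline (g \<odot> Q) (v * s)) (hline S (v * s)) = 0" using r(2) by (metis dist_self)
  then have "hline (g \<odot> Q) (v * s) = hline S (v * s)" using g Q by simp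
  moreover have "hline (g \<odot> Q) (v * a) = hline S (v * a)" using g(2) by (simp add: gQ)
  moreover have "v * a \<noteq> v * s" using s v by simp
  ultimately have "hline (g \<odot> Q) u = hline S u" using hline_eqI[of "g \<odot> Q" S "v * a" "v * s" u] g Q by simp
  then show ?thesis using g Q by (metis pi_\<Gamma> gQ Im_hline_pos)
qed

text \<open>Intervals that lift to a single line are enlarged by bisection. The inequality for the
  length uses a subdivision so fine that each of its chords has the exact length v / n.\<close>

lemma lift_geodesic_arc:
  assumes c: "geodesic_arc c" "path_image c \<subseteq> X"
  shows "\<exists>Q\<in>SL2. \<exists>v>0. (\<forall>t\<in>{0..1}. c t = \<pi> (hline Q (v * t))) \<and> v \<le> len c"
proof -
  obtain v where v: "v > 0" and geo: "\<And>t. t \<in> {0..1} \<Longrightarrow> \<exists>\<delta>>0. \<forall>s\<in>{0..1}. \<forall>s'\<in>{0..1}.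
        \<bar>s - t\<bar> < \<delta> \<and> \<bar>s' - t\<bar> < \<delta> \<longrightarrow> dist (c s) (c s') = v * \<bar>s - s'\<bar>"
    using c(1) unfolding geodesic_arc_def geodesic_on_def by blast
  have cX: "c t \<in> X" if "t \<in> {0..1}" for t using c(2) that by (auto simp: path_image_def)
  let ?P = "\<lambda>a b. 0 \<le> a \<and> b \<le> 1 \<and> a < b \<longrightarrow> (\<exists>Q\<in>SL2. \<forall>s\<in>{a..b}. c s = \<pi> (hline Q (v * s)))"
  have loc: "\<exists>d>0. \<forall>a b. a \<le> t \<and> t \<le> b \<and> b - a < d \<longrightarrow> ?P a b" if t: "0 \<le> t" "t \<le> 1" for t
  proof -
    have t01: "t \<in> {0..1}" using t by simp
    obtain \<delta> where \<delta>: "\<delta> > 0" "\<And>s s'. s \<in> {0..1} \<Longrightarrow> s' \<in> {0..1} \<Longrightarrow> \<bar>s - t\<bar> < \<delta> \<Longrightarrow> \<bar>s' - t\<bar> < \<delta> \<Longrightarrow> dist (c s) (c s') = v * \<bar>s - s'\<bar>"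
      using geo[OF t01] by blast
    obtain r where r: "good (c t) r" using exists_good cX[OF t01] by blast
    then have r0: "r > 0" by (simp add: good_def)
    obtain w where w: "Im w > 0" "\<pi> w = c t" using pi_surj[OF cX[OF t01]] by blast
    have gw: "good (\<pi> w) r" using r w by simp
    have "?P a b" if ab: "a \<le> t" "t \<le> b" "b - a < min \<delta> (r / v)" for a b
    proof
      assume h: "0 \<le> a \<and> b \<le> 1 \<and> a < b"
      have near: "s \<in> {0..1}" "\<bar>s - t\<bar> < \<delta>" "v * \<bar>s - t\<bar> < r" if "s \<in> {a..b}" for s
      proof -
        show "s \<in> {0..1}" using that h by auto
        have st: "\<bar>s - t\<bar> < min \<delta> (r / v)" using that ab by auto
        then show "\<bar>s - t\<bar> < \<delta>" by simp
        have "\<bar>s - t\<bar> < r / v" using st by simp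
        then show "v * \<bar>s - t\<bar> < r" using v by (simp add: pos_less_divide_eq mult.commute)
      qed
      have "\<forall>s\<in>{a..b}. \<exists>y. y \<in> hball w r \<and> \<pi> y = c s"
      proof
        fix s assume s: "s \<in> {a..b}"
        have "dist (c t) (c s) = v * \<bar>s - t\<bar>" using \<delta>(2)[OF t01 near(1)[OF s] _ near(2)[OF s]] \<delta>(1) by (simp add: abs_minus_commute)
        then have "dist (\<pi> w) (c s) < r" using near(3)[OF s] w by simp
        then show "\<exists>y. y \<in> hball w r \<and> \<pi> y = c s" using pi_good_ball(2)[OF w(1) gw] cX near(1)[OF s] by blast
      qed
      then obtain \<sigma> where \<sigma>: "\<forall>s\<in>{a..b}. \<sigma> s \<in> hball w r \<and> \<pi> (\<sigma> s) = c s" by (rule bchoice[THEN exE])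
      have "\<exists>Q\<in>SL2. \<forall>s\<in>{a..b}. \<sigma> s = hline Q (v * s)"
      proof (rule exists_hline_param[OF v])
        show "a < b" using h by simp
        show "Im (\<sigma> s) > 0" if "s \<in> {a..b}" for s using \<sigma> that hball_Im by blast
        fix s s' assume s: "s \<in> {a..b}" "s' \<in> {a..b}"
        have "\<sigma> s \<in> hball w r" "\<sigma> s' \<in> hball w r" using \<sigma> s by blast+
        then have "hyp_dist (\<sigma> s) (\<sigma> s') = dist (\<pi> (\<sigma> s)) (\<pi> (\<sigma> s'))" using pi_good_ball(1)[OF w(1) gw] by simp
        also have "\<dots> = dist (c s) (c s')" using \<sigma> s by simp
        also have "\<dots> = v * \<bar>s - s'\<bar>" using \<delta>(2) near s by blast
        finally show "hyp_dist (\<sigma> s) (\<sigma> s') = v * \<bar>s - s'\<bar>" .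
      qed
      then obtain Q where Q: "Q \<in> SL2" "\<forall>s\<in>{a..b}. \<sigma> s = hline Q (v * s)" by blast
      have "c s = \<pi> (hline Q (v * s))" if "s \<in> {a..b}" for s using \<sigma> Q(2) that by metis
      then show "\<exists>Q\<in>SL2. \<forall>s\<in>{a..b}. c s = \<pi> (hline Q (v * s))" using Q(1) by blast
    qed
    moreover have "min \<delta> (r / v) > 0" using \<delta> r0 v by simp
    ultimately show ?thesis by blast
  qed
  have "?P 0 1"
  proof (induction rule: Bolzano[where P = ?P, OF zero_le_one])
    case (1 a b d)
    show ?case
    proof
      assume h: "0 \<le> a \<and> d \<le> 1 \<and> a < d"
      show "\<exists>Q\<in>SL2. \<forall>s\<in>{a..d}. c s = \<pi> (hline Q (v * s))"
      proof (cases "a = b \<or> b = d")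
        case True
        then show ?thesis using 1 h by auto
      next
        case False
        then have abd: "a < b" "b < d" using 1 by auto
        obtain Q where Q: "Q \<in> SL2" "\<forall>s\<in>{a..b}. c s = \<pi> (hline Q (v * s))" using 1(1) h abd by auto
        obtain R where R: "R \<in> SL2" "\<forall>s\<in>{b..d}. c s = \<pi> (hline R (v * s))" using 1(2) h abd by auto
        have b01: "0 \<le> b" "b \<le> 1" using h abd by auto
        \<comment> \<open>Both pieces overlap with the lift \<open>S\<close> of a neighbourhood of
          the common endpoint, which exists because \<open>c\<close> is geodesic there; so there is
          no corner and \<open>S\<close> lifts both pieces.\<close>
        obtain \<delta> where \<delta>: "\<delta> > 0" "\<forall>a' b'. a' \<le> b \<and> b \<le> b' \<and> b' - a' < \<delta> \<longrightarrow> ?P a' b'" using loc[OF b01] by blast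
        define a' b' where "a' = max a (b - \<delta>/3)" and "b' = min d (b + \<delta>/3)"
        have ab': "a \<le> a'" "a' < b" "b < b'" "b' \<le> d" "b' - a' < \<delta>" using abd \<delta>(1) by (auto simp: a'_def b'_def)
        have "?P a' b'" using \<delta>(2) ab' by auto
        then obtain S where S: "S \<in> SL2" "\<forall>s\<in>{a'..b'}. c s = \<pi> (hline S (v * s))" using h ab' by auto
        have QS: "\<pi> (hline Q u) = \<pi> (hline S u)" for u
        proof (rule \<Gamma>_hline_eq[OF Q(1) S(1) v ab'(2)])
          fix s assume "s \<in> {a'..b}"
          then have "s \<in> {a..b}" "s \<in> {a'..b'}" using ab' by auto
          then show "\<pi> (hline Q (v * s)) = \<pi> (hline S (v * s))" using Q(2) S(2) by metis
        qed
        have RS: "\<pi> (hline R u) = \<pi> (hline S u)" for u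
        proof (rule \<Gamma>_hline_eq[OF R(1) S(1) v ab'(3)])
          fix s assume "s \<in> {b..b'}"
          then have "s \<in> {b..d}" "s \<in> {a'..b'}" using ab' by auto
          then show "\<pi> (hline R (v * s)) = \<pi> (hline S (v * s))" using R(2) S(2) by metis
        qed
        have "c s = \<pi> (hline S (v * s))" if "s \<in> {a..d}" for s
        proof (cases "s \<le> b")
          case True
          then have "s \<in> {a..b}" using that by simp
          then show ?thesis using Q(2) QS by metis
        next
          case False
          then have "s \<in> {b..d}" using that by simp
          then show ?thesis using R(2) RS by metis
        qed
        then show ?thesis using S(1) by blast
      qed
    qed
  next
    case (2 t)
    then show ?case by (rule loc)
  qed
  then obtain Q where Q: "Q \<in> SL2" "\<forall>t\<in>{0..1}. c t = \<pi> (hline Q (v * t))" by auto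
  have lip: "dist (c s) (c t) \<le> v * (t - s)" if "0 \<le> s" "s \<le> t" "t \<le> 1" for s t
  proof -
    have "c s = \<pi> (hline Q (v * s))" "c t = \<pi> (hline Q (v * t))" using Q(2) that by auto
    then have "dist (c s) (c t) \<le> hyp_dist (hline Q (v * s)) (hline Q (v * t))"
      using dist_pi_le[of "hline Q (v * s)" "hline Q (v * t)"] Q(1) by (simp del: hyp_dist_hline)
    also have "\<dots> = \<bar>v * s - v * t\<bar>" using Q by simp
    also have "\<dots> = v * (t - s)" using that v by (simp add: abs_if algebra_simps)
    finally show ?thesis .
  qed
  \<comment> \<open>Finiteness matters for \<open>len\<close>, since \<open>enn2real\<close> of an
    infinite length is 0.\<close>
  have fin: "curve_length c \<le> ennreal v" using lip v by (intro curve_length_le) auto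
  have "\<forall>t\<in>{0..1}. \<exists>V. open V \<and> t \<in> V \<and> (\<forall>s\<in>V \<inter> {0..1}. \<forall>s'\<in>V \<inter> {0..1}. dist (c s) (c s') = v * \<bar>s - s'\<bar>)"
  proof
    fix t :: real assume "t \<in> {0..1}"
    then obtain \<delta> where "\<delta> > 0" "\<forall>s\<in>{0..1}. \<forall>s'\<in>{0..1}. \<bar>s - t\<bar> < \<delta> \<and> \<bar>s' - t\<bar> < \<delta> \<longrightarrow> dist (c s) (c s') = v * \<bar>s - s'\<bar>"
      using geo by blast
    then show "\<exists>V. open V \<and> t \<in> V \<and> (\<forall>s\<in>V \<inter> {0..1}. \<forall>s'\<in>V \<inter> {0..1}. dist (c s) (c s') = v * \<bar>s - s'\<bar>)"
      by (intro exI[of _ "ball t \<delta>"]) (auto simp: dist_real_def abs_minus_commute)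
  qed
  then obtain V where V: "\<forall>t\<in>{0..1}. open (V t) \<and> t \<in> V t \<and> (\<forall>s\<in>V t \<inter> {0..1}. \<forall>s'\<in>V t \<inter> {0..1}. dist (c s) (c s') = v * \<bar>s - s'\<bar>)"
    by (rule bchoice[THEN exE])
  obtain e where e: "e > 0" "\<And>s. s \<in> {0..1} \<Longrightarrow> \<exists>G\<in>V ` {0..1}. ball s e \<subseteq> G"
    by (rule Heine_Borel_lemma[of "{0..1::real}" "V ` {0..1}"]) (use V in auto)
  obtain n :: nat where n: "n \<ge> 1" "1 / real n < e"
  proof -
    obtain m :: nat where "m > 1 / e" using reals_Archimedean2 by blast
    then have "1 / real (Suc m) < e" using e by (simp add: field_simps)
    then show ?thesis using that[of "Suc m"] by simp
  qed
  have step: "dist (c (real i / real n)) (c (real (Suc i) / real n)) = v / real n" if i: "i < n" for i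
  proof -
    have t01: "real i / real n \<in> {0..1}" "real (Suc i) / real n \<in> {0..1}" using i by auto
    obtain t where t: "t \<in> {0..1}" "ball (real i / real n) e \<subseteq> V t" using e(2)[OF t01(1)] by auto
    have d: "\<bar>real i / real n - real (Suc i) / real n\<bar> = 1 / real n" using n by (simp add: field_simps abs_if)
    then have "real (Suc i) / real n \<in> ball (real i / real n) e" using n by (simp add: dist_real_def)
    moreover have "real i / real n \<in> ball (real i / real n) e" using e by simp
    ultimately have "dist (c (real i / real n)) (c (real (Suc i) / real n)) = v * \<bar>real i / real n - real (Suc i) / real n\<bar>"
      using V t t01 by blast
    then show ?thesis unfolding d by simp
  qed
  have "ennreal v = (\<Sum>i<n. ennreal (v / real n))"
  proof -
    have "(\<Sum>i<n. ennreal (v / real n)) = ennreal (\<Sum>i<n. v / real n)" using v by (intro sum_ennreal) simp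
    then show ?thesis using n by simp
  qed
  also have "\<dots> = (\<Sum>i<n. ennreal (dist (c (real i / real n)) (c (real (Suc i) / real n))))" using step by simp
  also have "\<dots> \<le> curve_length c" by (rule sum_dist_le_curve_length[OF n(1)])
  finally have "curve_length c = ennreal v" using fin by simp
  then have "len c = v" using v by (simp add: len_def)
  then show ?thesis using Q v by auto
qed

lemma closed_geodesic_axis:
  assumes P: "P \<in> SL2" "l > 0" and G: "G \<in> \<Gamma>" "\<And>s. act G (hline P s) = hline P (s + l)"
  defines "\<gamma> \<equiv> \<lambda>t. \<pi> (hline P (l * t))"
  shows "closed_geodesic \<gamma>" "range \<gamma> \<subseteq> X" "len \<gamma> \<le> l" "\<And>r. \<pi> (hline P r) \<in> range \<gamma>"
proof -
  have "geodesic_on UNIV \<gamma>" unfolding geodesic_on_def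
  proof (rule exI[of _ l], intro conjI ballI P(2))
    fix t :: real
    obtain r where r: "r > 0" "\<forall>w\<in>hball (hline P (l * t)) r. \<forall>w'\<in>hball (hline P (l * t)) r. dist (\<pi> w) (\<pi> w') = hyp_dist w w'"
      using pi_local[of "hline P (l * t)"] P by auto
    have abs_l: "\<bar>l * a - l * b\<bar> = l * \<bar>a - b\<bar>" for a b using P(2) by (metis abs_mult abs_of_pos right_diff_distrib)
    have "dist (\<gamma> s) (\<gamma> s') = l * \<bar>s - s'\<bar>" if "\<bar>s - t\<bar> < r / l" "\<bar>s' - t\<bar> < r / l" for s s'
    proof -
      have "l * \<bar>t - s\<bar> < r" "l * \<bar>t - s'\<bar> < r" using that P(2) by (simp_all add: pos_less_divide_eq mult.commute abs_minus_commute)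
      then have "hline P (l * s) \<in> hball (hline P (l * t)) r" "hline P (l * s') \<in> hball (hline P (l * t)) r"
        using P by (simp_all add: hball_def abs_l)
      then show ?thesis unfolding \<gamma>_def using r(2) P by (simp add: abs_l)
    qed
    then show "\<exists>\<delta>>0. \<forall>s\<in>UNIV. \<forall>s'\<in>UNIV. \<bar>s - t\<bar> < \<delta> \<and> \<bar>s' - t\<bar> < \<delta> \<longrightarrow> dist (\<gamma> s) (\<gamma> s') = l * \<bar>s - s'\<bar>"
      using r(1) P(2) by (intro exI[of _ "r / l"]) auto
  qed
  moreover have "\<gamma> (t + 1) = \<gamma> t" for t
  proof -
    have "\<gamma> (t + 1) = \<pi> (act G (hline P (l * t)))" unfolding \<gamma>_def G(2) by (simp add: algebra_simps)
    also have "\<dots> = \<gamma> t" unfolding \<gamma>_def using G(1) P(1) by (intro pi_\<Gamma>) auto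
    finally show ?thesis .
  qed
  ultimately show "closed_geodesic \<gamma>" unfolding closed_geodesic_def by blast
  show "range \<gamma> \<subseteq> X" unfolding \<gamma>_def using pi_in P by auto
  show "len \<gamma> \<le> l"
  proof (rule len_le)
    fix s t :: real assume st: "0 \<le> s" "s \<le> t" "t \<le> 1"
    have "dist (\<gamma> s) (\<gamma> t) \<le> hyp_dist (hline P (l * s)) (hline P (l * t))" unfolding \<gamma>_def using P by (intro dist_pi_le) auto
    also have "\<dots> = \<bar>l * s - l * t\<bar>" using P by simp
    also have "\<dots> = l * (t - s)" using st P by (simp add: abs_if algebra_simps)
    finally show "dist (\<gamma> s) (\<gamma> t) \<le> l * (t - s)" .
  qed (use P in simp)
  show "\<pi> (hline P r) \<in> range \<gamma>" for r unfolding \<gamma>_def using P by (intro image_eqI[of _ _ "r / l"]) auto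
qed

end

section \<open>Closing up\<close>

lemma gp_chain:
  assumes "Im u > 0" "Im v > 0" "Im w > 0" "Im s > 0"
  shows "gp u s v \<le> gp u w v + gp u s w"
  using hyp_dist_triangle[of s w v] assms gp2[of u s v] gp2[of u w v] gp2[of u s w] hyp_dist_commute[of w v]
  by linarith

text \<open>A connection runs from the end \<open>v\<close> of an arc through orbit points
  \<open>w\<close> and \<open>y\<close> to the start \<open>s\<close> of the next arc;
  \<open>u\<close> and \<open>z\<close> are the far ends of these arcs. The sides from
  \<open>v\<close> to \<open>w\<close> and from \<open>y\<close> to \<open>s\<close> may be short,
  so \<open>w\<close> and \<open>y\<close> cannot serve as vertices. They are dropped, using that
  the side between them is long: corners worsen by 14 = 12 + 2, and 6 C + 100 is enough to keep the
  direct side from \<open>v\<close> to \<open>s\<close> long.\<close>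

lemma corners:
  assumes Im: "Im u > 0" "Im v > 0" "Im w > 0" "Im y > 0" "Im s > 0" "Im z > 0"
    and h: "gp u w v \<le> C" "gp u y w \<le> 12" "gp z w y \<le> 12" "gp z y s \<le> C" "6 * C + 100 \<le> hyp_dist w y" "C \<ge> 0"
  shows "gp u s v \<le> C + 14" "gp v z s \<le> C + 14" "2 * (C + 14) + 9 \<le> hyp_dist v s"
proof -
  have tri: "gp v y w \<le> gp u w v + gp u y w"
    using hyp_dist_triangle[OF Im(1,2,4)] gp2[of v y w] gp2[of u w v] gp2[of u y w] hyp_dist_commute[of w v] by linarith
  have tri2: "gp w s y \<le> gp z w y + gp z y s"
    using hyp_dist_triangle[OF Im(3,5,6)] gp2[of w s y] gp2[of z w y] gp2[of z y s] hyp_dist_commute[of y s] hyp_dist_commute[of s z] hyp_dist_commute[of z w] by linarith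
  have ysw: "gp y s w \<ge> 6 * C + 100 - (C + 12)"
    using gp_shift[of y s w] tri2 h by linarith
  have "gp u s w \<le> gp u y w + 2 \<or> gp y s w \<le> gp u y w + 2" using Im by (intro gp_hyperbolic) auto
  then have usw: "gp u s w \<le> 14" using h ysw by linarith
  then show "gp u s v \<le> C + 14" using gp_chain[of u v w s] Im h by linarith
  have wvy: "gp w v y \<ge> 6 * C + 100 - (C + 12)"
    using gp_shift[of w v y] gp_commute[of y v w] hyp_dist_commute[of y w] tri h by linarith
  have "gp z v y \<le> gp z w y + 2 \<or> gp w v y \<le> gp z w y + 2" using Im by (intro gp_hyperbolic) auto
  then have "gp z v y \<le> 14" using h wvy by linarith
  then show "gp v z s \<le> C + 14" using gp_chain[of z s y v] Im h gp_commute[of v z s] by linarith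
  have "hyp_dist u s \<le> hyp_dist u v + hyp_dist v s" using Im by (intro hyp_dist_triangle)
  moreover have "hyp_dist u s = hyp_dist u w + hyp_dist s w - 2 * gp u s w" using gp2[of u s w] by simp
  moreover have "hyp_dist u w = hyp_dist u v + hyp_dist w v - 2 * gp u w v" using gp2[of u w v] by simp
  moreover have "hyp_dist s w = hyp_dist w y + hyp_dist s y - 2 * gp w s y" using gp2[of w s y] hyp_dist_commute[of s w] by simp
  moreover have "hyp_dist w v \<ge> 0" "hyp_dist s y \<ge> 0" using Im by auto
  moreover have "gp w s y \<le> C + 12" using tri2 h by linarith
  ultimately have "2 * C + 48 \<le> hyp_dist v s"
    using h(1,5) usw by linarith
  then show "2 * (C + 14) + 9 \<le> hyp_dist v s" by (simp add: algebra_simps)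
qed

lemma hyp_dist_polygon:
  assumes "\<And>k. Im (x k) > 0"
  shows "hyp_dist (x 0) (x n) \<le> (\<Sum>k<n. hyp_dist (x k) (x (Suc k)))"
proof (induction n)
  case (Suc n)
  have "hyp_dist (x 0) (x (Suc n)) \<le> hyp_dist (x 0) (x n) + hyp_dist (x n) (x (Suc n))"
    using assms by (intro hyp_dist_triangle)
  then show ?case using Suc by simp
qed simp

context finite_area_covering
begin

text \<open>The geodesic segments \<open>Q i\<close> are extended by \<open>E\<close> at both ends and connected cyclically through orbit
  points of \<open>\<i>\<close>. Backtracking is avoided at both ends of every connection, so the result is a periodic
  broken geodesic, and its translation \<open>G\<close> is hyperbolic with axis \<open>P\<close>.\<close>

lemma cyclic_connection:
  assumes Ca0: "Ca \<ge> 0" "\<forall>q u t. Im q > 0 \<and> Im u > 0 \<and> near q t \<longrightarrow>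
      (\<exists>g\<in>\<Gamma>. hyp_dist q (act g \<i>) \<le> t + Ca \<and> gp u (act g \<i>) q \<le> Ca)"
    and L20: "\<forall>p q. Im p > 0 \<and> Im q > 0 \<longrightarrow> (\<exists>f\<in>\<Gamma>. gp p (act f \<i>) \<i> \<le> 12 \<and> gp q (act (madj f) \<i>) \<i> \<le> 12 \<and>
      6 * Ca + 100 \<le> hyp_dist \<i> (act f \<i>) \<and> hyp_dist \<i> (act f \<i>) \<le> L2)"
    and N: "N \<ge> 1" and Q0: "\<forall>i<N. Q i \<in> SL2 \<and> v i > 0"
    and near0: "\<forall>i<N. near (hline (Q i) 0) T \<and> near (hline (Q i) (v i)) T"
    and E: "2 * (Ca + 14) + 9 \<le> E"
  shows "\<exists>h :: nat \<Rightarrow> mat2. \<exists>P\<in>SL2. \<exists>l>0. \<exists>G\<in>\<Gamma>. (\<forall>k. h k \<in> \<Gamma>) \<and> (\<forall>s. act G (hline P s) = hline P (s + l)) \<and>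
     l \<le> (\<Sum>i<N. v i) + real N * (4 * E + 2 * T + 2 * Ca + L2) \<and>
     (\<forall>i<N. \<forall>s. 0 \<le> s \<and> s \<le> v i \<longrightarrow> (\<exists>r. hyp_dist (hline (h i \<odot> Q i) s) (hline P r) \<le> 8 * exp (Ca + 18) * exp (- E)))"
proof -
  note Ca = Ca0(1) Ca0(2)[rule_format, OF conjI[OF _ conjI]]
  note L2 = L20[rule_format, OF conjI]
  have Q: "\<And>i. i < N \<Longrightarrow> Q i \<in> SL2" "\<And>i. i < N \<Longrightarrow> v i > 0" using Q0 by auto
  have near: "\<And>i. i < N \<Longrightarrow> near (hline (Q i) 0) T" "\<And>i. i < N \<Longrightarrow> near (hline (Q i) (v i)) T" using near0 by auto
  define a where "a = (\<lambda>i. hline (Q i) (- E))"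
  define b where "b = (\<lambda>i. hline (Q i) (v i + E))"
  have E0: "E \<ge> 0" using E Ca by simp
  have Im: "Im (a i) > 0" "Im (b i) > 0" if "i < N" for i using Q that by (auto simp: a_def b_def)
  have dab: "hyp_dist (a i) (b i) = v i + 2 * E" if "i < N" for i
    using Q(1)[OF that] Q(2)[OF that] E0 by (simp add: a_def b_def)
  have na: "near (a i) (E + T)" if "i < N" for i
    using near_triangle[OF near(1)[OF that], of "a i"] Q(1)[OF that] E0 by (simp add: a_def)
  have nb: "near (b i) (E + T)" if "i < N" for i
    using near_triangle[OF near(2)[OF that], of "b i"] Q(1)[OF that] E0 by (simp add: b_def)
  have "\<forall>i\<in>{..<N}. \<exists>g. g \<in> \<Gamma> \<and> hyp_dist (a i) (act g \<i>) \<le> E + T + Ca \<and> gp (b i) (act g \<i>) (a i) \<le> Ca"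
    using Ca(2)[OF Im na] by blast
  then obtain gm where "\<forall>i\<in>{..<N}. gm i \<in> \<Gamma> \<and> hyp_dist (a i) (act (gm i) \<i>) \<le> E + T + Ca \<and> gp (b i) (act (gm i) \<i>) (a i) \<le> Ca"
    by (rule bchoice[THEN exE])
  then have gm: "gm i \<in> \<Gamma>" "hyp_dist (a i) (act (gm i) \<i>) \<le> E + T + Ca" "gp (b i) (act (gm i) \<i>) (a i) \<le> Ca" if "i < N" for i
    using that by auto
  have "\<forall>i\<in>{..<N}. \<exists>g. g \<in> \<Gamma> \<and> hyp_dist (b i) (act g \<i>) \<le> E + T + Ca \<and> gp (a i) (act g \<i>) (b i) \<le> Ca"
    using Ca(2)[OF Im(2,1) nb] by blast
  then obtain gq where "\<forall>i\<in>{..<N}. gq i \<in> \<Gamma> \<and> hyp_dist (b i) (act (gq i) \<i>) \<le> E + T + Ca \<and> gp (a i) (act (gq i) \<i>) (b i) \<le> Ca"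
    by (rule bchoice[THEN exE])
  then have gq: "gq i \<in> \<Gamma>" "hyp_dist (b i) (act (gq i) \<i>) \<le> E + T + Ca" "gp (a i) (act (gq i) \<i>) (b i) \<le> Ca" if "i < N" for i
    using that by auto
  define nx where "nx = (\<lambda>i. Suc i mod N)"
  have nx: "nx i < N" for i using N by (simp add: nx_def)
  have "\<forall>i\<in>{..<N}. \<exists>f. f \<in> \<Gamma> \<and> gp (act (madj (gq i)) (a i)) (act f \<i>) \<i> \<le> 12 \<and> gp (act (madj (gm (nx i))) (b (nx i))) (act (madj f) \<i>) \<i> \<le> 12 \<and>
      6 * Ca + 100 \<le> hyp_dist \<i> (act f \<i>) \<and> hyp_dist \<i> (act f \<i>) \<le> L2"
  proof
    fix i assume "i \<in> {..<N}"
    then have "Im (act (madj (gq i)) (a i)) > 0" "Im (act (madj (gm (nx i))) (b (nx i))) > 0"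
      using Im gq(1) gm(1) nx by auto
    from L2[OF this] show "\<exists>f. f \<in> \<Gamma> \<and> gp (act (madj (gq i)) (a i)) (act f \<i>) \<i> \<le> 12 \<and> gp (act (madj (gm (nx i))) (b (nx i))) (act (madj f) \<i>) \<i> \<le> 12 \<and>
      6 * Ca + 100 \<le> hyp_dist \<i> (act f \<i>) \<and> hyp_dist \<i> (act f \<i>) \<le> L2" by blast
  qed
  then obtain f where "\<forall>i\<in>{..<N}. f i \<in> \<Gamma> \<and> gp (act (madj (gq i)) (a i)) (act (f i) \<i>) \<i> \<le> 12 \<and> gp (act (madj (gm (nx i))) (b (nx i))) (act (madj (f i)) \<i>) \<i> \<le> 12 \<and>
      6 * Ca + 100 \<le> hyp_dist \<i> (act (f i) \<i>) \<and> hyp_dist \<i> (act (f i) \<i>) \<le> L2"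
    by (rule bchoice[THEN exE])
  then have f: "f i \<in> \<Gamma>" "gp (act (madj (gq i)) (a i)) (act (f i) \<i>) \<i> \<le> 12" "gp (act (madj (gm (nx i))) (b (nx i))) (act (madj (f i)) \<i>) \<i> \<le> 12"
      "6 * Ca + 100 \<le> hyp_dist \<i> (act (f i) \<i>)" "hyp_dist \<i> (act (f i) \<i>) \<le> L2" if "i < N" for i
    using that by auto
  \<comment> \<open>\<open>S i\<close> places the next arc at the end of the connection: it maps the
    orbit point that precedes this arc to the endpoint of the connecting side that starts at
    \<open>gq i\<close> applied to \<open>\<i>\<close>.\<close>
  define S where "S = (\<lambda>i. gq i \<odot> f i \<odot> madj (gm (nx i)))"
  have S: "S i \<in> \<Gamma>" if "i < N" for i unfolding S_def using that gq(1) gm(1) f(1) nx by simp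
  have turn: "gp (a i) (act (S i) (a (nx i))) (b i) \<le> Ca + 14"
    "gp (b i) (act (S i) (b (nx i))) (act (S i) (a (nx i))) \<le> Ca + 14"
    "2 * (Ca + 14) + 9 \<le> hyp_dist (b i) (act (S i) (a (nx i)))"
    "hyp_dist (b i) (act (S i) (a (nx i))) \<le> 2 * (E + T + Ca) + L2" if i: "i < N" for i
  proof -
    define w where "w = act (gq i) \<i>"
    define y where "y = act (gq i) (act (f i) \<i>)"
    define s where "s = act (S i) (a (nx i))"
    define z where "z = act (S i) (b (nx i))"
    note G = gq(1)[OF i] gm(1)[OF nx, of i] f(1)[OF i] S[OF i] and I = Im[OF i] Im[OF nx, of i]
    have ImW: "Im w > 0" "Im y > 0" "Im s > 0" "Im z > 0" using G I by (auto simp: w_def y_def s_def z_def)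
    have yS: "y = act (S i) (act (gm (nx i)) \<i>)" using G by (simp add: y_def S_def act_mmul)
    have "gp (act (gq i) (act (madj (gq i)) (a i))) (act (gq i) (act (f i) \<i>)) (act (gq i) \<i>) \<le> 12"
      using f(2)[OF i] G I by (subst gp_act) auto
    then have uyw: "gp (a i) y w \<le> 12" using G I by (simp add: y_def w_def)
    have zE: "act (gq i \<odot> f i) (act (madj (gm (nx i))) (b (nx i))) = z" using G I by (simp add: z_def S_def act_mmul)
    have "gp (act (gq i \<odot> f i) (act (madj (gm (nx i))) (b (nx i)))) (act (gq i \<odot> f i) (act (madj (f i)) \<i>)) (act (gq i \<odot> f i) \<i>) \<le> 12"
      using f(3)[OF i] G I by (subst gp_act) auto
    then have zwy: "gp z w y \<le> 12" unfolding zE using G by (simp add: y_def w_def act_mmul)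
    have zys: "gp z y s \<le> Ca" unfolding z_def s_def yS using gm(3)[OF nx, of i] G I by (subst gp_act) auto
    have dwy: "hyp_dist w y = hyp_dist \<i> (act (f i) \<i>)" unfolding w_def y_def using G by simp
    show "gp (a i) (act (S i) (a (nx i))) (b i) \<le> Ca + 14"
      "gp (b i) (act (S i) (b (nx i))) (act (S i) (a (nx i))) \<le> Ca + 14"
      "2 * (Ca + 14) + 9 \<le> hyp_dist (b i) (act (S i) (a (nx i)))"
      using corners[OF I(1,2) ImW gq(3)[OF i, folded w_def] uyw zwy zys _ Ca(1)] f(4)[OF i] unfolding dwy s_def z_def by auto
    have "hyp_dist (b i) s \<le> hyp_dist (b i) w + hyp_dist w s" using I ImW by (intro hyp_dist_triangle) auto
    also have "hyp_dist w s \<le> hyp_dist w y + hyp_dist y s" using I ImW by (intro hyp_dist_triangle) auto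
    also have "hyp_dist y s = hyp_dist (a (nx i)) (act (gm (nx i)) \<i>)" unfolding yS s_def using G I by (simp add: hyp_dist_commute)
    finally have "hyp_dist (b i) s \<le> hyp_dist (b i) w + (hyp_dist w y + hyp_dist (a (nx i)) (act (gm (nx i)) \<i>))"
      by simp
    also have "\<dots> \<le> (E + T + Ca) + (L2 + (E + T + Ca))"
      using gq(2)[OF i, folded w_def] gm(2)[OF nx, of i] f(5)[OF i] dwy by (intro add_mono) simp_all
    finally show "hyp_dist (b i) (act (S i) (a (nx i))) \<le> 2 * (E + T + Ca) + L2"
      unfolding s_def by (simp add: algebra_simps)
  qed
  \<comment> \<open>\<open>h k\<close> is the position of the k-th arc in the unrolled path;
    \<open>h N\<close> shifts the numbering by one round and is the holonomy.\<close>
  define h where "h = rec_nat mid (\<lambda>k M. M \<odot> S (k mod N))"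
  have h: "h 0 = mid" "h (Suc k) = h k \<odot> S (k mod N)" for k by (simp_all add: h_def)
  have h\<Gamma>: "h k \<in> \<Gamma>" for k using N by (induction k) (auto simp: h S)
  have hN: "h (k + N) = h N \<odot> h k" for k
    by (induction k) (simp_all add: h mmul_assoc)
  \<comment> \<open>Even vertices are the starts and odd vertices the ends of the lengthened arcs,
    so one period has 2 N sides.\<close>
  define x where "x = (\<lambda>k. if even k then act (h (k div 2)) (a (k div 2 mod N)) else act (h (k div 2)) (b (k div 2 mod N)))"
  have xe: "x (2 * k) = act (h k) (a (k mod N))" and xo: "x (Suc (2 * k)) = act (h k) (b (k mod N))" for k
    by (simp_all add: x_def)
  have modN: "k mod N < N" for k using N by simp
  have nxm: "nx (k mod N) = Suc k mod N" for k by (simp add: nx_def mod_Suc_eq)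
  have xe': "x (Suc (Suc (2 * k))) = act (h k) (act (S (k mod N)) (a (nx (k mod N))))" for k
    using xe[of "Suc k"] h\<Gamma> S[OF modN, of k] Im(1)[OF modN, of "Suc k"] by (simp add: h act_mmul nxm)
  have xo': "x (Suc (Suc (Suc (2 * k)))) = act (h k) (act (S (k mod N)) (b (nx (k mod N))))" for k
    using xo[of "Suc k"] h\<Gamma> S[OF modN, of k] Im(2)[OF modN, of "Suc k"] by (simp add: h act_mmul nxm)
  have Imx: "Im (x k) > 0" for k unfolding x_def using h\<Gamma> Im modN by auto
  have side_e: "hyp_dist (x (2 * k)) (x (Suc (2 * k))) = v (k mod N) + 2 * E" for k
    unfolding xe xo using h\<Gamma> Im[OF modN] dab[OF modN] by simp
  have ImS: "Im (act (S (k mod N)) (a (nx (k mod N)))) > 0" "Im (act (S (k mod N)) (b (nx (k mod N)))) > 0" for k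
    using S[OF modN] Im[OF nx] by auto
  have side_o: "hyp_dist (x (Suc (2 * k))) (x (Suc (Suc (2 * k)))) = hyp_dist (b (k mod N)) (act (S (k mod N)) (a (nx (k mod N))))" for k
    unfolding xo xe' using h\<Gamma> Im(2)[OF modN] ImS by simp
  interpret broken_geodesic x "Ca + 14" "2 * (Ca + 14) + 9"
  proof
    show "0 < Im (x k)" for k by (rule Imx)
    show "0 \<le> Ca + 14" using Ca by simp
    show "2 * (Ca + 14) + 9 \<le> hyp_dist (x k) (x (Suc k))" for k
    proof (cases "even k")
      case True
      then obtain m where m: "k = 2 * m" by (elim evenE)
      show ?thesis unfolding m side_e using E E0 Q(2)[OF modN, of m] by simp
    next
      case False
      then obtain m where m: "k = Suc (2 * m)" by (elim oddE) simp
      show ?thesis unfolding m side_o using turn(3)[OF modN] .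
    qed
    show "gp (x k) (x (Suc (Suc k))) (x (Suc k)) \<le> Ca + 14" for k
    proof (cases "even k")
      case True
      then obtain m where m: "k = 2 * m" by (elim evenE)
      show ?thesis unfolding m xe' unfolding xe xo
        using turn(1)[OF modN, of m] h\<Gamma>[of m] Im[OF modN, of m] ImS[of m] by (subst gp_act) auto
    next
      case False
      then obtain m where m: "k = Suc (2 * m)" by (elim oddE) simp
      show ?thesis unfolding m xe' xo' unfolding xo
        using turn(2)[OF modN, of m] h\<Gamma>[of m] Im[OF modN, of m] ImS[of m] by (subst gp_act) auto
    qed
  qed simp
  have per0: "x (k + 2 * N) = act (h N) (x k)" for k
  proof -
    have "(k + 2 * N) div 2 = k div 2 + N" by simp
    then show ?thesis unfolding x_def using hN[of "k div 2"] h\<Gamma> Im[OF modN, of "k div 2"] by (simp add: act_mmul add.commute)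
  qed
  have p0: "2 * N > 0" using N by simp
  have nontriv: "h N \<noteq> mid" "h N \<noteq> mneg mid"
    using periodic_growth(2)[OF \<Gamma>_SL2[OF h\<Gamma>] per0 p0, of 0] Ca by auto
  obtain G where G: "G \<in> \<Gamma>" "mtr G \<ge> 2" "\<And>z. act G z = act (h N) z"
  proof (cases "mtr (h N) \<ge> 2")
    case True
    then show ?thesis using that h\<Gamma> by blast
  next
    case False
    then have "mtr (mneg (h N)) \<ge> 2" using \<Gamma>_trace[OF h\<Gamma> nontriv] by (auto simp: mtr_def mneg_def)
    then show ?thesis using that[of "mneg (h N)"] h\<Gamma> by simp
  qed
  have GS: "G \<in> SL2" using G by simp
  have per: "x (k + 2 * N) = act G (x k)" for k using per0 G by simp
  note growth = periodic_growth[OF GS per p0]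
  have "mtr G > 2"
  proof (rule linear_growth_hyperbolic[OF GS G(2) Imx])
    show "0 < hyp_dist (x 0) (act G (x 0)) - 2 * (Ca + 14 + 4)" using growth(2)[of 0] by linarith
  qed (rule growth(1))
  then obtain P l where P: "P \<in> SL2" "l > 0" "mconj P G = Mat (exp (l / 2)) 0 0 (exp (- l / 2))"
    using hyperbolic_diagonal[OF GS] by blast
  let ?c = "2 * (Ca + 14 + 4)"
  have c0: "?c \<ge> 0" using Ca by simp
  have c2: "?c / 2 = Ca + 18" by simp
  note close = axis_close[OF P(1) GS P(2,3) Imx c0 growth(2) growth(1), unfolded c2]
  have l_le: "l \<le> (\<Sum>i<N. v i) + real N * (4 * E + 2 * T + 2 * Ca + L2)"
  proof -
    have "l \<le> hyp_dist (x 0) (x (2 * N))" using close(2)[of 0] per[of 0] by simp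
    also have "\<dots> \<le> (\<Sum>k<2 * N. hyp_dist (x k) (x (Suc k)))" by (rule hyp_dist_polygon[OF Imx])
    also have "\<dots> = (\<Sum>k<N. hyp_dist (x (2 * k)) (x (Suc (2 * k))) + hyp_dist (x (Suc (2 * k))) (x (Suc (Suc (2 * k)))))"
      for n by (induction N) auto
    also have "\<dots> \<le> (\<Sum>k<N. (v k + 2 * E) + (2 * (E + T + Ca) + L2))"
    proof (intro sum_mono add_mono)
      fix k assume "k \<in> {..<N}"
      then have k: "k < N" "k mod N = k" by auto
      show "hyp_dist (x (2 * k)) (x (Suc (2 * k))) \<le> v k + 2 * E" unfolding side_e using k by simp
      show "hyp_dist (x (Suc (2 * k))) (x (Suc (Suc (2 * k)))) \<le> 2 * (E + T + Ca) + L2"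
        unfolding side_o k(2) by (rule turn(4)[OF k(1)])
    qed
    also have "\<dots> = (\<Sum>i<N. v i) + real N * (4 * E + 2 * T + 2 * Ca + L2)" by (simp add: sum.distrib algebra_simps)
    finally show ?thesis .
  qed
  have mid_close: "\<exists>r. hyp_dist (hline (h i \<odot> Q i) s) (hline P r) \<le> 8 * exp (Ca + 18) * exp (- E)"
    if i: "i < N" and s: "0 \<le> s" "s \<le> v i" for i s
  proof -
    have hq: "h i \<odot> Q i \<in> SL2" using h\<Gamma>[of i] Q(1)[OF i] by simp
    have e: "hline (h i \<odot> Q i) (- E) = x (2 * i)" "hline (h i \<odot> Q i) (v i + E) = x (Suc (2 * i))"
      unfolding xe xo using i h\<Gamma>[of i] Q(1)[OF i] by (simp_all add: a_def b_def act_hline)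
    have "\<exists>r. hyp_dist (hline (h i \<odot> Q i) s) (hline P r) \<le> 4 * (2 * exp (Ca + 18)) * exp (- E)"
      by (rule axis_close_middle[OF P(1) hq, of "- E" _ "v i + E"])
         (use close(1)[of "2 * i"] close(1)[of "Suc (2 * i)"] s E E0 Ca Q(2)[OF i] in \<open>auto simp: e\<close>)
    then show ?thesis by simp
  qed
  show ?thesis
    by (rule exI[of _ h], rule bexI[OF _ P(1)], rule exI[of _ l], intro conjI P(2) bexI[OF _ G(1)] allI impI)
       (use h\<Gamma> hline_mconj[OF P(1) GS P(3)] l_le mid_close in auto)
qed

lemma exists_closed_geodesic:
  "\<exists>K. \<forall>\<epsilon> \<xi> N (c :: nat \<Rightarrow> real \<Rightarrow> 'a). 0 < \<epsilon> \<and> \<epsilon> \<le> 1 \<and> 0 < \<xi> \<and> \<xi> \<le> 1 \<and> 1 \<le> N \<and>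
    (\<forall>i\<in>{1..N}. geodesic_arc (c i) \<and> path_image (c i) \<subseteq> truncated X \<xi>) \<longrightarrow>
    (\<exists>\<gamma>. closed_geodesic \<gamma> \<and> range \<gamma> \<subseteq> X \<and>
       len \<gamma> \<le> (\<Sum>i=1..N. len (c i)) + real N * (K + 4 * ln (1 / \<epsilon>) + 2 * ln (1 / \<xi>)) \<and>
       (\<forall>i\<in>{1..N}. \<forall>x\<in>path_image (c i). \<exists>y\<in>range \<gamma>. dist x y < 2 * \<epsilon>))"
proof -
  obtain Ca where Ca: "Ca \<ge> 0" "\<forall>q u t. Im q > 0 \<and> Im u > 0 \<and> near q t \<longrightarrow>
      (\<exists>g\<in>\<Gamma>. hyp_dist q (act g \<i>) \<le> t + Ca \<and> gp u (act g \<i>) q \<le> Ca)" using orbit_point_avoiding by blast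
  obtain L2 where L2: "\<forall>p q. Im p > 0 \<and> Im q > 0 \<longrightarrow> (\<exists>f\<in>\<Gamma>. gp p (act f \<i>) \<i> \<le> 12 \<and> gp q (act (madj f) \<i>) \<i> \<le> 12 \<and>
      6 * Ca + 100 \<le> hyp_dist \<i> (act f \<i>) \<and> hyp_dist \<i> (act f \<i>) \<le> L2)" using connecting_element[of "6 * Ca + 100"] by blast
  obtain R where R: "\<And>q \<xi>. Im q > 0 \<Longrightarrow> 0 < \<xi> \<Longrightarrow> \<xi> \<le> 1 \<Longrightarrow> \<pi> q \<in> truncated X \<xi> \<Longrightarrow> near q (R + ln (1 / \<xi>))"
    using truncated_near by blast
  \<comment> \<open>Large enough for the side condition of \<open>cyclic_connection\<close> and for
    absorbing the factor 8 exp (Ca + 18); extending by \<open>K'\<close> + ln (1 / \<epsilon>) then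
    leaves an error of at most \<epsilon>.\<close>
  define K' where "K' = 3 * Ca + 50"
  have K': "2 * (Ca + 14) + 9 \<le> K'" "8 * exp (Ca + 18) * exp (- K') \<le> 1"
  proof -
    show "2 * (Ca + 14) + 9 \<le> K'" using Ca by (simp add: K'_def)
    have "(8::real) \<le> exp 7" using exp_ge_add_one_self[of 7] by simp
    then have "8 * exp (Ca + 18) \<le> exp 7 * exp (Ca + 18)" by (intro mult_right_mono) auto
    also have "\<dots> = exp (Ca + 25)" by (simp flip: exp_add)
    also have "\<dots> \<le> exp K'" using Ca by (simp add: K'_def)
    finally have "8 * exp (Ca + 18) \<le> exp K'" .
    then show "8 * exp (Ca + 18) * exp (- K') \<le> 1" by (simp add: exp_minus field_simps)
  qed
  let ?K = "4 * K' + 2 * R + 2 * Ca + L2"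
  have "\<exists>\<gamma>. closed_geodesic \<gamma> \<and> range \<gamma> \<subseteq> X \<and>
       len \<gamma> \<le> (\<Sum>i=1..N. len (c i)) + real N * (?K + 4 * ln (1 / \<epsilon>) + 2 * ln (1 / \<xi>)) \<and>
       (\<forall>i\<in>{1..N}. \<forall>x\<in>path_image (c i). \<exists>y\<in>range \<gamma>. dist x y < 2 * \<epsilon>)"
    if eps: "0 < \<epsilon>" "\<epsilon> \<le> 1" "0 < \<xi>" "\<xi> \<le> 1" and N: "1 \<le> N"
      and c: "\<And>i. i \<in> {1..N} \<Longrightarrow> geodesic_arc (c i)" "\<And>i. i \<in> {1..N} \<Longrightarrow> path_image (c i) \<subseteq> truncated X \<xi>"
    for \<epsilon> \<xi> N and c :: "nat \<Rightarrow> real \<Rightarrow> 'a"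
  proof -
    have cX: "path_image (c i) \<subseteq> X" if "i \<in> {1..N}" for i using c(2)[OF that] by (auto simp: truncated_def)
    \<comment> \<open>The arcs are numbered from 1 but their lifts from 0, because the successor of
      an arc is taken modulo \<open>N\<close>.\<close>
    have "\<forall>i\<in>{..<N}. \<exists>p. fst p \<in> SL2 \<and> snd p > 0 \<and> (\<forall>t\<in>{0..1}. c (Suc i) t = \<pi> (hline (fst p) (snd p * t))) \<and> snd p \<le> len (c (Suc i))"
    proof
      fix i assume "i \<in> {..<N}"
      then have "Suc i \<in> {1..N}" by auto
      from lift_geodesic_arc[OF c(1)[OF this] cX[OF this]]
      show "\<exists>p. fst p \<in> SL2 \<and> snd p > 0 \<and> (\<forall>t\<in>{0..1}. c (Suc i) t = \<pi> (hline (fst p) (snd p * t))) \<and> snd p \<le> len (c (Suc i))"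
        by (metis fst_conv snd_conv)
    qed
    then obtain p where p: "\<forall>i\<in>{..<N}. fst (p i) \<in> SL2 \<and> snd (p i) > 0 \<and> (\<forall>t\<in>{0..1}. c (Suc i) t = \<pi> (hline (fst (p i)) (snd (p i) * t))) \<and> snd (p i) \<le> len (c (Suc i))"
      by (rule bchoice[THEN exE])
    define Q where "Q = (\<lambda>i. fst (p i))"
    define v where "v = (\<lambda>i. snd (p i))"
    have Q: "Q i \<in> SL2" "v i > 0" "v i \<le> len (c (Suc i))" if "i < N" for i using p that by (auto simp: Q_def v_def)
    have cQ: "c (Suc i) t = \<pi> (hline (Q i) (v i * t))" if "i < N" "t \<in> {0..1}" for i t
      using p that by (simp add: Q_def v_def)
    have tr: "\<pi> (hline (Q i) (v i * t)) \<in> truncated X \<xi>" if "i < N" "t \<in> {0..1}" for i t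
    proof -
      have "c (Suc i) t \<in> path_image (c (Suc i))" using that by (auto simp: path_image_def)
      then show ?thesis using c(2)[of "Suc i"] that cQ[OF that] by auto
    qed
    define T where "T = R + ln (1 / \<xi>)"
    define E where "E = K' + ln (1 / \<epsilon>)"
    have lne: "ln (1 / \<epsilon>) \<ge> 0" using eps by (simp add: ln_ge_zero)
    have E: "2 * (Ca + 14) + 9 \<le> E" using K' lne by (simp add: E_def)
    have n0: "\<forall>i<N. near (hline (Q i) 0) T \<and> near (hline (Q i) (v i)) T"
      unfolding T_def using R[OF Im_hline_pos[OF Q(1)] eps(3,4)] tr[of _ 0] tr[of _ 1] by auto
    have Q': "\<forall>i<N. Q i \<in> SL2 \<and> v i > 0" using Q by blast
    obtain h P l G where hPG: "P \<in> SL2" "l > 0" "G \<in> \<Gamma>" "\<And>k. h k \<in> \<Gamma>" "\<And>s. act G (hline P s) = hline P (s + l)"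
       "l \<le> (\<Sum>i<N. v i) + real N * (4 * E + 2 * T + 2 * Ca + L2)"
       "\<And>i s. i < N \<Longrightarrow> 0 \<le> s \<Longrightarrow> s \<le> v i \<Longrightarrow> \<exists>r. hyp_dist (hline (h i \<odot> Q i) s) (hline P r) \<le> 8 * exp (Ca + 18) * exp (- E)"
      using cyclic_connection[OF Ca L2 N Q' n0 E] by blast
    note \<gamma> = closed_geodesic_axis[OF hPG(1,2,3,5)]
    have "(\<Sum>i<N. v i) \<le> (\<Sum>i<N. len (c (Suc i)))" using Q(3) by (intro sum_mono) auto
    also have "\<dots> = (\<Sum>i=1..N. len (c i))" by (rule sum.reindex_bij_witness[of _ "\<lambda>i. i - 1" Suc]) auto
    finally have "l \<le> (\<Sum>i=1..N. len (c i)) + real N * (4 * E + 2 * T + 2 * Ca + L2)" using hPG(6) by linarith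
    also have "4 * E + 2 * T + 2 * Ca + L2 = ?K + 4 * ln (1 / \<epsilon>) + 2 * ln (1 / \<xi>)" by (simp add: E_def T_def)
    finally have len: "len (\<lambda>t. \<pi> (hline P (l * t))) \<le> (\<Sum>i=1..N. len (c i)) + real N * (?K + 4 * ln (1 / \<epsilon>) + 2 * ln (1 / \<xi>))"
      using \<gamma>(3) by linarith
    have "8 * exp (Ca + 18) * exp (- E) \<le> \<epsilon>"
    proof -
      have "exp (- E) = exp (- K') * \<epsilon>" using eps by (simp add: E_def exp_diff exp_minus ln_div field_simps)
      then have "8 * exp (Ca + 18) * exp (- E) = (8 * exp (Ca + 18) * exp (- K')) * \<epsilon>" by simp
      also have "\<dots> \<le> 1 * \<epsilon>" using K'(2) eps by (intro mult_right_mono) auto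
      finally show ?thesis by simp
    qed
    then have small: "8 * exp (Ca + 18) * exp (- E) < 2 * \<epsilon>" using eps by linarith
    have "\<exists>y\<in>range (\<lambda>t. \<pi> (hline P (l * t))). dist x y < 2 * \<epsilon>" if i: "i \<in> {1..N}" and x: "x \<in> path_image (c i)" for i x
    proof -
      obtain j where j: "i = Suc j" "j < N" using i by (cases i) auto
      obtain t where t: "t \<in> {0..1}" "x = c i t" using x by (auto simp: path_image_def)
      have xj: "x = \<pi> (hline (Q j) (v j * t))" using cQ[OF j(2) t(1)] t j by simp
      have "0 \<le> v j * t" "v j * t \<le> v j * 1" using t Q(2)[OF j(2)] by (auto intro: mult_left_mono)
      then obtain r where r: "hyp_dist (hline (h j \<odot> Q j) (v j * t)) (hline P r) \<le> 8 * exp (Ca + 18) * exp (- E)"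
        using hPG(7)[OF j(2), of "v j * t"] by auto
      have "hline (h j \<odot> Q j) (v j * t) = act (h j) (hline (Q j) (v j * t))" using hPG(4)[of j] Q(1)[OF j(2)] by (simp add: act_hline)
      then have "x = \<pi> (hline (h j \<odot> Q j) (v j * t))" unfolding xj using hPG(4)[of j] Q(1)[OF j(2)] by simp
      then have "dist x (\<pi> (hline P r)) \<le> hyp_dist (hline (h j \<odot> Q j) (v j * t)) (hline P r)"
        using dist_pi_le hPG(1) hPG(4)[of j] Q(1)[OF j(2)] by simp
      then have "dist x (\<pi> (hline P r)) < 2 * \<epsilon>" using r small by linarith
      then show ?thesis using \<gamma>(4) by blast
    qed
    then show ?thesis using \<gamma>(1,2) len by blast
  qed
  then show ?thesis by (intro exI[of _ ?K]) blast
qed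

end

theorem theorem1:
  fixes X :: "'a::metric_space set" and g n :: nat
  assumes "in_moduli_space g n X"
  shows "\<exists>K::real. \<forall>(\<epsilon>::real) (\<xi>::real) (N::nat) (c :: nat \<Rightarrow> real \<Rightarrow> 'a).
    0 < \<epsilon> \<and> \<epsilon> \<le> 1 \<and> 0 < \<xi> \<and> \<xi> \<le> 1 \<and> 1 \<le> N \<and>
    (\<forall>i\<in>{1..N}. geodesic_arc (c i) \<and> path_image (c i) \<subseteq> truncated X \<xi>) \<longrightarrow>
    (\<exists>\<gamma>. closed_geodesic \<gamma> \<and> range \<gamma> \<subseteq> X \<and>
       len \<gamma> \<le> real N * (K + 1 / real N * (\<Sum>i=1..N. len (c i)) + 10 * ln (1 / \<epsilon>) + 8 * ln (1 / \<xi>)) \<and>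
       (\<forall>i\<in>{1..N}. \<forall>x\<in>path_image (c i). \<exists>y\<in>range \<gamma>. dist x y < 2 * \<epsilon>))"
proof (cases "X = {}")
  \<comment> \<open>The covering needs a base point. In an empty surface there are no arcs, and N
    \<ge> 1 makes the hypotheses contradictory.\<close>
  case True
  have False if "1 \<le> N" "\<forall>i\<in>{1..N}. geodesic_arc (c i) \<and> path_image (c i) \<subseteq> truncated X \<xi>" for N \<xi> and c :: "nat \<Rightarrow> real \<Rightarrow> 'a"
  proof -
    have "path_image (c 1) \<subseteq> {}" using that True by (auto simp: truncated_def)
    then show False by (simp add: path_image_def)
  qed
  then show ?thesis by blast
next
  case False
  have X: "complete X" "connected X" "length_metric X" "finite_area X"
    using assms by (auto simp: in_moduli_space_def hyperbolic_surface_def)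
  obtain A where A: "\<forall>(U, \<phi>)\<in>A. hyp_chart X U \<phi>" "X \<subseteq> (\<Union>(U, \<phi>)\<in>A. U)"
      "\<forall>(U, \<phi>)\<in>A. \<forall>(V, \<psi>)\<in>A. (\<lambda>z. \<psi> (inv_into U \<phi> z)) holomorphic_on \<phi> ` (U \<inter> V)"
    using assms unfolding in_moduli_space_def orientable_surface_def by blast
  interpret oriented_surface X A
    by unfold_locales (use A X in \<open>auto split: prod.splits\<close>)
  obtain \<pi> where \<pi>: "liso {z. Im z > 0} \<pi>" using exists_covering[OF False] by blast
  interpret finite_area_covering X A \<pi>
    by unfold_locales (use \<pi> X in auto)
  obtain K where K: "\<And>\<epsilon> \<xi> N (c :: nat \<Rightarrow> real \<Rightarrow> 'a). 0 < \<epsilon> \<and> \<epsilon> \<le> 1 \<and> 0 < \<xi> \<and> \<xi> \<le> 1 \<and> 1 \<le> N \<and>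
    (\<forall>i\<in>{1..N}. geodesic_arc (c i) \<and> path_image (c i) \<subseteq> truncated X \<xi>) \<Longrightarrow>
    \<exists>\<gamma>. closed_geodesic \<gamma> \<and> range \<gamma> \<subseteq> X \<and>
       len \<gamma> \<le> (\<Sum>i=1..N. len (c i)) + real N * (K + 4 * ln (1 / \<epsilon>) + 2 * ln (1 / \<xi>)) \<and>
       (\<forall>i\<in>{1..N}. \<forall>x\<in>path_image (c i). \<exists>y\<in>range \<gamma>. dist x y < 2 * \<epsilon>)"
    using exists_closed_geodesic by blast
  \<comment> \<open>Both logarithms are nonnegative as \<epsilon> and \<xi> are at most 1, so the
    coefficients 4 and 2 may be enlarged to 10 and 8.\<close>
  have le: "s + real N * (K + 4 * ln (1 / \<epsilon>) + 2 * ln (1 / \<xi>)) \<le> real N * (K + 1 / real N * s + 10 * ln (1 / \<epsilon>) + 8 * ln (1 / \<xi>))"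
    if "0 < \<epsilon>" "\<epsilon> \<le> 1" "0 < \<xi>" "\<xi> \<le> 1" "1 \<le> N" for \<epsilon> \<xi> s :: real and N :: nat
  proof -
    have "0 \<le> ln (1 / \<epsilon>)" "0 \<le> ln (1 / \<xi>)" using that by (simp_all add: ln_ge_zero)
    then have "real N * (K + 4 * ln (1 / \<epsilon>) + 2 * ln (1 / \<xi>)) \<le> real N * (K + 10 * ln (1 / \<epsilon>) + 8 * ln (1 / \<xi>))"
      by (intro mult_left_mono) auto
    moreover have "real N * (K + 1 / real N * s + 10 * ln (1 / \<epsilon>) + 8 * ln (1 / \<xi>)) = s + real N * (K + 10 * ln (1 / \<epsilon>) + 8 * ln (1 / \<xi>))"
      using that(5) by (simp add: distrib_left)
    ultimately show ?thesis by simp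
  qed
  show ?thesis
  proof (intro exI[of _ K] allI impI)
    fix \<epsilon> \<xi> :: real and N :: nat and c :: "nat \<Rightarrow> real \<Rightarrow> 'a"
    assume h: "0 < \<epsilon> \<and> \<epsilon> \<le> 1 \<and> 0 < \<xi> \<and> \<xi> \<le> 1 \<and> 1 \<le> N \<and>
      (\<forall>i\<in>{1..N}. geodesic_arc (c i) \<and> path_image (c i) \<subseteq> truncated X \<xi>)"
    then have "(\<Sum>i=1..N. len (c i)) + real N * (K + 4 * ln (1 / \<epsilon>) + 2 * ln (1 / \<xi>))
      \<le> real N * (K + 1 / real N * (\<Sum>i=1..N. len (c i)) + 10 * ln (1 / \<epsilon>) + 8 * ln (1 / \<xi>))" by (intro le) auto
    then show "\<exists>\<gamma>. closed_geodesic \<gamma> \<and> range \<gamma> \<subseteq> X \<and>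
       len \<gamma> \<le> real N * (K + 1 / real N * (\<Sum>i=1..N. len (c i)) + 10 * ln (1 / \<epsilon>) + 8 * ln (1 / \<xi>)) \<and>
       (\<forall>i\<in>{1..N}. \<forall>x\<in>path_image (c i). \<exists>y\<in>range \<gamma>. dist x y < 2 * \<epsilon>)"
      using K[OF h] order_trans by meson
  qed
qed

end
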